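(* Let $k$ be fixed. There is an algorithm (an extension of Williams' split-and-list algorithm) that, given any polynomially bounded PCSP instance with $n$ variables over domain $[k]$, computes its partition function in time and space $O^\star(k^{\omega n/3})$, where $\omega$ is the matrix-multiplication exponent for the ring of polynomials over the reals.
   Context: A PCSP instance $I$ with constraint graph $G=(V,E)$ (variables $=V$, clauses $=E$) and domain $[k]=\{0,\dots,k-1\}$ consists of generalized polynomials over the reals in some formal variables (exponents may be arbitrary reals) $p_\emptyset$, $p_v(i)$ ($v\in V,i\in[k]$) and $p_{xy}(i,j)$ ($xy\in E$, $i,j\in[k]$; $p_{xy}(i,j)=p_{yx}(j,i)$). The score of $\sigma:V\to[k]$ is $I(\sigma)=p_\emptyset\prod_{v\in V}p_v(\sigma(v))\prod_{xy\in E}p_{xy}(\sigma(x),\sigma(y))$ and the partition function is $Z_I=\sum_{\sigma:V\to[k]}I(\sigma)$. A family of PCSP instances is polynomially bounded if, for an instance with $n$ variables and $m$ clauses, the number of formal variables is $O(1)$, all exponents are integers of absolute value polynomial in $m+n$, and coefficients are integers of bit-length polynomial in $m+n$ (or alternatively sums and products of coefficients are counted as elementary operations). The matrix-multiplication exponent $\omega$ is such that two $N\times N$ matrices can be multiplied using $O(N^\omega)$ ring operations. $O^\star(\cdot)$ hides factors polynomial in $n,m$. *)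

theory Defs
  imports Complex_Main "HOL-Library.Poly_Mapping" "HOL-Library.FuncSet" "HOL-Library.Log_Nat"
begin

section \<open>PCSP instances\<close>

text \<open>
  A generalized polynomial over the reals is a finitely supported map from exponent vectors to
  coefficients, where an exponent vector is a finitely supported map from formal variables
  (numbered by naturals) to real exponents.  The product provided by the library for this type is
  the convolution product, i.e. the usual product of generalized polynomials.
\<close>

type_synonym gpoly = "(nat \<Rightarrow>\<^sub>0 real) \<Rightarrow>\<^sub>0 real"

text \<open>
  The variables of an instance are \<open>{..<nvars I}\<close>, its domain is \<open>{..<k}\<close>, and its generalized
  polynomials use the formal variables \<open>{..<fvars I}\<close>.
\<close>

record pcsp =
  nvars :: nat
  edges :: "nat set set"
  fvars :: nat
  p_empty :: gpoly
  p_var :: "nat \<Rightarrow> nat \<Rightarrow> gpoly"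
  p_edge :: "nat \<Rightarrow> nat \<Rightarrow> nat \<Rightarrow> nat \<Rightarrow> gpoly"

text \<open>Each edge is listed once, with its endpoints in increasing order.\<close>

definition arcs :: "pcsp \<Rightarrow> (nat \<times> nat) set" where
  "arcs I = {(x, y). x < y \<and> {x, y} \<in> edges I}"

definition polys :: "nat \<Rightarrow> pcsp \<Rightarrow> gpoly set" where
  "polys k I = {p_empty I} \<union> {p_var I v i | v i. v < nvars I \<and> i < k}
     \<union> {p_edge I x y i j | x y i j. (x, y) \<in> arcs I \<and> i < k \<and> j < k}"

definition is_pcsp :: "nat \<Rightarrow> pcsp \<Rightarrow> bool" where
  "is_pcsp k I \<longleftrightarrow>
     (\<forall>e \<in> edges I. \<exists>x y. x < nvars I \<and> y < nvars I \<and> x \<noteq> y \<and> e = {x, y}) \<and>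
     (\<forall>x y i j. {x, y} \<in> edges I \<and> i < k \<and> j < k \<longrightarrow> p_edge I x y i j = p_edge I y x j i) \<and>
     (\<forall>p \<in> polys k I. \<forall>e \<in> Poly_Mapping.keys p. Poly_Mapping.keys e \<subseteq> {..<fvars I})"

definition score :: "pcsp \<Rightarrow> (nat \<Rightarrow> nat) \<Rightarrow> gpoly" where
  "score I \<sigma> = p_empty I * (\<Prod>v<nvars I. p_var I v (\<sigma> v))
     * (\<Prod>(x, y) \<in> arcs I. p_edge I x y (\<sigma> x) (\<sigma> y))"

definition partition_function :: "nat \<Rightarrow> pcsp \<Rightarrow> gpoly" where
  "partition_function k I = (\<Sum>\<sigma> \<in> {..<nvars I} \<rightarrow>\<^sub>E {..<k}. score I \<sigma>)"

text \<open>Bit length of an integer plus one (for the sign), so that it is always positive.\<close>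

definition len :: "int \<Rightarrow> nat" where
  "len z = Suc (floorlog 2 (nat \<bar>z\<bar>))"

text \<open>
  The two alternatives for coefficients: either they are integers of polynomial bit length and
  every operation is charged by bit length, or they are arbitrary reals and
  each sum, difference or product of coefficients is one elementary operation.
\<close>

datatype coeff_model = Bit_Length | Unit_Cost

definition polynomially_bounded :: "coeff_model \<Rightarrow> nat \<Rightarrow> pcsp set \<Rightarrow> bool" where
  "polynomially_bounded M k F \<longleftrightarrow> (\<exists>c d :: nat. \<forall>I \<in> F.
     fvars I \<le> c \<and>
     (\<forall>p \<in> polys k I. \<forall>e \<in> Poly_Mapping.keys p.
        (\<forall>x. Poly_Mapping.lookup e x \<in> \<int> \<and>
             \<bar>Poly_Mapping.lookup e x\<bar> \<le> real (c * (nvars I + card (edges I) + 1) ^ d)) \<and>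
        (M = Bit_Length \<longrightarrow>
             Poly_Mapping.lookup p e \<in> \<int> \<and>
             len \<lfloor>Poly_Mapping.lookup p e\<rfloor> \<le> c * (nvars I + card (edges I) + 1) ^ d)))"

section \<open>The model of computation\<close>

text \<open>
  A random access machine under the logarithmic cost criterion, presented as a structured
  programming language.  Its memory consists of arrays of integers and of arrays of elements of
  a ring; every program uses finitely many of them.  Ring elements can only be moved, added,
  subtracted and multiplied, each at unit cost (the ring constants 0 and 1 are available).  They
  cannot be tested, and they never influence the integers.
\<close>

datatype 'r state = State (imem: "nat \<Rightarrow> nat \<Rightarrow> int") (rmem: "nat \<Rightarrow> nat \<Rightarrow> 'r")

datatype iexp =
    INum int
  | ILoad nat iexp
  | IAdd iexp iexp
  | ISub iexp iexp
  | IMul iexp iexp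
  | IDiv iexp iexp
  | IMod iexp iexp

datatype rexp =
    RZero
  | ROne
  | RLoad nat iexp
  | RAdd rexp rexp
  | RSub rexp rexp
  | RMul rexp rexp

text \<open>The conditions of \<open>IfPos\<close> and \<open>WhilePos\<close> hold if the expression is positive.\<close>

datatype com =
    Skip
  | IStore nat iexp iexp
  | RStore nat iexp rexp
  | Seq com com
  | IfPos iexp com com
  | WhilePos iexp com

text \<open>A negative array index is read as index 0.\<close>

fun ival :: "'r state \<Rightarrow> iexp \<Rightarrow> int" where
  "ival s (INum z) = z"
| "ival s (ILoad a e) = imem s a (nat (ival s e))"
| "ival s (IAdd e f) = ival s e + ival s f"
| "ival s (ISub e f) = ival s e - ival s f"
| "ival s (IMul e f) = ival s e * ival s f"
| "ival s (IDiv e f) = ival s e div ival s f"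
| "ival s (IMod e f) = ival s e mod ival s f"

text \<open>
  The cost of an integer expression is the total length of the values of all its
  subexpressions; an operation is thus charged the length of its operands and of its result, and
  a memory access that of the address and of the contents.
\<close>

fun icost :: "'r state \<Rightarrow> iexp \<Rightarrow> nat" where
  "icost s (INum z) = len z"
| "icost s (ILoad a e) = icost s e + len (ival s (ILoad a e))"
| "icost s (IAdd e f) = icost s e + icost s f + len (ival s (IAdd e f))"
| "icost s (ISub e f) = icost s e + icost s f + len (ival s (ISub e f))"
| "icost s (IMul e f) = icost s e + icost s f + len (ival s (IMul e f))"
| "icost s (IDiv e f) = icost s e + icost s f + len (ival s (IDiv e f))"
| "icost s (IMod e f) = icost s e + icost s f + len (ival s (IMod e f))"

fun rval :: "'r::ring_1 state \<Rightarrow> rexp \<Rightarrow> 'r" where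
  "rval s RZero = 0"
| "rval s ROne = 1"
| "rval s (RLoad a e) = rmem s a (nat (ival s e))"
| "rval s (RAdd e f) = rval s e + rval s f"
| "rval s (RSub e f) = rval s e - rval s f"
| "rval s (RMul e f) = rval s e * rval s f"

fun rcost :: "'r state \<Rightarrow> rexp \<Rightarrow> nat" where
  "rcost s RZero = 1"
| "rcost s ROne = 1"
| "rcost s (RLoad a e) = icost s e + 1"
| "rcost s (RAdd e f) = rcost s e + rcost s f + 1"
| "rcost s (RSub e f) = rcost s e + rcost s f + 1"
| "rcost s (RMul e f) = rcost s e + rcost s f + 1"

fun ring_ops :: "rexp \<Rightarrow> nat" where
  "ring_ops RZero = 0"
| "ring_ops ROne = 0"
| "ring_ops (RLoad a e) = 0"
| "ring_ops (RAdd e f) = ring_ops e + ring_ops f + 1"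
| "ring_ops (RSub e f) = ring_ops e + ring_ops f + 1"
| "ring_ops (RMul e f) = ring_ops e + ring_ops f + 1"

definition iupd :: "nat \<Rightarrow> nat \<Rightarrow> int \<Rightarrow> 'r state \<Rightarrow> 'r state" where
  "iupd a i z s = State ((imem s)(a := (imem s a)(i := z))) (rmem s)"

definition rupd :: "nat \<Rightarrow> nat \<Rightarrow> 'r \<Rightarrow> 'r state \<Rightarrow> 'r state" where
  "rupd a i z s = State (imem s) ((rmem s)(a := (rmem s a)(i := z)))"

text \<open>
  The space taken by a state: all nonzero cells count, with the length of their address and of
  their contents (1 for a ring element).  Executions below start with finitely many nonzero
  cells, so the sums are finite throughout.
\<close>

definition mem_size :: "'r::ring_1 state \<Rightarrow> nat" where
  "mem_size s = (\<Sum>(a, i) \<in> {(a, i). imem s a i \<noteq> 0}. len (int i) + len (imem s a i))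
     + (\<Sum>(a, i) \<in> {(a, i). rmem s a i \<noteq> 0}. len (int i) + 1)"

text \<open>
  \<open>exec c s t m r s'\<close>: started in \<open>s\<close>, the program \<open>c\<close> terminates in \<open>s'\<close> after time \<open>t\<close>, using
  space \<open>m\<close> and performing \<open>r\<close> additions, subtractions and multiplications in the ring.
  The space is the maximum over all steps of the size of the memory plus the scratch
  space for evaluating expressions, the latter being charged like time.
\<close>

inductive exec :: "com \<Rightarrow> 'r::ring_1 state \<Rightarrow> nat \<Rightarrow> nat \<Rightarrow> nat \<Rightarrow> 'r state \<Rightarrow> bool" where
  Skip: "exec Skip s 1 (mem_size s) 0 s"
| IStore: "s' = iupd a (nat (ival s i)) (ival s e) s \<Longrightarrow> \<tau> = icost s i + icost s e + 1 \<Longrightarrow>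
    exec (IStore a i e) s \<tau> (max (mem_size s + \<tau>) (mem_size s')) 0 s'"
| RStore: "s' = rupd a (nat (ival s i)) (rval s e) s \<Longrightarrow> \<tau> = icost s i + rcost s e + 1 \<Longrightarrow>
    exec (RStore a i e) s \<tau> (max (mem_size s + \<tau>) (mem_size s')) (ring_ops e) s'"
| Seq: "exec c1 s t1 m1 r1 s' \<Longrightarrow> exec c2 s' t2 m2 r2 s'' \<Longrightarrow>
    exec (Seq c1 c2) s (t1 + t2) (max m1 m2) (r1 + r2) s''"
| IfPos: "\<tau> = icost s e + 1 \<Longrightarrow> exec (if 0 < ival s e then c1 else c2) s t m r s' \<Longrightarrow>
    exec (IfPos e c1 c2) s (\<tau> + t) (max (mem_size s + \<tau>) m) r s'"
| While_False: "\<tau> = icost s e + 1 \<Longrightarrow> \<not> 0 < ival s e \<Longrightarrow>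
    exec (WhilePos e c) s \<tau> (mem_size s + \<tau>) 0 s"
| While_True: "\<tau> = icost s e + 1 \<Longrightarrow> 0 < ival s e \<Longrightarrow>
    exec c s t1 m1 r1 s' \<Longrightarrow> exec (WhilePos e c) s' t2 m2 r2 s'' \<Longrightarrow>
    exec (WhilePos e c) s (\<tau> + t1 + t2) (max (mem_size s + \<tau>) (max m1 m2)) (r1 + r2) s''"

section \<open>The matrix multiplication exponent\<close>

text \<open>The ring of polynomials over the reals (in the formal variables numbered by naturals).\<close>

type_synonym real_poly_ring = "(nat \<Rightarrow>\<^sub>0 nat) \<Rightarrow>\<^sub>0 real"

text \<open>
  The number \<open>N\<close> is given in cell 0 of integer array 0; the matrices are given row by row in ring
  arrays 0 and 1, and their product is expected in ring array 2.
\<close>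

definition matmul_input ::
  "nat \<Rightarrow> (nat \<Rightarrow> nat \<Rightarrow> 'r) \<Rightarrow> (nat \<Rightarrow> nat \<Rightarrow> 'r) \<Rightarrow> 'r::ring_1 state" where
  "matmul_input N A B = State
     (\<lambda>a i. if a = 0 \<and> i = 0 then int N else 0)
     (\<lambda>a i. if a = 0 \<and> i < N * N then A (i div N) (i mod N)
            else if a = 1 \<and> i < N * N then B (i div N) (i mod N) else 0)"

text \<open>
  \<open>\<omega>\<close> is such that two \<open>N \<times> N\<close> matrices can be multiplied using \<open>O(N\<^sup>\<omega>)\<close> ring operations.
  Beyond the ring operations, an algorithm also has to compute addresses and
  loop counters; under logarithmic cost each such step takes time about \<open>log N\<close>, hence the
  polylogarithmic factor in the bound on the total time.
\<close>

definition matmul_exponent :: "real \<Rightarrow> bool" where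
  "matmul_exponent \<omega> \<longleftrightarrow> (\<exists>P. \<exists>C :: real. \<exists>d :: nat. \<forall>N \<ge> 1.
     \<forall>A B :: nat \<Rightarrow> nat \<Rightarrow> real_poly_ring. \<exists>t m r s'.
       exec P (matmul_input N A B) t m r s' \<and>
       (\<forall>i < N. \<forall>j < N. rmem s' 2 (N * i + j) = (\<Sum>l<N. A i l * B l j)) \<and>
       real r \<le> C * real N powr \<omega> \<and>
       real t \<le> C * real N powr \<omega> * (1 + log 2 (real N)) ^ d)"

section \<open>Presenting instances and results to the machine\<close>

text \<open>
  A generalized polynomial with integer exponents in \<open>s\<close> formal variables is presented as a list
  of terms with distinct exponent vectors.
\<close>

type_synonym gterm = "real \<times> int list"

definition exponent :: "int list \<Rightarrow> nat \<Rightarrow>\<^sub>0 real" where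
  "exponent es = (\<Sum>x<length es. Poly_Mapping.single x (real_of_int (es ! x)))"

definition is_term_list :: "nat \<Rightarrow> gterm list \<Rightarrow> gpoly \<Rightarrow> bool" where
  "is_term_list s ts p \<longleftrightarrow>
     (\<forall>(c, es) \<in> set ts. length es = s) \<and> distinct (map snd ts) \<and>
     p = (\<Sum>(c, es) \<leftarrow> ts. Poly_Mapping.single (exponent es) c)"

text \<open>
  Coefficients are written into the integer memory in the bit-length model (where they are
  integers) and into the ring memory in the unit-cost model.
\<close>

fun int_code :: "coeff_model \<Rightarrow> gterm list \<Rightarrow> int list" where
  "int_code Bit_Length ts = int (length ts) # concat (map (\<lambda>(c, es). \<lfloor>c\<rfloor> # es) ts)"
| "int_code Unit_Cost ts = int (length ts) # concat (map snd ts)"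

fun ring_code :: "coeff_model \<Rightarrow> gterm list \<Rightarrow> real list" where
  "ring_code Bit_Length ts = []"
| "ring_code Unit_Cost ts = map fst ts"

definition poly_list :: "nat \<Rightarrow> pcsp \<Rightarrow> (nat \<times> nat) list \<Rightarrow> gpoly list" where
  "poly_list k I es = p_empty I # [p_var I v i. v \<leftarrow> [0..<nvars I], i \<leftarrow> [0..<k]]
     @ [p_edge I x y i j. (x, y) \<leftarrow> es, i \<leftarrow> [0..<k], j \<leftarrow> [0..<k]]"

text \<open>
  \<open>encodes M k I xs ys\<close>: the integers \<open>xs\<close> together with the ring elements \<open>ys\<close> present the
  instance \<open>I\<close>, with the edges and the nonzero terms of each polynomial in some order.
\<close>

definition encodes :: "coeff_model \<Rightarrow> nat \<Rightarrow> pcsp \<Rightarrow> int list \<Rightarrow> real list \<Rightarrow> bool" where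
  "encodes M k I xs ys \<longleftrightarrow> (\<exists>es tss.
     distinct es \<and> set es = arcs I \<and>
     list_all2 (\<lambda>ts p. is_term_list (fvars I) ts p \<and> 0 \<notin> fst ` set ts) tss (poly_list k I es) \<and>
     xs = [int (nvars I), int (length es), int (fvars I)]
          @ concat (map (\<lambda>(x, y). [int x, int y]) es) @ concat (map (int_code M) tss) \<and>
     ys = concat (map (ring_code M) tss))"

definition input_state :: "int list \<Rightarrow> real list \<Rightarrow> real state" where
  "input_state xs ys = State
     (\<lambda>a i. if a = 0 \<and> i < length xs then xs ! i else 0)
     (\<lambda>a i. if a = 0 \<and> i < length ys then ys ! i else 0)"

text \<open>
  The result is expected in integer array 1 and ring array 1.  Terms with coefficient zero are
  allowed in it, since in the unit-cost model coefficients cannot be tested.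
\<close>

definition outputs :: "coeff_model \<Rightarrow> nat \<Rightarrow> gpoly \<Rightarrow> real state \<Rightarrow> bool" where
  "outputs M s p st \<longleftrightarrow> (\<exists>ts. is_term_list s ts p \<and>
     (\<forall>i < length (int_code M ts). imem st 1 i = int_code M ts ! i) \<and>
     (\<forall>i < length (ring_code M ts). rmem st 1 i = ring_code M ts ! i))"

text \<open>
  \<open>computes M k I Q b\<close>: from every presentation of \<open>I\<close>, the program \<open>Q\<close> computes the partition
  function of \<open>I\<close> in time and space at most \<open>b\<close>.
\<close>

definition computes_partition_function ::
  "coeff_model \<Rightarrow> nat \<Rightarrow> pcsp \<Rightarrow> com \<Rightarrow> real \<Rightarrow> bool" where
  "computes_partition_function M k I Q b \<longleftrightarrow>
     (\<forall>xs ys. encodes M k I xs ys \<longrightarrow>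
        (\<exists>t m r s'. exec Q (input_state xs ys) t m r s' \<and>
           outputs M (fvars I) (partition_function k I) s' \<and>
           real t \<le> b \<and> real m \<le> b))"

end

theory Submission imports Defs
begin

text \<open>
  Split the variables into three parts of about \<open>n / 3\<close> variables each.  Every factor of the score
  misses one of the parts, so the partition function is a sum of products
  \<open>L a b * R b c * W a c\<close> over assignments \<open>a\<close>, \<open>b\<close>, \<open>c\<close> of the parts: a matrix product of size
  \<open>k ^ (n / 3)\<close> of polynomials, weighted by \<open>W\<close>.

  The given program for matrices over the ring of polynomials cannot branch on ring elements, so
  it also multiplies real matrices.  Kronecker substitution turns the
  polynomials into elements of the group ring of a cyclic group of polynomial order \<open>D\<close>, large
  enough for the exponents of the result to be recovered; writing the entries of \<open>L\<close> as circulant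
  \<open>D\<close> by \<open>D\<close> blocks and those of \<open>R\<close> as block columns gives one real matrix product of size
  \<open>k ^ (n / 3) * D\<close>.  In the bit model all ring operations are simulated by integers modulo
  \<open>2 * h + 1\<close>, where \<open>h\<close> bounds the coefficients of the result.

  Each output entry of a matrix product has to be written, so the multiplication takes time at
  least \<open>N ^ 2\<close>; this absorbs the quadratically many weights computed outside of it.  The
  space is at most the size of the initial memory plus the time.
\<close>

section \<open>Lengths, costs and memory\<close>

text \<open>The multiplication program is only ever fed with constants: the reals embed into the
  polynomials as an injective image, so a run over polynomials can be mirrored on reals step by
  step. Polynomial entries must therefore be spread over several real entries, at the price of a
  factor \<open>D\<close> in the matrix size. The number of formal variables is O(1), so
  \<open>D\<close> is polynomial in \<open>n + m\<close> and \<open>D powr \<omega>\<close>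
  disappears in the polynomial factor; the exponent of \<open>k\<close>, in contrast, has to come
  out exactly, so loops over partial assignments are nested at most two deep.

  Passing to the cyclic group ring is multiplicative, so exponents of intermediate products may wrap
  around; only those of the final result must be told apart. The same principle allows the bit model
  to compute with residues: only the final coefficients must lie between \<open>-h\<close> and
  \<open>h\<close>.

  Times are derived from one bound \<open>B\<close> on all integers that the structured programs
  read or store: an elementary step then costs a constant times \<open>len B\<close>, and what
  remains is to count loop iterations.\<close>

lemma len_ge_1: "1 \<le> len z"
  by (simp add: len_def)

lemma len_mono: "\<bar>x\<bar> \<le> \<bar>y\<bar> \<Longrightarrow> len x \<le> len y"
  unfolding len_def by (intro le_SucI Suc_le_mono[THEN iffD2] floorlog_mono) auto

lemma len_le_if_less_power:
  assumes "\<bar>x\<bar> < 2 ^ b"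
  shows "len x \<le> Suc b"
proof -
  have "int (nat \<bar>x\<bar>) < int (2 ^ b)" using assms by simp
  then have "nat \<bar>x\<bar> < 2 ^ b" by (simp only: of_nat_less_iff)
  then have "floorlog 2 (nat \<bar>x\<bar>) \<le> b" by (intro floorlog_leI) auto
  then show ?thesis by (simp add: len_def)
qed

lemma abs_less_power_len: "\<bar>x\<bar> < 2 ^ len x"
proof (cases "x = 0")
  case False
  then have "nat \<bar>x\<bar> < 2 ^ floorlog 2 (nat \<bar>x\<bar>)"
    using floorlog_bounds[of "nat \<bar>x\<bar>" 2] by auto
  then have "int (nat \<bar>x\<bar>) < int (2 ^ floorlog 2 (nat \<bar>x\<bar>))" by (simp only: of_nat_less_iff)
  also have "\<dots> \<le> 2 ^ len x" by (simp add: len_def)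
  finally show ?thesis by simp
qed simp

text \<open>Turns bounds of the form \<open>B ^ w\<close> on values of expressions into cost bounds
  linear in \<open>len B\<close>. With \<open>B < 2 ^ f\<close> the value has at most
  \<open>f * w\<close> bits, and \<open>1 \<le> w\<close> pays for the sign.\<close>

lemma len_le_power:
  assumes "\<bar>x\<bar> \<le> B ^ w" "2 \<le> B" "1 \<le> w"
  shows "len x \<le> w * len B"
proof -
  define f where "f = floorlog 2 (nat B)"
  have "nat B < 2 ^ f" using assms floorlog_bounds[of "nat B" 2] by (auto simp: f_def)
  then have "int (nat B) < int (2 ^ f)" by (simp only: of_nat_less_iff)
  then have "B < 2 ^ f" using assms by simp
  then have "B ^ w < (2 ^ f) ^ w" using assms by (intro power_strict_mono) auto
  then have "\<bar>x\<bar> < 2 ^ (f * w)" using assms by (simp add: power_mult)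
  then have "len x \<le> Suc (f * w)" by (rule len_le_if_less_power)
  also have "\<dots> \<le> w * Suc f" using assms(3) by (simp add: mult.commute)
  finally show ?thesis using assms by (simp add: len_def f_def)
qed

text \<open>The sum has at most \<open>?f + ?g + 1\<close> bits; the carry and the sign are paid for
  by the two sign bits on the right.\<close>

lemma len_add_le: "len (x + y) \<le> len x + len y"
proof -
  have x: "\<bar>x\<bar> < 2 ^ floorlog 2 (nat \<bar>x\<bar>)" for x :: int
  proof (cases "x = 0")
    case False
    then have "nat \<bar>x\<bar> < 2 ^ floorlog 2 (nat \<bar>x\<bar>)"
      using floorlog_bounds[of "nat \<bar>x\<bar>" 2] by auto
    then have "int (nat \<bar>x\<bar>) < int (2 ^ floorlog 2 (nat \<bar>x\<bar>))" by (simp only: of_nat_less_iff)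
    then show ?thesis by simp
  qed (simp add: floorlog_def)
  let ?f = "floorlog 2 (nat \<bar>x\<bar>)" and ?g = "floorlog 2 (nat \<bar>y\<bar>)"
  have "(2 :: int) ^ ?f + 2 ^ ?g \<le> 2 ^ (?f + ?g) + 2 ^ (?f + ?g)"
    by (intro add_mono power_increasing) auto
  moreover have "\<bar>x + y\<bar> < 2 ^ ?f + 2 ^ ?g" using x[of x] x[of y] by linarith
  ultimately have "\<bar>x + y\<bar> < 2 ^ Suc (?f + ?g)" by simp
  then have "len (x + y) \<le> Suc (Suc (?f + ?g))" by (rule len_le_if_less_power)
  then show ?thesis by (simp add: len_def)
qed

lemma len_mult_le: "len (x * y) \<le> len x + len y"
proof -
  have x: "\<bar>x\<bar> \<le> 2 ^ floorlog 2 (nat \<bar>x\<bar>) - 1" for x :: int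
  proof (cases "x = 0")
    case False
    then have "nat \<bar>x\<bar> < 2 ^ floorlog 2 (nat \<bar>x\<bar>)"
      using floorlog_bounds[of "nat \<bar>x\<bar>" 2] by auto
    then have "int (nat \<bar>x\<bar>) < int (2 ^ floorlog 2 (nat \<bar>x\<bar>))" by (simp only: of_nat_less_iff)
    then show ?thesis by simp
  qed (simp add: floorlog_def)
  let ?f = "floorlog 2 (nat \<bar>x\<bar>)" and ?g = "floorlog 2 (nat \<bar>y\<bar>)"
  have "\<bar>x * y\<bar> \<le> (2 ^ ?f - 1) * (2 ^ ?g - 1)"
    unfolding abs_mult using x[of x] x[of y] by (intro mult_mono) auto
  also have "\<dots> < 2 ^ (?f + ?g)"
    by (simp add: power_add algebra_simps) (smt (verit) one_le_power)
  finally have "len (x * y) \<le> Suc (?f + ?g)" by (rule len_le_if_less_power)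
  then show ?thesis by (simp add: len_def)
qed

lemma len_ival_le_icost: "len (ival s e) \<le> icost s e"
  by (cases e) auto

lemma len_int_nat_le: "len (int (nat z)) \<le> len z"
  by (rule len_mono) auto

lemma imem_iupd [simp]: "imem (iupd a i z s) = (imem s)(a := (imem s a)(i := z))"
  and rmem_iupd [simp]: "rmem (iupd a i z s) = rmem s"
  and imem_rupd [simp]: "imem (rupd a i x s) = imem s"
  and rmem_rupd [simp]: "rmem (rupd a i x s) = (rmem s)(a := (rmem s a)(i := x))"
  by (simp_all add: iupd_def rupd_def)

section \<open>Space in terms of time\<close>

definition fin_state :: "'r::ring_1 state \<Rightarrow> bool" where
  "fin_state s \<longleftrightarrow> finite {(a, i). imem s a i \<noteq> 0} \<and> finite {(a, i). rmem s a i \<noteq> 0}"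

text \<open>Models a single store: the support grows by at most the written cell \<open>x\<close>,
  whose old contribution is dropped.\<close>

lemma sum_insert_support_le:
  fixes g g' :: "'a \<Rightarrow> nat"
  assumes "finite S" "S' \<subseteq> insert x S" "\<And>y. y \<noteq> x \<Longrightarrow> g' y = g y"
  shows "sum g' S' \<le> sum g S + g' x"
proof -
  have "sum g' S' \<le> sum g' (insert x S)" using assms by (intro sum_mono2) auto
  also have "insert x S = insert x (S - {x})" by blast
  also have "sum g' \<dots> = g' x + sum g' (S - {x})" using assms by (intro sum.insert) auto
  also have "sum g' (S - {x}) = sum g (S - {x})" using assms by (intro sum.cong) auto
  also have "\<dots> \<le> sum g S" using assms by (intro sum_mono2) auto
  finally show ?thesis by simp
qed

lemma mem_size_iupd:
  assumes "fin_state s"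
  shows "fin_state (iupd a i z s) \<and> mem_size (iupd a i z s) \<le> mem_size s + len (int i) + len z"
proof -
  let ?S = "{(b, j). imem s b j \<noteq> 0}" and ?S' = "{(b, j). imem (iupd a i z s) b j \<noteq> 0}"
  have sub: "?S' \<subseteq> insert (a, i) ?S" by (auto split: if_splits)
  have fin: "finite ?S" using assms by (simp add: fin_state_def)
  have "finite ?S'" using finite_subset[OF sub] fin by simp
  moreover have "(\<Sum>(b, j) \<in> ?S'. len (int j) + len (imem (iupd a i z s) b j))
      \<le> (\<Sum>(b, j) \<in> ?S. len (int j) + len (imem s b j)) + (len (int i) + len z)"
    using sum_insert_support_le[OF fin sub, where
      g = "\<lambda>(b, j). len (int j) + len (imem s b j)" and
      g' = "\<lambda>(b, j). len (int j) + len (imem (iupd a i z s) b j)"]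
    by (auto split: if_splits)
  ultimately show ?thesis using assms by (simp add: fin_state_def mem_size_def)
qed

lemma mem_size_rupd:
  assumes "fin_state s"
  shows "fin_state (rupd a i z s) \<and> mem_size (rupd a i z s) \<le> mem_size s + len (int i) + 1"
proof -
  let ?S = "{(b, j). rmem s b j \<noteq> 0}" and ?S' = "{(b, j). rmem (rupd a i z s) b j \<noteq> 0}"
  have sub: "?S' \<subseteq> insert (a, i) ?S" by (auto split: if_splits)
  have fin: "finite ?S" using assms by (simp add: fin_state_def)
  have "finite ?S'" using finite_subset[OF sub] fin by simp
  moreover have "(\<Sum>(b, j) \<in> ?S'. len (int j) + 1)
      \<le> (\<Sum>(b, j) \<in> ?S. len (int j) + 1) + (len (int i) + 1)"
    using sum_insert_support_le[OF fin sub, where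
      g = "\<lambda>(b, j). len (int j) + 1" and g' = "\<lambda>(b, j). len (int j) + 1"]
    by auto
  ultimately show ?thesis using assms by (simp add: fin_state_def mem_size_def)
qed

text \<open>A store pays for the address and contents of its cell out of its own time, so the space
  bound reduces to the time bound. Finiteness has to be carried along because a sum over an infinite
  support would be 0.\<close>

lemma exec_mem_size:
  "exec c s t m r s' \<Longrightarrow> fin_state s \<Longrightarrow>
    fin_state s' \<and> m \<le> mem_size s + t \<and> mem_size s' \<le> mem_size s + t"
proof (induction rule: exec.induct)
  case (IStore s' a s i e \<tau>)
  have "len (int (nat (ival s i))) + len (ival s e) \<le> \<tau>"
    using len_ival_le_icost[of s i] len_ival_le_icost[of s e] len_int_nat_le[of "ival s i"] IStore
    by simp
  then show ?case using IStore mem_size_iupd[of s a "nat (ival s i)" "ival s e"] by auto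
next
  case (RStore s' a s i e \<tau>)
  have "len (int (nat (ival s i))) + 1 \<le> \<tau>"
    using len_ival_le_icost[of s i] len_int_nat_le[of "ival s i"] RStore by simp
  then show ?case using RStore mem_size_rupd[of s a "nat (ival s i)" "rval s e"] by auto
qed auto

text \<open>A store changes one cell and costs at least 1. Applied to the output array of a matrix
  product, this yields the lower bound \<open>N * N\<close> on the multiplication time.\<close>

lemma exec_changes:
  "exec c s t m r s' \<Longrightarrow>
    finite {i. rmem s' a i \<noteq> rmem s a i} \<and> card {i. rmem s' a i \<noteq> rmem s a i} \<le> t"
proof (induction rule: exec.induct)
  case (RStore s' b s i e \<tau>)
  have "{i. rmem s' a i \<noteq> rmem s a i} \<subseteq> {nat (ival s i)}" using RStore by auto
  from finite_subset[OF this] card_mono[OF _ this] show ?case using RStore by auto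
next
  case (Seq c1 s t1 m1 r1 s' c2 t2 m2 r2 s'')
  have sub: "{i. rmem s'' a i \<noteq> rmem s a i}
      \<subseteq> {i. rmem s' a i \<noteq> rmem s a i} \<union> {i. rmem s'' a i \<noteq> rmem s' a i}" by auto
  have "card {i. rmem s'' a i \<noteq> rmem s a i}
      \<le> card ({i. rmem s' a i \<noteq> rmem s a i} \<union> {i. rmem s'' a i \<noteq> rmem s' a i})"
    using Seq.IH by (intro card_mono[OF _ sub]) auto
  also have "\<dots> \<le> t1 + t2" using Seq.IH by (meson add_mono card_Un_le le_trans)
  finally show ?case using finite_subset[OF sub] Seq.IH by auto
next
  case (While_True \<tau> s e c t1 m1 r1 s' t2 m2 r2 s'')
  have sub: "{i. rmem s'' a i \<noteq> rmem s a i}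
      \<subseteq> {i. rmem s' a i \<noteq> rmem s a i} \<union> {i. rmem s'' a i \<noteq> rmem s' a i}" by auto
  have "card {i. rmem s'' a i \<noteq> rmem s a i}
      \<le> card ({i. rmem s' a i \<noteq> rmem s a i} \<union> {i. rmem s'' a i \<noteq> rmem s' a i})"
    using While_True.IH by (intro card_mono[OF _ sub]) auto
  also have "\<dots> \<le> t1 + t2" using While_True.IH by (meson add_mono card_Un_le le_trans)
  finally show ?case using finite_subset[OF sub] While_True.IH by auto
qed auto

section \<open>Program transformations\<close>

fun ishift :: "nat \<Rightarrow> iexp \<Rightarrow> iexp" where
  "ishift io (INum z) = INum z"
| "ishift io (ILoad a e) = ILoad (io + a) (ishift io e)"
| "ishift io (IAdd e f) = IAdd (ishift io e) (ishift io f)"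
| "ishift io (ISub e f) = ISub (ishift io e) (ishift io f)"
| "ishift io (IMul e f) = IMul (ishift io e) (ishift io f)"
| "ishift io (IDiv e f) = IDiv (ishift io e) (ishift io f)"
| "ishift io (IMod e f) = IMod (ishift io e) (ishift io f)"

fun rshift :: "nat \<Rightarrow> nat \<Rightarrow> rexp \<Rightarrow> rexp" where
  "rshift io ro RZero = RZero"
| "rshift io ro ROne = ROne"
| "rshift io ro (RLoad a e) = RLoad (ro + a) (ishift io e)"
| "rshift io ro (RAdd e f) = RAdd (rshift io ro e) (rshift io ro f)"
| "rshift io ro (RSub e f) = RSub (rshift io ro e) (rshift io ro f)"
| "rshift io ro (RMul e f) = RMul (rshift io ro e) (rshift io ro f)"

fun shift :: "nat \<Rightarrow> nat \<Rightarrow> com \<Rightarrow> com" where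
  "shift io ro Skip = Skip"
| "shift io ro (IStore a i e) = IStore (io + a) (ishift io i) (ishift io e)"
| "shift io ro (RStore a i e) = RStore (ro + a) (ishift io i) (rshift io ro e)"
| "shift io ro (Seq c d) = Seq (shift io ro c) (shift io ro d)"
| "shift io ro (IfPos e c d) = IfPos (ishift io e) (shift io ro c) (shift io ro d)"
| "shift io ro (WhilePos e c) = WhilePos (ishift io e) (shift io ro c)"

text \<open>\<open>'q\<close> is the ring for which the program is specified and \<open>'r\<close>
  the ring of the machine that runs it. In the application these are the polynomials and the reals,
  and \<open>h\<close> forms constant polynomials.\<close>

locale ring_embedding =
  fixes h :: "'r::ring_1 \<Rightarrow> 'q::ring_1"
  assumes h_0: "h 0 = 0" and h_1: "h 1 = 1"
    and h_add: "h (x + y) = h x + h y"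
    and h_diff: "h (x - y) = h x - h y"
    and h_mult: "h (x * y) = h x * h y"
begin

definition shifted :: "nat \<Rightarrow> nat \<Rightarrow> 'q state \<Rightarrow> 'r state \<Rightarrow> bool" where
  "shifted io ro s v \<longleftrightarrow>
     (\<forall>a. imem v (io + a) = imem s a) \<and> (\<forall>a i. h (rmem v (ro + a) i) = rmem s a i)"

lemma ishift_correct:
  "shifted io ro s v \<Longrightarrow> ival v (ishift io e) = ival s e \<and> icost v (ishift io e) = icost s e"
  by (induction e) (auto simp: shifted_def)

lemma rshift_correct:
  "shifted io ro s v \<Longrightarrow> h (rval v (rshift io ro e)) = rval s e \<and>
    rcost v (rshift io ro e) = rcost s e"
  by (induction e)
    (auto simp: h_0 h_1 h_add h_diff h_mult ishift_correct, auto simp: shifted_def)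

text \<open>Ring elements are never tested and ring operations cost the same in every ring, so both
  runs take the same branches and the same time. The space is left open, since the arrays below
  \<open>io\<close> and \<open>ro\<close> hold the caller's data; it is recovered from the time by
  \<open>exec_mem_size\<close>.\<close>

lemma exec_shift:
  "exec c s t m r s' \<Longrightarrow> shifted io ro s v \<Longrightarrow>
    \<exists>m' r' v'. exec (shift io ro c) v t m' r' v' \<and> shifted io ro s' v' \<and>
      (\<forall>a<io. imem v' a = imem v a) \<and> (\<forall>a<ro. rmem v' a = rmem v a)"
proof (induction arbitrary: v rule: exec.induct)
  case (Skip s)
  then show ?case using exec.Skip by fastforce
next
  case (IStore s' a s i e \<tau>)
  have *: "exec (IStore (io + a) (ishift io i) (ishift io e)) v \<tau>
     (max (mem_size v + \<tau>) (mem_size (iupd (io + a) (nat (ival s i)) (ival s e) v))) 0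
     (iupd (io + a) (nat (ival s i)) (ival s e) v)"
    using IStore ishift_correct[OF IStore.prems] by (intro exec.IStore) simp_all
  have "shifted io ro s' (iupd (io + a) (nat (ival s i)) (ival s e) v)"
    using IStore by (auto simp: shifted_def)
  then show ?case using * by (fastforce)
next
  case (RStore s' a s i e \<tau>)
  have *: "exec (RStore (ro + a) (ishift io i) (rshift io ro e)) v \<tau>
     (max (mem_size v + \<tau>) (mem_size (rupd (ro + a) (nat (ival s i)) (rval v (rshift io ro e)) v)))
     (ring_ops (rshift io ro e))
     (rupd (ro + a) (nat (ival s i)) (rval v (rshift io ro e)) v)"
    using RStore ishift_correct[OF RStore.prems] rshift_correct[OF RStore.prems]
    by (intro exec.RStore) simp_all
  have "shifted io ro s' (rupd (ro + a) (nat (ival s i)) (rval v (rshift io ro e)) v)"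
    using RStore rshift_correct[OF RStore.prems, of e] by (auto simp: shifted_def)
  then show ?case using * by fastforce
next
  case (Seq c1 s t1 m1 r1 s' c2 t2 m2 r2 s'')
  from Seq.IH(1)[OF Seq.prems] obtain m' r' v' where
    1: "exec (shift io ro c1) v t1 m' r' v'" "shifted io ro s' v'"
      "\<forall>a<io. imem v' a = imem v a" "\<forall>a<ro. rmem v' a = rmem v a" by blast
  from Seq.IH(2)[OF 1(2)] obtain m'' r'' v'' where
    2: "exec (shift io ro c2) v' t2 m'' r'' v''" "shifted io ro s'' v''"
      "\<forall>a<io. imem v'' a = imem v' a" "\<forall>a<ro. rmem v'' a = rmem v' a" by blast
  show ?case using exec.Seq[OF 1(1) 2(1)] 1 2 by auto
next
  case (IfPos \<tau> s e c1 c2 t m r s')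
  from IfPos.IH[OF IfPos.prems] obtain m' r' v' where
    1: "exec (shift io ro (if 0 < ival s e then c1 else c2)) v t m' r' v'" "shifted io ro s' v'"
      "\<forall>a<io. imem v' a = imem v a" "\<forall>a<ro. rmem v' a = rmem v a" by blast
  have "exec (shift io ro (IfPos e c1 c2)) v (\<tau> + t) (max (mem_size v + \<tau>) m') r' v'"
    unfolding shift.simps using ishift_correct[OF IfPos.prems, of e] 1(1) IfPos.hyps
    by (intro exec.IfPos) (auto split: if_splits)
  then show ?case using 1 by blast
next
  case (While_False \<tau> s e c)
  have "exec (shift io ro (WhilePos e c)) v \<tau> (mem_size v + \<tau>) 0 v"
    unfolding shift.simps using ishift_correct[OF While_False.prems, of e] While_False
    by (intro exec.While_False) auto
  then show ?case using While_False by blast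
next
  case (While_True \<tau> s e c t1 m1 r1 s' t2 m2 r2 s'')
  from While_True.IH(1)[OF While_True.prems] obtain m' r' v' where
    1: "exec (shift io ro c) v t1 m' r' v'" "shifted io ro s' v'"
      "\<forall>a<io. imem v' a = imem v a" "\<forall>a<ro. rmem v' a = rmem v a" by blast
  from While_True.IH(2)[OF 1(2)] obtain m'' r'' v'' where
    2: "exec (shift io ro (WhilePos e c)) v' t2 m'' r'' v''" "shifted io ro s'' v''"
      "\<forall>a<io. imem v'' a = imem v' a" "\<forall>a<ro. rmem v'' a = rmem v' a" by blast
  have "exec (shift io ro (WhilePos e c)) v (\<tau> + t1 + t2)
      (max (mem_size v + \<tau>) (max m' m'')) (r' + r'') v''"
    unfolding shift.simps
    using ishift_correct[OF While_True.prems, of e] While_True.hyps 1(1) 2(1)[unfolded shift.simps]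
    by (intro exec.While_True) auto
  then show ?case using 1 2 by auto
qed

end

section \<open>Ring operations simulated by residues\<close>

fun iarrs :: "iexp \<Rightarrow> nat set" where
  "iarrs (INum z) = {}"
| "iarrs (ILoad a e) = insert a (iarrs e)"
| "iarrs (IAdd e f) = iarrs e \<union> iarrs f"
| "iarrs (ISub e f) = iarrs e \<union> iarrs f"
| "iarrs (IMul e f) = iarrs e \<union> iarrs f"
| "iarrs (IDiv e f) = iarrs e \<union> iarrs f"
| "iarrs (IMod e f) = iarrs e \<union> iarrs f"

fun rarrs :: "rexp \<Rightarrow> nat set" where
  "rarrs RZero = {}"
| "rarrs ROne = {}"
| "rarrs (RLoad a e) = iarrs e"
| "rarrs (RAdd e f) = rarrs e \<union> rarrs f"
| "rarrs (RSub e f) = rarrs e \<union> rarrs f"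
| "rarrs (RMul e f) = rarrs e \<union> rarrs f"

fun carrs :: "com \<Rightarrow> nat set" where
  "carrs Skip = {}"
| "carrs (IStore a i e) = insert a (iarrs i \<union> iarrs e)"
| "carrs (RStore a i e) = iarrs i \<union> rarrs e"
| "carrs (Seq c d) = carrs c \<union> carrs d"
| "carrs (IfPos e c d) = iarrs e \<union> carrs c \<union> carrs d"
| "carrs (WhilePos e c) = iarrs e \<union> carrs c"

fun cwrites :: "com \<Rightarrow> nat set" where
  "cwrites (IStore a i e) = {a}"
| "cwrites (Seq c d) = cwrites c \<union> cwrites d"
| "cwrites (IfPos e c d) = cwrites c \<union> cwrites d"
| "cwrites (WhilePos e c) = cwrites c"
| "cwrites _ = {}"

lemma finite_carrs: "finite (carrs c)"
proof -
  have i: "finite (iarrs e)" for e by (induction e) auto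
  have "finite (rarrs e)" for e by (induction e) (auto simp: i)
  then show ?thesis using i by (induction c) auto
qed

lemma cwrites_shift: "cwrites (shift io ro c) = (+) io ` cwrites c"
  by (induction c) auto

text \<open>
  Ring array \<open>r\<close> is moved to integer array \<open>off + r\<close>, and all ring operations are carried out
  modulo the integer kept in cell 0 of array \<open>Q\<close>.
\<close>

fun rmod :: "nat \<Rightarrow> nat \<Rightarrow> rexp \<Rightarrow> iexp" where
  "rmod Q off RZero = INum 0"
| "rmod Q off ROne = IMod (INum 1) (ILoad Q (INum 0))"
| "rmod Q off (RLoad a e) = ILoad (off + a) e"
| "rmod Q off (RAdd e f) = IMod (IAdd (rmod Q off e) (rmod Q off f)) (ILoad Q (INum 0))"
| "rmod Q off (RSub e f) = IMod (ISub (rmod Q off e) (rmod Q off f)) (ILoad Q (INum 0))"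
| "rmod Q off (RMul e f) = IMod (IMul (rmod Q off e) (rmod Q off f)) (ILoad Q (INum 0))"

fun cmod :: "nat \<Rightarrow> nat \<Rightarrow> com \<Rightarrow> com" where
  "cmod Q off (RStore a i e) = IStore (off + a) i (rmod Q off e)"
| "cmod Q off (Seq c d) = Seq (cmod Q off c) (cmod Q off d)"
| "cmod Q off (IfPos e c d) = IfPos e (cmod Q off c) (cmod Q off d)"
| "cmod Q off (WhilePos e c) = WhilePos e (cmod Q off c)"
| "cmod Q off c = c"

text \<open>Integrality of all ring cells of \<open>s\<close> is part of the relation: it is what
  gives residues a meaning, and it is preserved by sums, differences and products.\<close>

definition reduced :: "int \<Rightarrow> nat \<Rightarrow> nat \<Rightarrow> 'r::ring_1 state \<Rightarrow> 'p state \<Rightarrow> bool" where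
  "reduced q Q off s v \<longleftrightarrow> (\<forall>a<off. imem v a = imem s a) \<and> imem v Q 0 = q \<and>
     (\<forall>a i. \<exists>z. rmem s a i = of_int z \<and> imem v (off + a) i = z mod q)"

lemma reduced_ival:
  "reduced q Q off s v \<Longrightarrow> iarrs e \<subseteq> {..<off} \<Longrightarrow>
    ival v e = ival s e \<and> icost v e = icost s e"
  by (induction e) (auto simp: reduced_def)

text \<open>Reducing after every operation keeps all simulated ring elements as short as the
  modulus, which is why the simulation costs only a factor proportional to
  \<open>len q\<close>.\<close>

lemma len_mod_le: "0 < q \<Longrightarrow> len (z mod q) \<le> len q"
  by (rule len_mono) (simp add: order_less_imp_le)

text \<open>Besides its operands, a simulated operation pays for an unreduced value of length at
  most \<open>2 * len q\<close>, for loading the modulus and for the reduced value; the factor 10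
  covers this.\<close>

lemma rmod_correct:
  assumes "reduced q Q off s v" "2 \<le> q" "rarrs e \<subseteq> {..<off}"
  shows "(\<exists>z. rval s e = of_int z \<and> ival v (rmod Q off e) = z mod q) \<and>
    icost v (rmod Q off e) \<le> 10 * len q * rcost s e"
proof -
  have Q: "imem v Q 0 = q" using assms by (simp add: reduced_def)
  have small: "len 0 \<le> len q" "len 1 \<le> len q" using assms(2) by (auto intro!: len_mono)
  have l2: "1 \<le> len q" by (rule len_ge_1)
  show ?thesis using assms(3)
  proof (induction e)
    case RZero
    have "rval s RZero = of_int 0 \<and> ival v (rmod Q off RZero) = 0 mod q" by simp
    then show ?case using small by (fastforce)
  next
    case ROne
    have "rval s ROne = of_int 1 \<and> ival v (rmod Q off ROne) = 1 mod q" using Q by simp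
    moreover have "len (1 mod q) \<le> len q" by (rule len_mod_le) (use assms in simp)
    ultimately show ?case using small l2 Q by (fastforce)
  next
    case (RLoad a e)
    have "ival v e = ival s e" "icost v e = icost s e"
      using reduced_ival[OF assms(1), of e] RLoad by auto
    moreover obtain z where z: "rmem s a (nat (ival s e)) = of_int z"
        "imem v (off + a) (nat (ival s e)) = z mod q"
      using assms(1) unfolding reduced_def by blast
    moreover have "len (z mod q) \<le> len q" by (rule len_mod_le) (use assms in simp)
    moreover have "icost v (rmod Q off (RLoad a e)) = icost s e + len (z mod q)"
      using z \<open>ival v e = ival s e\<close> \<open>icost v e = icost s e\<close> by simp
    moreover have "1 * icost s e \<le> 10 * len q * icost s e" using l2 by (intro mult_le_mono1) simp
    ultimately have "icost v (rmod Q off (RLoad a e)) \<le> 10 * len q * icost s e + 10 * len q * 1"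
      by linarith
    then show ?case using z \<open>ival v e = ival s e\<close> unfolding rcost.simps distrib_left by auto
  next
    case (RAdd e f)
    then obtain z y where z: "rval s e = of_int z" "ival v (rmod Q off e) = z mod q"
        "icost v (rmod Q off e) \<le> 10 * len q * rcost s e"
        "rval s f = of_int y" "ival v (rmod Q off f) = y mod q"
        "icost v (rmod Q off f) \<le> 10 * len q * rcost s f" by auto
    have l: "len (x mod q) \<le> len q" for x by (rule len_mod_le) (use assms in simp)
    have "len (z mod q + y mod q) \<le> 2 * len q"
      using len_add_le[of "z mod q" "y mod q"] l[of z] l[of y] by linarith
    then have "icost v (rmod Q off (RAdd e f)) \<le> 10 * len q * rcost s (RAdd e f)"
      using z Q l[of "z mod q + y mod q"] small by (simp add: algebra_simps)
    then show ?case using z Q by (auto intro!: exI[of _ "z + y"] simp: mod_simps)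
  next
    case (RSub e f)
    then obtain z y where z: "rval s e = of_int z" "ival v (rmod Q off e) = z mod q"
        "icost v (rmod Q off e) \<le> 10 * len q * rcost s e"
        "rval s f = of_int y" "ival v (rmod Q off f) = y mod q"
        "icost v (rmod Q off f) \<le> 10 * len q * rcost s f" by auto
    have l: "len (x mod q) \<le> len q" for x by (rule len_mod_le) (use assms in simp)
    have "len (- (y mod q)) \<le> len (y mod q)" by (rule len_mono) simp
    then have "len (z mod q - y mod q) \<le> 2 * len q"
      using len_add_le[of "z mod q" "- (y mod q)"] l[of z] l[of y] by simp
    then have "icost v (rmod Q off (RSub e f)) \<le> 10 * len q * rcost s (RSub e f)"
      using z Q l[of "z mod q - y mod q"] small by (simp add: algebra_simps)
    then show ?case using z Q by (auto intro!: exI[of _ "z - y"] simp: mod_simps)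
  next
    case (RMul e f)
    then obtain z y where z: "rval s e = of_int z" "ival v (rmod Q off e) = z mod q"
        "icost v (rmod Q off e) \<le> 10 * len q * rcost s e"
        "rval s f = of_int y" "ival v (rmod Q off f) = y mod q"
        "icost v (rmod Q off f) \<le> 10 * len q * rcost s f" by auto
    have l: "len (x mod q) \<le> len q" for x by (rule len_mod_le) (use assms in simp)
    have "len ((z mod q) * (y mod q)) \<le> 2 * len q"
      using len_mult_le[of "z mod q" "y mod q"] l[of z] l[of y] by linarith
    then have "icost v (rmod Q off (RMul e f)) \<le> 10 * len q * rcost s (RMul e f)"
      using z Q l[of "(z mod q) * (y mod q)"] small by (simp add: algebra_simps)
    then show ?case using z Q by (auto intro!: exI[of _ "z * y"] simp: mod_simps)
  qed
qed

text \<open>Addresses and tests depend only on integer arrays below \<open>off\<close>, which both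
  runs share, so the control flow is the same and only ring operations become longer. The modulus
  survives because \<open>c\<close> does not write to \<open>Q\<close>.\<close>

lemma exec_cmod:
  assumes "2 \<le> q" "Q < off"
  shows "exec c s t m r s' \<Longrightarrow> reduced q Q off s v \<Longrightarrow> carrs c \<subseteq> {..<off} \<Longrightarrow> Q \<notin> cwrites c \<Longrightarrow>
    \<exists>t' m' r' v'. exec (cmod Q off c) v t' m' r' v' \<and> reduced q Q off s' v' \<and>
      t' \<le> 10 * len q * t"
proof (induction arbitrary: v rule: exec.induct)
  case (Skip s)
  then show ?case using exec.Skip[of v] len_ge_1[of q] by fastforce
next
  case (IStore s' a s i e \<tau>)
  have c: "ival v i = ival s i \<and> icost v i = icost s i" "ival v e = ival s e \<and> icost v e = icost s e"
    using reduced_ival[OF IStore.prems(1)] IStore.prems by auto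
  have *: "exec (IStore a i e) v \<tau>
     (max (mem_size v + \<tau>) (mem_size (iupd a (nat (ival s i)) (ival s e) v))) 0
     (iupd a (nat (ival s i)) (ival s e) v)"
    using IStore c by (intro exec.IStore) simp_all
  have "reduced q Q off s' (iupd a (nat (ival s i)) (ival s e) v)"
    using IStore by (auto simp: reduced_def)
  moreover have "\<tau> \<le> 10 * len q * \<tau>" using len_ge_1[of q] by simp
  ultimately show ?case using * by (metis cmod.simps(6))
next
  case (RStore s' a s i e \<tau>)
  have c: "ival v i = ival s i \<and> icost v i = icost s i"
    using reduced_ival[OF RStore.prems(1)] RStore.prems by auto
  from rmod_correct[OF RStore.prems(1) assms(1), of e] RStore.prems obtain z where
    z: "rval s e = of_int z" "ival v (rmod Q off e) = z mod q"
      "icost v (rmod Q off e) \<le> 10 * len q * rcost s e" by auto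
  let ?v = "iupd (off + a) (nat (ival s i)) (z mod q) v"
  have *: "exec (IStore (off + a) i (rmod Q off e)) v (icost v i + icost v (rmod Q off e) + 1)
     (max (mem_size v + (icost v i + icost v (rmod Q off e) + 1)) (mem_size ?v)) 0 ?v"
    using c z by (intro exec.IStore) simp_all
  have "reduced q Q off s' ?v" using RStore z assms(2)
    by (auto simp: reduced_def)
  moreover have "1 * (icost s i + 1) \<le> 10 * len q * (icost s i + 1)"
    using len_ge_1[of q] by (intro mult_le_mono1) simp
  then have "icost v i + icost v (rmod Q off e) + 1 \<le> 10 * len q * \<tau>"
    using c z RStore.hyps by (simp add: algebra_simps)
  ultimately show ?case using * by (metis cmod.simps(1))
next
  case (Seq c1 s t1 m1 r1 s' c2 t2 m2 r2 s'')
  from Seq.IH(1)[OF Seq.prems(1)] Seq.prems obtain t' m' r' v' where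
    1: "exec (cmod Q off c1) v t' m' r' v'" "reduced q Q off s' v'" "t' \<le> 10 * len q * t1" by auto
  from Seq.IH(2)[OF 1(2)] Seq.prems obtain t'' m'' r'' v'' where
    2: "exec (cmod Q off c2) v' t'' m'' r'' v''" "reduced q Q off s'' v''" "t'' \<le> 10 * len q * t2"
    by auto
  have "t' + t'' \<le> 10 * len q * (t1 + t2)" using 1(3) 2(3) by (simp add: distrib_left)
  then show ?case using exec.Seq[OF 1(1) 2(1)] 2(2) unfolding cmod.simps by blast
next
  case (IfPos \<tau> s e c1 c2 t m r s')
  have c: "ival v e = ival s e \<and> icost v e = icost s e"
    using reduced_ival[OF IfPos.prems(1)] IfPos.prems by auto
  have "carrs (if 0 < ival s e then c1 else c2) \<subseteq> {..<off}"
    "Q \<notin> cwrites (if 0 < ival s e then c1 else c2)" using IfPos.prems by auto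
  from IfPos.IH[OF IfPos.prems(1) this] obtain t' m' r' v' where
    1: "exec (cmod Q off (if 0 < ival s e then c1 else c2)) v t' m' r' v'" "reduced q Q off s' v'"
      "t' \<le> 10 * len q * t" by blast
  have "exec (cmod Q off (IfPos e c1 c2)) v (\<tau> + t') (max (mem_size v + \<tau>) m') r' v'"
    unfolding cmod.simps using c 1(1) IfPos.hyps
    by (intro exec.IfPos) (auto split: if_splits)
  moreover have "\<tau> \<le> 10 * len q * \<tau>" using len_ge_1[of q] by simp
  then have "\<tau> + t' \<le> 10 * len q * (\<tau> + t)" using 1(3) unfolding distrib_left by linarith
  ultimately show ?case using 1(2) by blast
next
  case (While_False \<tau> s e c)
  have c: "ival v e = ival s e \<and> icost v e = icost s e"
    using reduced_ival[OF While_False.prems(1)] While_False.prems by auto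
  have "exec (cmod Q off (WhilePos e c)) v \<tau> (mem_size v + \<tau>) 0 v"
    unfolding cmod.simps using c While_False by (intro exec.While_False) auto
  moreover have "\<tau> \<le> 10 * len q * \<tau>" using len_ge_1[of q] by simp
  ultimately show ?case using While_False by blast
next
  case (While_True \<tau> s e c t1 m1 r1 s' t2 m2 r2 s'')
  have c: "ival v e = ival s e \<and> icost v e = icost s e"
    using reduced_ival[OF While_True.prems(1)] While_True.prems by auto
  from While_True.IH(1)[OF While_True.prems(1)] While_True.prems obtain t' m' r' v' where
    1: "exec (cmod Q off c) v t' m' r' v'" "reduced q Q off s' v'" "t' \<le> 10 * len q * t1" by auto
  from While_True.IH(2)[OF 1(2)] While_True.prems obtain t'' m'' r'' v'' where
    2: "exec (cmod Q off (WhilePos e c)) v' t'' m'' r'' v''" "reduced q Q off s'' v''"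
      "t'' \<le> 10 * len q * t2" by auto
  have "exec (cmod Q off (WhilePos e c)) v (\<tau> + t' + t'')
      (max (mem_size v + \<tau>) (max m' m'')) (r' + r'') v''"
    unfolding cmod.simps using c While_True.hyps 1(1) 2(1)[unfolded cmod.simps]
    by (intro exec.While_True) auto
  moreover have "\<tau> \<le> 10 * len q * \<tau>" using len_ge_1[of q] by simp
  then have "\<tau> + t' + t'' \<le> 10 * len q * (\<tau> + t1 + t2)" using 1(3) 2(3)
    unfolding distrib_left by linarith
  ultimately show ?case using 2(2) by blast
qed

section \<open>Structured programs and their weakest preconditions\<close>

text \<open>
  In \<open>For big v e c\<close> the counter is kept in cell 0 and the number of iterations in cell 1 of
  integer array \<open>v\<close>.  The flag separates the loops over partial assignments, of exponential
  length, from those of polynomial length.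
\<close>

datatype prog =
    Nop
  | IS nat iexp iexp
  | RS nat iexp rexp
  | Sq prog prog (infixr \<open>;;\<close> 60)
  | Cond iexp prog prog
  | For bool nat iexp prog

primrec compile :: "prog \<Rightarrow> com" where
  "compile Nop = Skip"
| "compile (IS a i e) = IStore a i e"
| "compile (RS a i e) = RStore a i e"
| "compile (c ;; d) = Seq (compile c) (compile d)"
| "compile (Cond e c d) = IfPos e (compile c) (compile d)"
| "compile (For big v e c) =
     Seq (IStore v (INum 1) e) (Seq (IStore v (INum 0) (INum 0))
       (WhilePos (ISub (ILoad v (INum 1)) (ILoad v (INum 0)))
         (Seq (compile c) (IStore v (INum 0) (IAdd (ILoad v (INum 0)) (INum 1))))))"

primrec arrs :: "prog \<Rightarrow> nat set" where
  "arrs Nop = {}"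
| "arrs (IS a i e) = iarrs i \<union> iarrs e"
| "arrs (RS a i e) = iarrs i \<union> rarrs e"
| "arrs (c ;; d) = arrs c \<union> arrs d"
| "arrs (Cond e c d) = iarrs e \<union> arrs c \<union> arrs d"
| "arrs (For big v e c) = insert v (iarrs e \<union> arrs c)"

primrec iwrites :: "prog \<Rightarrow> nat set" where
  "iwrites Nop = {}"
| "iwrites (IS a i e) = {a}"
| "iwrites (RS a i e) = {}"
| "iwrites (c ;; d) = iwrites c \<union> iwrites d"
| "iwrites (Cond e c d) = iwrites c \<union> iwrites d"
| "iwrites (For big v e c) = insert v (iwrites c)"

primrec rwrites :: "prog \<Rightarrow> nat set" where
  "rwrites Nop = {}"
| "rwrites (IS a i e) = {}"
| "rwrites (RS a i e) = {a}"
| "rwrites (c ;; d) = rwrites c \<union> rwrites d"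
| "rwrites (Cond e c d) = rwrites c \<union> rwrites d"
| "rwrites (For big v e c) = rwrites c"

primrec wf_prog :: "prog \<Rightarrow> bool" where
  "wf_prog Nop = True"
| "wf_prog (IS a i e) = True"
| "wf_prog (RS a i e) = True"
| "wf_prog (c ;; d) = (wf_prog c \<and> wf_prog d)"
| "wf_prog (Cond e c d) = (wf_prog c \<and> wf_prog d)"
| "wf_prog (For big v e c) = (v \<notin> iwrites c \<and> wf_prog c)"

lemma cwrites_compile: "cwrites (compile c) = iwrites c"
  by (induction c) auto

lemma carrs_compile: "carrs (compile c) = arrs c \<union> iwrites c"
  by (induction c) auto

text \<open>Values of \<open>e\<close> are bounded by \<open>B ^ wt e\<close> if all memory cells are bounded by \<open>B\<close>.\<close>

primrec wt :: "iexp \<Rightarrow> nat" where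
  "wt (INum z) = nat \<bar>z\<bar> + 1"
| "wt (ILoad a e) = 1"
| "wt (IAdd e f) = wt e + wt f"
| "wt (ISub e f) = wt e + wt f"
| "wt (IMul e f) = wt e + wt f"
| "wt (IDiv e f) = wt e + wt f"
| "wt (IMod e f) = wt e + wt f"

text \<open>\<open>ki\<close>, \<open>kr\<close> and \<open>kp\<close> measure costs in units of
  \<open>len B\<close>. Each arithmetic node contributes its operands and the weight of its own
  value.\<close>

primrec ki :: "iexp \<Rightarrow> nat" where
  "ki (INum z) = wt (INum z)"
| "ki (ILoad a e) = ki e + 1"
| "ki (IAdd e f) = ki e + ki f + (wt e + wt f)"
| "ki (ISub e f) = ki e + ki f + (wt e + wt f)"
| "ki (IMul e f) = ki e + ki f + (wt e + wt f)"
| "ki (IDiv e f) = ki e + ki f + (wt e + wt f)"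
| "ki (IMod e f) = ki e + ki f + (wt e + wt f)"

primrec kr :: "rexp \<Rightarrow> nat" where
  "kr RZero = 1"
| "kr ROne = 1"
| "kr (RLoad a e) = ki e + 1"
| "kr (RAdd e f) = kr e + kr f + 1"
| "kr (RSub e f) = kr e + kr f + 1"
| "kr (RMul e f) = kr e + kr f + 1"

text \<open>The 100 of a loop pays for initializing, testing and incrementing its counter; the
  number of iterations is accounted for by \<open>sdepth\<close> and \<open>bdepth\<close>.\<close>

primrec kp :: "prog \<Rightarrow> nat" where
  "kp Nop = 1"
| "kp (IS a i e) = ki i + ki e + 1"
| "kp (RS a i e) = ki i + kr e + 1"
| "kp (c ;; d) = kp c + kp d"
| "kp (Cond e c d) = ki e + 1 + kp c + kp d"
| "kp (For big v e c) = ki e + kp c + 100"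

text \<open>The nesting depths of the two kinds of loops become the exponents of \<open>X\<close>
  and \<open>Y\<close> in the time bound. Keeping them apart allows the exponential part to be fixed
  at \<open>Y ^ 2\<close>.\<close>

primrec sdepth :: "prog \<Rightarrow> nat" where
  "sdepth Nop = 0"
| "sdepth (IS a i e) = 0"
| "sdepth (RS a i e) = 0"
| "sdepth (c ;; d) = max (sdepth c) (sdepth d)"
| "sdepth (Cond e c d) = max (sdepth c) (sdepth d)"
| "sdepth (For big v e c) = (if big then sdepth c else Suc (sdepth c))"

primrec bdepth :: "prog \<Rightarrow> nat" where
  "bdepth Nop = 0"
| "bdepth (IS a i e) = 0"
| "bdepth (RS a i e) = 0"
| "bdepth (c ;; d) = max (bdepth c) (bdepth d)"
| "bdepth (Cond e c d) = max (bdepth c) (bdepth d)"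
| "bdepth (For big v e c) = (if big then Suc (bdepth c) else bdepth c)"

text \<open>\<open>X\<close> and \<open>Y\<close> bound the lengths of the polynomial and of the
  exponential loops. Integers are bounded only in the arrays \<open>S\<close> that the structured
  programs read, since nothing is known about the integers that the multiplication program leaves in
  its own arrays.\<close>

locale bounds =
  fixes B :: int and X Y :: nat and S :: "nat set"
  assumes B_ge: "2 \<le> B" and X_ge: "1 \<le> X" and Y_ge: "1 \<le> Y"
begin

definition bdd :: "real state \<Rightarrow> bool" where
  "bdd s \<longleftrightarrow> (\<forall>a\<in>S. \<forall>i. \<bar>imem s a i\<bar> \<le> B)"

lemma wt_ge_1: "1 \<le> wt e"
  by (induction e) auto

lemma power_wt_ge: "2 \<le> B ^ wt e"
proof -
  have "B ^ 1 \<le> B ^ wt e" using B_ge wt_ge_1 by (intro power_increasing) auto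
  then show ?thesis using B_ge by simp
qed

text \<open>For \<open>x\<close> and \<open>y\<close> at least 2 the sum is at most the product, so
  every operation, not only multiplication, can be charged by adding weights in the exponent of
  \<open>B\<close>.\<close>

lemma abs_ival_le:
  assumes "bdd s" "iarrs e \<subseteq> S"
  shows "\<bar>ival s e\<bar> \<le> B ^ wt e"
  using assms(2)
proof (induction e)
  case (INum z)
  have "z \<le> 2 ^ n" if "nat z \<le> n" for z :: int and n
  proof -
    have "z \<le> int n" using that by (simp add: nat_le_iff)
    then show ?thesis using of_nat_less_two_power[of n, where 'a = int] by linarith
  qed
  from this[of "\<bar>z\<bar>" "nat \<bar>z\<bar> + 1"] have "\<bar>z\<bar> \<le> 2 ^ (nat \<bar>z\<bar> + 1)" by simp
  also have "\<dots> \<le> B ^ (nat \<bar>z\<bar> + 1)" using B_ge by (intro power_mono) auto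
  finally show ?case by simp
next
  case (ILoad a e)
  then show ?case using assms by (auto simp: bdd_def)
next
  case (IAdd e f)
  have "x + y \<le> x * y" if "2 \<le> x" "2 \<le> y" for x y :: int
    using mult_mono[of 2 x 2 y] mult_nonneg_nonneg[of "x - 2" "y - 2"] that
    by (simp add: algebra_simps)
  from this[OF power_wt_ge[of e] power_wt_ge[of f]] IAdd show ?case by (simp add: power_add)
next
  case (ISub e f)
  have "x + y \<le> x * y" if "2 \<le> x" "2 \<le> y" for x y :: int
    using mult_mono[of 2 x 2 y] mult_nonneg_nonneg[of "x - 2" "y - 2"] that
    by (simp add: algebra_simps)
  from this[OF power_wt_ge[of e] power_wt_ge[of f]] ISub show ?case by (simp add: power_add)
next
  case (IMul e f)
  then show ?case by (auto simp: power_add abs_mult intro!: mult_mono)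
next
  case (IDiv e f)
  have pos: "\<bar>x div y\<bar> \<le> \<bar>x\<bar>" if "0 < y" for x y :: int
  proof (cases "0 \<le> x div y")
    case True
    then have "1 * (x div y) \<le> y * (x div y)" using that by (intro mult_right_mono) auto
    moreover have "y * (x div y) + x mod y = x" "0 \<le> x mod y" using that by simp_all
    ultimately show ?thesis using True by linarith
  next
    case False
    \<comment> \<open>A negative quotient is rounded away from zero; it suffices that
      \<open>x = y * q + r\<close> lies below \<open>q\<close>, which is itself negative.\<close>
    have "y * q + r \<le> q" if "0 < y" "r < y" "q < 0" for y q r :: int
    proof -
      have "y * (q + 1) \<le> 1 * (q + 1)" using that by (intro mult_right_mono_neg) auto
      then show ?thesis using that by (simp add: distrib_left)
    qed
    from this[of y "x mod y" "x div y"] have "x \<le> x div y" using that False by simp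
    then show ?thesis using False by simp
  qed
  have "\<bar>x div y\<bar> \<le> \<bar>x\<bar>" for x y :: int
    using pos[of y x] pos[of "- y" "- x"] by (cases y "0 :: int" rule: linorder_cases) auto
  then have "\<bar>ival s e div ival s f\<bar> \<le> B ^ wt e * 1" using IDiv by (force intro: order_trans)
  also have "\<dots> \<le> B ^ wt e * B ^ wt f" using power_wt_ge[of e] power_wt_ge[of f]
    by (intro mult_left_mono) auto
  finally show ?case by (simp add: power_add)
next
  case (IMod e f)
  have "x + y \<le> x * y" if "2 \<le> x" "2 \<le> y" for x y :: int
    using mult_mono[of 2 x 2 y] mult_nonneg_nonneg[of "x - 2" "y - 2"] that
    by (simp add: algebra_simps)
  note * = this[OF power_wt_ge[of e] power_wt_ge[of f]]
  \<comment> \<open>Reduction modulo 0 returns \<open>x\<close>, while otherwise the result is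
    bounded by \<open>y\<close>; hence both operands enter the bound.\<close>
  have "\<bar>x mod y\<bar> \<le> \<bar>x\<bar> + \<bar>y\<bar>" for x y :: int
    by (cases "y = 0") (simp_all, smt (verit) abs_mod_less)
  then have "\<bar>ival s e mod ival s f\<bar> \<le> \<bar>ival s e\<bar> + \<bar>ival s f\<bar>" .
  then show ?case using IMod * by (simp add: power_add)
qed

lemma len_ival_le:
  assumes "bdd s" "iarrs e \<subseteq> S"
  shows "len (ival s e) \<le> wt e * len B"
  using abs_ival_le[OF assms] B_ge wt_ge_1 by (rule len_le_power)

lemma icost_le: "bdd s \<Longrightarrow> iarrs e \<subseteq> S \<Longrightarrow> icost s e \<le> ki e * len B"
proof (induction e)
  case (INum z)
  then show ?case using len_ival_le[of s "INum z"] by simp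
next
  case (ILoad a e)
  then show ?case using len_ival_le[of s "ILoad a e"] by (simp add: algebra_simps)
next
  case (IAdd e f)
  then show ?case using len_ival_le[of s "IAdd e f"] by (simp add: algebra_simps)
next
  case (ISub e f)
  then show ?case using len_ival_le[of s "ISub e f"] by (simp add: algebra_simps)
next
  case (IMul e f)
  then show ?case using len_ival_le[of s "IMul e f"] by (simp add: algebra_simps)
next
  case (IDiv e f)
  then show ?case using len_ival_le[of s "IDiv e f"] by (simp add: algebra_simps)
next
  case (IMod e f)
  then show ?case using len_ival_le[of s "IMod e f"] by (simp add: algebra_simps)
qed

lemma rcost_le: "bdd s \<Longrightarrow> rarrs e \<subseteq> S \<Longrightarrow> rcost s e \<le> kr e * len B"
  using len_ge_1[of B] icost_le[of s] by (induction e) (fastforce simp: algebra_simps)+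

text \<open>Besides the postcondition it demands that stored integers stay within \<open>B\<close>
  and loop lengths within \<open>X\<close> or \<open>Y\<close>, so that it also controls the time.
  The number of iterations is fixed on entry, so a loop unfolds into a \<open>foldr\<close> and no
  fixed point is involved.\<close>

primrec wp :: "prog \<Rightarrow> (real state \<Rightarrow> bool) \<Rightarrow> real state \<Rightarrow> bool" where
  "wp Nop Q s = Q s"
| "wp (IS a i e) Q s = (\<bar>ival s e\<bar> \<le> B \<and> Q (iupd a (nat (ival s i)) (ival s e) s))"
| "wp (RS a i e) Q s = Q (rupd a (nat (ival s i)) (rval s e) s)"
| "wp (c ;; d) Q s = wp c (wp d Q) s"
| "wp (Cond e c d) Q s = (if 0 < ival s e then wp c Q s else wp d Q s)"
| "wp (For big v e c) Q s = (\<bar>ival s e\<bar> \<le> B \<and> nat (ival s e) \<le> (if big then Y else X) \<and>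
     foldr (\<lambda>j R s. wp c (\<lambda>s'. R (iupd v 0 (int j + 1) s')) s) [0..<nat (ival s e)] Q
       (iupd v 0 0 (iupd v 1 (ival s e) s)))"

definition frame :: "nat set \<Rightarrow> nat set \<Rightarrow> real state \<Rightarrow> real state \<Rightarrow> bool" where
  "frame W V s s' \<longleftrightarrow>
     (\<forall>a. a \<notin> W \<longrightarrow> imem s' a = imem s a) \<and> (\<forall>a. a \<notin> V \<longrightarrow> rmem s' a = rmem s a)"

lemma frame_trans: "frame W V s s' \<Longrightarrow> frame W' V' s' s'' \<Longrightarrow> W \<subseteq> U \<Longrightarrow> W' \<subseteq> U \<Longrightarrow>
    V \<subseteq> U' \<Longrightarrow> V' \<subseteq> U' \<Longrightarrow> frame U U' s s''"
  unfolding frame_def by (metis subset_iff)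

text \<open>Consequence and frame rule in one: whatever \<open>c\<close> cannot write is available
  unchanged afterwards. Correctness lemmas can therefore mention only what their program
  computes.\<close>

lemma wp_frame_mono:
  "wp c Q s \<Longrightarrow> (\<And>s'. Q s' \<Longrightarrow> frame (iwrites c) (rwrites c) s s' \<Longrightarrow> R s') \<Longrightarrow> wp c R s"
proof (induction c arbitrary: Q R s)
  case (Sq c d)
  have "wp c (wp d Q) s" using Sq.prems by simp
  then have "wp c (wp d R) s"
  proof (rule Sq.IH(1))
    fix s' assume 1: "wp d Q s'" "frame (iwrites c) (rwrites c) s s'"
    show "wp d R s'"
    proof (rule Sq.IH(2)[OF 1(1)])
      fix s'' assume 2: "Q s''" "frame (iwrites d) (rwrites d) s' s''"
      have "frame (iwrites (c ;; d)) (rwrites (c ;; d)) s s''"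
        by (rule frame_trans[OF 1(2) 2(2)]) auto
      then show "R s''" by (rule Sq.prems(2)[OF 2(1)])
    qed
  qed
  then show ?case by simp
next
  case (Cond e c d)
  have sub: "frame (iwrites (Cond e c d)) (rwrites (Cond e c d)) s s'"
    if "frame (iwrites c) (rwrites c) s s' \<or> frame (iwrites d) (rwrites d) s s'" for s'
    using that unfolding frame_def by auto
  show ?case
  proof (cases "0 < ival s e")
    case True
    then have "wp c Q s" using Cond.prems(1) by simp
    then have "wp c R s"
      by (rule Cond.IH(1)) (rule Cond.prems(2), assumption, rule sub, rule disjI1)
    then show ?thesis using True by simp
  next
    case False
    then have "wp d Q s" using Cond.prems(1) by simp
    then have "wp d R s"
      by (rule Cond.IH(2)) (rule Cond.prems(2), assumption, rule sub, rule disjI2)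
    then show ?thesis using False by simp
  qed
next
  case (For big v e c)
  let ?W = "insert v (iwrites c)" and ?V = "rwrites c"
  have loop: "foldr (\<lambda>j R s. wp c (\<lambda>s'. R (iupd v 0 (int j + 1) s')) s) js R u"
    if "foldr (\<lambda>j R s. wp c (\<lambda>s'. R (iupd v 0 (int j + 1) s')) s) js Q u" "frame ?W ?V s u"
    for js u using that
  proof (induction js arbitrary: u)
    case Nil
    then show ?case by (simp add: For.prems(2))
  next
    case (Cons j js)
    from Cons.prems(1) have
      "wp c (\<lambda>s'. foldr (\<lambda>j R s. wp c (\<lambda>s'. R (iupd v 0 (int j + 1) s')) s) js Q
        (iupd v 0 (int j + 1) s')) u" by simp
    then have "wp c (\<lambda>s'. foldr (\<lambda>j R s. wp c (\<lambda>s'. R (iupd v 0 (int j + 1) s')) s) js R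
        (iupd v 0 (int j + 1) s')) u"
    proof (rule For.IH)
      fix s' assume 1: "foldr (\<lambda>j R s. wp c (\<lambda>s'. R (iupd v 0 (int j + 1) s')) s) js Q
        (iupd v 0 (int j + 1) s')" "frame (iwrites c) (rwrites c) u s'"
      then have "frame ?W ?V s (iupd v 0 (int j + 1) s')"
        using Cons.prems(2) by (auto simp: frame_def)
      from Cons.IH[OF 1(1) this]
      show "foldr (\<lambda>j R s. wp c (\<lambda>s'. R (iupd v 0 (int j + 1) s')) s) js R
        (iupd v 0 (int j + 1) s')" .
    qed
    then show ?case by simp
  qed
  have "frame ?W ?V s (iupd v 0 0 (iupd v 1 (ival s e) s))" by (simp add: frame_def)
  then show ?case using For.prems(1) loop unfolding wp.simps by blast
next
  case Nop
  then show ?case by (simp add: frame_def)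
next
  case (IS a i e)
  have "frame {a} {} s (iupd a (nat (ival s i)) (ival s e) s)" by (simp add: frame_def)
  then show ?case using IS by simp
next
  case (RS a i e)
  have "frame {} {a} s (rupd a (nat (ival s i)) (rval s e) s)" by (simp add: frame_def)
  then show ?case using RS by simp
qed

text \<open>The counter is stored in \<open>v\<close>, so the invariant has to tolerate writes to
  \<open>v\<close>. In exchange \<open>step\<close> and \<open>final\<close> receive the frame
  relative to the state before the whole loop, and invariants need not repeat what the loop leaves
  alone.\<close>

lemma wp_For:
  assumes n: "ival s e = int n" "int n \<le> B" "n \<le> (if big then Y else X)" "v \<notin> iwrites c"
    and init: "I 0 s" and stable: "\<And>j i z s'. I j s' \<Longrightarrow> I j (iupd v i z s')"
    and step: "\<And>j s'. j < n \<Longrightarrow> I j s' \<Longrightarrow> imem s' v 0 = int j \<Longrightarrow>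
      frame (insert v (iwrites c)) (rwrites c) s s' \<Longrightarrow> wp c (I (Suc j)) s'"
    and final: "\<And>s'. I n s' \<Longrightarrow> frame (insert v (iwrites c)) (rwrites c) s s' \<Longrightarrow> Q s'"
  shows "wp (For big v e c) Q s"
proof -
  let ?F = "frame (insert v (iwrites c)) (rwrites c)"
  have loop: "foldr (\<lambda>j R s. wp c (\<lambda>s'. R (iupd v 0 (int j + 1) s')) s) [j..<n] Q u"
    if "j \<le> n" "I j u" "imem u v 0 = int j" "?F s u" for j u using that
  proof (induction j arbitrary: u rule: inc_induct)
    case base
    then show ?case using final by simp
  next
    case (step j)
    \<comment> \<open>\<open>assms(7)\<close> is the hypothesis \<open>step\<close>, whose name is
      taken here by the case of the induction.\<close>
    have "wp c (I (Suc j)) u" by (rule assms(7)) (use step in auto)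
    then have "wp c (\<lambda>s'. foldr (\<lambda>j R s. wp c (\<lambda>s'. R (iupd v 0 (int j + 1) s')) s) [Suc j..<n] Q
        (iupd v 0 (int j + 1) s')) u"
    proof (rule wp_frame_mono)
      fix s' assume "I (Suc j) s'" "frame (iwrites c) (rwrites c) u s'"
      then show "foldr (\<lambda>j R s. wp c (\<lambda>s'. R (iupd v 0 (int j + 1) s')) s) [Suc j..<n] Q
        (iupd v 0 (int j + 1) s')"
        using step.prems by (intro step.IH stable) (auto simp: frame_def)
    qed
    then show ?case using step by (simp add: upt_conv_Cons)
  qed
  have "foldr (\<lambda>j R s. wp c (\<lambda>s'. R (iupd v 0 (int j + 1) s')) s) [0..<n] Q
       (iupd v 0 0 (iupd v 1 (ival s e) s))"
    by (rule loop) (auto simp: frame_def intro!: stable init)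
  then show ?thesis using n by simp
qed

section \<open>Soundness with a time bound\<close>

lemma bdd_iupd: "bdd s \<Longrightarrow> \<bar>z\<bar> \<le> B \<Longrightarrow> bdd (iupd a i z s)"
  by (auto simp: bdd_def)

abbreviation T :: "prog \<Rightarrow> nat" where
  "T c \<equiv> kp c * X ^ sdepth c * Y ^ bdepth c * len B"

lemma T_mono:
  assumes "k \<le> k'" "a \<le> a'" "b \<le> b'"
  shows "k * X ^ a * Y ^ b * len B \<le> k' * X ^ a' * Y ^ b' * len B"
  using assms X_ge Y_ge by (intro mult_le_mono power_increasing) auto

text \<open>Each iteration costs the body plus at most \<open>20 * len B\<close> for the test and
  the increment; the last summand pays for the final, failing test.\<close>

lemma loop_sound:
  assumes IH: "\<And>Q s. wp c Q s \<Longrightarrow> bdd s \<Longrightarrow> \<exists>t m r s'. exec (compile c) s t m r s' \<and> Q s' \<and>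
      bdd s' \<and> t \<le> T c"
    and v: "v \<in> S" "v \<notin> iwrites c" and n: "int n \<le> B"
  shows "foldr (\<lambda>j R s. wp c (\<lambda>s'. R (iupd v 0 (int j + 1) s')) s) [j..<n] Q s \<Longrightarrow> bdd s \<Longrightarrow>
    j \<le> n \<Longrightarrow> imem s v 0 = int j \<Longrightarrow> imem s v 1 = int n \<Longrightarrow>
    \<exists>t m r s'. exec (WhilePos (ISub (ILoad v (INum 1)) (ILoad v (INum 0)))
         (Seq (compile c) (IStore v (INum 0) (IAdd (ILoad v (INum 0)) (INum 1))))) s t m r s' \<and>
      Q s' \<and> bdd s' \<and> t \<le> (n - j) * (T c + 20 * len B) + 20 * len B"
proof (induction "n - j" arbitrary: j s)
  case 0
  let ?b = "ISub (ILoad v (INum 1)) (ILoad v (INum 0))"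
  have "icost s ?b + 1 \<le> 20 * len B"
    using icost_le[OF 0(3), of ?b] v len_ge_1[of B] by (simp add: algebra_simps)
  moreover have "\<not> 0 < ival s ?b" using 0 by simp
  note exec.While_False[OF refl this]
  ultimately show ?case using 0 by fastforce
next
  case (Suc x)
  let ?b = "ISub (ILoad v (INum 1)) (ILoad v (INum 0))"
  let ?i = "IStore v (INum 0) (IAdd (ILoad v (INum 0)) (INum 1))"
  have jn: "j < n" using Suc by simp
  have "wp c (\<lambda>s'. foldr (\<lambda>j R s. wp c (\<lambda>s'. R (iupd v 0 (int j + 1) s')) s) [Suc j..<n] Q
        (iupd v 0 (int j + 1) s')) s" using Suc.prems(1) jn by (simp add: upt_conv_Cons)
  \<comment> \<open>The frame rule adds that the body leaves the counter array alone, so counter and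
    bound survive it.\<close>
  then have "wp c (\<lambda>s'. foldr (\<lambda>j R s. wp c (\<lambda>s'. R (iupd v 0 (int j + 1) s')) s) [Suc j..<n] Q
        (iupd v 0 (int j + 1) s') \<and> imem s' v = imem s v) s"
    by (rule wp_frame_mono) (use v in \<open>auto simp: frame_def\<close>)
  from IH[OF this Suc.prems(2)] obtain t m r s1 where
    1: "exec (compile c) s t m r s1" "bdd s1" "t \<le> T c" "imem s1 v = imem s v"
      "foldr (\<lambda>j R s. wp c (\<lambda>s'. R (iupd v 0 (int j + 1) s')) s) [Suc j..<n] Q
        (iupd v 0 (int j + 1) s1)" by blast
  let ?s2 = "iupd v 0 (int j + 1) s1"
  have 2: "exec ?i s1 (icost s1 (INum 0) + icost s1 (IAdd (ILoad v (INum 0)) (INum 1)) + 1)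
      (max (mem_size s1 + (icost s1 (INum 0) + icost s1 (IAdd (ILoad v (INum 0)) (INum 1)) + 1))
        (mem_size ?s2)) 0 ?s2"
    by (rule exec.IStore) (use 1 Suc.prems in simp_all)
  have c2: "icost s1 (INum 0) + icost s1 (IAdd (ILoad v (INum 0)) (INum 1)) + 1 \<le> 10 * len B"
    using icost_le[OF 1(2), of "INum 0"] icost_le[OF 1(2), of "IAdd (ILoad v (INum 0)) (INum 1)"]
      v len_ge_1[of B] by simp
  have b2: "bdd ?s2" using 1(2) jn n by (intro bdd_iupd) auto
  have x: "x = n - Suc j" using Suc.hyps(2) by simp
  obtain t3 m3 r3 s3 where
    3: "exec (WhilePos ?b (Seq (compile c) ?i)) ?s2 t3 m3 r3 s3"
       "Q s3" "bdd s3" "t3 \<le> (n - Suc j) * (T c + 20 * len B) + 20 * len B"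
    using Suc.hyps(1)[OF x 1(5) b2] jn 1(4) Suc.prems by auto
  have c1: "icost s ?b + 1 \<le> 10 * len B"
    using icost_le[OF Suc.prems(2), of ?b] v len_ge_1[of B] by simp
  have 4: "0 < ival s ?b" using Suc.prems jn by simp
  note ex = exec.While_True[OF refl this exec.Seq[OF 1(1) 2] 3(1)]
  have "(n - j) * (T c + 20 * len B) = (n - Suc j) * (T c + 20 * len B) + (T c + 20 * len B)"
    using jn by (metis Suc_diff_Suc add.commute mult_Suc)
  then have "icost s ?b + 1 + (t + (icost s1 (INum 0) + icost s1 (IAdd (ILoad v (INum 0)) (INum 1)) + 1)) + t3
     \<le> (n - j) * (T c + 20 * len B) + 20 * len B" using c1 c2 3(4) 1(3) by linarith
  then show ?case using ex 3 by blast
qed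

text \<open>Costs of consecutive programs are added after raising both to the larger loop depths by
  \<open>T_mono\<close>; a loop multiplies by one more \<open>X\<close> or \<open>Y\<close>.\<close>

theorem wp_sound:
  "wp c Q s \<Longrightarrow> bdd s \<Longrightarrow> wf_prog c \<Longrightarrow> arrs c \<subseteq> S \<Longrightarrow>
    \<exists>t m r s'. exec (compile c) s t m r s' \<and> Q s' \<and> bdd s' \<and> t \<le> T c"
proof (induction c arbitrary: Q s)
  case Nop
  then show ?case using exec.Skip[of s] len_ge_1[of B] by fastforce
next
  case (IS a i e)
  let ?t = "icost s i + icost s e + 1"
  let ?s = "iupd a (nat (ival s i)) (ival s e) s"
  have "exec (IStore a i e) s ?t (max (mem_size s + ?t) (mem_size ?s)) 0 ?s"
    by (rule exec.IStore) simp_all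
  moreover have "?t \<le> T (IS a i e)"
    using icost_le[of s i] icost_le[of s e] IS len_ge_1[of B] by (simp add: algebra_simps)
  moreover have "bdd ?s" using IS by (intro bdd_iupd) auto
  ultimately show ?case using IS by (metis compile.simps(2) wp.simps(2))
next
  case (RS a i e)
  let ?t = "icost s i + rcost s e + 1"
  let ?s = "rupd a (nat (ival s i)) (rval s e) s"
  have "exec (RStore a i e) s ?t (max (mem_size s + ?t) (mem_size ?s)) (ring_ops e) ?s"
    by (rule exec.RStore) simp_all
  moreover have "?t \<le> T (RS a i e)"
    using icost_le[of s i] rcost_le[of s e] RS len_ge_1[of B] by (simp add: algebra_simps)
  moreover have "bdd ?s" using RS by (simp add: bdd_def)
  ultimately show ?case using RS by (metis compile.simps(3) wp.simps(3))
next
  case (Sq c d)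
  from Sq.prems Sq.IH(1)[of "wp d Q" s] obtain t m r s' where
    1: "exec (compile c) s t m r s'" "wp d Q s'" "bdd s'" "t \<le> T c" by auto
  from Sq.prems Sq.IH(2)[OF 1(2,3)] obtain t' m' r' s'' where
    2: "exec (compile d) s' t' m' r' s''" "Q s''" "bdd s''" "t' \<le> T d" by auto
  have "t + t' \<le> kp c * X ^ sdepth (c ;; d) * Y ^ bdepth (c ;; d) * len B +
      kp d * X ^ sdepth (c ;; d) * Y ^ bdepth (c ;; d) * len B"
    by (intro add_mono order_trans[OF 1(4)] order_trans[OF 2(4)] T_mono) auto
  also have "\<dots> = T (c ;; d)" by (simp add: algebra_simps)
  finally show ?case using exec.Seq[OF 1(1) 2(1)] 2 by auto
next
  case (Cond e c d)
  obtain t m r s' where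
    1: "exec (compile (if 0 < ival s e then c else d)) s t m r s'" "Q s'" "bdd s'"
       "t \<le> T (if 0 < ival s e then c else d)"
    using Cond.prems Cond.IH[of Q s] by (auto split: if_splits)
  note 2 = exec.IfPos[OF refl, of s e "compile c" "compile d" t m r s']
  have "icost s e + 1 \<le> ki e * len B + 1 * len B"
    using icost_le[of s e] len_ge_1[of B] Cond.prems by (intro add_mono) auto
  also have "\<dots> = (ki e + 1) * X ^ 0 * Y ^ 0 * len B" by (simp add: algebra_simps)
  also have "\<dots> \<le> (ki e + 1) * X ^ sdepth (Cond e c d) * Y ^ bdepth (Cond e c d) * len B"
    by (rule T_mono) auto
  finally have "icost s e + 1 + t \<le>
      (ki e + 1) * X ^ sdepth (Cond e c d) * Y ^ bdepth (Cond e c d) * len B +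
      (kp c + kp d) * X ^ sdepth (Cond e c d) * Y ^ bdepth (Cond e c d) * len B"
    by (rule add_mono) (rule order_trans[OF 1(4)], rule T_mono, auto)
  also have "\<dots> = T (Cond e c d)" by (simp add: algebra_simps)
  finally show ?case using 1 2 by (auto split: if_splits)
next
  case (For big v e c)
  let ?n = "nat (ival s e)"
  let ?s1 = "iupd v 1 (ival s e) s" and ?s2 = "iupd v 0 0 (iupd v 1 (ival s e) s)"
  have IH: "wp c Q s \<Longrightarrow> bdd s \<Longrightarrow> \<exists>t m r s'. exec (compile c) s t m r s' \<and> Q s' \<and>
      bdd s' \<and> t \<le> T c" for Q s using For by auto
  have b1: "bdd ?s1" using For by (intro bdd_iupd) auto
  have b2: "bdd ?s2" using B_ge by (intro bdd_iupd[OF b1]) auto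
  let ?t1 = "icost s (INum 1) + icost s e + 1" and ?t2 = "icost ?s1 (INum 0) + icost ?s1 (INum 0) + 1"
  have e1: "exec (IStore v (INum 1) e) s ?t1 (max (mem_size s + ?t1) (mem_size ?s1)) 0 ?s1"
    by (rule exec.IStore) simp_all
  have e2: "exec (IStore v (INum 0) (INum 0)) ?s1 ?t2 (max (mem_size ?s1 + ?t2) (mem_size ?s2)) 0 ?s2"
    by (rule exec.IStore) simp_all
  let ?w = "WhilePos (ISub (ILoad v (INum 1)) (ILoad v (INum 0)))
         (Seq (compile c) (IStore v (INum 0) (IAdd (ILoad v (INum 0)) (INum 1))))"
  have "\<exists>t m r s'. exec ?w ?s2 t m r s' \<and>
      Q s' \<and> bdd s' \<and> t \<le> ?n * (T c + 20 * len B) + 20 * len B"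
  proof (cases "0 \<le> ival s e")
    case True
    then show ?thesis
      using loop_sound[OF IH, of v ?n 0 Q ?s2] For.prems b2 by (auto simp: le_nat_iff)
  next
    \<comment> \<open>A negative bound is stored as it is; the first test then fails, in agreement
      with the empty loop that \<open>nat\<close> produces in \<open>wp\<close>.\<close>
    case False
    let ?b = "ISub (ILoad v (INum 1)) (ILoad v (INum 0))"
    have "icost ?s2 ?b + 1 \<le> 20 * len B"
      using icost_le[OF b2, of ?b] For.prems len_ge_1[of B] by simp
    moreover have "\<not> 0 < ival ?s2 ?b" using False by simp
    note exec.While_False[OF refl this]
    ultimately show ?thesis using For.prems False b2 by fastforce
  qed
  then obtain t m r s' where w: "exec ?w ?s2 t m r s'" "Q s'" "bdd s'"
      "t \<le> ?n * (T c + 20 * len B) + 20 * len B" by blast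
  let ?Z = "if big then Y else X"
  have Z: "1 \<le> ?Z" "?n \<le> ?Z" using X_ge Y_ge For.prems by auto
  have "?t1 + (?t2 + t) \<le> (ki e + 10) * len B + 20 * len B + ?n * (T c + 20 * len B)"
    using icost_le[of s "INum 1"] icost_le[of s e] icost_le[OF b1, of "INum 0"] w(4) For.prems
      len_ge_1[of B] by (simp add: algebra_simps)
  \<comment> \<open>Costs paid only once are multiplied by the loop length \<open>?Z\<close>, which
    is at least 1, so that it can be factored out; the slack added next rounds the constant up to
    the 100 of \<open>kp\<close>.\<close>
  also have "\<dots> \<le> ?Z * ((ki e + 10) * len B) + ?Z * (20 * len B) + ?Z * (T c + 20 * len B)"
    using Z by (intro add_mono mult_le_mono1) auto
  also have "\<dots> \<le> ?Z * ((ki e + 10) * len B) + ?Z * (20 * len B) + ?Z * (T c + 20 * len B) +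
      ?Z * (50 * len B)" by simp
  also have "\<dots> = ?Z * (T c + (ki e + 100) * X ^ 0 * Y ^ 0 * len B)" by (simp add: algebra_simps)
  also have "\<dots> \<le> ?Z * (T c + (ki e + 100) * X ^ sdepth c * Y ^ bdepth c * len B)"
    by (intro mult_le_mono2 add_left_mono T_mono) auto
  also have "\<dots> = T (For big v e c)" by (simp add: algebra_simps)
  finally show ?case using exec.Seq[OF e1 exec.Seq[OF e2 w(1)]] w(2,3)
    unfolding compile.simps by blast
qed

end

section \<open>Kronecker substitution into a cyclic group ring\<close>

lemma lookup_exponent:
  "Poly_Mapping.lookup (exponent es) x = (if x < length es then real_of_int (es ! x) else 0)"
  by (simp add: exponent_def lookup_sum lookup_single when_def)

lemma floor_lookup_exponent:
  "\<lfloor>Poly_Mapping.lookup (exponent es) x\<rfloor> = (if x < length es then es ! x else 0)"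
  by (simp add: lookup_exponent)

lemma exponent_inject:
  assumes "length es = length fs"
  shows "exponent es = exponent fs \<longleftrightarrow> es = fs"
proof
  assume "exponent es = exponent fs"
  then have "Poly_Mapping.lookup (exponent es) x = Poly_Mapping.lookup (exponent fs) x" for x by simp
  then show "es = fs" using assms
    by (intro nth_equalityI) (auto simp: lookup_exponent split: if_splits, metis of_int_eq_iff)
qed simp

lemma poly_mapping_eq_sum_single:
  fixes p :: gpoly
  shows "p = (\<Sum>e \<in> Poly_Mapping.keys p. Poly_Mapping.single e (Poly_Mapping.lookup p e))"
  by (rule poly_mapping_eqI)
    (auto simp: lookup_sum lookup_single when_def in_keys_iff)

definition boxed :: "nat \<Rightarrow> nat \<Rightarrow> (nat \<Rightarrow>\<^sub>0 real) \<Rightarrow> bool" where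
  "boxed s T e \<longleftrightarrow> Poly_Mapping.keys e \<subseteq> {..<s} \<and>
     (\<forall>x. Poly_Mapping.lookup e x \<in> \<int> \<and> \<bar>Poly_Mapping.lookup e x\<bar> \<le> real T)"

definition box_poly :: "nat \<Rightarrow> nat \<Rightarrow> gpoly \<Rightarrow> bool" where
  "box_poly s T p \<longleftrightarrow> (\<forall>e \<in> Poly_Mapping.keys p. boxed s T e)"

lemma boxed_add: "boxed s T e \<Longrightarrow> boxed s U f \<Longrightarrow> boxed s (T + U) (e + f)"
  using keys_add[of e f]
  by (force simp: boxed_def lookup_add abs_triangle_ineq intro: order_trans[OF abs_triangle_ineq] add_mono)

lemma box_poly_mono: "box_poly s T p \<Longrightarrow> T \<le> U \<Longrightarrow> box_poly s U p"
  unfolding box_poly_def boxed_def by (meson of_nat_mono order_trans)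

lemma box_poly_zero: "box_poly s T 0"
  by (simp add: box_poly_def)

lemma box_poly_one: "box_poly s T 1"
  by (auto simp: box_poly_def boxed_def simp flip: single_one)

lemma box_poly_mult: "box_poly s T p \<Longrightarrow> box_poly s U q \<Longrightarrow> box_poly s (T + U) (p * q)"
  using keys_mult[of p q] unfolding box_poly_def by (blast intro: boxed_add)

lemma box_poly_add: "box_poly s T p \<Longrightarrow> box_poly s T q \<Longrightarrow> box_poly s T (p + q)"
  using keys_add[of p q] unfolding box_poly_def by blast

lemma box_poly_sum: "(\<And>i. i \<in> A \<Longrightarrow> box_poly s T (p i)) \<Longrightarrow> box_poly s T (sum p A)"
  by (induction A rule: infinite_finite_induct) (auto intro: box_poly_add box_poly_zero)

lemma box_poly_prod:
  "(\<And>i. i \<in> A \<Longrightarrow> box_poly s (T i) (p i)) \<Longrightarrow> box_poly s (sum T A) (prod p A)"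
  by (induction A rule: infinite_finite_induct) (auto intro: box_poly_mult box_poly_one)

text \<open>The exponent of \<open>z\<close> after substituting \<open>z ^ (W ^ x)\<close> for
  formal variable \<open>x\<close>, where \<open>z\<close> generates a cyclic group of order
  \<open>W ^ s\<close>. In a group negative exponents cause no difficulty.\<close>

definition kcode :: "nat \<Rightarrow> nat \<Rightarrow> (nat \<Rightarrow>\<^sub>0 real) \<Rightarrow> nat" where
  "kcode s W e = nat ((\<Sum>x<s. \<lfloor>Poly_Mapping.lookup e x\<rfloor> * int W ^ x) mod int W ^ s)"

text \<open>Coefficient \<open>d\<close> of the image of \<open>p\<close> in the group ring of the integers modulo \<open>W ^ s\<close>.\<close>

definition kron :: "nat \<Rightarrow> nat \<Rightarrow> gpoly \<Rightarrow> nat \<Rightarrow> real" where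
  "kron s W p d = (\<Sum>e \<in> Poly_Mapping.keys p. if kcode s W e = d then Poly_Mapping.lookup p e else 0)"

section \<open>The substitution is a ring homomorphism\<close>

lemma kron_superset:
  "finite A \<Longrightarrow> Poly_Mapping.keys p \<subseteq> A \<Longrightarrow>
    kron s W p d = (\<Sum>e \<in> A. if kcode s W e = d then Poly_Mapping.lookup p e else 0)"
  unfolding kron_def by (rule sum.mono_neutral_left) (auto simp: in_keys_iff)

lemma kron_add: "kron s W (p + q) d = kron s W p d + kron s W q d"
proof -
  let ?A = "Poly_Mapping.keys p \<union> Poly_Mapping.keys q"
  have "kron s W (p + q) d = (\<Sum>e \<in> ?A. if kcode s W e = d then Poly_Mapping.lookup (p + q) e else 0)"
    by (rule kron_superset) (use keys_add[of p q] in auto)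
  also have "\<dots> = (\<Sum>e \<in> ?A. if kcode s W e = d then Poly_Mapping.lookup p e else 0) +
      (\<Sum>e \<in> ?A. if kcode s W e = d then Poly_Mapping.lookup q e else 0)"
    unfolding sum.distrib[symmetric] by (rule sum.cong) (auto simp: lookup_add)
  also have "\<dots> = kron s W p d + kron s W q d"
    by (intro arg_cong2[where f = "(+)"] kron_superset[symmetric]) auto
  finally show ?thesis .
qed

lemma kron_zero [simp]: "kron s W 0 d = 0"
  by (simp add: kron_def)

lemma kron_sum: "kron s W (sum p A) d = (\<Sum>i\<in>A. kron s W (p i) d)"
  by (induction A rule: infinite_finite_induct) (auto simp: kron_add)

lemma kron_single: "kron s W (Poly_Mapping.single e c) d = (if kcode s W e = d then c else 0)"
  by (simp add: kron_def)

lemma kcode_zero [simp]: "kcode s W 0 = 0"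
  by (simp add: kcode_def)

lemma kron_one: "kron s W 1 d = (if d = 0 then 1 else 0)"
  unfolding single_one[symmetric] kron_single by auto

lemma kcode_less: "1 \<le> W \<Longrightarrow> kcode s W e < W ^ s"
  by (simp add: kcode_def nat_less_iff)

text \<open>Taking floors is additive because \<open>boxed\<close> makes the exponents integers. The
  sum may leave the range of the digits; reduction modulo \<open>W ^ s\<close> takes care of
  that.\<close>

lemma kcode_add:
  assumes "boxed s T e" "boxed s U f" "1 \<le> W"
  shows "kcode s W (e + f) = (kcode s W e + kcode s W f) mod W ^ s"
proof -
  have "\<lfloor>Poly_Mapping.lookup (e + f) x\<rfloor> = \<lfloor>Poly_Mapping.lookup e x\<rfloor> + \<lfloor>Poly_Mapping.lookup f x\<rfloor>" for x
    using assms unfolding boxed_def lookup_add by (metis Ints_cases floor_of_int of_int_add)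
  then have "int (kcode s W (e + f)) = (int (kcode s W e) + int (kcode s W f)) mod int W ^ s"
    using assms(3) by (simp add: kcode_def distrib_right sum.distrib mod_simps)
  then have "int (kcode s W (e + f)) = int ((kcode s W e + kcode s W f) mod W ^ s)"
    by (simp add: zmod_int)
  then show ?thesis by simp
qed

text \<open>Multiplication by one term rotates the coefficient vector by the code of the term and
  scales it. This is one pass of the inner loop of \<open>mul_prog\<close>.\<close>

lemma kron_mult_single:
  assumes p: "box_poly s T p" and e: "boxed s U e" and W: "1 \<le> W"
  shows "kron s W (p * Poly_Mapping.single e c) d' =
    (\<Sum>d<W ^ s. if (d + kcode s W e) mod W ^ s = d' then kron s W p d * c else 0)"
proof -
  let ?K = "Poly_Mapping.keys p" and ?l = "Poly_Mapping.lookup p"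
  have "p * Poly_Mapping.single e c = (\<Sum>f\<in>?K. Poly_Mapping.single f (?l f)) * Poly_Mapping.single e c"
    using poly_mapping_eq_sum_single[of p] by simp
  also have "\<dots> = (\<Sum>f\<in>?K. Poly_Mapping.single (f + e) (?l f * c))"
    by (simp add: sum_distrib_right mult_single)
  finally have "kron s W (p * Poly_Mapping.single e c) d' =
      (\<Sum>f\<in>?K. if kcode s W (f + e) = d' then ?l f * c else 0)"
    by (simp add: kron_sum kron_single)
  also have "\<dots> = (\<Sum>f\<in>?K. if (kcode s W f + kcode s W e) mod W ^ s = d' then ?l f * c else 0)"
    using p e W by (intro sum.cong) (auto simp: box_poly_def kcode_add)
  \<comment> \<open>Group the terms of \<open>p\<close> by their code \<open>d\<close>, so that
    after exchanging the sums the inner one is a coefficient of the image of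
    \<open>p\<close>.\<close>
  also have "\<dots> = (\<Sum>f\<in>?K. \<Sum>d<W ^ s. if kcode s W f = d then
      (if (d + kcode s W e) mod W ^ s = d' then ?l f * c else 0) else 0)"
    using kcode_less[OF W] by (intro sum.cong) auto
  also have "\<dots> = (\<Sum>d<W ^ s. \<Sum>f\<in>?K. if kcode s W f = d then
      (if (d + kcode s W e) mod W ^ s = d' then ?l f * c else 0) else 0)"
    by (rule sum.swap)
  also have "\<dots> = (\<Sum>d<W ^ s. if (d + kcode s W e) mod W ^ s = d' then kron s W p d * c else 0)"
    unfolding kron_def by (intro sum.cong) (auto simp: sum_distrib_right intro!: sum.cong sum.neutral)
  finally show ?thesis .
qed

text \<open>Cyclic convolution, i.e. the product in the group ring; obtained from
  \<open>kron_mult_single\<close> by splitting \<open>q\<close> into its terms.\<close>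

lemma kron_mult:
  assumes p: "box_poly s T p" and q: "box_poly s U q" and W: "1 \<le> W"
  shows "kron s W (p * q) d' =
    (\<Sum>i<W ^ s. \<Sum>j<W ^ s. if (i + j) mod W ^ s = d' then kron s W p i * kron s W q j else 0)"
proof -
  let ?K = "Poly_Mapping.keys q" and ?l = "Poly_Mapping.lookup q"
  have "p * q = (\<Sum>e\<in>?K. p * Poly_Mapping.single e (?l e))"
    using poly_mapping_eq_sum_single[of q] by (metis sum_distrib_left)
  then have "kron s W (p * q) d' = (\<Sum>e\<in>?K. kron s W (p * Poly_Mapping.single e (?l e)) d')"
    by (simp add: kron_sum)
  also have "\<dots> = (\<Sum>e\<in>?K. \<Sum>i<W ^ s.
      if (i + kcode s W e) mod W ^ s = d' then kron s W p i * ?l e else 0)"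
    using q by (intro sum.cong refl kron_mult_single[OF p _ W]) (auto simp: box_poly_def)
  also have "\<dots> = (\<Sum>i<W ^ s. \<Sum>e\<in>?K.
      if (i + kcode s W e) mod W ^ s = d' then kron s W p i * ?l e else 0)"
    by (rule sum.swap)
  also have "\<dots> = (\<Sum>i<W ^ s. \<Sum>j<W ^ s.
      if (i + j) mod W ^ s = d' then kron s W p i * kron s W q j else 0)"
  proof (rule sum.cong[OF refl])
    fix i
    have "(\<Sum>e\<in>?K. if (i + kcode s W e) mod W ^ s = d' then kron s W p i * ?l e else 0) =
        (\<Sum>e\<in>?K. \<Sum>j<W ^ s. if kcode s W e = j then
          (if (i + j) mod W ^ s = d' then kron s W p i * ?l e else 0) else 0)"
      using kcode_less[OF W] by (intro sum.cong) auto
    also have "\<dots> = (\<Sum>j<W ^ s. \<Sum>e\<in>?K. if kcode s W e = j then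
          (if (i + j) mod W ^ s = d' then kron s W p i * ?l e else 0) else 0)"
      by (rule sum.swap)
    also have "\<dots> = (\<Sum>j<W ^ s. if (i + j) mod W ^ s = d' then kron s W p i * kron s W q j else 0)"
      unfolding kron_def[of s W q] by (intro sum.cong) (auto simp: sum_distrib_left intro!: sum.cong sum.neutral)
    finally show "(\<Sum>e\<in>?K. if (i + kcode s W e) mod W ^ s = d' then kron s W p i * ?l e else 0) =
      (\<Sum>j<W ^ s. if (i + j) mod W ^ s = d' then kron s W p i * kron s W q j else 0)" .
  qed
  finally show ?thesis .
qed

section \<open>Decoding by balanced digits\<close>

lemma sum_digits_mod: "(\<Sum>y<n. (u div b ^ y mod b) * b ^ y) = u mod (b :: nat) ^ n"
proof (induction n)
  case (Suc n)
  have "u mod b ^ Suc n = b ^ n * (u div b ^ n mod b) + u mod b ^ n"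
    by (metis mod_mult2_eq power_Suc2)
  then show ?case using Suc by simp
qed simp

lemma digit_of_sum:
  fixes a :: "nat \<Rightarrow> nat"
  shows "(\<And>x. x < n \<Longrightarrow> a x < b) \<Longrightarrow> x < n \<Longrightarrow> (\<Sum>y<n. a y * b ^ y) div b ^ x mod b = a x"
proof (induction n arbitrary: a x)
  case (Suc n)
  let ?r = "\<Sum>y<n. a (Suc y) * b ^ y"
  have s: "(\<Sum>y<Suc n. a y * b ^ y) = a 0 + b * ?r"
    by (subst sum.lessThan_Suc_shift) (simp add: sum_distrib_left mult_ac)
  have b: "0 < b" "a 0 < b" using Suc.prems(1)[of 0] by auto
  show ?case
  proof (cases x)
    case 0
    then show ?thesis using b unfolding s by simp
  next
    case (Suc z)
    have "(a 0 + b * ?r) div b ^ x = (a 0 + b * ?r) div b div b ^ z"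
      by (simp add: Suc div_mult2_eq)
    also have "(a 0 + b * ?r) div b = ?r" using b by simp
    finally show ?thesis using Suc.IH[of "\<lambda>y. a (Suc y)" z] Suc.prems Suc unfolding s by simp
  qed
qed simp

lemma sum_digits_less:
  fixes a :: "nat \<Rightarrow> nat"
  shows "(\<And>x. x < n \<Longrightarrow> a x < b) \<Longrightarrow> (\<Sum>y<n. a y * b ^ y) < b ^ n"
proof (induction n)
  case (Suc n)
  have "a n * b ^ n + b ^ n \<le> b * b ^ n"
    using Suc.prems[of n] by (metis add.commute lessI mult_Suc mult_le_mono1 Suc_leI)
  then show ?case using Suc by fastforce
qed simp

text \<open>Exponents are read off the digits in balanced representation.\<close>

definition unkron :: "nat \<Rightarrow> nat \<Rightarrow> nat \<Rightarrow> int list" where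
  "unkron s T d = map (\<lambda>x. int (d div (2 * T + 1) ^ x mod (2 * T + 1)) - int T) [0..<s]"

lemma length_unkron [simp]: "length (unkron s T d) = s"
  by (simp add: unkron_def)

text \<open>A number \<open>d\<close> encodes an exponent vector shifted by \<open>T\<close> in
  every entry. The shift vector has code \<open>(D - 1) div 2\<close> by \<open>half_power\<close>,
  so subtracting it modulo \<open>D\<close> gives the group element of the unshifted vector; adding
  \<open>D\<close> first keeps the subtraction on naturals exact.\<close>

definition kindex :: "nat \<Rightarrow> nat \<Rightarrow> nat" where
  "kindex D d = (d + D - (D - 1) div 2) mod D"

lemma half_power:
  fixes T :: nat
  shows "((2 * T + 1) ^ s - 1) div 2 = (\<Sum>x<s. T * (2 * T + 1) ^ x)" (is "?D s div 2 = ?S s")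
proof -
  have "(2 * T + 1) ^ s = 2 * ?S s + 1" by (induction s) (auto simp: algebra_simps)
  then show ?thesis by simp
qed

lemma unkron_inj:
  assumes "d < (2 * T + 1) ^ s" "d' < (2 * T + 1) ^ s" "unkron s T d = unkron s T d'"
  shows "d = d'"
proof -
  have "d div (2 * T + 1) ^ x mod (2 * T + 1) = d' div (2 * T + 1) ^ x mod (2 * T + 1)" if "x < s" for x
    using assms(3) that by (auto simp: unkron_def)
  then show ?thesis
    using sum_digits_mod[where n = s and b = "2 * T + 1" and u = d]
      sum_digits_mod[where n = s and b = "2 * T + 1" and u = d'] assms(1,2)
    by simp
qed

text \<open>Adding \<open>T\<close> to the entries of a vector in the box yields digits to base
  \<open>2 * T + 1\<close>, so the numbers below \<open>(2 * T + 1) ^ s\<close> enumerate the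
  box.\<close>

lemma boxed_iff_unkron:
  "boxed s T e \<longleftrightarrow> (\<exists>d < (2 * T + 1) ^ s. e = exponent (unkron s T d))"
proof
  let ?W = "2 * T + 1"
  assume e: "boxed s T e"
  have v: "of_int \<lfloor>Poly_Mapping.lookup e x\<rfloor> = Poly_Mapping.lookup e x" for x
    using e unfolding boxed_def by (metis Ints_cases floor_of_int)
  have abs: "\<bar>\<lfloor>Poly_Mapping.lookup e x\<rfloor>\<bar> \<le> int T" for x
  proof -
    have "\<bar>real_of_int \<lfloor>Poly_Mapping.lookup e x\<rfloor>\<bar> \<le> real T" using e v unfolding boxed_def by auto
    then show ?thesis by (metis of_int_abs of_int_le_iff of_int_of_nat_eq)
  qed
  let ?a = "\<lambda>x. nat (\<lfloor>Poly_Mapping.lookup e x\<rfloor> + int T)"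
  have a: "?a x < ?W" "int (?a x) = \<lfloor>Poly_Mapping.lookup e x\<rfloor> + int T" for x
    using abs[of x] by auto
  define d where "d = (\<Sum>x<s. ?a x * ?W ^ x)"
  have "d < ?W ^ s" unfolding d_def using a by (intro sum_digits_less)
  moreover have "e = exponent (unkron s T d)"
  proof (rule poly_mapping_eqI)
    fix x
    show "Poly_Mapping.lookup e x = Poly_Mapping.lookup (exponent (unkron s T d)) x"
    proof (cases "x < s")
      case True
      have "d div ?W ^ x mod ?W = ?a x" unfolding d_def by (rule digit_of_sum) (use a True in auto)
      then have "unkron s T d ! x = \<lfloor>Poly_Mapping.lookup e x\<rfloor>"
        using True a(2)[of x] by (simp add: unkron_def)
      then have "Poly_Mapping.lookup (exponent (unkron s T d)) x = of_int \<lfloor>Poly_Mapping.lookup e x\<rfloor>"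
        using True by (simp add: lookup_exponent)
      then show ?thesis using v[of x] by simp
    next
      case False
      then show ?thesis using e by (auto simp: lookup_exponent boxed_def unkron_def in_keys_iff)
    qed
  qed
  ultimately show "\<exists>d < ?W ^ s. e = exponent (unkron s T d)" by blast
next
  assume "\<exists>d < (2 * T + 1) ^ s. e = exponent (unkron s T d)"
  then obtain d where e: "e = exponent (unkron s T d)" by blast
  have "\<bar>unkron s T d ! x\<bar> \<le> int T" if "x < s" for x
  proof -
    have "d div (2 * T + 1) ^ x mod (2 * T + 1) < 2 * T + 1" by (rule mod_less_divisor) simp
    then have "int (d div (2 * T + 1) ^ x mod (2 * T + 1)) \<le> 2 * int T" by linarith
    moreover have "unkron s T d ! x = int (d div (2 * T + 1) ^ x mod (2 * T + 1)) - int T"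
      using that unfolding unkron_def by simp
    ultimately show ?thesis by linarith
  qed
  then have "\<bar>real_of_int (unkron s T d ! x)\<bar> \<le> real T" if "x < s" for x
    using that by (metis of_int_abs of_int_le_iff of_int_of_nat_eq)
  then show "boxed s T e" unfolding e boxed_def
    by (auto simp: lookup_exponent in_keys_iff split: if_splits)
qed

lemma kcode_unkron:
  assumes "d < (2 * T + 1) ^ s"
  shows "kcode s (2 * T + 1) (exponent (unkron s T d)) = kindex ((2 * T + 1) ^ s) d"
proof -
  let ?W = "2 * T + 1" and ?D = "(2 * T + 1) ^ s"
  have "(\<Sum>x<s. \<lfloor>Poly_Mapping.lookup (exponent (unkron s T d)) x\<rfloor> * int ?W ^ x) =
      (\<Sum>x<s. (int (d div ?W ^ x mod ?W) - int T) * int ?W ^ x)"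
    by (intro sum.cong refl) (simp add: floor_lookup_exponent, simp add: unkron_def)
  also have "\<dots> = int (\<Sum>x<s. (d div ?W ^ x mod ?W) * ?W ^ x) - int (\<Sum>x<s. T * ?W ^ x)"
    by (simp add: left_diff_distrib sum_subtractf)
  also have "\<dots> = int d - int ((?D - 1) div 2)"
    using assms unfolding half_power sum_digits_mod by simp
  finally have "kcode s ?W (exponent (unkron s T d)) = nat ((int d - int ((?D - 1) div 2)) mod int ?D)"
    by (simp add: kcode_def)
  also have "(int d - int ((?D - 1) div 2)) mod int ?D = (int d - int ((?D - 1) div 2) + int ?D) mod int ?D"
    by simp
  also have "int d - int ((?D - 1) div 2) + int ?D = int (d + ?D - (?D - 1) div 2)"
    by (subst of_nat_diff) auto
  also have "nat (int (d + ?D - (?D - 1) div 2) mod int ?D) = kindex ?D d"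
    unfolding kindex_def by (metis nat_int zmod_int)
  finally show ?thesis .
qed

lemma kindex_inj:
  assumes "d < D" "d' < D" "kindex D d = kindex D d'"
  shows "d = d'"
proof -
  let ?h = "(D - 1) div 2"
  have "int (d + D - ?h) mod int D = int (d' + D - ?h) mod int D"
    using assms(3) unfolding kindex_def by (metis zmod_int)
  moreover have "int (x + D - ?h) = int x + int D - int ?h" for x
    using assms by (subst of_nat_diff) auto
  ultimately have "(int d - int ?h) mod int D = (int d' - int ?h) mod int D"
    by (metis add_diff_eq diff_add_eq mod_add_self2 add.commute)
  then have "(int d - int ?h + int ?h) mod int D = (int d' - int ?h + int ?h) mod int D"
    by (rule mod_add_cong) simp
  then show ?thesis using assms by simp
qed

text \<open>On the box of radius \<open>T\<close> the code to base \<open>2 * T + 1\<close> is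
  injective, so no two terms of \<open>p\<close> are merged in the group ring and each coefficient
  of the image belongs to one known exponent vector.\<close>

lemma kron_decode:
  assumes p: "box_poly s T p"
  defines "D \<equiv> (2 * T + 1) ^ s"
  shows "p = (\<Sum>d<D. Poly_Mapping.single (exponent (unkron s T d)) (kron s (2 * T + 1) p (kindex D d)))"
proof (rule poly_mapping_eqI)
  fix e0
  let ?x = "\<lambda>d. exponent (unkron s T d)"
  have inj: "?x d = ?x d' \<longleftrightarrow> d = d'" if "d < D" "d' < D" for d d'
    using unkron_inj[of d T s d'] that exponent_inject[of "unkron s T d" "unkron s T d'"]
    by (auto simp: D_def unkron_def)
  have R: "Poly_Mapping.lookup (\<Sum>d<D. Poly_Mapping.single (?x d) (kron s (2 * T + 1) p (kindex D d))) e0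
    = (\<Sum>d<D. if ?x d = e0 then kron s (2 * T + 1) p (kindex D d) else 0)"
    by (simp only: lookup_sum lookup_single when_def)
  show "Poly_Mapping.lookup p e0 =
    Poly_Mapping.lookup (\<Sum>d<D. Poly_Mapping.single (?x d) (kron s (2 * T + 1) p (kindex D d))) e0"
  proof (cases "boxed s T e0")
    case False
    then have "Poly_Mapping.lookup p e0 = 0" using p by (auto simp: box_poly_def in_keys_iff)
    moreover have "?x d \<noteq> e0" if "d < D" for d using False that boxed_iff_unkron D_def by blast
    then have "(\<Sum>d<D. if ?x d = e0 then kron s (2 * T + 1) p (kindex D d) else 0) = 0"
      by (intro sum.neutral) auto
    ultimately show ?thesis unfolding R by simp
  next
    case True
    then obtain d0 where d0: "d0 < D" "e0 = ?x d0" unfolding boxed_iff_unkron D_def by blast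
    have "(\<Sum>d<D. if ?x d = e0 then kron s (2 * T + 1) p (kindex D d) else 0)
        = (\<Sum>d<D. if d = d0 then kron s (2 * T + 1) p (kindex D d) else 0)"
      using d0 inj by (intro sum.cong) auto
    also have "\<dots> = kron s (2 * T + 1) p (kindex D d0)" using d0 by simp
    also have "\<dots> = (\<Sum>e \<in> Poly_Mapping.keys p. if e = e0 then Poly_Mapping.lookup p e else 0)"
      unfolding kron_def
    proof (rule sum.cong[OF refl])
      fix e assume "e \<in> Poly_Mapping.keys p"
      then obtain d where d: "d < D" "e = ?x d"
        using p unfolding box_poly_def boxed_iff_unkron D_def by blast
      have "kcode s (2 * T + 1) e = kindex D d0 \<longleftrightarrow> e = e0"
        using kcode_unkron[of d T s] kindex_inj[of d D d0] d d0 inj D_def by auto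
      then show "(if kcode s (2 * T + 1) e = kindex D d0 then Poly_Mapping.lookup p e else 0) =
        (if e = e0 then Poly_Mapping.lookup p e else 0)" by simp
    qed
    also have "\<dots> = Poly_Mapping.lookup p e0" by (auto simp: in_keys_iff)
    finally show ?thesis unfolding R by simp
  qed
qed

text \<open>The sum of the absolute coefficients rather than their maximum: it is submultiplicative,
  and it bounds the coefficients of the image in the group ring even where terms are merged.\<close>

definition norm1 :: "gpoly \<Rightarrow> real" where
  "norm1 p = (\<Sum>e \<in> Poly_Mapping.keys p. \<bar>Poly_Mapping.lookup p e\<bar>)"

lemma norm1_ge_0: "0 \<le> norm1 p"
  by (simp add: norm1_def sum_nonneg)

lemma norm1_add: "norm1 (p + q) \<le> norm1 p + norm1 q"
proof -
  let ?A = "Poly_Mapping.keys p \<union> Poly_Mapping.keys q"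
  have *: "norm1 r = (\<Sum>e\<in>?A. \<bar>Poly_Mapping.lookup r e\<bar>)" if "Poly_Mapping.keys r \<subseteq> ?A" for r
    unfolding norm1_def by (rule sum.mono_neutral_left) (use that in \<open>auto simp: in_keys_iff\<close>)
  have "norm1 (p + q) = (\<Sum>e\<in>?A. \<bar>Poly_Mapping.lookup p e + Poly_Mapping.lookup q e\<bar>)"
    using *[of "p + q"] keys_add[of p q] by (simp add: lookup_add)
  also have "\<dots> \<le> (\<Sum>e\<in>?A. \<bar>Poly_Mapping.lookup p e\<bar> + \<bar>Poly_Mapping.lookup q e\<bar>)"
    by (rule sum_mono) (rule abs_triangle_ineq)
  also have "\<dots> = norm1 p + norm1 q" using *[of p] *[of q] by (simp add: sum.distrib)
  finally show ?thesis .
qed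

lemma norm1_zero [simp]: "norm1 0 = 0"
  by (simp add: norm1_def)

lemma norm1_single [simp]: "norm1 (Poly_Mapping.single e c) = \<bar>c\<bar>"
  by (simp add: norm1_def)

lemma norm1_sum: "norm1 (sum p A) \<le> (\<Sum>i\<in>A. norm1 (p i))"
  by (induction A rule: infinite_finite_induct) (auto intro: order_trans[OF norm1_add])

lemma norm1_mult: "norm1 (p * q) \<le> norm1 p * norm1 q"
proof -
  have "p * q = (\<Sum>e\<in>Poly_Mapping.keys p. \<Sum>f\<in>Poly_Mapping.keys q.
      Poly_Mapping.single (e + f) (Poly_Mapping.lookup p e * Poly_Mapping.lookup q f))"
    by (subst poly_mapping_eq_sum_single[of p], subst poly_mapping_eq_sum_single[of q])
      (simp add: sum_product mult_single)
  then have "norm1 (p * q) \<le> (\<Sum>e\<in>Poly_Mapping.keys p. norm1 (\<Sum>f\<in>Poly_Mapping.keys q.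
      Poly_Mapping.single (e + f) (Poly_Mapping.lookup p e * Poly_Mapping.lookup q f)))"
    by (simp add: norm1_sum)
  also have "\<dots> \<le> (\<Sum>e\<in>Poly_Mapping.keys p. \<Sum>f\<in>Poly_Mapping.keys q.
      \<bar>Poly_Mapping.lookup p e * Poly_Mapping.lookup q f\<bar>)"
    by (intro sum_mono order_trans[OF norm1_sum]) simp
  also have "\<dots> = norm1 p * norm1 q" by (simp add: norm1_def sum_product abs_mult)
  finally show ?thesis .
qed

lemma norm1_prod: "norm1 (prod p A) \<le> (\<Prod>i\<in>A. norm1 (p i))"
proof (induction A rule: infinite_finite_induct)
  case (insert x A)
  have "norm1 (prod p (insert x A)) \<le> norm1 (p x) * norm1 (prod p A)"
    using insert by (simp add: norm1_mult)
  also have "\<dots> \<le> norm1 (p x) * (\<Prod>i\<in>A. norm1 (p i))"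
    using insert norm1_ge_0 by (intro mult_left_mono)
  finally show ?case using insert by simp
qed (simp_all flip: single_one)

lemma abs_kron_le: "\<bar>kron s W p d\<bar> \<le> norm1 p"
  unfolding kron_def norm1_def by (rule order_trans[OF sum_abs]) (auto intro!: sum_mono)

section \<open>Splitting the partition function\<close>

lemma mod_add_iff:
  fixes i j l D :: nat
  assumes "i < D" "j < D" "l < D"
  shows "(l + j) mod D = i \<longleftrightarrow> l = (i + D - j) mod D"
proof -
  have "(l + j) mod D = (if l + j < D then l + j else l + j - D)"
    using assms by (simp add: le_mod_geq)
  moreover have "(i + D - j) mod D = (if j \<le> i then i - j else i + D - j)"
  proof (cases "j \<le> i")
    case True
    then have "i + D - j = (i - j) + D" by simp
    then have "(i + D - j) mod D = (i - j) mod D" by (metis mod_add_self2)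
    then show ?thesis using True assms by simp
  qed (use assms in simp)
  ultimately show ?thesis using assms by auto
qed

lemma block_less:
  fixes v i k n :: nat
  assumes "v < n" "i < k"
  shows "v * k + i < n * k"
proof -
  have "v * k + i < Suc v * k" using assms by simp
  also have "\<dots> \<le> n * k" using assms by (intro mult_le_mono1) simp
  finally show ?thesis .
qed

text \<open>The convolution solved for the index of \<open>p\<close>: a circulant matrix built from
  \<open>p\<close> times the column built from \<open>q\<close>. This is the form of the blocks of
  \<open>left_matrix\<close> and \<open>right_matrix\<close>.\<close>

lemma kron_mult_circulant:
  assumes p: "box_poly s T p" and q: "box_poly s U q" and W: "1 \<le> W" and i: "i < W ^ s"
  shows "kron s W (p * q) i =
    (\<Sum>j<W ^ s. kron s W p ((i + W ^ s - j) mod W ^ s) * kron s W q j)"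
proof -
  let ?D = "W ^ s"
  have "kron s W (p * q) i =
      (\<Sum>j<?D. \<Sum>l<?D. if (l + j) mod ?D = i then kron s W p l * kron s W q j else 0)"
    unfolding kron_mult[OF p q W] by (rule sum.swap)
  also have "\<dots> = (\<Sum>j<?D. \<Sum>l<?D. if l = (i + ?D - j) mod ?D then kron s W p l * kron s W q j else 0)"
  proof (intro sum.cong refl)
    fix j l assume "j \<in> {..<?D}" "l \<in> {..<?D}"
    then have jl: "j < ?D" "l < ?D" by auto
    have "(l + j) mod ?D = i \<longleftrightarrow> l = (i + ?D - j) mod ?D" using jl i by (intro mod_add_iff)
    then show "(if (l + j) mod ?D = i then kron s W p l * kron s W q j else 0) =
      (if l = (i + ?D - j) mod ?D then kron s W p l * kron s W q j else 0)" by simp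
  qed
  also have "\<dots> = (\<Sum>j<?D. kron s W p ((i + ?D - j) mod ?D) * kron s W q j)"
    using W by (intro sum.cong) (auto simp: mod_less_divisor[of "W ^ s"])
  finally show ?thesis .
qed

lemma prod_lessThan_add:
  fixes g :: "nat \<Rightarrow> 'a::comm_monoid_mult"
  shows "(\<Prod>f<a + b. g f) = (\<Prod>f<a. g f) * (\<Prod>y<b. g (a + y))"
  by (induction b) (auto simp: mult_ac)

lemma prod_blocks:
  fixes g :: "nat \<Rightarrow> 'a::comm_monoid_mult"
  shows "(\<Prod>f<a * b. g f) = (\<Prod>x<a. \<Prod>y<b. g (x * b + y))"
proof (induction a)
  case (Suc a)
  have "(\<Prod>f<Suc a * b. g f) = (\<Prod>f<a * b + b. g f)" by (simp add: add.commute)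
  then show ?case unfolding prod_lessThan_add using Suc by simp
qed simp

lemma sum_lessThan_add:
  fixes g :: "nat \<Rightarrow> 'a::comm_monoid_add"
  shows "(\<Sum>f<a + b. g f) = (\<Sum>f<a. g f) + (\<Sum>y<b. g (a + y))"
  by (induction b) (auto simp: add_ac)

text \<open>In contrast to \<open>prod_blocks\<close> the outer sum runs over the low-order part of
  the index, because the first third of an assignment sits in the low-order digits.\<close>

lemma sum_blocks:
  fixes g :: "nat \<Rightarrow> 'a::comm_monoid_add"
  shows "(\<Sum>f<a * b. g f) = (\<Sum>x<b. \<Sum>y<a. g (x + b * y))"
proof -
  have "(\<Sum>f<a * b. g f) = (\<Sum>y<a. \<Sum>x<b. g (x + b * y))"
  proof (induction a)
    case (Suc a)
    have "(\<Sum>f<Suc a * b. g f) = (\<Sum>f<a * b + b. g f)" by (simp add: add.commute)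
    moreover have "a * b + y = y + b * a" for y by simp
    ultimately show ?case unfolding sum_lessThan_add using Suc by simp
  qed simp
  also have "\<dots> = (\<Sum>x<b. \<Sum>y<a. g (x + b * y))" by (rule sum.swap)
  finally show ?thesis .
qed

lemma nth_concat_uniform:
  "(\<forall>x\<in>set xs. length x = l) \<Longrightarrow> q < length xs \<Longrightarrow> r < l \<Longrightarrow> concat xs ! (q * l + r) = xs ! q ! r"
proof (induction xs arbitrary: q)
  case (Cons x xs)
  then show ?case by (cases q) (auto simp: nth_append add.assoc)
qed simp

lemma length_concat_uniform: "(\<forall>x\<in>set xs. length x = l) \<Longrightarrow> length (concat xs) = length xs * l"
  by (induction xs) auto

definition digit :: "nat \<Rightarrow> nat \<Rightarrow> nat \<Rightarrow> nat" where
  "digit k u x = u div k ^ x mod k"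

lemma digit_less: "1 \<le> k \<Longrightarrow> digit k u x < k"
  by (simp add: digit_def)

lemma digit_add_low:
  assumes "x < p"
  shows "digit k (u + k ^ p * r) x = digit k u x"
proof (cases "k = 0")
  case False
  have "k ^ p = k ^ x * (k * k ^ (p - x - 1))"
    using assms by (metis Suc_diff_Suc diff_diff_left le_add_diff_inverse less_imp_le plus_1_eq_Suc
      add.commute power_Suc power_add)
  then have "(u + k ^ p * r) div k ^ x = u div k ^ x + k * (k ^ (p - x - 1) * r)"
    using False by (simp add: mult.assoc)
  then show ?thesis by (simp add: digit_def)
qed (use assms in \<open>cases p; simp add: digit_def\<close>)

lemma digit_add_high:
  assumes "a < k ^ p" "p \<le> x"
  shows "digit k (a + k ^ p * r) x = digit k (k ^ p * r) x"
proof -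
  have "k ^ x = k ^ p * k ^ (x - p)" using assms(2) by (simp flip: power_add)
  then have x: "v div k ^ x = v div k ^ p div k ^ (x - p)" for v by (simp only: div_mult2_eq)
  have nz: "k ^ p \<noteq> 0" using assms(1) by (metis not_less_zero)
  have "(a + k ^ p * r) div k ^ p = r + a div k ^ p" by (rule div_mult_self2[OF nz])
  also have "\<dots> = (k ^ p * r) div k ^ p"
    using assms(1) by (simp only: nonzero_mult_div_cancel_left[OF nz] div_less add_0_right)
  finally show ?thesis unfolding digit_def x by (rule arg_cong)
qed

lemma bij_betw_digits:
  assumes "1 \<le> k"
  shows "bij_betw (\<lambda>u. \<lambda>v\<in>{..<n}. digit k u v) {..<k ^ n} ({..<n} \<rightarrow>\<^sub>E {..<k})"
proof (rule bij_betwI[where g = "\<lambda>\<sigma>. \<Sum>y<n. \<sigma> y * k ^ y"])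
  show "(\<lambda>u. \<lambda>v\<in>{..<n}. digit k u v) \<in> {..<k ^ n} \<rightarrow> {..<n} \<rightarrow>\<^sub>E {..<k}"
    using assms by (auto simp: digit_less)
  show "(\<lambda>\<sigma>. \<Sum>y<n. \<sigma> y * k ^ y) \<in> ({..<n} \<rightarrow>\<^sub>E {..<k}) \<rightarrow> {..<k ^ n}"
    by (auto intro!: sum_digits_less)
next
  fix u assume "u \<in> {..<k ^ n}"
  then show "(\<Sum>y<n. (\<lambda>v\<in>{..<n}. digit k u v) y * k ^ y) = u"
    using sum_digits_mod[of u k n] by (simp add: digit_def)
next
  fix \<sigma> assume "\<sigma> \<in> {..<n} \<rightarrow>\<^sub>E {..<k}"
  then show "(\<lambda>v\<in>{..<n}. digit k (\<Sum>y<n. \<sigma> y * k ^ y) v) = \<sigma>"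
    by (intro PiE_ext[of _ "{..<n}" "\<lambda>_. {..<k}"])
      (auto simp: digit_def digit_of_sum PiE_def Pi_def extensional_def)
qed

text \<open>
  Factor \<open>f\<close> of the score is the \<open>f\<close>-th polynomial of the input.  It constrains the values at
  \<open>fx f\<close> and \<open>fy f\<close>; a unary factor has \<open>fx f = fy f\<close>, and the constraint of \<open>p_empty\<close> is void.
\<close>

locale pcsp_inst =
  fixes k :: nat and I :: pcsp and es :: "(nat \<times> nat) list"
  assumes k_ge: "1 \<le> k" and is_pcsp: "is_pcsp k I" and distinct_es: "distinct es"
    and set_es: "set es = arcs I"
begin

abbreviation "n \<equiv> nvars I"
abbreviation "m \<equiv> length es"
abbreviation "ps \<equiv> poly_list k I es"
definition "F = 1 + n * k + m * k * k"

text \<open>The numbering follows \<open>poly_list\<close>: number 0 is \<open>p_empty\<close>, then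
  come \<open>n * k\<close> unary factors, then \<open>k * k\<close> factors for each edge.\<close>

definition fx :: "nat \<Rightarrow> nat" where
  "fx f = (if f = 0 then 0 else if f < n * k + 1 then (f - 1) div k
     else fst (es ! ((f - 1 - n * k) div (k * k))))"

definition fy :: "nat \<Rightarrow> nat" where
  "fy f = (if f = 0 then 0 else if f < n * k + 1 then (f - 1) div k
     else snd (es ! ((f - 1 - n * k) div (k * k))))"

definition fi :: "nat \<Rightarrow> nat \<Rightarrow> nat" where
  "fi u f = (if f = 0 then digit k u 0 else if f < n * k + 1 then (f - 1) mod k
     else (f - 1 - n * k) div k mod k)"

definition fj :: "nat \<Rightarrow> nat \<Rightarrow> nat" where
  "fj u f = (if f = 0 then digit k u 0 else if f < n * k + 1 then (f - 1) mod k
     else (f - 1 - n * k) mod k)"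

definition active :: "nat \<Rightarrow> nat \<Rightarrow> bool" where
  "active u f \<longleftrightarrow> digit k u (fx f) = fi u f \<and> digit k u (fy f) = fj u f"

section \<open>The score as a product over numbered factors\<close>

lemma arcs_less: "(x, y) \<in> set es \<Longrightarrow> x < n \<and> y < n"
  using is_pcsp unfolding set_es arcs_def is_pcsp_def by fastforce

lemma length_ps: "length ps = F"
proof -
  have 1: "length (concat (map (\<lambda>v. map (p_var I v) [0..<k]) [0..<n])) = n * k"
    by (subst length_concat_uniform[where l = k]) auto
  have 2: "length (concat (map (\<lambda>(x, y). concat (map (\<lambda>i. map (p_edge I x y i) [0..<k]) [0..<k])) es))
      = m * (k * k)"
    by (subst length_concat_uniform[where l = "k * k"]) (auto simp: length_concat_uniform[where l = k])
  show ?thesis using 1 2 by (simp add: poly_list_def F_def)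
qed

lemma ps_0: "ps ! 0 = p_empty I"
  by (simp add: poly_list_def)

lemma ps_var:
  assumes "v < n" "i < k"
  shows "ps ! (1 + (v * k + i)) = p_var I v i"
proof -
  have l: "length (concat (map (\<lambda>v. map (p_var I v) [0..<k]) [0..<n])) = n * k"
    by (subst length_concat_uniform[where l = k]) auto
  have "v * k + i < n * k" using assms by (rule block_less)
  then show ?thesis
    using assms l nth_concat_uniform[of "map (\<lambda>v. map (p_var I v) [0..<k]) [0..<n]" k v i]
    by (simp add: poly_list_def nth_append)
qed

lemma ps_edge:
  assumes "e < m" "i < k" "j < k"
  shows "ps ! (1 + n * k + ((e * k + i) * k + j)) = p_edge I (fst (es ! e)) (snd (es ! e)) i j"
proof -
  let ?c = "\<lambda>(x, y). concat (map (\<lambda>i. map (p_edge I x y i) [0..<k]) [0..<k])"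
  have l: "length (concat (map (\<lambda>v. map (p_var I v) [0..<k]) [0..<n])) = n * k"
    by (subst length_concat_uniform[where l = k]) auto
  have ij: "i * k + j < k * k" using assms(2,3) by (rule block_less)
  have "concat (map ?c es) ! (e * (k * k) + (i * k + j)) = map ?c es ! e ! (i * k + j)"
    by (rule nth_concat_uniform) (use assms ij in \<open>auto simp: length_concat_uniform[where l = k]\<close>)
  also have "map ?c es ! e = ?c (es ! e)" using assms by simp
  also have "?c (es ! e) ! (i * k + j) = p_edge I (fst (es ! e)) (snd (es ! e)) i j"
    using assms by (simp add: case_prod_beta nth_concat_uniform[where l = k])
  finally have "concat (map ?c es) ! ((e * k + i) * k + j) = p_edge I (fst (es ! e)) (snd (es ! e)) i j"
    by (simp add: algebra_simps)
  then show ?thesis using l by (simp add: poly_list_def nth_append)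
qed

text \<open>Of the \<open>k\<close> factors of a variable exactly one is active, and likewise of the
  \<open>k * k\<close> factors of an edge; all others contribute 1. The uniform shape over all
  \<open>F\<close> factors is what the program iterates over.\<close>

lemma score_eq_prod:
  "score I (digit k u) = (\<Prod>f<F. if active u f then ps ! f else 1)" (is "_ = (\<Prod>f<F. ?g f)")
proof -
  have "(\<Prod>f<F. ?g f) = (\<Prod>f<1. ?g f) * (\<Prod>f<n * k. ?g (1 + f)) *
      (\<Prod>f<m * k * k. ?g (1 + n * k + f))"
    by (simp only: F_def prod_lessThan_add[of ?g])
  also have "(\<Prod>f<1. ?g f) = p_empty I"
    using k_ge by (simp add: active_def fx_def fy_def fi_def fj_def ps_0)
  also have "(\<Prod>f<n * k. ?g (1 + f)) = (\<Prod>v<n. \<Prod>i<k. ?g (1 + (v * k + i)))"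
    by (rule prod_blocks)
  also have "\<dots> = (\<Prod>v<n. p_var I v (digit k u v))"
  proof (rule prod.cong[OF refl])
    fix v assume "v \<in> {..<n}"
    then have v: "v < n" by simp
    have "?g (1 + (v * k + i)) = (if i = digit k u v then p_var I v i else 1)" if "i < k" for i
    proof -
      have "v * k + i < n * k" using v that by (rule block_less)
      then have "active u (1 + (v * k + i)) \<longleftrightarrow> i = digit k u v"
        using that by (auto simp: active_def fx_def fy_def fi_def fj_def)
      then show ?thesis by (simp only: ps_var[OF v that])
    qed
    then have "(\<Prod>i<k. ?g (1 + (v * k + i))) = (\<Prod>i<k. if i = digit k u v then p_var I v i else 1)"
      by (intro prod.cong) auto
    also have "\<dots> = p_var I v (digit k u v)" using digit_less[OF k_ge] by simp
    finally show "(\<Prod>i<k. ?g (1 + (v * k + i))) = p_var I v (digit k u v)" .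
  qed
  also have "(\<Prod>f<m * k * k. ?g (1 + n * k + f)) =
      (\<Prod>e<m. \<Prod>i<k. \<Prod>j<k. ?g (1 + n * k + ((e * k + i) * k + j)))"
    unfolding prod_blocks[of _ "m * k"] prod_blocks[of _ m] ..
  also have "\<dots> = (\<Prod>e<m. p_edge I (fst (es ! e)) (snd (es ! e))
      (digit k u (fst (es ! e))) (digit k u (snd (es ! e))))"
  proof (rule prod.cong[OF refl])
    fix e assume "e \<in> {..<m}"
    then have e: "e < m" by simp
    let ?x = "fst (es ! e)" and ?y = "snd (es ! e)"
    have *: "?g (1 + n * k + ((e * k + i) * k + j)) =
        (if i = digit k u ?x then if j = digit k u ?y then p_edge I ?x ?y i j else 1 else 1)"
      if "i < k" "j < k" for i j
    proof -
      have ij: "i * k + j < k * k" using that by (rule block_less)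
      have "((e * k + i) * k + j) div (k * k) = (e * (k * k) + (i * k + j)) div (k * k)"
        by (simp add: algebra_simps)
      also have "\<dots> = e + (i * k + j) div (k * k)" by (rule div_mult_self3) (use k_ge in auto)
      also have "\<dots> = e" using ij by simp
      finally have "((e * k + i) * k + j) div (k * k) = e" .
      moreover have "((e * k + i) * k + j) div k mod k = i" using that by simp
      moreover have "((e * k + i) * k + j) mod k = j" using that by simp
      moreover define g where "g = (e * k + i) * k + j"
      ultimately have g: "g div (k * k) = e" "g div k mod k = i" "g mod k = j" by simp_all
      have "1 + n * k + g \<noteq> 0" "\<not> 1 + n * k + g < n * k + 1" "1 + n * k + g - 1 - n * k = g" by simp_all
      then have "active u (1 + n * k + ((e * k + i) * k + j)) \<longleftrightarrow>
          i = digit k u ?x \<and> j = digit k u ?y"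
        unfolding active_def fx_def fy_def fi_def fj_def g_def[symmetric]
        by (simp only: if_False g eq_commute[of _ i] eq_commute[of _ j])
      then show ?thesis by (simp only: ps_edge[OF e that] if_if_eq_conj)
    qed
    have "(\<Prod>i<k. \<Prod>j<k. ?g (1 + n * k + ((e * k + i) * k + j))) =
      (\<Prod>i<k. \<Prod>j<k. if i = digit k u ?x then if j = digit k u ?y then p_edge I ?x ?y i j else 1 else 1)"
      by (intro prod.cong refl *) auto
    also have "\<dots> = (\<Prod>i<k. if i = digit k u ?x then
        \<Prod>j<k. if j = digit k u ?y then p_edge I ?x ?y i j else 1 else 1)"
      by (intro prod.cong) auto
    also have "\<dots> = p_edge I ?x ?y (digit k u ?x) (digit k u ?y)" using digit_less[OF k_ge] by simp
    finally show "(\<Prod>i<k. \<Prod>j<k. ?g (1 + n * k + ((e * k + i) * k + j))) =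
      p_edge I ?x ?y (digit k u ?x) (digit k u ?y)" .
  qed
  also have "\<dots> = (\<Prod>(x, y) \<in> arcs I. p_edge I x y (digit k u x) (digit k u y))"
  proof -
    have "bij_betw (\<lambda>e. es ! e) {..<m} (arcs I)"
      using bij_betw_nth[OF distinct_es refl] set_es by blast
    from prod.reindex_bij_betw[OF this, of "\<lambda>(x, y). p_edge I x y (digit k u x) (digit k u y)"]
    show ?thesis by (simp add: case_prod_beta)
  qed
  finally show ?thesis by (simp add: score_def)
qed

lemma partition_function_eq_sum:
  "partition_function k I = (\<Sum>u<k ^ n. \<Prod>f<F. if active u f then ps ! f else 1)"
proof -
  have "partition_function k I = (\<Sum>u<k ^ n. score I (\<lambda>v\<in>{..<n}. digit k u v))"
    unfolding partition_function_def
    using sum.reindex_bij_betw[OF bij_betw_digits[OF k_ge], of "score I" n] by simp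
  \<comment> \<open>\<open>score\<close> looks only at variables below \<open>n\<close>, where the
    restricted function agrees with the digits.\<close>
  also have "\<dots> = (\<Sum>u<k ^ n. score I (digit k u))"
  proof (rule sum.cong[OF refl])
    fix u
    have "x < n \<and> y < n" if "(x, y) \<in> arcs I" for x y using arcs_less that set_es by blast
    then show "score I (\<lambda>v\<in>{..<n}. digit k u v) = score I (digit k u)"
      unfolding score_def by (intro arg_cong2[where f = "(*)"] prod.cong refl) (auto split: prod.splits)
  qed
  finally show ?thesis by (simp add: score_eq_prod)
qed

section \<open>The three parts of the variables\<close>

definition "n1 = n div 3"
text \<open>Variables below \<open>n1\<close> form the first part, those from \<open>n1\<close> up
  to \<open>n12\<close> the second, the others the third. The rounding is such that the third part
  is the largest.\<close>

definition "n12 = n div 3 + (n + 1) div 3"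
definition "N1 = k ^ (n div 3)"
definition "N2 = k ^ ((n + 1) div 3)"
definition "N3 = k ^ ((n + 2) div 3)"

lemma thirds: "n div 3 + ((n + 1) div 3 + (n + 2) div 3) = n"
proof -
  define q r where "q = n div 3" and "r = n mod 3"
  have n: "n = 3 * q + r" by (simp add: q_def r_def)
  have "r < 3" by (simp add: r_def)
  then consider "r = 0" | "r = 1" | "r = 2" by linarith
  moreover have d: "(3 * q + c) div 3 = q + c div 3" for c by (rule div_mult_self4) simp
  ultimately show ?thesis unfolding n add.assoc d by cases simp_all
qed

lemma N123: "N1 * (N2 * N3) = k ^ n"
  unfolding N1_def N2_def N3_def power_add[symmetric] thirds ..

lemma N12: "N1 * N2 = k ^ n12"
  unfolding N1_def N2_def n12_def power_add[symmetric] ..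

text \<open>Two endpoints meet at most two of the three parts. The order of the tests assigns
  factors living inside a single part to just one group, so that none is multiplied twice.\<close>

definition grp :: "nat \<Rightarrow> nat" where
  "grp f = (if fx f < n12 \<and> fy f < n12 then 0 else if n1 \<le> fx f \<and> n1 \<le> fy f then 1 else 2)"

definition weight :: "nat \<Rightarrow> nat \<Rightarrow> gpoly" where
  "weight c u = (\<Prod>f<F. if active u f \<and> grp f = c then ps ! f else 1)"

lemma active_cong:
  assumes "digit k u (fx f) = digit k u' (fx f)" "digit k u (fy f) = digit k u' (fy f)"
  shows "active u f \<longleftrightarrow> active u' f"
  using assms unfolding active_def by (auto simp: fi_def fj_def fx_def fy_def)

text \<open>The factors of a group do not look at the part that the group misses, so the digits of
  that part can be replaced by 0. Each weight thus depends on only two of \<open>a\<close>,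
  \<open>b\<close> and \<open>c\<close>.\<close>

lemma weight_split:
  fixes a b c :: nat
  assumes "a < N1" "b < N2"
  defines "u \<equiv> a + N1 * (b + N2 * c)"
  shows "(\<Prod>f<F. if active u f then ps ! f else 1) =
    weight 0 (a + N1 * b) * weight 1 (N1 * (b + N2 * c)) * weight 2 (a + N1 * N2 * c)"
proof -
  have u0: "u = (a + N1 * b) + k ^ n12 * c" unfolding u_def N12[symmetric] by (simp add: algebra_simps)
  have u1: "u = a + k ^ n1 * (b + N2 * c)" by (simp add: u_def N1_def n1_def)
  have a: "a < k ^ n1" using assms by (simp add: N1_def n1_def)
  have ab: "a + N1 * b < k ^ n12"
    using block_less[OF assms(2,1)] by (simp add: N12 mult.commute add.commute flip: N12)
  have n: "n1 \<le> n12" by (simp add: n1_def n12_def)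
  have low: "digit k u x = digit k a x" if "x < n1" for x
    unfolding u1 by (rule digit_add_low[OF that])
  have low12: "digit k u x = digit k (a + N1 * b) x" if "x < n12" for x
    unfolding u0 by (rule digit_add_low[OF that])
  have high1: "digit k u x = digit k (N1 * (b + N2 * c)) x" if "n1 \<le> x" for x
    unfolding u1 using digit_add_high[OF a that] by (simp add: N1_def n1_def)
  have high12: "digit k u x = digit k (k ^ n12 * c) x" if "n12 \<le> x" for x
    unfolding u0 by (rule digit_add_high[OF ab that])
  have l2: "digit k (a + N1 * N2 * c) x = digit k a x" if "x < n1" for x
    using digit_add_low[OF that, of k a "N2 * c"] by (simp add: N1_def n1_def mult.assoc)
  have "a < k ^ n12" using ab by simp
  then have h2: "digit k (a + N1 * N2 * c) x = digit k (k ^ n12 * c) x" if "n12 \<le> x" for x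
    using digit_add_high[OF _ that, of a k c] by (simp add: N12)
  have "grp f \<in> {0, 1, 2}" for f by (simp add: grp_def)
  moreover have "active u f \<longleftrightarrow> active (a + N1 * b) f" if "grp f = 0" for f
    using that by (intro active_cong low12) (auto simp: grp_def split: if_splits)
  moreover have "active u f \<longleftrightarrow> active (N1 * (b + N2 * c)) f" if "grp f = 1" for f
    using that by (intro active_cong high1) (auto simp: grp_def split: if_splits)
  moreover have "active u f \<longleftrightarrow> active (a + N1 * N2 * c) f" if "grp f = 2" for f
  proof (rule active_cong)
    have "digit k u x = digit k (a + N1 * N2 * c) x" if "x < n1 \<or> n12 \<le> x" for x
      using that low[of x] high12[of x] l2[of x] h2[of x] by auto
    moreover have "(fx f < n1 \<or> n12 \<le> fx f) \<and> (fy f < n1 \<or> n12 \<le> fy f)"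
      using that n by (auto simp: grp_def split: if_splits)
    ultimately show "digit k u (fx f) = digit k (a + N1 * N2 * c) (fx f)"
      "digit k u (fy f) = digit k (a + N1 * N2 * c) (fy f)" by auto
  qed
  ultimately have "(if active u f then ps ! f else 1) =
    (if active (a + N1 * b) f \<and> grp f = 0 then ps ! f else 1) *
    (if active (N1 * (b + N2 * c)) f \<and> grp f = 1 then ps ! f else 1) *
    (if active (a + N1 * N2 * c) f \<and> grp f = 2 then ps ! f else 1)" for f
    by (cases "grp f = 0"; cases "grp f = 1"; cases "grp f = 2") force+
  then show ?thesis unfolding weight_def by (simp add: prod.distrib)
qed

text \<open>The sum over \<open>b\<close> is moved innermost because only it is carried out by the
  matrix product; the third weight does not depend on \<open>b\<close>.\<close>

lemma partition_function_split:
  "partition_function k I = (\<Sum>a<N1. \<Sum>c<N3. \<Sum>b<N2.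
     weight 0 (a + N1 * b) * weight 1 (N1 * (b + N2 * c)) * weight 2 (a + N1 * N2 * c))"
proof -
  have "partition_function k I =
      (\<Sum>u<(N3 * N2) * N1. \<Prod>f<F. if active u f then ps ! f else 1)"
    unfolding partition_function_eq_sum N123[symmetric] by (simp add: mult_ac)
  also have "\<dots> = (\<Sum>a<N1. \<Sum>r<N3 * N2. \<Prod>f<F. if active (a + N1 * r) f then ps ! f else 1)"
    by (rule sum_blocks)
  also have "\<dots> = (\<Sum>a<N1. \<Sum>b<N2. \<Sum>c<N3.
      weight 0 (a + N1 * b) * weight 1 (N1 * (b + N2 * c)) * weight 2 (a + N1 * N2 * c))"
    unfolding sum_blocks by (intro sum.cong refl weight_split) auto
  also have "\<dots> = (\<Sum>a<N1. \<Sum>c<N3. \<Sum>b<N2.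
      weight 0 (a + N1 * b) * weight 1 (N1 * (b + N2 * c)) * weight 2 (a + N1 * N2 * c))"
    by (intro sum.cong refl sum.swap)
  finally show ?thesis .
qed

end

section \<open>The programs\<close>

abbreviation "Cell a \<equiv> ILoad a (INum 0)"
abbreviation "Asg a \<equiv> IS a (INum 0)"

abbreviation "nI \<equiv> ILoad 0 (INum 0)"
abbreviation "mI \<equiv> ILoad 0 (INum 1)"
abbreviation "sI \<equiv> ILoad 0 (INum 2)"

text \<open>
  Integer array 0 is the input and 1 the output.  \<open>aST\<close>, \<open>aCNT\<close>: first term and number of terms of
  each of the \<open>vF\<close> factors; \<open>aTP\<close>: position of each term in the input; \<open>vTT\<close>: bound on the exponents
  of the result; \<open>vW\<close>, \<open>aWP\<close>: Kronecker base and its powers; \<open>vD\<close>: order of the cyclic group; \<open>aE\<close>: code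
  of each term; \<open>aKP\<close>: powers of \<open>k\<close>; \<open>vN1\<close>, \<open>vN2\<close>, \<open>vN3\<close>: numbers of assignments to the three thirds;
  \<open>vU\<close>: current assignment in base \<open>k\<close>; \<open>vX\<close>, \<open>vY\<close>, \<open>vI\<close>, \<open>vJ\<close>: constraint of the current factor;
  \<open>vC\<close>: its group, 0 if it avoids the last third, else 1 if it avoids the first, else 2; \<open>vG\<close>: the group
  wanted; \<open>vQ\<close>: the modulus \<open>2 * vH + 1\<close>; \<open>lf\<close>, ..., \<open>lj\<close>: loop counters.

  Ring array 0 is the input, 1 the output, 2 the current weight, 4 the result.  The matrix
  multiplication program runs in the integer arrays from \<open>A0\<close> and the ring arrays from \<open>R0\<close> on.
\<close>

abbreviation (input) "vF \<equiv> 2 :: nat"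
abbreviation (input) "vPos \<equiv> 3 :: nat"
abbreviation (input) "vTC \<equiv> 4 :: nat"
abbreviation (input) "aST \<equiv> 5 :: nat"
abbreviation (input) "aCNT \<equiv> 6 :: nat"
abbreviation (input) "aTP \<equiv> 7 :: nat"
abbreviation (input) "vTT \<equiv> 8 :: nat"
abbreviation (input) "vW \<equiv> 9 :: nat"
abbreviation (input) "aWP \<equiv> 10 :: nat"
abbreviation (input) "vD \<equiv> 11 :: nat"
abbreviation (input) "aE \<equiv> 12 :: nat"
abbreviation (input) "aKP \<equiv> 13 :: nat"
abbreviation (input) "vN1 \<equiv> 14 :: nat"
abbreviation (input) "vN2 \<equiv> 15 :: nat"
abbreviation (input) "vN3 \<equiv> 16 :: nat"
abbreviation (input) "vND \<equiv> 17 :: nat"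
abbreviation (input) "vU \<equiv> 18 :: nat"
abbreviation (input) "vX \<equiv> 19 :: nat"
abbreviation (input) "vY \<equiv> 20 :: nat"
abbreviation (input) "vI \<equiv> 21 :: nat"
abbreviation (input) "vJ \<equiv> 22 :: nat"
abbreviation (input) "vC \<equiv> 23 :: nat"
abbreviation (input) "vG \<equiv> 24 :: nat"
abbreviation (input) "vQ \<equiv> 25 :: nat"
abbreviation (input) "vH \<equiv> 26 :: nat"
abbreviation (input) "lf \<equiv> 27 :: nat"
abbreviation (input) "lt \<equiv> 28 :: nat"
abbreviation (input) "lx \<equiv> 29 :: nat"
abbreviation (input) "ld \<equiv> 30 :: nat"
abbreviation (input) "la \<equiv> 31 :: nat"
abbreviation (input) "lb \<equiv> 32 :: nat"
abbreviation (input) "lc \<equiv> 33 :: nat"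
abbreviation (input) "li \<equiv> 34 :: nat"
abbreviation (input) "lj \<equiv> 35 :: nat"

abbreviation (input) "A0 \<equiv> 36 :: nat"
abbreviation (input) "R0 \<equiv> 5 :: nat"

section \<open>Selecting factors and computing weights\<close>

definition digit_exp :: "nat \<Rightarrow> iexp \<Rightarrow> iexp" where
  "digit_exp k e = IMod (IDiv (Cell vU) (ILoad aKP e)) (INum (int k))"

definition edge_index :: "nat \<Rightarrow> iexp" where
  "edge_index k = ISub (ISub (Cell lf) (INum 1)) (IMul nI (INum (int k)))"

definition factor_prog :: "nat \<Rightarrow> prog" where
  "factor_prog k =
     Cond (Cell lf)
       (Cond (ISub (IAdd (IMul nI (INum (int k))) (INum 1)) (Cell lf))
         (Asg vX (IDiv (ISub (Cell lf) (INum 1)) (INum (int k))) ;; Asg vY (Cell vX) ;;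
          Asg vI (IMod (ISub (Cell lf) (INum 1)) (INum (int k))) ;; Asg vJ (Cell vI))
         (Asg vX (ILoad 0 (IAdd (INum 3) (IMul (INum 2) (IDiv (edge_index k) (INum (int (k * k))))))) ;;
          Asg vY (ILoad 0 (IAdd (INum 4) (IMul (INum 2) (IDiv (edge_index k) (INum (int (k * k))))))) ;;
          Asg vI (IMod (IDiv (edge_index k) (INum (int k))) (INum (int k))) ;;
          Asg vJ (IMod (edge_index k) (INum (int k)))))
       (Asg vX (INum 0) ;; Asg vY (INum 0) ;; Asg vI (digit_exp k (INum 0)) ;; Asg vJ (Cell vI))"

text \<open>Later assignments overwrite earlier ones, so the tests appear in reverse order of
  precedence. Adding 1 to \<open>vX\<close> and \<open>vY\<close> turns a weak inequality into a
  positive difference.\<close>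

definition group_prog :: prog where
  "group_prog =
     Asg vC (INum 2) ;;
     Cond (ISub (IAdd (Cell vX) (INum 1)) (IDiv nI (INum 3)))
       (Cond (ISub (IAdd (Cell vY) (INum 1)) (IDiv nI (INum 3))) (Asg vC (INum 1)) Nop) Nop ;;
     Cond (ISub (IAdd (IDiv nI (INum 3)) (IDiv (IAdd nI (INum 1)) (INum 3))) (Cell vX))
       (Cond (ISub (IAdd (IDiv nI (INum 3)) (IDiv (IAdd nI (INum 1)) (INum 3))) (Cell vY))
         (Asg vC (INum 0)) Nop) Nop"

definition select_prog :: "nat \<Rightarrow> prog" where
  "select_prog k = factor_prog k ;; group_prog"

definition term_index :: iexp where
  "term_index = IAdd (ILoad aST (Cell lf)) (Cell lt)"

definition mul_index :: iexp where
  "mul_index = IMod (IAdd (Cell ld) (ILoad aE term_index)) (Cell vD)"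

text \<open>Multiplies the group ring element in ring array 2 by the factor \<open>lf\<close>, one
  term at a time, with ring array 3 as accumulator.\<close>

definition mul_prog :: prog where
  "mul_prog =
     For False ld (Cell vD) (RS 3 (Cell ld) RZero) ;;
     For False lt (ILoad aCNT (Cell lf)) (For False ld (Cell vD)
       (RS 3 mul_index (RAdd (RLoad 3 mul_index) (RMul (RLoad 2 (Cell ld)) (RLoad 0 term_index))))) ;;
     For False ld (Cell vD) (RS 2 (Cell ld) (RLoad 3 (Cell ld)))"

definition sq_diff :: "iexp \<Rightarrow> iexp \<Rightarrow> iexp" where
  "sq_diff e f = IMul (ISub e f) (ISub e f)"

text \<open>A conjunction of three equalities as one positivity test: a sum of integer squares is
  below 1 only if all of them vanish.\<close>

definition test_exp :: "nat \<Rightarrow> iexp" where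
  "test_exp k = ISub (INum 1) (IAdd (sq_diff (digit_exp k (Cell vX)) (Cell vI))
     (IAdd (sq_diff (digit_exp k (Cell vY)) (Cell vJ)) (sq_diff (Cell vC) (Cell vG))))"

definition weight_prog :: "nat \<Rightarrow> prog" where
  "weight_prog k =
     For False ld (Cell vD) (RS 2 (Cell ld) RZero) ;; RS 2 (INum 0) ROne ;;
     For False lf (Cell vF) (select_prog k ;; Cond (test_exp k) mul_prog Nop)"

section \<open>Filling and using the matrices\<close>

definition row_index :: "nat \<Rightarrow> nat \<Rightarrow> iexp \<Rightarrow> iexp" where
  "row_index l l' e = IAdd (IMul (IAdd (IMul (Cell l) (Cell vD)) (Cell l')) (Cell vND)) e"

definition left_prog :: "nat \<Rightarrow> prog" where
  "left_prog k = Asg vG (INum 0) ;;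
     For True la (Cell vN1) (For True lb (Cell vN2)
       (Asg vU (IAdd (Cell la) (IMul (Cell vN1) (Cell lb))) ;; weight_prog k ;;
        For False li (Cell vD) (For False lj (Cell vD)
          (RS R0 (row_index la li (IAdd (IMul (Cell lb) (Cell vD)) (Cell lj)))
             (RLoad 2 (IMod (ISub (IAdd (Cell li) (Cell vD)) (Cell lj)) (Cell vD)))))))"

text \<open>Each block is a single column of height \<open>D\<close>, so only the first
  \<open>N3\<close> of the \<open>ND\<close> columns are filled; the rest of the square matrix stays
  0.\<close>

definition right_prog :: "nat \<Rightarrow> prog" where
  "right_prog k = Asg vG (INum 1) ;;
     For True lb (Cell vN2) (For True lc (Cell vN3)
       (Asg vU (IMul (Cell vN1) (IAdd (Cell lb) (IMul (Cell vN2) (Cell lc)))) ;; weight_prog k ;;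
        For False lj (Cell vD) (RS (R0 + 1) (row_index lb lj (Cell lc)) (RLoad 2 (Cell lj)))))"

definition sum_index :: iexp where
  "sum_index = IMod (IAdd (Cell li) (Cell lj)) (Cell vD)"

definition combine_prog :: "nat \<Rightarrow> prog" where
  "combine_prog k = For False ld (Cell vD) (RS 4 (Cell ld) RZero) ;; Asg vG (INum 2) ;;
     For True la (Cell vN1) (For True lc (Cell vN3)
       (Asg vU (IAdd (Cell la) (IMul (IMul (Cell vN1) (Cell vN2)) (Cell lc))) ;; weight_prog k ;;
        For False li (Cell vD) (For False lj (Cell vD)
          (RS 4 sum_index (RAdd (RLoad 4 sum_index)
             (RMul (RLoad (R0 + 2) (row_index la li (Cell lc))) (RLoad 2 (Cell lj))))))))"

text \<open>\<open>\<delta>\<close> is the number of integers that a coefficient occupies: 1 in the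
  bit model and 0 in the unit-cost model, where coefficients are in the ring memory.\<close>

definition parse_prog :: "nat \<Rightarrow> nat \<Rightarrow> prog" where
  "parse_prog k \<delta> =
     Asg vF (IAdd (IAdd (INum 1) (IMul nI (INum (int k)))) (IMul (IMul mI (INum (int k))) (INum (int k)))) ;;
     Asg vPos (IAdd (INum 3) (IMul (INum 2) mI)) ;; Asg vTC (INum 0) ;;
     For False lf (Cell vF)
       (IS aST (Cell lf) (Cell vTC) ;; IS aCNT (Cell lf) (ILoad 0 (Cell vPos)) ;;
        Asg vPos (IAdd (Cell vPos) (INum 1)) ;;
        For False lt (ILoad aCNT (Cell lf))
          (IS aTP (Cell vTC) (Cell vPos) ;; Asg vPos (IAdd (Cell vPos) (IAdd sI (INum (int \<delta>)))) ;;
           Asg vTC (IAdd (Cell vTC) (INum 1))))"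

definition exp_entry :: "nat \<Rightarrow> iexp" where
  "exp_entry \<delta> = ILoad 0 (IAdd (IAdd (ILoad aTP (Cell lt)) (INum (int \<delta>))) (Cell lx))"

text \<open>The sum of the squares of all exponents in the input serves as the bound
  \<open>vTT\<close>: it dominates the absolute values, needs no comparisons and is still
  polynomial.\<close>

definition code_prog :: "nat \<Rightarrow> prog" where
  "code_prog \<delta> =
     Asg vTT (INum 0) ;;
     For False lt (Cell vTC) (For False lx sI
       (Asg vTT (IAdd (Cell vTT) (IMul (exp_entry \<delta>) (exp_entry \<delta>))))) ;;
     Asg vW (IAdd (IMul (INum 2) (Cell vTT)) (INum 1)) ;;
     IS aWP (INum 0) (INum 1) ;;
     For False lx sI (IS aWP (IAdd (Cell lx) (INum 1)) (IMul (ILoad aWP (Cell lx)) (Cell vW))) ;;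
     Asg vD (ILoad aWP sI) ;;
     For False lt (Cell vTC) (IS aE (Cell lt) (INum 0) ;; For False lx sI
       (IS aE (Cell lt) (IMod (IAdd (ILoad aE (Cell lt)) (IMul (exp_entry \<delta>) (ILoad aWP (Cell lx)))) (Cell vD))))"

definition power_prog :: "nat \<Rightarrow> prog" where
  "power_prog k =
     IS aKP (INum 0) (INum 1) ;;
     For False lx nI (IS aKP (IAdd (Cell lx) (INum 1)) (IMul (ILoad aKP (Cell lx)) (INum (int k)))) ;;
     Asg vN1 (ILoad aKP (IDiv nI (INum 3))) ;;
     Asg vN2 (ILoad aKP (IDiv (IAdd nI (INum 1)) (INum 3))) ;;
     Asg vN3 (ILoad aKP (IDiv (IAdd nI (INum 2)) (INum 3))) ;;
     Asg vND (IMul (Cell vN3) (Cell vD))"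

definition out_index :: iexp where
  "out_index = IMod (ISub (IAdd (Cell ld) (Cell vD)) (IDiv (ISub (Cell vD) (INum 1)) (INum 2))) (Cell vD)"

text \<open>In the bit model the balanced residue is taken: adding \<open>vH\<close> before the
  reduction and subtracting it afterwards moves the range to the interval from \<open>-h\<close> to
  \<open>h\<close>.\<close>

definition coeff_prog :: "coeff_model \<Rightarrow> nat \<Rightarrow> prog" where
  "coeff_prog M off = (case M of
     Bit_Length \<Rightarrow> IS 1 (IAdd (INum 1) (IMul (Cell ld) (IAdd sI (INum 1))))
       (ISub (IMod (IAdd (ILoad (off + 4) out_index) (Cell vH)) (Cell vQ)) (Cell vH))
   | Unit_Cost \<Rightarrow> RS 1 (Cell ld) (RLoad 4 out_index))"

definition width :: "coeff_model \<Rightarrow> nat" where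
  "width M = (case M of Bit_Length \<Rightarrow> 1 | Unit_Cost \<Rightarrow> 0)"

definition output_prog :: "coeff_model \<Rightarrow> nat \<Rightarrow> prog" where
  "output_prog M off =
     IS 1 (INum 0) (Cell vD) ;;
     For False ld (Cell vD) (coeff_prog M off ;;
       For False lx sI
         (IS 1 (IAdd (IAdd (INum (int (1 + width M))) (IMul (Cell ld) (IAdd sI (INum (int (width M)))))) (Cell lx))
           (ISub (IMod (IDiv (Cell ld) (ILoad aWP (Cell lx))) (Cell vW)) (Cell vTT))))"

definition coeff_entry :: iexp where
  "coeff_entry = ILoad 0 (ILoad aTP (Cell lt))"

text \<open>The product of \<open>1 + c * c\<close> over all coefficients \<open>c\<close> bounds
  every score, and \<open>k ^ n\<close> counts the assignments; squares replace absolute values, so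
  that no tests are needed. The residues of the coefficients are put where the simulated ring array
  0 begins.\<close>

definition modulus_prog :: "nat \<Rightarrow> nat \<Rightarrow> prog" where
  "modulus_prog k off =
     Asg vH (INum 1) ;;
     For False lt (Cell vTC) (Asg vH (IMul (Cell vH) (IAdd (INum 1) (IMul coeff_entry coeff_entry)))) ;;
     For False lx nI (Asg vH (IMul (Cell vH) (INum (int k)))) ;;
     Asg vQ (IAdd (IMul (INum 2) (Cell vH)) (INum 1)) ;;
     For False lt (Cell vTC) (IS off (Cell lt) (IMod coeff_entry (Cell vQ)))"

section \<open>Correctness of the weight computation\<close>

lemma iwrites_factor [simp]: "iwrites (factor_prog k) = {19, 20, 21, 22}"
  by (auto simp: factor_prog_def)

lemma iwrites_select [simp]: "iwrites (select_prog k) = {19, 20, 21, 22, 23}"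
  by (auto simp: select_prog_def factor_prog_def group_prog_def)

lemma rwrites_select [simp]: "rwrites (select_prog k) = {}"
  by (auto simp: select_prog_def factor_prog_def group_prog_def)

lemma iwrites_mul [simp]: "iwrites mul_prog = {28, 30}"
  by (auto simp: mul_prog_def)

lemma rwrites_mul [simp]: "rwrites mul_prog = {2, 3}"
  by (auto simp: mul_prog_def)

lemma iwrites_weight [simp]: "iwrites (weight_prog k) = {19, 20, 21, 22, 23, 27, 28, 30}"
  by (auto simp: weight_prog_def)

lemma rwrites_weight [simp]: "rwrites (weight_prog k) = {2, 3}"
  by (auto simp: weight_prog_def)

section \<open>Terms of the input, exponent bound and group order\<close>

locale pcsp_enc = pcsp_inst k I es + bounds B X Y S
  for k :: nat and I :: pcsp and es :: "(nat \<times> nat) list"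
    and B :: int and X Y :: nat and S :: "nat set" +
  fixes tss :: "gterm list list"
  assumes tss: "list_all2 (is_term_list (fvars I)) tss (poly_list k I es)"
begin

abbreviation "sv \<equiv> fvars I"

definition terms :: "gterm list" where
  "terms = concat tss"

definition start :: "nat \<Rightarrow> nat" where
  "start f = length (concat (take f tss))"

definition term_bound :: "gterm \<Rightarrow> nat" where
  "term_bound t = (\<Sum>x<sv. nat ((snd t ! x) ^ 2))"

definition TT :: nat where
  "TT = (\<Sum>t<length terms. term_bound (terms ! t))"

definition W :: nat where
  "W = 2 * TT + 1"

definition D :: nat where
  "D = W ^ sv"

abbreviation "kro \<equiv> kron sv W"

lemma W_ge: "1 \<le> W"
  by (simp add: W_def)

lemma D_ge: "1 \<le> D"
  using W_ge by (simp add: D_def)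

lemma length_tss: "length tss = F"
  using list_all2_lengthD[OF tss] by (simp add: length_ps)

lemma start_Suc: "f < F \<Longrightarrow> start (Suc f) = start f + length (tss ! f)"
  by (simp add: start_def take_Suc_conv_app_nth length_tss)

lemma start_F: "start F = length terms"
  by (simp add: start_def terms_def length_tss flip: length_tss)

lemma terms_split: "f < F \<Longrightarrow> terms = concat (take f tss) @ tss ! f @ concat (drop (Suc f) tss)"
  unfolding terms_def using id_take_nth_drop[of f tss]
  by (metis concat.simps(2) concat_append length_tss)

lemma terms_nth: "f < F \<Longrightarrow> t < length (tss ! f) \<Longrightarrow> terms ! (start f + t) = tss ! f ! t"
  by (simp add: terms_split[of f] start_def nth_append)

lemma start_le: "f < F \<Longrightarrow> start f + length (tss ! f) \<le> length terms"
  by (simp add: terms_split[of f] start_def)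

lemma length_exps: "t < length terms \<Longrightarrow> length (snd (terms ! t)) = sv"
proof -
  assume "t < length terms"
  then have "terms ! t \<in> set terms" by (rule nth_mem)
  then have "terms ! t \<in> set (concat tss)" by (simp only: terms_def)
  then obtain ts where "ts \<in> set tss" "terms ! t \<in> set ts" by auto
  then show ?thesis using tss unfolding list_all2_conv_all_nth is_term_list_def
    by (force simp: in_set_conv_nth[of ts])
qed

definition term_poly :: "gterm \<Rightarrow> gpoly" where
  "term_poly t = Poly_Mapping.single (exponent (snd t)) (fst t)"

lemma ps_eq: "f < F \<Longrightarrow> ps ! f = (\<Sum>t<length (tss ! f). term_poly (tss ! f ! t))"
proof -
  assume "f < F"
  then have "is_term_list sv (tss ! f) (ps ! f)"
    using tss by (simp add: list_all2_conv_all_nth length_tss)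
  then have "ps ! f = sum_list (map term_poly (tss ! f))"
    by (simp add: is_term_list_def case_prod_beta' flip: term_poly_def)
  then show ?thesis by (simp add: sum_list_sum_nth lessThan_atLeast0)
qed

lemma boxed_term: "t < length terms \<Longrightarrow> boxed sv (term_bound (terms ! t)) (exponent (snd (terms ! t)))"
proof -
  assume t: "t < length terms"
  let ?es = "snd (terms ! t)"
  have "\<bar>?es ! x\<bar> \<le> int (term_bound (terms ! t))" if "x < sv" for x
  proof -
    have "\<bar>?es ! x\<bar> \<le> (?es ! x) ^ 2"
    proof (cases "?es ! x = 0")
      case False
      then have "\<bar>?es ! x\<bar> * 1 \<le> \<bar>?es ! x\<bar> * \<bar>?es ! x\<bar>" by (intro mult_left_mono) auto
      then show ?thesis by (simp add: power2_eq_square)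
    qed simp
    also have "(?es ! x) ^ 2 = int (nat ((?es ! x) ^ 2))" by simp
    also have "nat ((?es ! x) ^ 2) \<le> term_bound (terms ! t)"
      unfolding term_bound_def using that by (intro member_le_sum) auto
    then have "int (nat ((?es ! x) ^ 2)) \<le> int (term_bound (terms ! t))" by (simp only: of_nat_le_iff)
    finally show ?thesis .
  qed
  then have "\<bar>real_of_int (?es ! x)\<bar> \<le> real (term_bound (terms ! t))" if "x < sv" for x
    using that by (metis of_int_abs of_int_le_iff of_int_of_nat_eq)
  then show ?thesis unfolding boxed_def using length_exps[OF t]
    by (auto simp: lookup_exponent in_keys_iff split: if_splits)
qed

definition poly_bound :: "nat \<Rightarrow> nat" where
  "poly_bound f = (\<Sum>t<length (tss ! f). term_bound (tss ! f ! t))"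

lemma box_ps: "f < F \<Longrightarrow> box_poly sv (poly_bound f) (ps ! f)"
  unfolding ps_eq
proof (rule box_poly_sum)
  fix t assume f: "f < F" and "t \<in> {..<length (tss ! f)}"
  then have t: "t < length (tss ! f)" by simp
  have "boxed sv (term_bound (tss ! f ! t)) (exponent (snd (tss ! f ! t)))"
    using boxed_term[of "start f + t"] t f start_le[OF f] by (simp add: terms_nth)
  moreover have "term_bound (tss ! f ! t) \<le> poly_bound f"
    unfolding poly_bound_def using t by (intro member_le_sum) auto
  ultimately show "box_poly sv (poly_bound f) (term_poly (tss ! f ! t))"
    by (auto simp: term_poly_def box_poly_def boxed_def intro: order_trans[OF _ of_nat_mono])
qed

text \<open>Hence \<open>TT\<close> bounds the exponents of every product of distinct factors, in
  particular of all weights and of the partition function.\<close>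

lemma sum_poly_bound: "(\<Sum>f<F. poly_bound f) = TT"
proof -
  have "(\<Sum>f<g. poly_bound f) = (\<Sum>t<start g. term_bound (terms ! t))" if "g \<le> F" for g
    using that
  proof (induction g)
    case (Suc g)
    have "(\<Sum>t<start (Suc g). term_bound (terms ! t)) =
        (\<Sum>t<start g. term_bound (terms ! t)) + (\<Sum>t<length (tss ! g). term_bound (terms ! (start g + t)))"
      using Suc.prems by (simp add: start_Suc sum_lessThan_add)
    also have "(\<Sum>t<length (tss ! g). term_bound (terms ! (start g + t))) = poly_bound g"
      unfolding poly_bound_def using Suc.prems by (intro sum.cong) (auto simp: terms_nth)
    finally show ?case using Suc by simp
  qed (simp add: start_def)
  from this[of F] show ?thesis by (simp add: start_F TT_def)
qed

lemma box_weight: "box_poly sv TT (weight c u)"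
proof -
  have "box_poly sv (\<Sum>f<F. poly_bound f) (weight c u)"
    unfolding weight_def by (rule box_poly_prod) (auto intro: box_ps box_poly_one)
  then show ?thesis by (simp add: sum_poly_bound)
qed

lemma box_partition_function: "box_poly sv TT (partition_function k I)"
  unfolding partition_function_eq_sum
proof (rule box_poly_sum)
  fix u
  have "box_poly sv (\<Sum>f<F. poly_bound f) (\<Prod>f<F. if active u f then ps ! f else 1)"
    by (rule box_poly_prod) (auto intro: box_ps box_poly_one)
  then show "box_poly sv TT (\<Prod>f<F. if active u f then ps ! f else 1)" by (simp add: sum_poly_bound)
qed

end

text \<open>The bound \<open>k ^ n * X\<close> covers the exponentially large integers that are
  stored in both models: codes of assignments, powers of \<open>k\<close> and the matrix size
  \<open>N3 * D\<close>.\<close>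

locale pcsp_run = pcsp_enc +
  assumes F_le: "F \<le> X" and n_le: "nvars I \<le> X" and sv_le: "fvars I \<le> X"
    and terms_le: "length terms \<le> X" and D_le: "D \<le> X" and k_le: "k \<le> X"
    and N3_le: "N3 \<le> Y" and B_le: "int (k ^ nvars I * X) \<le> B"
begin

section \<open>Memory contents during the main computation\<close>

definition input_ok :: "real state \<Rightarrow> bool" where
  "input_ok s \<longleftrightarrow> imem s 0 0 = int n \<and> imem s 0 1 = int m \<and> imem s 0 2 = int sv \<and>
     (\<forall>e<m. imem s 0 (3 + 2 * e) = int (fst (es ! e)) \<and> imem s 0 (4 + 2 * e) = int (snd (es ! e)))"

definition tables :: "real state \<Rightarrow> bool" where
  "tables s \<longleftrightarrow> input_ok s \<and> imem s vF 0 = int F \<and> imem s vTC 0 = int (length terms) \<and>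
     (\<forall>f<F. imem s aST f = int (start f) \<and> imem s aCNT f = int (length (tss ! f))) \<and>
     imem s vTT 0 = int TT \<and> imem s vW 0 = int W \<and> (\<forall>x\<le>sv. imem s aWP x = int (W ^ x)) \<and>
     imem s vD 0 = int D \<and>
     (\<forall>t<length terms. imem s aE t = int (kcode sv W (exponent (snd (terms ! t))))) \<and>
     (\<forall>x\<le>n. imem s aKP x = int (k ^ x)) \<and>
     imem s vN1 0 = int N1 \<and> imem s vN2 0 = int N2 \<and> imem s vN3 0 = int N3 \<and>
     imem s vND 0 = int (N3 * D)"

lemma tables_cong: "(\<And>a. a < vU \<Longrightarrow> imem s' a = imem s a) \<Longrightarrow> tables s \<Longrightarrow> tables s'"
  by (simp add: tables_def input_ok_def)

lemma tables_vD: "tables s \<Longrightarrow> imem s vD 0 = int D"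
  by (simp add: tables_def)

lemma tables_iupd [simp]: "vU \<le> a \<Longrightarrow> tables (iupd a i z s) = tables s"
  using tables_cong[of "iupd a i z s" s] tables_cong[of s "iupd a i z s"] by auto

lemma tables_rupd [simp]: "tables (rupd a i z s) = tables s"
  using tables_cong[of "rupd a i z s" s] tables_cong[of s "rupd a i z s"] by auto

lemma tables_frame: "frame U U' s s' \<Longrightarrow> U \<inter> {..<vU} = {} \<Longrightarrow> tables s \<Longrightarrow> tables s'"
  by (rule tables_cong) (auto simp: frame_def)

definition coeffs :: "real state \<Rightarrow> bool" where
  "coeffs s \<longleftrightarrow> (\<forall>t<length terms. rmem s 0 t = fst (terms ! t))"

lemma X_le_B: "int X \<le> B"
proof -
  have "1 * X \<le> k ^ nvars I * X" using k_ge by (intro mult_le_mono1) simp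
  then have "int (1 * X) \<le> int (k ^ nvars I * X)" by (simp only: of_nat_le_iff)
  then show ?thesis using B_le by simp
qed

lemma power_le_B: "x \<le> n \<Longrightarrow> int (k ^ x) \<le> B"
proof -
  assume "x \<le> n"
  then have "k ^ x * 1 \<le> k ^ n * X" using k_ge X_ge by (intro mult_le_mono power_increasing) auto
  then have "int (k ^ x * 1) \<le> int (k ^ n * X)" by (simp only: of_nat_le_iff)
  then show ?thesis using B_le by simp
qed

lemma le_B: "x \<le> X \<Longrightarrow> int x \<le> B"
  using X_le_B by linarith

lemma edge_index_less:
  assumes "f < F" "\<not> f < n * k + 1"
  shows "(f - 1 - n * k) div (k * k) < m"
proof -
  have "f - 1 - n * k < m * (k * k)" using assms by (simp add: F_def mult.assoc)
  then show ?thesis by (simp add: less_mult_imp_div_less)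
qed

lemma fx_le: "f < F \<Longrightarrow> fx f \<le> n" and fy_le: "f < F \<Longrightarrow> fy f \<le> n"
proof -
  assume f: "f < F"
  have 1: "(f - 1) div k \<le> n" if "f < n * k + 1"
  proof -
    have "f - 1 \<le> n * k" using that by simp
    then have "(f - 1) div k \<le> n * k div k" by (rule div_le_mono)
    then show ?thesis using k_ge by simp
  qed
  have 2: "fst (es ! ((f - 1 - n * k) div (k * k))) \<le> n \<and> snd (es ! ((f - 1 - n * k) div (k * k))) \<le> n"
    if "\<not> f < n * k + 1"
    using arcs_less[of "fst (es ! ((f - 1 - n * k) div (k * k)))" "snd (es ! ((f - 1 - n * k) div (k * k)))"]
      nth_mem[OF edge_index_less[OF f that]] by simp
  show "fx f \<le> n" "fy f \<le> n" using 1 2 by (auto simp: fx_def fy_def)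
qed

lemma fi_less: "fi u f < k" and fj_less: "fj u f < k"
  using k_ge by (auto simp: fi_def fj_def digit_less)

lemma ival_digit_exp:
  assumes "tables s" "imem s vU 0 = int u" "ival s e = int x" "x \<le> n"
  shows "ival s (digit_exp k e) = int (digit k u x)"
  using assms by (simp add: digit_exp_def digit_def tables_def zdiv_int zmod_int)

lemma wp_select:
  assumes "tables s" "imem s lf 0 = int f" "f < F" "imem s vU 0 = int u"
  shows "wp (select_prog k) (\<lambda>s'. imem s' vX 0 = int (fx f) \<and> imem s' vY 0 = int (fy f) \<and>
    imem s' vI 0 = int (fi u f) \<and> imem s' vJ 0 = int (fj u f) \<and> imem s' vC 0 = int (grp f)) s"
proof -
  have in_ok: "imem s 0 0 = int n" "imem s 0 (Suc 0) = int m"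
    "\<And>e. e < m \<Longrightarrow> imem s 0 (3 + 2 * e) = int (fst (es ! e)) \<and> imem s 0 (4 + 2 * e) = int (snd (es ! e))"
    using assms(1) by (auto simp: tables_def input_ok_def)
  have bd: "int (fx f) \<le> B" "int (fy f) \<le> B" "int (fi u f) \<le> B" "int (fj u f) \<le> B" "2 \<le> B"
    using fx_le[of f] fy_le[of f] fi_less[of u f] fj_less[of u f] assms(3) n_le k_le B_ge
    by (auto intro!: le_B)
  have g: "grp f = (if int (fx f) < int n div 3 + (int n + 1) div 3 \<and> int (fy f) < int n div 3 + (int n + 1) div 3
      then 0 else if int n div 3 \<le> int (fx f) \<and> int n div 3 \<le> int (fy f) then 1 else 2)"
  proof -
    have "int n div 3 = int (n div 3)" "(int n + 1) div 3 = int ((n + 1) div 3)"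
      by (simp_all add: zdiv_int)
    then show ?thesis unfolding grp_def n12_def n1_def by (simp flip: of_nat_add)
  qed
  let ?R = "\<lambda>s'. imem s' vX 0 = int (fx f) \<and> imem s' vY 0 = int (fy f) \<and>
    imem s' vI 0 = int (fi u f) \<and> imem s' vJ 0 = int (fj u f)"
  have 2: "wp group_prog (\<lambda>s'. ?R s' \<and> imem s' vC 0 = int (grp f)) s'"
    if "?R s'" "imem s' 0 0 = int n" for s'
    using that bd by (auto simp: g group_prog_def)
  have f_nk: "f - 1 - n * k = f - Suc (n * k)" by simp
  have 1: "wp (factor_prog k) ?R s"
  proof (cases "f = 0")
    case True
    have *: "ival (iupd vY 0 0 (iupd vX 0 0 s)) (digit_exp k (INum 0)) = int (digit k u 0)"
      by (rule ival_digit_exp) (use assms in simp_all)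
    have "fx f = 0" "fy f = 0" "fi u f = digit k u 0" "fj u f = digit k u 0"
      using True by (simp_all add: fx_def fy_def fi_def fj_def)
    then show ?thesis using True assms(2) bd * by (simp add: factor_prog_def)
  next
    case False
    have f1: "int f - 1 = int (f - 1)" using False by simp
    show ?thesis
    proof (cases "f < n * k + 1")
      case True
      then have nk: "int f < int n * int k + 1" by (metis of_nat_1 of_nat_add of_nat_less_iff of_nat_mult)
      have "fx f = (f - 1) div k" "fy f = (f - 1) div k" "fi u f = (f - 1) mod k" "fj u f = (f - 1) mod k"
        using True False by (simp_all add: fx_def fy_def fi_def fj_def)
      then have "int (fx f) = (int f - 1) div int k" "int (fy f) = (int f - 1) div int k"
        "int (fi u f) = (int f - 1) mod int k" "int (fj u f) = (int f - 1) mod int k"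
        by (simp_all only: f1 zdiv_int zmod_int)
      then show ?thesis using False nk assms(2) bd in_ok(1) by (simp add: factor_prog_def del: of_nat_diff)
    next
      case F: False
      define g where "g = f - 1 - n * k"
      have g: "int f - 1 - int n * int k = int g" using F False by (simp add: g_def)
      have nk: "\<not> int f < int n * int k + 1"
        using F by (metis of_nat_1 of_nat_add of_nat_less_iff of_nat_mult)
      have e: "\<And>s'. imem s' lf = imem s lf \<Longrightarrow> imem s' 0 = imem s 0 \<Longrightarrow> ival s' (edge_index k) = int g"
        using assms(2) in_ok(1) g by (simp add: edge_index_def)
      have gm: "g div (k * k) < m" unfolding g_def by (rule edge_index_less[OF assms(3) F])
      have ix: "nat (3 + 2 * (int g div (int k * int k))) = 3 + 2 * (g div (k * k))"
        "nat (4 + 2 * (int g div (int k * int k))) = 4 + 2 * (g div (k * k))"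
        unfolding of_nat_mult[symmetric] zdiv_int[symmetric] by simp_all
      have "fx f = fst (es ! (g div (k * k)))" "fy f = snd (es ! (g div (k * k)))"
        "fi u f = g div k mod k" "fj u f = g mod k"
        using F False by (simp_all add: fx_def fy_def fi_def fj_def g_def)
      then have "imem s 0 (3 + 2 * (g div (k * k))) = int (fx f)"
        "imem s 0 (4 + 2 * (g div (k * k))) = int (fy f)"
        "int g div int k mod int k = int (fi u f)" "int g mod int k = int (fj u f)"
        using in_ok(3)[OF gm] by (simp_all add: zdiv_int zmod_int)
      then show ?thesis using False nk assms(2) bd in_ok(1) ix by (simp add: e factor_prog_def)
    qed
  qed
  show ?thesis unfolding select_prog_def wp.simps
    by (rule wp_frame_mono[OF 1], rule wp_frame_mono[OF 2]) (use in_ok in \<open>auto simp: frame_def\<close>)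
qed

lemma X_B: "int F \<le> B" "int n \<le> B" "int sv \<le> B" "int (length terms) \<le> B" "int D \<le> B" "int k \<le> B"
  using F_le n_le sv_le terms_le D_le k_le by (auto intro!: le_B)

lemma wp_mul:
  assumes s: "tables s" "coeffs s" "imem s lf 0 = int f" and f: "f < F"
    and acc: "\<forall>d<D. rmem s 2 d = kro p d" and p: "box_poly sv U p"
  shows "wp mul_prog (\<lambda>s'. \<forall>d<D. rmem s' 2 d = kro (p * ps ! f) d) s"
proof -
  let ?A = "For False ld (Cell vD) (RS 3 (Cell ld) RZero)"
  let ?Bb = "RS 3 mul_index (RAdd (RLoad 3 mul_index) (RMul (RLoad 2 (Cell ld)) (RLoad 0 term_index)))"
  let ?B = "For False lt (ILoad aCNT (Cell lf)) (For False ld (Cell vD) ?Bb)"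
  let ?C = "For False ld (Cell vD) (RS 2 (Cell ld) (RLoad 3 (Cell ld)))"
  let ?G = "\<lambda>s'. tables s' \<and> coeffs s' \<and> imem s' lf 0 = int f \<and> (\<forall>d<D. rmem s' 2 d = kro p d)"
  have G: "?G s'" if "?G s1" "frame U {3} s1 s'" "U \<subseteq> {lt, ld}" for U s1 s'
  proof -
    have "U \<inter> {..<vU} = {}" "lf \<notin> U" using that(3) by auto
    then show ?thesis using that tables_frame[of U "{3}" s1 s'] by (auto simp: frame_def coeffs_def)
  qed
  have A: "wp ?A (\<lambda>s'. ?G s' \<and> (\<forall>d<D. rmem s' 3 d = 0)) s"
  proof (rule wp_For[where n = D and I = "\<lambda>j s'. \<forall>d<j. rmem s' 3 d = 0"])
    fix s' assume I: "\<forall>d<D. rmem s' 3 d = 0"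
      and fr: "frame (insert ld (iwrites (RS 3 (Cell ld) RZero))) (rwrites (RS 3 (Cell ld) RZero)) s s'"
    have "?G s'" by (rule G[of s "{ld}"]) (use s acc fr in auto)
    then show "?G s' \<and> (\<forall>d<D. rmem s' 3 d = 0)" using I by blast
  qed (use s D_le X_B in \<open>auto simp: tables_vD less_Suc_eq\<close>)
  \<comment> \<open>The product with the first \<open>t\<close> terms of the factor; the loop over
    the terms keeps its image in ring array 3.\<close>
  let ?p = "\<lambda>t. p * (\<Sum>t'<t. term_poly (tss ! f ! t'))"
  have len: "length (tss ! f) \<le> length terms" using start_le[OF f] by simp
  have B: "wp ?B (\<lambda>s'. tables s' \<and> (\<forall>d<D. rmem s' 3 d = kro (p * ps ! f) d)) s1"
    if s1: "?G s1" "\<forall>d<D. rmem s1 3 d = 0" for s1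
  proof (rule wp_For[where n = "length (tss ! f)" and I = "\<lambda>t s'. \<forall>d<D. rmem s' 3 d = kro (?p t) d"])
    show "ival s1 (ILoad aCNT (Cell lf)) = int (length (tss ! f))" using s1(1) f by (simp add: tables_def)
    show "int (length (tss ! f)) \<le> B" "length (tss ! f) \<le> (if False then Y else X)"
      using len terms_le by (auto intro!: le_B)
  next
    fix t s2 assume t: "t < length (tss ! f)" and I: "\<forall>d<D. rmem s2 3 d = kro (?p t) d"
      and t2: "imem s2 lt 0 = int t"
      and fr: "frame (insert lt (iwrites (For False ld (Cell vD) ?Bb))) (rwrites (For False ld (Cell vD) ?Bb)) s1 s2"
    have s2: "?G s2" by (rule G[OF s1(1), of "{lt, ld}"]) (use fr in simp_all)
    have idx: "start f + t < length terms" using t start_le[OF f] by simp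
    define e where "e = exponent (snd (terms ! (start f + t)))"
    define c where "c = fst (terms ! (start f + t))"
    have tp: "term_poly (tss ! f ! t) = Poly_Mapping.single e c"
      by (simp add: term_poly_def e_def c_def terms_nth[OF f t])
    show "wp (For False ld (Cell vD) ?Bb) (\<lambda>s'. \<forall>d<D. rmem s' 3 d = kro (?p (Suc t)) d) s2"
    \<comment> \<open>Inside, the coefficients \<open>d < j\<close> of \<open>p\<close> have already
      been rotated by the code of the current term; at \<open>j = D\<close> this is the sum in
      \<open>kron_mult_single\<close>.\<close>
    proof (rule wp_For[where n = D and I = "\<lambda>j s3. \<forall>d'<D. rmem s3 3 d' =
        kro (?p t) d' + (\<Sum>d<j. if (d + kcode sv W e) mod D = d' then kro p d * c else 0)"])
      show "ival s2 (Cell vD) = int D" using s2 by (simp add: tables_def)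
      show "int D \<le> B" "D \<le> (if False then Y else X)" using X_B D_le by auto
      show "\<forall>d'<D. rmem s2 3 d' =
          kro (?p t) d' + (\<Sum>d<0. if (d + kcode sv W e) mod D = d' then kro p d * c else 0)"
        using I by simp
      fix j s3 assume j: "j < D" and I3: "\<forall>d'<D. rmem s3 3 d' =
          kro (?p t) d' + (\<Sum>d<j. if (d + kcode sv W e) mod D = d' then kro p d * c else 0)"
        and j3: "imem s3 ld 0 = int j" and fr3: "frame (insert ld (iwrites ?Bb)) (rwrites ?Bb) s2 s3"
      have s3: "?G s3" by (rule G[OF s2, of "{ld}"]) (use fr3 in simp_all)
      have t3: "imem s3 lt 0 = int t" using fr3 t2 by (simp add: frame_def)
      have ti: "ival s3 term_index = int (start f + t)" using s3 t3 f by (simp add: term_index_def tables_def)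
      have mi: "ival s3 mul_index = int ((j + kcode sv W e) mod D)"
        using s3 j3 ti idx by (simp add: mul_index_def tables_def zmod_int e_def nat_int_add)
      have lt: "(j + kcode sv W e) mod D < D" using D_ge by simp
      have c: "rmem s3 0 (start f + t) = c" using s3 idx by (simp add: coeffs_def c_def)
      show "wp ?Bb (\<lambda>s3. \<forall>d'<D. rmem s3 3 d' =
          kro (?p t) d' + (\<Sum>d<Suc j. if (d + kcode sv W e) mod D = d' then kro p d * c else 0)) s3"
        using I3 j s3 lt c by (simp add: mi ti j3 nat_int_add)
    next
      fix s3 assume I3: "\<forall>d'<D. rmem s3 3 d' =
          kro (?p t) d' + (\<Sum>d<D. if (d + kcode sv W e) mod D = d' then kro p d * c else 0)"
      have "kro (?p (Suc t)) d' = kro (?p t) d' + kro (p * Poly_Mapping.single e c) d'" for d'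
        by (simp add: distrib_left kron_add tp)
      moreover have "boxed sv (term_bound (terms ! (start f + t))) e"
        unfolding e_def by (rule boxed_term[OF idx])
      note kron_mult_single[OF p this W_ge, of c]
      ultimately show "\<forall>d<D. rmem s3 3 d = kro (?p (Suc t)) d"
        using I3 by (simp add: D_def)
    qed simp_all
  next
    show "\<forall>d<D. rmem s1 3 d = kro (?p 0) d" using s1(2) by simp
    fix s' assume "\<forall>d<D. rmem s' 3 d = kro (?p (length (tss ! f))) d"
      and fr: "frame (insert lt (iwrites (For False ld (Cell vD) ?Bb))) (rwrites (For False ld (Cell vD) ?Bb)) s1 s'"
    moreover have "?G s'" by (rule G[OF s1(1), of "{lt, ld}"]) (use fr in simp_all)
    ultimately show "tables s' \<and> (\<forall>d<D. rmem s' 3 d = kro (p * ps ! f) d)" by (simp add: ps_eq[OF f])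
  qed simp_all
  have C: "wp ?C (\<lambda>s'. \<forall>d<D. rmem s' 2 d = kro (p * ps ! f) d) s2"
    if s2: "tables s2" "\<forall>d<D. rmem s2 3 d = kro (p * ps ! f) d" for s2
    by (rule wp_For[where n = D and I = "\<lambda>j s'. \<forall>d<j. rmem s' 2 d = kro (p * ps ! f) d"])
      (use s2 D_le X_B in \<open>auto simp: tables_vD less_Suc_eq frame_def\<close>)
  show ?thesis unfolding mul_prog_def wp.simps(4)
  proof (rule wp_frame_mono[OF A], elim conjE)
    fix s1 assume "tables s1" "coeffs s1" "imem s1 lf 0 = int f" "\<forall>d<D. rmem s1 2 d = kro p d"
      "\<forall>d<D. rmem s1 3 d = 0"
    then have "wp ?B (\<lambda>s'. tables s' \<and> (\<forall>d<D. rmem s' 3 d = kro (p * ps ! f) d)) s1" by (intro B) auto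
    then show "wp ?B (wp ?C (\<lambda>s'. \<forall>d<D. rmem s' 2 d = kro (p * ps ! f) d)) s1"
      by (rule wp_frame_mono) (use C in auto)
  qed
qed

lemma wp_weight:
  assumes s: "tables s" "coeffs s" "imem s vU 0 = int u" "imem s vG 0 = int g"
  shows "wp (weight_prog k) (\<lambda>s'. \<forall>d<D. rmem s' 2 d = kro (weight g u) d) s"
proof -
  let ?A = "For False ld (Cell vD) (RS 2 (Cell ld) RZero)"
  let ?b = "select_prog k ;; Cond (test_exp k) mul_prog Nop"
  let ?G = "\<lambda>s'. tables s' \<and> coeffs s' \<and> imem s' vU 0 = int u \<and> imem s' vG 0 = int g"
  have G: "?G s'" if "?G s1" "frame U U' s1 s'" "U \<inter> {..<vX} = {}" "vG \<notin> U" "0 \<notin> U'" for U U' s1 s'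
  proof -
    have "U \<inter> {..<vU} = {}" using that(3) by auto
    moreover have "vU \<notin> U" using that(3) by auto
    ultimately show ?thesis using that tables_frame[of U U' s1 s'] by (auto simp: frame_def coeffs_def)
  qed
  have A: "wp ?A (\<lambda>s'. ?G s' \<and> (\<forall>d<D. rmem s' 2 d = 0)) s"
  proof (rule wp_For[where n = D and I = "\<lambda>j s'. \<forall>d<j. rmem s' 2 d = 0"])
    fix s' assume I: "\<forall>d<D. rmem s' 2 d = 0"
      and fr: "frame (insert ld (iwrites (RS 2 (Cell ld) RZero))) (rwrites (RS 2 (Cell ld) RZero)) s s'"
    have "?G s'" by (rule G[OF _ fr]) (use s in auto)
    then show "?G s' \<and> (\<forall>d<D. rmem s' 2 d = 0)" using I by blast
  qed (use s D_le X_B in \<open>auto simp: tables_vD less_Suc_eq\<close>)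
  \<comment> \<open>The partial product over the first \<open>j\<close> factors, whose image is the
    loop invariant. Its exponents stay within \<open>TT\<close>, which supplies the box that
    \<open>wp_mul\<close> asks for.\<close>
  let ?w = "\<lambda>j. \<Prod>f<j. if active u f \<and> grp f = g then ps ! f else 1"
  have bw: "box_poly sv TT (?w j)" if "j \<le> F" for j
  proof -
    have "box_poly sv (\<Sum>f<j. poly_bound f) (?w j)"
      using that by (intro box_poly_prod) (auto intro: box_ps box_poly_one)
    moreover have "(\<Sum>f<j. poly_bound f) \<le> (\<Sum>f<F. poly_bound f)" using that by (intro sum_mono2) auto
    ultimately show ?thesis unfolding sum_poly_bound by (rule box_poly_mono)
  qed
  have L: "wp (For False lf (Cell vF) ?b) (\<lambda>s'. \<forall>d<D. rmem s' 2 d = kro (weight g u) d) s1"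
    if s1: "?G s1" "\<forall>d<D. rmem s1 2 d = kro 1 d" for s1
  proof (rule wp_For[where n = F and I = "\<lambda>j s'. \<forall>d<D. rmem s' 2 d = kro (?w j) d"])
    show "ival s1 (Cell vF) = int F" using s1 by (simp add: tables_def)
    show "int F \<le> B" "F \<le> (if False then Y else X)" using F_le X_B by auto
    show "\<forall>d<D. rmem s1 2 d = kro (?w 0) d" using s1 by simp
    fix f s2 assume f: "f < F" and I: "\<forall>d<D. rmem s2 2 d = kro (?w f) d" and f2: "imem s2 lf 0 = int f"
      and fr: "frame (insert lf (iwrites ?b)) (rwrites ?b) s1 s2"
    have s2: "?G s2" by (rule G[OF s1(1) fr]) auto
    have sel: "wp (select_prog k) (\<lambda>s'. imem s' vX 0 = int (fx f) \<and> imem s' vY 0 = int (fy f) \<and>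
      imem s' vI 0 = int (fi u f) \<and> imem s' vJ 0 = int (fj u f) \<and> imem s' vC 0 = int (grp f)) s2"
      by (rule wp_select) (use s2 f f2 in auto)
    show "wp ?b (\<lambda>s'. \<forall>d<D. rmem s' 2 d = kro (?w (Suc f)) d) s2" unfolding wp.simps(4)
    proof (rule wp_frame_mono[OF sel], elim conjE)
      fix s3 assume 3: "imem s3 vX 0 = int (fx f)" "imem s3 vY 0 = int (fy f)"
        "imem s3 vI 0 = int (fi u f)" "imem s3 vJ 0 = int (fj u f)" "imem s3 vC 0 = int (grp f)"
        and fr3: "frame (iwrites (select_prog k)) (rwrites (select_prog k)) s2 s3"
      have s3: "?G s3" by (rule G[OF s2 fr3]) auto
      have f3: "imem s3 lf 0 = int f" using fr3 f2 by (simp add: frame_def)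
      have I3: "\<forall>d<D. rmem s3 2 d = kro (?w f) d" using fr3 I by (simp add: frame_def)
      have x: "ival s3 (digit_exp k (Cell vX)) = int (digit k u (fx f))"
        "ival s3 (digit_exp k (Cell vY)) = int (digit k u (fy f))"
        using s3 3 fx_le[OF f] fy_le[OF f] by (simp_all add: ival_digit_exp)
      have sq: "0 < 1 - ((a - a') * (a - a') + ((b - b') * (b - b') + (c - c') * (c - c'))) \<longleftrightarrow>
          a = a' \<and> b = b' \<and> c = c'" for a a' b b' c c' :: int
      proof
        assume "0 < 1 - ((a - a') * (a - a') + ((b - b') * (b - b') + (c - c') * (c - c')))"
        then have "(a - a') * (a - a') + ((b - b') * (b - b') + (c - c') * (c - c')) \<le> 0" by simp
        moreover have "0 \<le> (a - a') * (a - a')" "0 \<le> (b - b') * (b - b')" "0 \<le> (c - c') * (c - c')" by simp_all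
        ultimately have "(a - a') * (a - a') = 0 \<and> (b - b') * (b - b') = 0 \<and> (c - c') * (c - c') = 0" by linarith
        then show "a = a' \<and> b = b' \<and> c = c'" by simp
      qed simp
      have test: "0 < ival s3 (test_exp k) \<longleftrightarrow> active u f \<and> grp f = g"
      proof -
        have "ival s3 (test_exp k) = 1 -
          ((int (digit k u (fx f)) - int (fi u f)) * (int (digit k u (fx f)) - int (fi u f)) +
          ((int (digit k u (fy f)) - int (fj u f)) * (int (digit k u (fy f)) - int (fj u f)) +
           (int (grp f) - int g) * (int (grp f) - int g)))"
          using 3 s3 x by (simp add: test_exp_def sq_diff_def)
        then show ?thesis by (simp only: sq of_nat_eq_iff active_def conj_assoc)
      qed
      show "wp (Cond (test_exp k) mul_prog Nop) (\<lambda>s'. \<forall>d<D. rmem s' 2 d = kro (?w (Suc f)) d) s3"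
      proof (cases "active u f \<and> grp f = g")
        case True
        have "wp mul_prog (\<lambda>s'. \<forall>d<D. rmem s' 2 d = kro (?w f * ps ! f) d) s3"
          using s3 f3 f I3 by (intro wp_mul[where U = TT] bw) auto
        moreover have "?w (Suc f) = ?w f * ps ! f" using True by simp
        moreover have "0 < ival s3 (test_exp k)" using True test by blast
        ultimately show ?thesis by (simp only: wp.simps if_True)
      next
        case False
        then have "?w (Suc f) = ?w f" by (simp only: prod.lessThan_Suc if_False mult_1_right)
        moreover have "\<not> 0 < ival s3 (test_exp k)" using False test by blast
        ultimately show ?thesis using I3 by (simp only: wp.simps if_False)
      qed
    qed
  next
    fix s' assume "\<forall>d<D. rmem s' 2 d = kro (?w F) d"
    then show "\<forall>d<D. rmem s' 2 d = kro (weight g u) d" by (simp add: weight_def)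
  qed simp_all
  show ?thesis unfolding weight_prog_def wp.simps(4)
  proof (rule wp_frame_mono[OF A])
    fix s1 assume s1: "?G s1 \<and> (\<forall>d<D. rmem s1 2 d = 0)"
    then have "wp (For False lf (Cell vF) ?b) (\<lambda>s'. \<forall>d<D. rmem s' 2 d = kro (weight g u) d)
       (rupd 2 0 1 s1)" by (intro L) (auto simp: coeffs_def kron_one)
    then show "wp (RS 2 (INum 0) ROne) (wp (For False lf (Cell vF) ?b)
        (\<lambda>s'. \<forall>d<D. rmem s' 2 d = kro (weight g u) d)) s1" by simp
  qed
qed

end

section \<open>Correctness of the matrix programs\<close>

context pcsp_run
begin

section \<open>The two real matrices\<close>

definition ND :: nat where
  "ND = N3 * D"

text \<open>Block \<open>(a, b)\<close> is the circulant of a weight. The guards pad with zeros to a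
  square, since \<open>N1\<close> and \<open>N2\<close> may be smaller than
  \<open>N3\<close>.\<close>

definition left_matrix :: "nat \<Rightarrow> nat \<Rightarrow> real" where
  "left_matrix r c = (if r div D < N1 \<and> c div D < N2
     then kro (weight 0 (r div D + N1 * (c div D))) ((r mod D + D - c mod D) mod D) else 0)"

definition right_matrix :: "nat \<Rightarrow> nat \<Rightarrow> real" where
  "right_matrix r c = (if r div D < N2 \<and> c < N3
     then kro (weight 1 (N1 * (r div D + N2 * c))) (r mod D) else 0)"

definition flat :: "(nat \<Rightarrow> nat \<Rightarrow> real) \<Rightarrow> nat \<Rightarrow> real" where
  "flat A x = (if x < ND * ND then A (x div ND) (x mod ND) else 0)"

lemma N_le: "N1 \<le> N3" "N2 \<le> N3" "N1 \<le> Y" "N2 \<le> Y" "N3 \<le> Y"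
proof -
  show "N1 \<le> N3" "N2 \<le> N3"
    using k_ge by (auto simp: N1_def N2_def N3_def intro!: power_increasing div_le_mono)
  then show "N1 \<le> Y" "N2 \<le> Y" "N3 \<le> Y" using N3_le by auto
qed

lemma N_ge: "1 \<le> N1" "1 \<le> N2" "1 \<le> N3"
  using k_ge by (simp_all add: N1_def N2_def N3_def)

lemma ND_ge: "1 \<le> ND"
  using N_ge D_ge by (simp add: ND_def)

lemma less_power_B: "u < k ^ n \<Longrightarrow> int u \<le> B"
  using power_le_B[of n] by (simp flip: of_nat_power)

lemma N_B: "int N1 \<le> B" "int N2 \<le> B" "int N3 \<le> B"
proof -
  have "n div 3 \<le> n" "(n + 1) div 3 \<le> n" "(n + 2) div 3 \<le> n" using thirds by linarith+
  then show "int N1 \<le> B" "int N2 \<le> B" "int N3 \<le> B"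
    unfolding N1_def N2_def N3_def by (simp_all only: power_le_B)
qed

lemma less_N12: "a < N1 \<Longrightarrow> b < N2 \<Longrightarrow> a + N1 * b < k ^ n"
proof -
  assume ab: "a < N1" "b < N2"
  have "a + N1 * b < N2 * N1" using block_less[OF ab(2,1)] by (simp add: ac_simps)
  also have "\<dots> * 1 \<le> N2 * N1 * N3" using N_ge by (intro mult_le_mono2) auto
  also have "\<dots> = k ^ n" by (simp flip: N123)
  finally show ?thesis by simp
qed

lemma less_N123: "a < N1 \<Longrightarrow> b < N2 \<Longrightarrow> c < N3 \<Longrightarrow> a + N1 * (b + N2 * c) < k ^ n"
proof -
  assume abc: "a < N1" "b < N2" "c < N3"
  have "b + N2 * c < N3 * N2" using block_less[OF abc(3,2)] by (simp add: ac_simps)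
  then have "a + N1 * (b + N2 * c) < (N3 * N2) * N1" using block_less[OF _ abc(1), of "b + N2 * c" "N3 * N2"] by (simp add: ac_simps)
  also have "\<dots> = k ^ n" by (simp flip: N123)
  finally show ?thesis .
qed

lemma less_N23: "b < N2 \<Longrightarrow> c < N3 \<Longrightarrow> N1 * (b + N2 * c) < k ^ n"
  using less_N123[of 0 b c] N_ge by simp

lemma less_N13: "a < N1 \<Longrightarrow> c < N3 \<Longrightarrow> a + N1 * N2 * c < k ^ n"
  using less_N123[of a 0 c] N_ge by (simp add: mult.assoc)

lemma col_less: "b < N2 \<Longrightarrow> j < D \<Longrightarrow> b * D + j < ND"
proof -
  assume b: "b < N2" and j: "j < D"
  then show ?thesis unfolding ND_def using N_le(2) by (intro block_less) auto
qed

lemma row_less: "a < N1 \<Longrightarrow> i < D \<Longrightarrow> a * D + i < ND"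
proof -
  assume a: "a < N1" and i: "i < D"
  then show ?thesis unfolding ND_def using N_le(1) by (intro block_less) auto
qed

lemma flat_index: "r < ND \<Longrightarrow> c < ND \<Longrightarrow> flat A (r * ND + c) = A r c"
  using block_less[of r ND c ND] by (simp add: flat_def)

text \<open>\<open>R\<close> collects the addresses written so far. All others are recorded as 0, so
  the zero padding is in place without being written.\<close>

definition filled :: "nat \<Rightarrow> nat set \<Rightarrow> (nat \<Rightarrow> nat \<Rightarrow> real) \<Rightarrow> real state \<Rightarrow> bool" where
  "filled r R A s \<longleftrightarrow> (\<forall>x. rmem s r x = (if x \<in> R then flat A x else 0))"

lemma filled_rupd: "filled r R A s \<Longrightarrow> v = flat A x \<Longrightarrow> filled r (insert x R) A (rupd r x v s)"
  by (auto simp: filled_def)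

lemma filled_cong: "filled r R A s \<Longrightarrow> rmem s' r = rmem s r \<Longrightarrow> filled r R A s'"
  by (simp add: filled_def)

lemma filled_iupd [simp]: "filled r R A (iupd a i z s) = filled r R A s"
  by (simp add: filled_def)

definition ready :: "nat \<Rightarrow> real state \<Rightarrow> bool" where
  "ready g s \<longleftrightarrow> tables s \<and> coeffs s \<and> imem s vG 0 = int g"

lemma ready_frame:
  "ready g s \<Longrightarrow> frame U U' s s' \<Longrightarrow> U \<inter> {..<vU} = {} \<Longrightarrow> vG \<notin> U \<Longrightarrow> 0 \<notin> U' \<Longrightarrow> ready g s'"
  using tables_frame[of U U' s s'] by (auto simp: ready_def coeffs_def frame_def)

lemma ready_N: "ready g s \<Longrightarrow> imem s vD 0 = int D" "ready g s \<Longrightarrow> imem s vN1 0 = int N1"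
  "ready g s \<Longrightarrow> imem s vN2 0 = int N2" "ready g s \<Longrightarrow> imem s vN3 0 = int N3"
  "ready g s \<Longrightarrow> imem s vND 0 = int ND"
  by (simp_all add: ready_def tables_def ND_def)

lemma wp_weight_at:
  assumes s: "ready g s" and e: "ival s e = int u" "u < k ^ n"
  shows "wp (Asg vU e ;; weight_prog k) (\<lambda>s'. \<forall>d<D. rmem s' 2 d = kro (weight g u) d) s"
proof -
  have "wp (weight_prog k) (\<lambda>s'. \<forall>d<D. rmem s' 2 d = kro (weight g u) d) (iupd vU 0 (int u) s)"
    by (rule wp_weight) (use s in \<open>auto simp: ready_def coeffs_def\<close>)
  then show ?thesis using e less_power_B[of u] by simp
qed

lemma ival_row_index:
  assumes "imem s l 0 = int a" "imem s l' 0 = int i" "ival s e = int c"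
    "imem s vD 0 = int D" "imem s vND 0 = int ND"
  shows "ival s (row_index l l' e) = int ((a * D + i) * ND + c)"
  using assms by (simp add: row_index_def)

lemma wp_left:
  assumes s: "tables s" "coeffs s" and z: "\<forall>x. rmem s R0 x = 0"
  shows "wp (left_prog k) (\<lambda>s'. \<forall>x. rmem s' R0 x = flat left_matrix x) s"
proof -
  define idx where "idx = (\<lambda>(a, b, i, j). (a * D + i) * ND + (b * D + j))"
  \<comment> \<open>The quadruples lexicographically below \<open>(a, b, i, j)\<close>, i.e. those
    visited before. The invariants of all four nested loops are instances of this set, and the
    equations below make the end of an inner loop match the next step of the outer one.\<close>
  define P where "P a b i j = {(a', b', i', j'). b' < N2 \<and> i' < D \<and> j' < D \<and>
    (a' < a \<or> a' = a \<and> (b' < b \<or> b' = b \<and> (i' < i \<or> i' = i \<and> j' < j)))}" for a b i j :: nat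
  have P: "P 0 0 0 0 = {}" "P a N2 0 0 = P (Suc a) 0 0 0" "P a b D 0 = P a (Suc b) 0 0"
    "P a b i D = P a b (Suc i) 0"
    "b < N2 \<Longrightarrow> i < D \<Longrightarrow> j < D \<Longrightarrow> insert (a, b, i, j) (P a b i j) = P a b i (Suc j)"
    for a b i j :: nat unfolding P_def by (auto simp: less_Suc_eq)
  let ?w = "RS R0 (row_index la li (IAdd (IMul (Cell lb) (Cell vD)) (Cell lj)))
     (RLoad 2 (IMod (ISub (IAdd (Cell li) (Cell vD)) (Cell lj)) (Cell vD)))"
  let ?u = "Asg vU (IAdd (Cell la) (IMul (Cell vN1) (Cell lb)))"
  let ?lj = "For False lj (Cell vD) ?w"
  let ?li = "For False li (Cell vD) ?lj"
  let ?lb = "For True lb (Cell vN2) (?u ;; weight_prog k ;; ?li)"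
  let ?la = "For True la (Cell vN1) ?lb"
  let ?f = "\<lambda>R s. filled R0 (idx ` R) left_matrix s"
  have main: "wp ?la (\<lambda>s'. \<forall>x. rmem s' R0 x = flat left_matrix x) s1"
    if s1: "ready 0 s1" and f1: "?f {} s1" for s1
  proof (rule wp_For[where n = N1 and I = "\<lambda>a s'. ?f (P a 0 0 0) s'"])
    show "ival s1 (Cell vN1) = int N1" using s1 by (simp add: ready_N)
    show "int N1 \<le> B" "N1 \<le> (if True then Y else X)" using N_B N_le by auto
    show "?f (P 0 0 0 0) s1" using f1 by (simp add: P)
  next
    fix a s2 assume a: "a < N1" and f2: "?f (P a 0 0 0) s2" and a2: "imem s2 la 0 = int a"
      and fr: "frame (insert la (iwrites ?lb)) (rwrites ?lb) s1 s2"
    have s2: "ready 0 s2" by (rule ready_frame[OF s1 fr]) auto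
    show "wp ?lb (?f (P (Suc a) 0 0 0)) s2"
    proof (rule wp_For[where n = N2 and I = "\<lambda>b s'. ?f (P a b 0 0) s'"])
      show "ival s2 (Cell vN2) = int N2" using s2 by (simp add: ready_N)
      show "int N2 \<le> B" "N2 \<le> (if True then Y else X)" using N_B N_le by auto
      show "?f (P a 0 0 0) s2" using f2 by simp
    next
      fix b s3 assume b: "b < N2" and f3: "?f (P a b 0 0) s3" and b3: "imem s3 lb 0 = int b"
        and fr3: "frame (insert lb (iwrites (?u ;; weight_prog k ;; ?li)))
          (rwrites (?u ;; weight_prog k ;; ?li)) s2 s3"
      have s3: "ready 0 s3" by (rule ready_frame[OF s2 fr3]) auto
      have a3: "imem s3 la 0 = int a" using fr3 a2 by (simp add: frame_def)
      have u: "wp (?u ;; weight_prog k) (\<lambda>s'. \<forall>d<D. rmem s' 2 d = kro (weight 0 (a + N1 * b)) d) s3"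
        by (rule wp_weight_at[OF s3 _ less_N12[OF a b]]) (use a3 b3 s3 in \<open>simp add: ready_N\<close>)
      have li: "wp ?li (?f (P a (Suc b) 0 0)) s4"
        if w4: "\<forall>d<D. rmem s4 2 d = kro (weight 0 (a + N1 * b)) d"
          and s4: "ready 0 s4" and a4: "imem s4 la 0 = int a" and b4: "imem s4 lb 0 = int b"
          and f4: "?f (P a b 0 0) s4" for s4
      proof (rule wp_For[where n = D and I = "\<lambda>i s'. ?f (P a b i 0) s'"])
        show "ival s4 (Cell vD) = int D" using s4 by (simp add: ready_N)
        show "int D \<le> B" "D \<le> (if False then Y else X)" using X_B D_le by auto
        show "?f (P a b 0 0) s4" using f4 by simp
      next
        fix i s5 assume i: "i < D" and f5: "?f (P a b i 0) s5"
          and i5: "imem s5 li 0 = int i" and fr5: "frame (insert li (iwrites ?lj)) (rwrites ?lj) s4 s5"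
        have s5: "ready 0 s5" by (rule ready_frame[OF s4 fr5]) auto
        have ab5: "imem s5 la 0 = int a" "imem s5 lb 0 = int b" "rmem s5 2 = rmem s4 2"
          using fr5 a4 b4 by (simp_all add: frame_def)
        show "wp ?lj (?f (P a b (Suc i) 0)) s5"
        proof (rule wp_For[where n = D and I = "\<lambda>j s'. ?f (P a b i j) s'"])
          show "ival s5 (Cell vD) = int D" using s5 by (simp add: ready_N)
          show "int D \<le> B" "D \<le> (if False then Y else X)" using X_B D_le by auto
          show "?f (P a b i 0) s5" using f5 by simp
        next
          fix j s6 assume j: "j < D" and f6: "?f (P a b i j) s6"
            and j6: "imem s6 lj 0 = int j" and fr6: "frame (insert lj (iwrites ?w)) (rwrites ?w) s5 s6"
          have s6: "ready 0 s6" by (rule ready_frame[OF s5 fr6]) auto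
          have abi: "imem s6 la 0 = int a" "imem s6 lb 0 = int b" "imem s6 li 0 = int i" "rmem s6 2 = rmem s4 2"
            using fr6 ab5 i5 by (simp_all add: frame_def)
          have ix: "ival s6 (row_index la li (IAdd (IMul (Cell lb) (Cell vD)) (Cell lj))) = int (idx (a, b, i, j))"
            unfolding idx_def prod.case by (rule ival_row_index) (use abi j6 s6 in \<open>simp_all add: ready_N\<close>)
          have e: "int i + int D - int j = int (i + D - j)" using j by simp
          have "ival s6 (IMod (ISub (IAdd (Cell li) (Cell vD)) (Cell lj)) (Cell vD)) =
              (int i + int D - int j) mod int D"
            using abi j6 s6 by (simp add: ready_N)
          then have iy: "ival s6 (IMod (ISub (IAdd (Cell li) (Cell vD)) (Cell lj)) (Cell vD)) = int ((i + D - j) mod D)"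
            unfolding e zmod_int .
          have "left_matrix (a * D + i) (b * D + j) = kro (weight 0 (a + N1 * b)) ((i + D - j) mod D)"
            using a b i j by (simp add: left_matrix_def)
          moreover have "rmem s6 2 ((i + D - j) mod D) = kro (weight 0 (a + N1 * b)) ((i + D - j) mod D)"
            using abi(4) w4 D_ge by simp
          ultimately have v: "rmem s6 2 ((i + D - j) mod D) = flat left_matrix (idx (a, b, i, j))"
            unfolding idx_def prod.case flat_index[OF row_less[OF a i] col_less[OF b j]] by (simp only:)
          have "insert (idx (a, b, i, j)) (idx ` P a b i j) = idx ` P a b i (Suc j)"
            using P(5)[OF b i j] by (metis image_insert)
          then have "?f (P a b i (Suc j))
              (rupd R0 (idx (a, b, i, j)) (rmem s6 2 ((i + D - j) mod D)) s6)"
            using filled_rupd[OF f6 v] by simp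
          then show "wp ?w (?f (P a b i (Suc j))) s6"
            by (simp only: wp.simps ix rval.simps iy nat_int)
        next
          fix s' assume "?f (P a b i D) s'"
          then show "?f (P a b (Suc i) 0) s'" by (simp only: P)
        qed simp_all
      next
        fix s' assume "?f (P a b D 0) s'"
        then show "?f (P a (Suc b) 0 0) s'" by (simp only: P)
      qed simp_all
      have "wp (?u ;; weight_prog k) (wp ?li (?f (P a (Suc b) 0 0))) s3"
      proof (rule wp_frame_mono[OF u], rule li)
        fix s4 assume fr4: "frame (iwrites (?u ;; weight_prog k)) (rwrites (?u ;; weight_prog k)) s3 s4"
        show "ready 0 s4" by (rule ready_frame[OF s3 fr4]) auto
        show "imem s4 la 0 = int a" "imem s4 lb 0 = int b" using fr4 a3 b3 by (simp_all add: frame_def)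
        show "?f (P a b 0 0) s4" by (rule filled_cong[OF f3]) (use fr4 in \<open>simp add: frame_def\<close>)
      qed
      then show "wp (?u ;; weight_prog k ;; ?li) (?f (P a (Suc b) 0 0)) s3" by simp
    next
      fix s' assume "?f (P a N2 0 0) s'"
      then show "?f (P (Suc a) 0 0 0) s'" by (simp only: P)
    qed simp_all
  next
    fix s' assume f: "?f (P N1 0 0 0) s'"
    \<comment> \<open>Every nonzero entry has been visited, so the cells still holding 0 agree with
      the padding.\<close>
    have "x \<in> idx ` P N1 0 0 0" if "flat left_matrix x \<noteq> 0" for x
    proof -
      let ?r = "x div ND" and ?c = "x mod ND"
      have "?r div D < N1" "?c div D < N2"
        using that by (auto simp: flat_def left_matrix_def split: if_splits)
      moreover have "?r mod D < D" "?c mod D < D" using D_ge by simp_all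
      ultimately have "(?r div D, ?c div D, ?r mod D, ?c mod D) \<in> P N1 0 0 0" by (simp add: P_def)
      moreover have "x = idx (?r div D, ?c div D, ?r mod D, ?c mod D)" by (simp only: idx_def prod.case div_mult_mod_eq)
      ultimately show ?thesis by blast
    qed
    then show "\<forall>x. rmem s' R0 x = flat left_matrix x" using f by (auto simp: filled_def)
  qed simp_all
  have "ready 0 (iupd vG 0 0 s)" using s by (simp add: ready_def coeffs_def)
  moreover have "?f {} (iupd vG 0 0 s)" using z by (simp add: filled_def)
  ultimately have "wp ?la (\<lambda>s'. \<forall>x. rmem s' (R0) x = flat left_matrix x) (iupd vG 0 0 s)" by (rule main)
  then show ?thesis unfolding left_prog_def wp.simps(2,4) using B_ge by (simp del: wp.simps)
qed

lemma wp_right: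
  assumes s: "tables s" "coeffs s" and z: "\<forall>x. rmem s (R0 + 1) x = 0"
  shows "wp (right_prog k) (\<lambda>s'. \<forall>x. rmem s' (R0 + 1) x = flat right_matrix x) s"
proof -
  define idx where "idx = (\<lambda>(b, c, j). (b * D + j) * ND + c)"
  define P where "P b c j = {(b', c', j'). c' < N3 \<and> j' < D \<and>
    (b' < b \<or> b' = b \<and> (c' < c \<or> c' = c \<and> j' < j))}" for b c j :: nat
  have P: "P 0 0 0 = {}" "P b N3 0 = P (Suc b) 0 0" "P b c D = P b (Suc c) 0"
    "c < N3 \<Longrightarrow> j < D \<Longrightarrow> insert (b, c, j) (P b c j) = P b c (Suc j)"
    for b c j :: nat unfolding P_def by (auto simp: less_Suc_eq)
  let ?w = "RS (R0 + 1) (row_index lb lj (Cell lc)) (RLoad 2 (Cell lj))"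
  let ?u = "Asg vU (IMul (Cell vN1) (IAdd (Cell lb) (IMul (Cell vN2) (Cell lc))))"
  let ?lj = "For False lj (Cell vD) ?w"
  let ?lc = "For True lc (Cell vN3) (?u ;; weight_prog k ;; ?lj)"
  let ?lb = "For True lb (Cell vN2) ?lc"
  let ?f = "\<lambda>R s. filled (R0 + 1) (idx ` R) right_matrix s"
  have main: "wp ?lb (\<lambda>s'. \<forall>x. rmem s' (R0 + 1) x = flat right_matrix x) s1"
    if s1: "ready 1 s1" and f1: "?f {} s1" for s1
  proof (rule wp_For[where n = N2 and I = "\<lambda>b s'. ?f (P b 0 0) s'"])
    show "ival s1 (Cell vN2) = int N2" using s1 by (simp add: ready_N)
    show "int N2 \<le> B" "N2 \<le> (if True then Y else X)" using N_B N_le by auto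
    show "?f (P 0 0 0) s1" using f1 by (simp add: P)
  next
    fix b s2 assume b: "b < N2" and f2: "?f (P b 0 0) s2" and b2: "imem s2 lb 0 = int b"
      and fr: "frame (insert lb (iwrites ?lc)) (rwrites ?lc) s1 s2"
    have s2: "ready 1 s2" by (rule ready_frame[OF s1 fr]) auto
    show "wp ?lc (?f (P (Suc b) 0 0)) s2"
    proof (rule wp_For[where n = N3 and I = "\<lambda>c s'. ?f (P b c 0) s'"])
      show "ival s2 (Cell vN3) = int N3" using s2 by (simp add: ready_N)
      show "int N3 \<le> B" "N3 \<le> (if True then Y else X)" using N_B N_le by auto
      show "?f (P b 0 0) s2" using f2 by simp
    next
      fix c s3 assume c: "c < N3" and f3: "?f (P b c 0) s3" and c3: "imem s3 lc 0 = int c"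
        and fr3: "frame (insert lc (iwrites (?u ;; weight_prog k ;; ?lj)))
          (rwrites (?u ;; weight_prog k ;; ?lj)) s2 s3"
      have s3: "ready 1 s3" by (rule ready_frame[OF s2 fr3]) auto
      have b3: "imem s3 lb 0 = int b" using fr3 b2 by (simp add: frame_def)
      have u: "wp (?u ;; weight_prog k) (\<lambda>s'. \<forall>d<D. rmem s' 2 d = kro (weight 1 (N1 * (b + N2 * c))) d) s3"
        by (rule wp_weight_at[OF s3 _ less_N23[OF b c]]) (use b3 c3 s3 in \<open>simp add: ready_N\<close>)
      have lj: "wp ?lj (?f (P b (Suc c) 0)) s4"
        if w4: "\<forall>d<D. rmem s4 2 d = kro (weight 1 (N1 * (b + N2 * c))) d"
          and s4: "ready 1 s4" and b4: "imem s4 lb 0 = int b" and c4: "imem s4 lc 0 = int c"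
          and f4: "?f (P b c 0) s4" for s4
      proof (rule wp_For[where n = D and I = "\<lambda>j s'. ?f (P b c j) s'"])
        show "ival s4 (Cell vD) = int D" using s4 by (simp add: ready_N)
        show "int D \<le> B" "D \<le> (if False then Y else X)" using X_B D_le by auto
        show "?f (P b c 0) s4" using f4 by simp
      next
        fix j s6 assume j: "j < D" and f6: "?f (P b c j) s6"
          and j6: "imem s6 lj 0 = int j" and fr6: "frame (insert lj (iwrites ?w)) (rwrites ?w) s4 s6"
        have s6: "ready 1 s6" by (rule ready_frame[OF s4 fr6]) auto
        have bc: "imem s6 lb 0 = int b" "imem s6 lc 0 = int c" "rmem s6 2 = rmem s4 2"
          using fr6 b4 c4 by (simp_all add: frame_def)
        have ix: "ival s6 (row_index lb lj (Cell lc)) = int (idx (b, c, j))"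
          unfolding idx_def prod.case by (rule ival_row_index) (use bc j6 s6 in \<open>simp_all add: ready_N\<close>)
        have "N3 * 1 \<le> N3 * D" using D_ge by (intro mult_le_mono2)
        then have "c < ND" using c unfolding ND_def by linarith
        then have v: "rmem s6 2 j = flat right_matrix (idx (b, c, j))"
          using flat_index[OF col_less[OF b j]] bc w4 j b c by (simp add: right_matrix_def idx_def)
        have "insert (idx (b, c, j)) (idx ` P b c j) = idx ` P b c (Suc j)"
          using P(4)[OF c j] by (metis image_insert)
        then have "?f (P b c (Suc j)) (rupd (R0 + 1) (idx (b, c, j)) (rmem s6 2 j) s6)"
          using filled_rupd[OF f6 v] by simp
        then show "wp ?w (?f (P b c (Suc j))) s6"
          by (simp only: wp.simps ix rval.simps ival.simps j6 nat_int nat_zero_as_int[symmetric])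
      next
        fix s' assume "?f (P b c D) s'"
        then show "?f (P b (Suc c) 0) s'" by (simp only: P)
      qed simp_all
      have "wp (?u ;; weight_prog k) (wp ?lj (?f (P b (Suc c) 0))) s3"
      proof (rule wp_frame_mono[OF u], rule lj)
        fix s4 assume fr4: "frame (iwrites (?u ;; weight_prog k)) (rwrites (?u ;; weight_prog k)) s3 s4"
        show "ready 1 s4" by (rule ready_frame[OF s3 fr4]) auto
        show "imem s4 lb 0 = int b" "imem s4 lc 0 = int c" using fr4 b3 c3 by (simp_all add: frame_def)
        show "?f (P b c 0) s4" by (rule filled_cong[OF f3]) (use fr4 in \<open>simp add: frame_def\<close>)
      qed
      then show "wp (?u ;; weight_prog k ;; ?lj) (?f (P b (Suc c) 0)) s3" by simp
    next
      fix s' assume "?f (P b N3 0) s'"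
      then show "?f (P (Suc b) 0 0) s'" by (simp only: P)
    qed simp_all
  next
    fix s' assume f: "?f (P N2 0 0) s'"
    have "x \<in> idx ` P N2 0 0" if "flat right_matrix x \<noteq> 0" for x
    proof -
      let ?r = "x div ND" and ?c = "x mod ND"
      have "?r div D < N2" "?c < N3"
        using that by (auto simp: flat_def right_matrix_def split: if_splits)
      moreover have "?r mod D < D" using D_ge by simp_all
      ultimately have "(?r div D, ?c, ?r mod D) \<in> P N2 0 0" by (simp add: P_def)
      moreover have "x = idx (?r div D, ?c, ?r mod D)" by (simp only: idx_def prod.case div_mult_mod_eq)
      ultimately show ?thesis by blast
    qed
    then show "\<forall>x. rmem s' (R0 + 1) x = flat right_matrix x" using f by (auto simp: filled_def)
  qed simp_all
  have "ready 1 (iupd vG 0 1 s)" using s by (simp add: ready_def coeffs_def)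
  moreover have "?f {} (iupd vG 0 1 s)" using z by (simp add: filled_def)
  ultimately have "wp ?lb (\<lambda>s'. \<forall>x. rmem s' (R0 + 1) x = flat right_matrix x) (iupd vG 0 1 s)" by (rule main)
  then show ?thesis unfolding right_prog_def wp.simps(2,4) using B_ge by (simp del: wp.simps)
qed

text \<open>Coefficient \<open>i\<close> of entry \<open>(a, c)\<close> of the matrix product over
  the group ring, before the third weight is applied.\<close>

definition entry :: "nat \<Rightarrow> nat \<Rightarrow> nat \<Rightarrow> real" where
  "entry a c i = (\<Sum>b<N2. kro (weight 0 (a + N1 * b) * weight 1 (N1 * (b + N2 * c))) i)"

lemma sum_div_mod:
  fixes g :: "nat \<Rightarrow> nat \<Rightarrow> real"
  shows "(\<Sum>l<N * D. g (l div D) (l mod D)) = (\<Sum>b<N. \<Sum>j<D. g b j)"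
proof -
  have "(\<Sum>l<N * D. g (l div D) (l mod D)) =
      (\<Sum>j<D. \<Sum>b<N. g ((j + D * b) div D) ((j + D * b) mod D))" by (rule sum_blocks)
  also have "\<dots> = (\<Sum>j<D. \<Sum>b<N. g b j)" by (intro sum.cong) auto
  also have "\<dots> = (\<Sum>b<N. \<Sum>j<D. g b j)" by (rule sum.swap)
  finally show ?thesis .
qed

text \<open>The inner index splits into a block number \<open>b\<close> and a position
  \<open>j\<close>. The sum over \<open>j\<close> is the circulant form of a convolution, and blocks
  with \<open>b\<close> at least \<open>N2\<close> are padding.\<close>

lemma matrix_product:
  assumes a: "a < N1" and i: "i < D" and c: "c < N3"
  shows "(\<Sum>l<ND. left_matrix (a * D + i) l * right_matrix l c) = entry a c i"
proof -
  let ?g = "\<lambda>b j. if b < N2 then kro (weight 0 (a + N1 * b)) ((i + D - j) mod D) *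
      kro (weight 1 (N1 * (b + N2 * c))) j else 0"
  have "(\<Sum>l<ND. left_matrix (a * D + i) l * right_matrix l c) = (\<Sum>l<N3 * D. ?g (l div D) (l mod D))"
    unfolding ND_def using a i c
    by (intro sum.cong) (auto simp: left_matrix_def right_matrix_def)
  also have "\<dots> = (\<Sum>b<N3. \<Sum>j<D. ?g b j)" by (rule sum_div_mod)
  also have "\<dots> = (\<Sum>b<N2. \<Sum>j<D. ?g b j)"
    using N_le by (intro sum.mono_neutral_right) auto
  also have "\<dots> = entry a c i"
    unfolding entry_def D_def
    by (intro sum.cong refl) (use i in \<open>simp add: kron_mult_circulant[OF box_weight box_weight W_ge] D_def\<close>)
  finally show ?thesis .
qed

text \<open>The third weight enters by one more convolution for each pair \<open>(a, c)\<close>,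
  which \<open>combine_prog\<close> carries out directly: quadratically many pairs, with polynomial
  work for each.\<close>

lemma kron_partition_function:
  "d < D \<Longrightarrow> kro (partition_function k I) d = (\<Sum>a<N1. \<Sum>c<N3. \<Sum>i<D. \<Sum>j<D.
     if (i + j) mod D = d then entry a c i * kro (weight 2 (a + N1 * N2 * c)) j else 0)"
proof -
  have "partition_function k I = (\<Sum>a<N1. \<Sum>c<N3. (\<Sum>b<N2.
     weight 0 (a + N1 * b) * weight 1 (N1 * (b + N2 * c))) * weight 2 (a + N1 * N2 * c))"
    unfolding partition_function_split sum_distrib_right ..
  then have "kro (partition_function k I) d = (\<Sum>a<N1. \<Sum>c<N3. kro ((\<Sum>b<N2.
     weight 0 (a + N1 * b) * weight 1 (N1 * (b + N2 * c))) * weight 2 (a + N1 * N2 * c)) d)"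
    by (simp add: kron_sum)
  also have "\<dots> = (\<Sum>a<N1. \<Sum>c<N3. \<Sum>i<D. \<Sum>j<D.
     if (i + j) mod D = d then entry a c i * kro (weight 2 (a + N1 * N2 * c)) j else 0)"
  proof (intro sum.cong refl)
    fix a c
    \<comment> \<open>The bound \<open>TT + TT\<close> exceeds what base \<open>W\<close> can
      decode, but multiplicativity of \<open>kron\<close> tolerates wrap-around.\<close>
    have "box_poly sv (TT + TT) (\<Sum>b<N2. weight 0 (a + N1 * b) * weight 1 (N1 * (b + N2 * c)))"
      by (intro box_poly_sum box_poly_mult box_weight)
    from kron_mult[OF this box_weight W_ge, of 2 "a + N1 * N2 * c" d]
    show "kro ((\<Sum>b<N2. weight 0 (a + N1 * b) * weight 1 (N1 * (b + N2 * c))) * weight 2 (a + N1 * N2 * c)) d =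
      (\<Sum>i<D. \<Sum>j<D. if (i + j) mod D = d then entry a c i * kro (weight 2 (a + N1 * N2 * c)) j else 0)"
      unfolding D_def entry_def kron_sum .
  qed
  finally show ?thesis .
qed

lemma wp_combine:
  assumes s: "tables s" "coeffs s"
    and C: "\<forall>a<N1. \<forall>i<D. \<forall>c<N3. rmem s (R0 + 2) ((a * D + i) * ND + c) = entry a c i"
  shows "wp (combine_prog k) (\<lambda>s'. \<forall>d<D. rmem s' 4 d = kro (partition_function k I) d) s"
proof -
  let ?z = "For False ld (Cell vD) (RS 4 (Cell ld) RZero)"
  let ?w = "RS 4 sum_index (RAdd (RLoad 4 sum_index)
     (RMul (RLoad (R0 + 2) (row_index la li (Cell lc))) (RLoad 2 (Cell lj))))"
  let ?u = "Asg vU (IAdd (Cell la) (IMul (IMul (Cell vN1) (Cell vN2)) (Cell lc)))"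
  let ?lj = "For False lj (Cell vD) ?w"
  let ?li = "For False li (Cell vD) ?lj"
  let ?lc = "For True lc (Cell vN3) (?u ;; weight_prog k ;; ?li)"
  let ?la = "For True la (Cell vN1) ?lc"
  define T where "T a c i j d = (if (i + j) mod D = d then entry a c i * kro (weight 2 (a + N1 * N2 * c)) j else 0)"
    for a c i j d
  let ?f = "\<lambda>g s. \<forall>d<D. rmem s 4 d = g d"
  \<comment> \<open>Contributions of the quadruples visited so far, one abbreviation per loop level:
    each adds the part of its own loop to the completed outer part.\<close>
  let ?Sa = "\<lambda>a d. \<Sum>a'<a. \<Sum>c<N3. \<Sum>i<D. \<Sum>j<D. T a' c i j d"
  let ?Sc = "\<lambda>a c d. ?Sa a d + (\<Sum>c'<c. \<Sum>i<D. \<Sum>j<D. T a c' i j d)"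
  let ?Si = "\<lambda>a c i d. ?Sc a c d + (\<Sum>i'<i. \<Sum>j<D. T a c i' j d)"
  let ?Sj = "\<lambda>a c i j d. ?Si a c i d + (\<Sum>j'<j. T a c i j' d)"
  let ?C = "\<lambda>s. \<forall>a<N1. \<forall>i<D. \<forall>c<N3. rmem s (R0 + 2) ((a * D + i) * ND + c) = entry a c i"
  have Z: "wp ?z (?f (\<lambda>d. 0)) s"
  proof (rule wp_For[where n = D and I = "\<lambda>j s'. \<forall>d<j. rmem s' 4 d = 0"])
  qed (use s D_le X_B in \<open>auto simp: tables_vD less_Suc_eq\<close>)
  have main: "wp ?la (?f (?Sa N1)) s1" if s1: "ready 2 s1" and C1: "?C s1" and f1: "?f (\<lambda>d. 0) s1" for s1
  proof (rule wp_For[where n = N1 and I = "\<lambda>a s'. ?f (?Sa a) s'"])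
    show "ival s1 (Cell vN1) = int N1" using s1 by (simp add: ready_N)
    show "int N1 \<le> B" "N1 \<le> (if True then Y else X)" using N_B N_le by auto
    show "?f (?Sa 0) s1" using f1 by simp
  next
    fix a s2 assume a: "a < N1" and f2: "?f (?Sa a) s2" and a2: "imem s2 la 0 = int a"
      and fr: "frame (insert la (iwrites ?lc)) (rwrites ?lc) s1 s2"
    have s2: "ready 2 s2" by (rule ready_frame[OF s1 fr]) auto
    have C2: "?C s2" using fr C1 by (simp add: frame_def)
    show "wp ?lc (?f (?Sa (Suc a))) s2"
    proof (rule wp_For[where n = N3 and I = "\<lambda>c s'. ?f (?Sc a c) s'"])
      show "ival s2 (Cell vN3) = int N3" using s2 by (simp add: ready_N)
      show "int N3 \<le> B" "N3 \<le> (if True then Y else X)" using N_B N_le by auto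
      show "?f (?Sc a 0) s2" using f2 by simp
    next
      fix c s3 assume c: "c < N3" and f3: "?f (?Sc a c) s3" and c3: "imem s3 lc 0 = int c"
        and fr3: "frame (insert lc (iwrites (?u ;; weight_prog k ;; ?li)))
          (rwrites (?u ;; weight_prog k ;; ?li)) s2 s3"
      have s3: "ready 2 s3" by (rule ready_frame[OF s2 fr3]) auto
      have C3: "?C s3" using fr3 C2 by (simp add: frame_def)
      have a3: "imem s3 la 0 = int a" using fr3 a2 by (simp add: frame_def)
      have u: "wp (?u ;; weight_prog k) (\<lambda>s'. \<forall>d<D. rmem s' 2 d = kro (weight 2 (a + N1 * N2 * c)) d) s3"
        by (rule wp_weight_at[OF s3 _ less_N13[OF a c]]) (use a3 c3 s3 in \<open>simp add: ready_N\<close>)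
      have li: "wp ?li (?f (?Sc a (Suc c))) s4"
        if w4: "\<forall>d<D. rmem s4 2 d = kro (weight 2 (a + N1 * N2 * c)) d" and C4: "?C s4"
          and s4: "ready 2 s4" and a4: "imem s4 la 0 = int a" and c4: "imem s4 lc 0 = int c"
          and f4: "?f (?Sc a c) s4" for s4
      proof (rule wp_For[where n = D and I = "\<lambda>i s'. ?f (?Si a c i) s'"])
        show "ival s4 (Cell vD) = int D" using s4 by (simp add: ready_N)
        show "int D \<le> B" "D \<le> (if False then Y else X)" using X_B D_le by auto
        show "?f (?Si a c 0) s4" using f4 by simp
      next
        fix i s5 assume i: "i < D" and f5: "?f (?Si a c i) s5"
          and i5: "imem s5 li 0 = int i" and fr5: "frame (insert li (iwrites ?lj)) (rwrites ?lj) s4 s5"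
        have s5: "ready 2 s5" by (rule ready_frame[OF s4 fr5]) auto
        have ac5: "imem s5 la 0 = int a" "imem s5 lc 0 = int c" "rmem s5 2 = rmem s4 2"
          using fr5 a4 c4 by (simp_all add: frame_def)
        have C5: "?C s5" using fr5 C4 by (simp add: frame_def)
        show "wp ?lj (?f (?Si a c (Suc i))) s5"
        proof (rule wp_For[where n = D and I = "\<lambda>j s'. ?f (?Sj a c i j) s'"])
          show "ival s5 (Cell vD) = int D" using s5 by (simp add: ready_N)
          show "int D \<le> B" "D \<le> (if False then Y else X)" using X_B D_le by auto
          show "?f (?Sj a c i 0) s5" using f5 by simp
        next
          fix j s6 assume j: "j < D" and f6: "?f (?Sj a c i j) s6"
            and j6: "imem s6 lj 0 = int j" and fr6: "frame (insert lj (iwrites ?w)) (rwrites ?w) s5 s6"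
          have s6: "ready 2 s6" by (rule ready_frame[OF s5 fr6]) auto
          have aci: "imem s6 la 0 = int a" "imem s6 lc 0 = int c" "imem s6 li 0 = int i" "rmem s6 2 = rmem s4 2"
            "rmem s6 (R0 + 2) = rmem s5 (R0 + 2)"
            using fr6 ac5 i5 by (simp_all add: frame_def)
          have ix: "ival s6 (row_index la li (Cell lc)) = int ((a * D + i) * ND + c)"
            by (rule ival_row_index) (use aci s6 in \<open>simp_all add: ready_N\<close>)
          have iy: "ival s6 sum_index = int ((i + j) mod D)"
            using aci j6 s6 by (simp add: sum_index_def ready_N zmod_int)
          have iz: "ival s6 (Cell lj) = int j" using j6 by simp
          have cell: "rmem s6 (R0 + 2) ((a * D + i) * ND + c) = entry a c i"
            using C5 a i c aci(5) by simp
          have "rmem s6 2 j = kro (weight 2 (a + N1 * N2 * c)) j" using w4 aci(4) j by simp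
          then have "?f (?Sj a c i (Suc j)) (rupd 4 ((i + j) mod D) (rmem s6 4 ((i + j) mod D) +
              rmem s6 (R0 + 2) ((a * D + i) * ND + c) * rmem s6 2 j) s6)"
            using f6 D_ge unfolding cell by (simp add: T_def)
          then show "wp ?w (?f (?Sj a c i (Suc j))) s6"
            by (simp only: wp.simps ix rval.simps iy iz nat_int)
        next
          fix s' assume "?f (?Sj a c i D) s'"
          then show "?f (?Si a c (Suc i)) s'" by (simp add: add.assoc)
        qed simp_all
      next
        fix s' assume "?f (?Si a c D) s'"
        then show "?f (?Sc a (Suc c)) s'" by (simp add: add.assoc)
      qed simp_all
      have "wp (?u ;; weight_prog k) (wp ?li (?f (?Sc a (Suc c)))) s3"
      proof (rule wp_frame_mono[OF u], rule li)
        fix s4 assume fr4: "frame (iwrites (?u ;; weight_prog k)) (rwrites (?u ;; weight_prog k)) s3 s4"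
        show "ready 2 s4" by (rule ready_frame[OF s3 fr4]) auto
        show "imem s4 la 0 = int a" "imem s4 lc 0 = int c" using fr4 a3 c3 by (simp_all add: frame_def)
        show "?f (?Sc a c) s4" using f3 fr4 by (simp add: frame_def)
        show "?C s4" using C3 fr4 by (simp add: frame_def)
      qed
      then show "wp (?u ;; weight_prog k ;; ?li) (?f (?Sc a (Suc c))) s3" by (simp only: wp.simps)
    next
      fix s' assume "?f (?Sc a N3) s'"
      then show "?f (?Sa (Suc a)) s'" by simp
    qed simp_all
  qed simp_all
  have Zf: "?f (?Sa N1) s' \<Longrightarrow> ?f (kro (partition_function k I)) s'" for s'
    by (simp add: kron_partition_function T_def)
  show ?thesis unfolding combine_prog_def wp.simps(4)
  proof (rule wp_frame_mono[OF Z])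
    fix s1 assume f1: "?f (\<lambda>d. 0) s1" and fr1: "frame (iwrites ?z) (rwrites ?z) s s1"
    let ?s = "iupd vG 0 2 s1"
    have "tables s1" by (rule tables_frame[OF fr1 _ s(1)]) auto
    moreover have "coeffs s1" using fr1 s(2) by (simp add: coeffs_def frame_def)
    ultimately have "ready 2 ?s" by (simp add: ready_def coeffs_def)
    moreover have "?C ?s" using C fr1 by (simp add: frame_def)
    moreover have "?f (\<lambda>d. 0) ?s" using f1 by simp
    ultimately have "wp ?la (?f (?Sa N1)) ?s" by (rule main)
    then have "wp ?la (?f (kro (partition_function k I))) ?s" by (rule wp_frame_mono) (rule Zf)
    then show "wp (Asg vG (INum 2)) (wp ?la (?f (kro (partition_function k I)))) s1"
      unfolding wp.simps(2) using B_ge by (simp del: wp.simps)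
  qed
qed

end

section \<open>Reading the input\<close>

definition term_code :: "coeff_model \<Rightarrow> gterm \<Rightarrow> int list" where
  "term_code M t = (case M of Bit_Length \<Rightarrow> \<lfloor>fst t\<rfloor> # snd t | Unit_Cost \<Rightarrow> snd t)"

lemma int_code_eq: "int_code M ts = int (length ts) # concat (map (term_code M) ts)"
proof (cases M)
  case Bit_Length
  have "(\<lambda>(c, es). \<lfloor>c\<rfloor> # es) = term_code M" by (auto simp: term_code_def Bit_Length)
  then show ?thesis using Bit_Length by simp
next
  case Unit_Cost
  have "snd = term_code M" by (auto simp: term_code_def Unit_Cost)
  then show ?thesis using Unit_Cost by simp
qed

lemma length_term_code: "length (term_code M t) = width M + length (snd t)"
  by (cases M) (auto simp: term_code_def width_def)

lemma term_code_nth: "x < length (snd t) \<Longrightarrow> term_code M t ! (width M + x) = snd t ! x"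
  by (cases M) (auto simp: term_code_def width_def)

locale pcsp_input = pcsp_run +
  fixes M :: coeff_model and xs :: "int list"
  assumes xs: "xs = [int (nvars I), int (length es), int (fvars I)] @
      concat (map (\<lambda>(x, y). [int x, int y]) es) @ concat (map (int_code M) tss)"
    and length_xs: "length xs \<le> X"
begin

abbreviation "\<delta> \<equiv> width M"

definition holds :: "real state \<Rightarrow> bool" where
  "holds s \<longleftrightarrow> (\<forall>i<length xs. imem s 0 i = xs ! i)"

text \<open>Positions are described by the suffix of the input that starts there, which avoids
  closed formulas for the offsets of terms of varying number.\<close>

definition occurs :: "nat \<Rightarrow> nat \<Rightarrow> bool" where
  "occurs p t \<longleftrightarrow> (\<exists>rest. drop p xs = term_code M (terms ! t) @ rest)"

definition located :: "real state \<Rightarrow> nat \<Rightarrow> bool" where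
  "located s t \<longleftrightarrow> (\<exists>p. imem s aTP t = int p \<and> occurs p t)"

lemma length_edge_list: "length (concat (map (\<lambda>(x, y). [int x, int y]) es)) = m * 2"
  by (subst length_concat_uniform[where l = 2]) auto

lemma holds_input_ok: "holds s \<Longrightarrow> input_ok s"
proof -
  assume h: "holds s"
  have "xs ! 0 = int n" "xs ! 1 = int m" "xs ! 2 = int sv"
    "0 < length xs" "1 < length xs" "2 < length xs" by (simp_all add: xs)
  moreover have "xs ! (3 + 2 * e + r) = [int (fst (es ! e)), int (snd (es ! e))] ! r \<and> 3 + 2 * e + r < length xs"
    if e: "e < m" "r < 2" for e r
  proof -
    have "e * 2 + r < m * 2" using e by (rule block_less)
    moreover have "concat (map (\<lambda>(x, y). [int x, int y]) es) ! (e * 2 + r) =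
        map (\<lambda>(x, y). [int x, int y]) es ! e ! r"
      by (rule nth_concat_uniform) (use e in auto)
    ultimately show ?thesis using e length_edge_list
      by (auto simp: xs nth_append case_prod_beta nth_Cons' mult.commute)
  qed
  from this[of _ 0] this[of _ 1] have "xs ! (3 + 2 * e) = int (fst (es ! e)) \<and> 3 + 2 * e < length xs"
    "xs ! (4 + 2 * e) = int (snd (es ! e)) \<and> 4 + 2 * e < length xs" if "e < m" for e
    using that by (fastforce simp: numeral_eq_Suc)+
  ultimately show ?thesis using h by (auto simp: input_ok_def holds_def)
qed

lemma drop_3_xs: "drop (3 + 2 * m) xs = concat (map (int_code M) tss)"
  using length_edge_list by (simp add: xs mult.commute numeral_3_eq_3)

lemma drop_nth: "drop p xs = a @ rest \<Longrightarrow> i < length a \<Longrightarrow> p + i < length xs \<and> xs ! (p + i) = a ! i"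
proof -
  assume d: "drop p xs = a @ rest" and i: "i < length a"
  have "length xs - p \<ge> length a" using arg_cong[OF d, of length] by simp
  then have "p + i < length xs" using i by linarith
  moreover have "drop p xs ! i = a ! i" using d i by (simp add: nth_append)
  ultimately show ?thesis by (simp add: nth_drop)
qed

lemma wp_parse:
  assumes s: "holds s"
  shows "wp (parse_prog k \<delta>) (\<lambda>s'. imem s' vF 0 = int F \<and> imem s' vTC 0 = int (length terms) \<and>
     (\<forall>f<F. imem s' aST f = int (start f) \<and> imem s' aCNT f = int (length (tss ! f))) \<and>
     (\<forall>t<length terms. located s' t)) s"
proof -
  let ?lt = "IS aTP (Cell vTC) (Cell vPos) ;; Asg vPos (IAdd (Cell vPos) (IAdd sI (INum (int \<delta>)))) ;;
           Asg vTC (IAdd (Cell vTC) (INum 1))"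
  let ?lt' = "For False lt (ILoad aCNT (Cell lf)) ?lt"
  let ?lf = "IS aST (Cell lf) (Cell vTC) ;; IS aCNT (Cell lf) (ILoad 0 (Cell vPos)) ;;
        Asg vPos (IAdd (Cell vPos) (INum 1)) ;; ?lt'"
  \<comment> \<open>Both invariants say that the unread suffix is the code of what remains: the
    remaining factors in \<open>?I\<close>, and first the remaining terms of the current factor in
    \<open>?J\<close>.\<close>
  let ?I = "\<lambda>f s. (\<exists>p. imem s vPos 0 = int p \<and> p \<le> length xs \<and> drop p xs = concat (map (int_code M) (drop f tss))) \<and>
     imem s vTC 0 = int (start f) \<and>
     (\<forall>f'<f. imem s aST f' = int (start f') \<and> imem s aCNT f' = int (length (tss ! f'))) \<and>
     (\<forall>t<start f. located s t)"
  let ?J = "\<lambda>f t s. (\<exists>p. imem s vPos 0 = int p \<and> p \<le> length xs \<and> drop p xs =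
       concat (map (term_code M) (drop t (tss ! f))) @ concat (map (int_code M) (drop (Suc f) tss))) \<and>
     imem s vTC 0 = int (start f + t) \<and> (\<forall>t'<start f + t. located s t')"
  have in_ok: "imem s 0 0 = int n" "imem s 0 (Suc 0) = int m" "imem s 0 2 = int sv"
    using holds_input_ok[OF s] by (auto simp: input_ok_def)
  have main: "wp (For False lf (Cell vF) ?lf) (\<lambda>s'. imem s' vF 0 = int F \<and> imem s' vTC 0 = int (length terms) \<and>
     (\<forall>f<F. imem s' aST f = int (start f) \<and> imem s' aCNT f = int (length (tss ! f))) \<and>
     (\<forall>t<length terms. located s' t)) s1"
    if s1: "imem s1 0 = imem s 0" "imem s1 vF 0 = int F" "imem s1 vPos 0 = int (3 + 2 * m)" "imem s1 vTC 0 = 0" for s1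
  proof (rule wp_For[where n = F and I = ?I])
    show "ival s1 (Cell vF) = int F" using s1 by simp
    show "int F \<le> B" "F \<le> (if False then Y else X)" using F_le X_B by auto
    have "3 + 2 * m \<le> length xs" using length_edge_list by (simp add: xs)
    then show "?I 0 s1" using s1 drop_3_xs by (auto simp: start_def intro!: exI[of _ "3 + 2 * m"])
  next
    fix f s2 assume f: "f < F" and I2: "?I f s2" and f2: "imem s2 lf 0 = int f"
      and fr: "frame (insert lf (iwrites ?lf)) (rwrites ?lf) s1 s2"
    have h2: "imem s2 0 = imem s 0" using fr s1 by (simp add: frame_def)
    from I2 obtain p where p: "imem s2 vPos 0 = int p" "p \<le> length xs"
      "drop p xs = concat (map (int_code M) (drop f tss))" by blast
    have f': "f < length tss" using f by (simp add: length_tss)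
    have d: "drop p xs = int (length (tss ! f)) # concat (map (term_code M) (tss ! f)) @
        concat (map (int_code M) (drop (Suc f) tss))"
      using p(3) by (simp add: Cons_nth_drop_Suc[OF f', symmetric] int_code_eq)
    have pl: "p < length xs" and xp: "xs ! p = int (length (tss ! f))"
      using drop_nth[of p "[int (length (tss ! f))]" _ 0] d by auto
    have d1: "drop (Suc p) xs = concat (map (term_code M) (tss ! f)) @
        concat (map (int_code M) (drop (Suc f) tss))"
      using d by (metis drop_Suc tl_drop list.sel(3))
    have cnt: "imem s2 0 p = int (length (tss ! f))" using h2 s pl xp by (simp add: holds_def)
    have lenB: "length (tss ! f) \<le> X" using start_le[OF f] terms_le by simp
    have stB: "start f \<le> X" using start_le[OF f] terms_le by simp
    have pB: "Suc p \<le> X" using pl length_xs by simp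
    let ?s3 = "iupd vPos 0 (int (Suc p)) (iupd aCNT f (int (length (tss ! f))) (iupd aST f (int (start f)) s2))"
    have inner: "wp ?lt' (?I (Suc f)) ?s3"
    proof (rule wp_For[where n = "length (tss ! f)" and I = "?J f"])
      show "ival ?s3 (ILoad aCNT (Cell lf)) = int (length (tss ! f))" using f2 by simp
      show "int (length (tss ! f)) \<le> B" "length (tss ! f) \<le> (if False then Y else X)"
        using lenB by (auto intro!: le_B)
      show "?J f 0 ?s3" using I2 d1 pl by (auto simp: located_def intro!: exI[of _ "Suc p"])
    next
      fix t s4 assume t: "t < length (tss ! f)" and J: "?J f t s4" and t4: "imem s4 lt 0 = int t"
        and fr4: "frame (insert lt (iwrites ?lt)) (rwrites ?lt) ?s3 s4"
      from J obtain p' where p': "imem s4 vPos 0 = int p'" "p' \<le> length xs" "drop p' xs =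
         concat (map (term_code M) (drop t (tss ! f))) @ concat (map (int_code M) (drop (Suc f) tss))" by blast
      have sv4: "imem s4 0 2 = int sv" using fr4 h2 in_ok by (simp add: frame_def)
      have idx: "start f + t < length terms" using start_le[OF f] t by simp
      have tn: "terms ! (start f + t) = tss ! f ! t" using terms_nth[OF f t] .
      have l: "length (term_code M (tss ! f ! t)) = sv + \<delta>"
        using length_exps[OF idx] by (simp add: length_term_code tn)
      have d4: "drop p' xs = term_code M (tss ! f ! t) @
          (concat (map (term_code M) (drop (Suc t) (tss ! f))) @ concat (map (int_code M) (drop (Suc f) tss)))"
        using p'(3) by (simp add: Cons_nth_drop_Suc[OF t, symmetric])
      then have "drop (p' + (sv + \<delta>)) xs =
          concat (map (term_code M) (drop (Suc t) (tss ! f))) @ concat (map (int_code M) (drop (Suc f) tss))"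
        using l by (metis append_eq_conv_conj drop_drop add.commute)
      moreover have "p' + (sv + \<delta>) \<le> length xs"
        using arg_cong[OF d4, of length] p'(2) l by simp
      moreover have "occurs p' (start f + t)" using d4 by (auto simp: occurs_def tn)
      moreover have "int p' \<le> B" "int (p' + (sv + \<delta>)) \<le> B" "int (Suc (start f + t)) \<le> B"
        by (rule le_B, use p'(2) calculation(2) length_xs idx terms_le in simp)+
      moreover have "\<exists>p. int p' + (int sv + int \<delta>) = int p \<and> p \<le> length xs \<and> drop p xs =
          concat (map (term_code M) (drop (Suc t) (tss ! f))) @ concat (map (int_code M) (drop (Suc f) tss))"
        by (rule exI[of _ "p' + (sv + \<delta>)"]) (use calculation in simp)
      ultimately show "wp ?lt (?J f (Suc t)) s4"
        using J p'(1) sv4 by (auto simp: located_def less_Suc_eq nat_int_add add.assoc)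
    next
      fix s' assume J: "?J f (length (tss ! f)) s'"
        and fr': "frame (insert lt (iwrites ?lt)) (rwrites ?lt) ?s3 s'"
      have "imem s' aST = (imem s2 aST)(f := int (start f))"
        "imem s' aCNT = (imem s2 aCNT)(f := int (length (tss ! f)))"
        using fr' by (simp_all add: frame_def)
      then show "?I (Suc f) s'" using J I2 f by (auto simp: start_Suc less_Suc_eq)
    qed (auto simp: located_def)
    have "int (start f) \<le> B" "int (length (tss ! f)) \<le> B" "int (Suc p) \<le> B"
      by (rule le_B, use lenB stB pB in simp)+
    then show "wp ?lf (?I (Suc f)) s2"
      using inner I2 f2 p(1) cnt by (simp add: nat_int_add add.commute del: wp.simps(6))
  next
    fix s' assume "?I F s'" and fr': "frame (insert lf (iwrites ?lf)) (rwrites ?lf) s1 s'"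
    then show "imem s' vF 0 = int F \<and> imem s' vTC 0 = int (length terms) \<and>
     (\<forall>f<F. imem s' aST f = int (start f) \<and> imem s' aCNT f = int (length (tss ! f))) \<and>
     (\<forall>t<length terms. located s' t)" using s1 by (auto simp: start_F frame_def)
  qed (auto simp: located_def)
  have v: "1 + int n * int k + int m * int k * int k = int F" by (simp add: F_def)
  have b: "int (3 + 2 * m) \<le> B"
    using length_xs length_edge_list by (intro le_B) (simp add: xs)
  have "wp (For False lf (Cell vF) ?lf) (\<lambda>s'. imem s' vF 0 = int F \<and> imem s' vTC 0 = int (length terms) \<and>
     (\<forall>f<F. imem s' aST f = int (start f) \<and> imem s' aCNT f = int (length (tss ! f))) \<and>
     (\<forall>t<length terms. located s' t)) (iupd vTC 0 0 (iupd vPos 0 (int (3 + 2 * m)) (iupd vF 0 (int F) s)))"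
    by (rule main) simp_all
  then show ?thesis unfolding parse_prog_def using X_B in_ok b B_ge
    by (simp add: v del: wp.simps(6))
qed

lemma ival_exp_entry:
  assumes "holds s" "located s t" "imem s lt 0 = int t" "imem s lx 0 = int x" "x < sv" "t < length terms"
  shows "ival s (exp_entry \<delta>) = snd (terms ! t) ! x"
proof -
  from assms(2) obtain p rest where p: "imem s aTP t = int p" "drop p xs = term_code M (terms ! t) @ rest"
    by (auto simp: located_def occurs_def)
  have l: "length (snd (terms ! t)) = sv" using assms(6) by (rule length_exps)
  have "p + (\<delta> + x) < length xs \<and> xs ! (p + (\<delta> + x)) = snd (terms ! t) ! x"
    using drop_nth[OF p(2), of "\<delta> + x"] term_code_nth[of x "terms ! t" M] l assms(5)
    by (simp add: length_term_code)
  moreover have "nat (int p + int \<delta> + int x) = p + (\<delta> + x)" by simp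
  ultimately show ?thesis using assms p(1) by (simp add: exp_entry_def holds_def)
qed

text \<open>Without formal variables \<open>D = 1\<close>, but then the sums in \<open>TT\<close>
  are empty and \<open>W = 1\<close> as well.\<close>

lemma W_le_D: "W \<le> D"
proof (cases "sv = 0")
  case True
  then have "term_bound t = 0" for t by (simp add: term_bound_def)
  then show ?thesis using True by (simp add: W_def D_def TT_def)
next
  case False
  then have "W ^ 1 \<le> W ^ sv" using W_ge by (intro power_increasing) auto
  then show ?thesis by (simp add: D_def)
qed

lemma power_W_le: "x \<le> sv \<Longrightarrow> W ^ x \<le> D"
  using W_ge unfolding D_def by (intro power_increasing) auto

lemma code_B: "int TT \<le> B" "int W \<le> B" "x \<le> sv \<Longrightarrow> int (W ^ x) \<le> B"
proof -
  show "int W \<le> B" using W_le_D D_le by (intro le_B) simp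
  show "int TT \<le> B" using W_le_D D_le by (intro le_B) (simp add: W_def)
  show "int (W ^ x) \<le> B" if "x \<le> sv" using power_W_le[OF that] D_le by (intro le_B) simp
qed

lemma wp_code:
  assumes s: "holds s" "imem s vTC 0 = int (length terms)" "\<forall>t<length terms. located s t"
  shows "wp (code_prog \<delta>) (\<lambda>s'. imem s' vTT 0 = int TT \<and> imem s' vW 0 = int W \<and>
     (\<forall>x\<le>sv. imem s' aWP x = int (W ^ x)) \<and> imem s' vD 0 = int D \<and>
     (\<forall>t<length terms. imem s' aE t = int (kcode sv W (exponent (snd (terms ! t)))))) s"
proof -
  let ?G = "\<lambda>s'. imem s' 0 = imem s 0 \<and> imem s' vTC = imem s vTC \<and> imem s' aTP = imem s aTP"
  have G: "holds s'" "imem s' 0 2 = int sv" "imem s' vTC 0 = int (length terms)" "\<forall>t<length terms. located s' t"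
    if "?G s'" for s'
    using that s holds_input_ok[OF s(1)] by (simp_all add: holds_def located_def input_ok_def)
  let ?z = "\<lambda>t x. snd (terms ! t) ! x"
  let ?a = "Asg vTT (IAdd (Cell vTT) (IMul (exp_entry \<delta>) (exp_entry \<delta>)))"
  let ?A = "For False lt (Cell vTC) (For False lx sI ?a)"
  have A: "wp ?A (\<lambda>s'. imem s' vTT 0 = int TT) s1" if s1: "?G s1" "imem s1 vTT 0 = 0" for s1
  proof (rule wp_For[where n = "length terms" and
        I = "\<lambda>t s'. imem s' vTT 0 = int (\<Sum>t'<t. term_bound (terms ! t'))"])
    show "ival s1 (Cell vTC) = int (length terms)" using G(3)[OF s1(1)] by simp
    show "int (length terms) \<le> B" "length terms \<le> (if False then Y else X)" using X_B terms_le by auto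
    fix t s2 assume t: "t < length terms" and I2: "imem s2 vTT 0 = int (\<Sum>t'<t. term_bound (terms ! t'))"
      and t2: "imem s2 lt 0 = int t" and fr: "frame (insert lt (iwrites (For False lx sI ?a))) (rwrites (For False lx sI ?a)) s1 s2"
    have s2: "?G s2" using fr s1 by (simp add: frame_def)
    show "wp (For False lx sI ?a) (\<lambda>s'. imem s' vTT 0 = int (\<Sum>t'<Suc t. term_bound (terms ! t'))) s2"
    proof (rule wp_For[where n = sv and I = "\<lambda>x s'. imem s' vTT 0 =
        int ((\<Sum>t'<t. term_bound (terms ! t')) + (\<Sum>x'<x. nat ((?z t x') ^ 2)))"])
      show "ival s2 sI = int sv" using G(2)[OF s2] by simp
      show "int sv \<le> B" "sv \<le> (if False then Y else X)" using X_B sv_le by auto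
      show "imem s2 vTT 0 = int ((\<Sum>t'<t. term_bound (terms ! t')) + (\<Sum>x'<0. nat ((?z t x') ^ 2)))"
        using I2 by simp
      fix x s3 assume x: "x < sv" and I3: "imem s3 vTT 0 =
          int ((\<Sum>t'<t. term_bound (terms ! t')) + (\<Sum>x'<x. nat ((?z t x') ^ 2)))"
        and x3: "imem s3 lx 0 = int x" and fr3: "frame (insert lx (iwrites ?a)) (rwrites ?a) s2 s3"
      have s3: "?G s3" using fr3 s2 by (simp add: frame_def)
      have t3: "imem s3 lt 0 = int t" using fr3 t2 by (simp add: frame_def)
      have z: "ival s3 (exp_entry \<delta>) = ?z t x"
        by (rule ival_exp_entry) (use G[OF s3] t3 x3 x t in auto)
      have v: "ival s3 (IAdd (Cell vTT) (IMul (exp_entry \<delta>) (exp_entry \<delta>))) =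
          int ((\<Sum>t'<t. term_bound (terms ! t')) + (\<Sum>x'<Suc x. nat ((?z t x') ^ 2)))"
        using I3 z by (simp add: power2_eq_square)
      \<comment> \<open>Partial sums of squares never exceed the final \<open>TT\<close>, so every
        intermediate value stays within \<open>B\<close>.\<close>
      have "(\<Sum>x'<Suc x. nat ((?z t x') ^ 2)) \<le> term_bound (terms ! t)"
        unfolding term_bound_def using x by (intro sum_mono2) auto
      then have "(\<Sum>t'<t. term_bound (terms ! t')) + (\<Sum>x'<Suc x. nat ((?z t x') ^ 2)) \<le>
          (\<Sum>t'<Suc t. term_bound (terms ! t'))" by simp
      also have "\<dots> \<le> TT" unfolding TT_def using t by (intro sum_mono2) auto
      finally have b: "int ((\<Sum>t'<t. term_bound (terms ! t')) + (\<Sum>x'<Suc x. nat ((?z t x') ^ 2))) \<le> B"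
        using code_B(1) by (meson of_nat_le_iff order_trans)
      show "wp ?a (\<lambda>s'. imem s' vTT 0 =
          int ((\<Sum>t'<t. term_bound (terms ! t')) + (\<Sum>x'<Suc x. nat ((?z t x') ^ 2)))) s3"
        unfolding wp.simps v using b by (simp del: of_nat_add of_nat_sum sum.lessThan_Suc)
    next
      fix s' assume "imem s' vTT 0 = int ((\<Sum>t'<t. term_bound (terms ! t')) + (\<Sum>x'<sv. nat ((?z t x') ^ 2)))"
      then show "imem s' vTT 0 = int (\<Sum>t'<Suc t. term_bound (terms ! t'))" by (simp add: term_bound_def)
    qed simp_all
  next
    show "imem s1 vTT 0 = int (\<Sum>t'<0. term_bound (terms ! t'))" using s1 by simp
  qed (simp_all add: TT_def)
  let ?b = "IS aWP (IAdd (Cell lx) (INum 1)) (IMul (ILoad aWP (Cell lx)) (Cell vW))"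
  have Bp: "wp (For False lx sI ?b) (\<lambda>s'. \<forall>x\<le>sv. imem s' aWP x = int (W ^ x)) s1"
    if s1: "?G s1" "imem s1 vW 0 = int W" "imem s1 aWP 0 = 1" for s1
  proof (rule wp_For[where n = sv and I = "\<lambda>j s'. \<forall>x\<le>j. imem s' aWP x = int (W ^ x)"])
    show "ival s1 sI = int sv" using G(2)[OF s1(1)] by simp
    show "int sv \<le> B" "sv \<le> (if False then Y else X)" using X_B sv_le by auto
    fix j s2 assume j: "j < sv" and I2: "\<forall>x\<le>j. imem s2 aWP x = int (W ^ x)" and j2: "imem s2 lx 0 = int j"
      and fr: "frame (insert lx (iwrites ?b)) (rwrites ?b) s1 s2"
    have W2: "imem s2 vW 0 = int W" using fr s1 by (simp add: frame_def)
    have v: "ival s2 (IMul (ILoad aWP (Cell lx)) (Cell vW)) = int (W ^ Suc j)" using I2 j2 W2 by simp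
    show "wp ?b (\<lambda>s'. \<forall>x\<le>Suc j. imem s' aWP x = int (W ^ x)) s2"
      unfolding wp.simps v using I2 j2 code_B(3)[of "Suc j"] j by (auto simp: le_Suc_eq nat_int_add)
  qed (use s1 in auto)
  let ?c = "IS aE (Cell lt) (IMod (IAdd (ILoad aE (Cell lt)) (IMul (exp_entry \<delta>) (ILoad aWP (Cell lx)))) (Cell vD))"
  let ?c' = "IS aE (Cell lt) (INum 0) ;; For False lx sI ?c"
  have C: "wp (For False lt (Cell vTC) ?c')
      (\<lambda>s'. \<forall>t<length terms. imem s' aE t = int (kcode sv W (exponent (snd (terms ! t))))) s1"
    if s1: "?G s1" "\<forall>x\<le>sv. imem s1 aWP x = int (W ^ x)" "imem s1 vD 0 = int D" for s1
  proof (rule wp_For[where n = "length terms" and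
        I = "\<lambda>j s'. \<forall>t<j. imem s' aE t = int (kcode sv W (exponent (snd (terms ! t))))"])
    show "ival s1 (Cell vTC) = int (length terms)" using G(3)[OF s1(1)] by simp
    show "int (length terms) \<le> B" "length terms \<le> (if False then Y else X)" using X_B terms_le by auto
    fix t s2 assume t: "t < length terms"
      and I2: "\<forall>t'<t. imem s2 aE t' = int (kcode sv W (exponent (snd (terms ! t'))))"
      and t2: "imem s2 lt 0 = int t" and fr: "frame (insert lt (iwrites ?c')) (rwrites ?c') s1 s2"
    have s2: "?G s2" using fr s1 by (simp add: frame_def)
    \<comment> \<open>The code is reduced modulo \<open>D\<close> after each summand, which keeps
      the cell nonnegative and within \<open>B\<close>.\<close>
    let ?K = "\<lambda>x s'. (\<forall>t'<t. imem s' aE t' = int (kcode sv W (exponent (snd (terms ! t'))))) \<and>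
        imem s' aE t = (\<Sum>x'<x. ?z t x' * int W ^ x') mod int D"
    have "wp (For False lx sI ?c) (\<lambda>s'. \<forall>t'<Suc t. imem s' aE t' = int (kcode sv W (exponent (snd (terms ! t'))))) (iupd aE t 0 s2)"
    proof (rule wp_For[where n = sv and I = ?K])
      show "ival (iupd aE t 0 s2) sI = int sv" using G(2)[OF s2] by simp
      show "int sv \<le> B" "sv \<le> (if False then Y else X)" using X_B sv_le by auto
      show "?K 0 (iupd aE t 0 s2)" using I2 by simp
      fix x s3 assume x: "x < sv" and I3: "?K x s3" and x3: "imem s3 lx 0 = int x"
        and fr3: "frame (insert lx (iwrites ?c)) (rwrites ?c) (iupd aE t 0 s2) s3"
      have s3: "?G s3" using fr3 s2 by (simp add: frame_def)
      have t3: "imem s3 lt 0 = int t" "imem s3 aWP x = int (W ^ x)" "imem s3 vD 0 = int D"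
        using fr3 fr t2 s1 x by (simp_all add: frame_def)
      have z: "ival s3 (exp_entry \<delta>) = ?z t x"
        by (rule ival_exp_entry) (use G[OF s3] t3 x3 x t in auto)
      have v: "ival s3 (IMod (IAdd (ILoad aE (Cell lt)) (IMul (exp_entry \<delta>) (ILoad aWP (Cell lx)))) (Cell vD)) =
          (\<Sum>x'<Suc x. ?z t x' * int W ^ x') mod int D"
        using I3 z t3 x3 by (simp add: mod_simps)
      have "0 \<le> (\<Sum>x'<Suc x. ?z t x' * int W ^ x') mod int D" "(\<Sum>x'<Suc x. ?z t x' * int W ^ x') mod int D < int D"
        using D_ge by simp_all
      then have "\<bar>(\<Sum>x'<Suc x. ?z t x' * int W ^ x') mod int D\<bar> \<le> B" using X_B by linarith
      then show "wp ?c (?K (Suc x)) s3"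
        unfolding wp.simps v using I3 t3 by simp
    next
      fix s' assume K: "?K sv s'"
      have "int (kcode sv W (exponent (snd (terms ! t)))) = (\<Sum>x'<sv. ?z t x' * int W ^ x') mod int D"
        using length_exps[OF t] W_ge by (simp add: kcode_def floor_lookup_exponent D_def)
      then show "\<forall>t'<Suc t. imem s' aE t' = int (kcode sv W (exponent (snd (terms ! t'))))"
        using K by (auto simp: less_Suc_eq)
    qed auto
    then show "wp ?c' (\<lambda>s'. \<forall>t'<Suc t. imem s' aE t' = int (kcode sv W (exponent (snd (terms ! t'))))) s2"
      using t2 B_ge by (simp del: wp.simps(6))
  qed auto
  let ?P = "\<lambda>s. ?G s \<and> imem s vTT 0 = int TT"
  let ?Q = "\<lambda>s. ?P s \<and> imem s vW 0 = int W"
  let ?post = "\<lambda>s'. imem s' vTT 0 = int TT \<and> imem s' vW 0 = int W \<and>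
     (\<forall>x\<le>sv. imem s' aWP x = int (W ^ x)) \<and> imem s' vD 0 = int D \<and>
     (\<forall>t<length terms. imem s' aE t = int (kcode sv W (exponent (snd (terms ! t)))))"
  have 3: "wp (Asg vD (ILoad aWP sI) ;; For False lt (Cell vTC) ?c') ?post s1"
    if s1: "?Q s1" "\<forall>x\<le>sv. imem s1 aWP x = int (W ^ x)" for s1
  proof -
    have "wp (For False lt (Cell vTC) ?c') ?post (iupd vD 0 (int D) s1)"
      by (rule wp_frame_mono[OF C]) (use s1 in \<open>auto simp: frame_def\<close>)
    moreover have "ival s1 (ILoad aWP sI) = int D" using s1 G(2)[of s1] by (simp add: D_def)
    ultimately show ?thesis using X_B by (simp del: wp.simps(6) ival.simps(2))
  qed
  have 2: "wp (Asg vW (IAdd (IMul (INum 2) (Cell vTT)) (INum 1)) ;; IS aWP (INum 0) (INum 1) ;;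
     For False lx sI ?b ;; Asg vD (ILoad aWP sI) ;; For False lt (Cell vTC) ?c') ?post s1" if s1: "?P s1" for s1
  proof -
    have "wp (For False lx sI ?b) (wp (Asg vD (ILoad aWP sI) ;; For False lt (Cell vTC) ?c') ?post)
        (iupd aWP 0 1 (iupd vW 0 (int W) s1))"
      by (rule wp_frame_mono[OF Bp], use s1 in simp, use s1 in simp, use s1 in simp, rule 3)
        (use s1 in \<open>auto simp: frame_def\<close>)
    moreover have "ival s1 (IAdd (IMul (INum 2) (Cell vTT)) (INum 1)) = int W" using s1 by (simp add: W_def)
    ultimately show ?thesis using code_B(2) B_ge by (simp del: wp.simps(6) ival.simps(3))
  qed
  have "wp ?A (wp (Asg vW (IAdd (IMul (INum 2) (Cell vTT)) (INum 1)) ;; IS aWP (INum 0) (INum 1) ;;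
     For False lx sI ?b ;; Asg vD (ILoad aWP sI) ;; For False lt (Cell vTC) ?c') ?post) (iupd vTT 0 0 s)"
    by (rule wp_frame_mono[OF A], simp, simp, rule 2) (auto simp: frame_def)
  then show ?thesis unfolding code_prog_def using B_ge by (simp del: wp.simps(6))
qed

lemma wp_power:
  assumes s: "imem s 0 0 = int n" "imem s vD 0 = int D"
  shows "wp (power_prog k) (\<lambda>s'. (\<forall>x\<le>n. imem s' aKP x = int (k ^ x)) \<and>
     imem s' vN1 0 = int N1 \<and> imem s' vN2 0 = int N2 \<and> imem s' vN3 0 = int N3 \<and>
     imem s' vND 0 = int (N3 * D)) s"
proof -
  let ?b = "IS aKP (IAdd (Cell lx) (INum 1)) (IMul (ILoad aKP (Cell lx)) (INum (int k)))"
  have A: "wp (For False lx nI ?b) (\<lambda>s'. \<forall>x\<le>n. imem s' aKP x = int (k ^ x)) (iupd aKP 0 1 s)"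
  proof (rule wp_For[where n = n and I = "\<lambda>j s'. \<forall>x\<le>j. imem s' aKP x = int (k ^ x)"])
    show "ival (iupd aKP 0 1 s) nI = int n" using s by simp
    show "int n \<le> B" "n \<le> (if False then Y else X)" using X_B n_le by auto
    fix j and s2 :: "real state" assume j: "j < n" and I2: "\<forall>x\<le>j. imem s2 aKP x = int (k ^ x)" and j2: "imem s2 lx 0 = int j"
    have v: "ival s2 (IMul (ILoad aKP (Cell lx)) (INum (int k))) = int (k ^ Suc j)" using I2 j2 by simp
    show "wp ?b (\<lambda>s'. \<forall>x\<le>Suc j. imem s' aKP x = int (k ^ x)) s2"
      unfolding wp.simps v using I2 j2 power_le_B[of "Suc j"] j by (auto simp: le_Suc_eq nat_int_add)
  qed auto
  have le: "n div 3 \<le> n" "(n + 1) div 3 \<le> n" "(n + 2) div 3 \<le> n" using thirds by linarith+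
  have dv: "nat (int n div 3) = n div 3" "nat ((int n + 1) div 3) = (n + 1) div 3"
    "nat ((int n + 2) div 3) = (n + 2) div 3" by (simp_all add: nat_div_distrib nat_int_add)
  have "N3 * D \<le> k ^ n * X"
    using le(3) k_ge D_le unfolding N3_def by (intro mult_le_mono power_increasing) auto
  then have ND: "int N3 * int D \<le> B" using B_le by (metis of_nat_le_iff of_nat_mult order_trans)
  have N: "int (k ^ (n div 3)) = int N1" "int (k ^ ((n + 1) div 3)) = int N2" "int (k ^ ((n + 2) div 3)) = int N3"
    by (simp_all add: N1_def N2_def N3_def)
  have 2: "wp (Asg vN1 (ILoad aKP (IDiv nI (INum 3))) ;;
     Asg vN2 (ILoad aKP (IDiv (IAdd nI (INum 1)) (INum 3))) ;;
     Asg vN3 (ILoad aKP (IDiv (IAdd nI (INum 2)) (INum 3))) ;;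
     Asg vND (IMul (Cell vN3) (Cell vD))) (\<lambda>s'. (\<forall>x\<le>n. imem s' aKP x = int (k ^ x)) \<and>
     imem s' vN1 0 = int N1 \<and> imem s' vN2 0 = int N2 \<and> imem s' vN3 0 = int N3 \<and>
     imem s' vND 0 = int (N3 * D)) s1"
    if s1: "\<forall>x\<le>n. imem s1 aKP x = int (k ^ x)" "imem s1 0 0 = int n" "imem s1 vD 0 = int D" for s1
  proof -
    have kp: "imem s1 aKP (n div 3) = int N1" "imem s1 aKP ((n + 1) div 3) = int N2"
      "imem s1 aKP ((n + 2) div 3) = int N3" using s1(1) le N by simp_all
    have "wp (Asg vN1 (ILoad aKP (IDiv nI (INum 3))) ;;
     Asg vN2 (ILoad aKP (IDiv (IAdd nI (INum 1)) (INum 3))) ;;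
     Asg vN3 (ILoad aKP (IDiv (IAdd nI (INum 2)) (INum 3))) ;;
     Asg vND (IMul (Cell vN3) (Cell vD))) (\<lambda>s'. imem s' vN1 0 = int N1 \<and> imem s' vN2 0 = int N2 \<and>
     imem s' vN3 0 = int N3 \<and> imem s' vND 0 = int (N3 * D)) s1"
      using s1(2,3) N_B ND kp by (simp add: dv del: One_nat_def)
    then show ?thesis by (rule wp_frame_mono) (use s1(1) in \<open>auto simp: frame_def\<close>)
  qed
  have "wp (For False lx nI ?b) (wp (Asg vN1 (ILoad aKP (IDiv nI (INum 3))) ;;
     Asg vN2 (ILoad aKP (IDiv (IAdd nI (INum 1)) (INum 3))) ;;
     Asg vN3 (ILoad aKP (IDiv (IAdd nI (INum 2)) (INum 3))) ;;
     Asg vND (IMul (Cell vN3) (Cell vD))) (\<lambda>s'. (\<forall>x\<le>n. imem s' aKP x = int (k ^ x)) \<and>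
     imem s' vN1 0 = int N1 \<and> imem s' vN2 0 = int N2 \<and> imem s' vN3 0 = int N3 \<and>
     imem s' vND 0 = int (N3 * D))) (iupd aKP 0 1 s)"
    by (rule wp_frame_mono[OF A], rule 2) (use s in \<open>auto simp: frame_def\<close>)
  then show ?thesis unfolding power_prog_def using B_ge by (simp only: wp.simps(2,4)) simp
qed

end

section \<open>Writing the output\<close>

text \<open>Expanding the product gives 1, every single \<open>a t\<close> and further nonnegative
  terms.\<close>

lemma sum_le_prod_one_plus:
  fixes a :: "nat \<Rightarrow> real"
  shows "(\<And>t. t < j \<Longrightarrow> 0 \<le> a t) \<Longrightarrow> (\<Sum>t<j. a t) \<le> (\<Prod>t<j. 1 + a t) - 1"
proof (induction j)
  case (Suc j)
  have "0 \<le> (\<Sum>t<j. a t)" using Suc.prems by (intro sum_nonneg) auto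
  then have p: "1 \<le> (\<Prod>t<j. 1 + a t)" using Suc by fastforce
  have "(\<Sum>t<Suc j. a t) \<le> (\<Prod>t<j. 1 + a t) - 1 + 1 * a j" using Suc by simp
  also have "\<dots> \<le> (\<Prod>t<j. 1 + a t) - 1 + (\<Prod>t<j. 1 + a t) * a j"
    using p Suc.prems[of j] by (intro add_left_mono mult_right_mono) auto
  also have "\<dots> = (\<Prod>t<Suc j. 1 + a t) - 1" by (simp add: algebra_simps)
  finally show ?case .
qed simp

context pcsp_enc
begin

section \<open>A bound on the coefficients of the result\<close>

definition int_coeff :: "nat \<Rightarrow> int" where
  "int_coeff t = \<lfloor>fst (terms ! t)\<rfloor>"

definition coeff_prod :: "nat \<Rightarrow> int" where
  "coeff_prod j = (\<Prod>t<j. 1 + int_coeff t * int_coeff t)"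

definition height :: int where
  "height = coeff_prod (length terms) * int k ^ nvars I"

definition modulus :: int where
  "modulus = 2 * height + 1"

lemma coeff_prod_ge: "1 \<le> coeff_prod j"
  unfolding coeff_prod_def by (rule prod_ge_1) simp

lemma coeff_prod_mono: "i \<le> j \<Longrightarrow> coeff_prod i \<le> coeff_prod j"
proof (rule lift_Suc_mono_le[of coeff_prod])
  fix j
  have "coeff_prod j * 1 \<le> coeff_prod j * (1 + int_coeff j * int_coeff j)"
    using coeff_prod_ge[of j] by (intro mult_left_mono) auto
  then show "coeff_prod j \<le> coeff_prod (Suc j)" by (simp add: coeff_prod_def)
qed

text \<open>For the intermediate values of \<open>modulus_prog\<close>: the products only grow, so
  none exceeds the final value.\<close>

lemma coeff_prod_power_le: "j \<le> length terms \<Longrightarrow> x \<le> nvars I \<Longrightarrow> coeff_prod j * int k ^ x \<le> height"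
  unfolding height_def using k_ge coeff_prod_ge[of j] coeff_prod_ge[of "length terms"]
  by (intro mult_mono coeff_prod_mono power_increasing) auto

lemma height_ge: "1 \<le> height"
  using coeff_prod_power_le[of 0 0] by (simp add: coeff_prod_def)

text \<open>For integers the absolute value is at most the square, so the norm of a factor is at
  most the product of \<open>1 + c * c\<close> over its terms. That product is at least 1, hence it
  may be inserted for inactive factors too, and over all factors it runs through all terms once.
  Summing over \<open>k ^ n\<close> assignments gives \<open>height\<close>.\<close>

lemma abs_kron_partition_function_le:
  assumes "\<forall>t<length terms. fst (terms ! t) \<in> \<int>"
  shows "\<bar>kro (partition_function k I) d\<bar> \<le> of_int height"
proof -
  let ?a = "\<lambda>t. real_of_int (int_coeff t * int_coeff t)"
  have c: "\<bar>fst (terms ! t)\<bar> \<le> ?a t" if "t < length terms" for t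
  proof -
    have e: "fst (terms ! t) = of_int (int_coeff t)"
      using assms that unfolding int_coeff_def by (metis Ints_cases floor_of_int)
    have "\<bar>int_coeff t\<bar> \<le> int_coeff t * int_coeff t"
    proof (cases "int_coeff t = 0")
      case False
      then have "\<bar>int_coeff t\<bar> * 1 \<le> \<bar>int_coeff t\<bar> * \<bar>int_coeff t\<bar>" by (intro mult_left_mono) auto
      then show ?thesis by simp
    qed simp
    then have "of_int \<bar>int_coeff t\<bar> \<le> ?a t" by (simp only: of_int_le_iff)
    then show ?thesis by (simp add: e)
  qed
  let ?p = "\<lambda>f. \<Prod>t<length (tss ! f). 1 + ?a (start f + t)"
  have p_ge: "1 \<le> ?p f" for f by (rule prod_ge_1) simp
  have norm_ps: "norm1 (ps ! f) \<le> ?p f" if f: "f < F" for f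
  proof -
    have "norm1 (ps ! f) \<le> (\<Sum>t<length (tss ! f). norm1 (term_poly (tss ! f ! t)))"
      unfolding ps_eq[OF f] by (rule norm1_sum)
    also have "\<dots> \<le> (\<Sum>t<length (tss ! f). ?a (start f + t))"
    proof (rule sum_mono)
      fix t assume "t \<in> {..<length (tss ! f)}"
      then have t: "t < length (tss ! f)" by simp
      then have "start f + t < length terms" using start_le[OF f] by simp
      from c[OF this] show "norm1 (term_poly (tss ! f ! t)) \<le> ?a (start f + t)"
        unfolding terms_nth[OF f t] by (simp only: term_poly_def norm1_single)
    qed
    also have "\<dots> \<le> ?p f - 1" by (rule sum_le_prod_one_plus) simp
    finally show ?thesis by simp
  qed
  have prods: "(\<Prod>f<g. ?p f) = (\<Prod>t<start g. 1 + ?a t)" if "g \<le> F" for g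
    using that
  proof (induction g)
    case (Suc g)
    then show ?case by (simp add: start_Suc prod_lessThan_add)
  qed (simp add: start_def)
  have "\<bar>kro (partition_function k I) d\<bar> \<le> norm1 (partition_function k I)" by (rule abs_kron_le)
  also have "\<dots> \<le> (\<Sum>u<k ^ n. norm1 (\<Prod>f<F. if active u f then ps ! f else 1))"
    unfolding partition_function_eq_sum by (rule norm1_sum)
  also have "\<dots> \<le> (\<Sum>u<k ^ n. \<Prod>f<F. ?p f)"
  proof (rule sum_mono)
    fix u
    have "norm1 (\<Prod>f<F. if active u f then ps ! f else 1) \<le> (\<Prod>f<F. norm1 (if active u f then ps ! f else 1))"
      by (rule norm1_prod)
    also have "\<dots> \<le> (\<Prod>f<F. ?p f)"
    proof (rule prod_mono)
      fix f assume "f \<in> {..<F}"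
      moreover have "norm1 1 = 1" unfolding single_one[symmetric] by (simp only: norm1_single abs_one)
      ultimately show "0 \<le> norm1 (if active u f then ps ! f else 1) \<and> norm1 (if active u f then ps ! f else 1) \<le> ?p f"
        using norm_ps[of f] p_ge[of f] norm1_ge_0 by simp
    qed
    finally show "norm1 (\<Prod>f<F. if active u f then ps ! f else 1) \<le> (\<Prod>f<F. ?p f)" .
  qed
  also have "\<dots> = of_int height"
    unfolding prods[OF order_refl] start_F by (simp add: height_def coeff_prod_def)
  finally show ?thesis .
qed

text \<open>All \<open>D\<close> exponent vectors of the box are listed, whatever their
  coefficients: in the unit-cost model zero coefficients cannot be detected.\<close>

definition out_terms :: "gterm list" where
  "out_terms = map (\<lambda>d. (kro (partition_function k I) (kindex D d), unkron sv TT d)) [0..<D]"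

lemma is_term_list_out: "is_term_list sv out_terms (partition_function k I)"
proof -
  have "inj_on (unkron sv TT) {..<D}" unfolding D_def W_def by (rule inj_onI) (auto intro: unkron_inj)
  then have "distinct (map snd out_terms)"
    by (simp add: out_terms_def comp_def distinct_map atLeast0LessThan)
  moreover have "partition_function k I = (\<Sum>(c, es) \<leftarrow> out_terms. Poly_Mapping.single (exponent es) c)"
    by (subst kron_decode[OF box_partition_function])
      (simp add: out_terms_def comp_def D_def W_def interv_sum_list_conv_sum_set_nat atLeast0LessThan)
  moreover have "\<forall>(c, es) \<in> set out_terms. length es = sv" by (auto simp: out_terms_def)
  ultimately show ?thesis unfolding is_term_list_def by blast
qed

end

context pcsp_input
begin

section \<open>Layout of the output\<close>

abbreviation "lw \<equiv> sv + \<delta>"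

definition out_code :: "int list" where
  "out_code = int_code M out_terms"

lemma length_out_code: "length out_code = 1 + D * lw"
  unfolding out_code_def int_code_eq
  by (simp, subst length_concat_uniform[where l = lw]) (auto simp: length_term_code out_terms_def)

lemma out_code_0: "out_code ! 0 = int D"
  by (simp add: out_code_def int_code_eq out_terms_def)

lemma out_code_nth:
  assumes "d < D" "r < lw"
  shows "out_code ! (1 + (d * lw + r)) =
    term_code M (kro (partition_function k I) (kindex D d), unkron sv TT d) ! r"
proof -
  have "concat (map (term_code M) out_terms) ! (d * lw + r) = map (term_code M) out_terms ! d ! r"
    by (rule nth_concat_uniform) (use assms in \<open>auto simp: length_term_code out_terms_def\<close>)
  then show ?thesis using assms by (simp add: out_code_def int_code_eq out_terms_def)
qed

lemma outputsI:
  assumes "\<forall>i<length out_code. imem s 1 i = out_code ! i"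
    and "M = Unit_Cost \<Longrightarrow> \<forall>d<D. rmem s 1 d = kro (partition_function k I) (kindex D d)"
  shows "outputs M sv (partition_function k I) s"
proof -
  have "\<forall>i<length (ring_code M out_terms). rmem s 1 i = ring_code M out_terms ! i"
    using assms(2) by (cases M) (simp_all add: out_terms_def)
  then show ?thesis using assms(1) is_term_list_out unfolding outputs_def out_code_def by blast
qed

lemma kindex_less: "kindex D d < D"
  using D_ge by (simp add: kindex_def)

lemma ival_out_index:
  assumes "imem s vD 0 = int D" "imem s ld 0 = int d"
  shows "ival s out_index = int (kindex D d)"
proof -
  have "(int D - 1) div 2 = int ((D - 1) div 2)" using D_ge by (simp add: zdiv_int of_nat_diff)
  moreover have "int d + int D - int ((D - 1) div 2) = int (d + D - (D - 1) div 2)"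
    by (subst of_nat_diff) auto
  ultimately show ?thesis using assms by (simp add: out_index_def kindex_def zmod_int del: of_nat_diff)
qed

text \<open>In the bit model the cells hold residues only; the bound by \<open>height\<close> is
  what lets them determine the coefficients.\<close>

definition result :: "nat \<Rightarrow> real state \<Rightarrow> bool" where
  "result off s \<longleftrightarrow>
     (M = Unit_Cost \<longrightarrow> (\<forall>d<D. rmem s 4 d = kro (partition_function k I) d)) \<and>
     (M = Bit_Length \<longrightarrow> imem s vH 0 = height \<and> imem s vQ 0 = modulus \<and>
       (\<forall>d<D. \<exists>z. kro (partition_function k I) d = of_int z \<and> \<bar>z\<bar> \<le> height \<and>
         imem s (off + 4) d = z mod modulus))"

lemma wp_coeff:
  assumes s: "tables s" "result off s" "imem s ld 0 = int d" "d < D" and B: "M = Bit_Length \<Longrightarrow> modulus \<le> B"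
    and i: "\<forall>i<1 + d * lw. imem s 1 i = out_code ! i"
    and r: "M = Unit_Cost \<Longrightarrow> \<forall>d'<d. rmem s 1 d' = kro (partition_function k I) (kindex D d')"
  shows "wp (coeff_prog M off) (\<lambda>s'. (\<forall>i<1 + (d * lw + \<delta>). imem s' 1 i = out_code ! i) \<and>
     (M = Unit_Cost \<longrightarrow> (\<forall>d'<Suc d. rmem s' 1 d' = kro (partition_function k I) (kindex D d')))) s"
proof -
  have ix: "ival s out_index = int (kindex D d)"
    using s by (intro ival_out_index) (auto simp: tables_vD)
  have sv: "imem s 0 2 = int sv" using s(1) by (simp add: tables_def input_ok_def)
  show ?thesis
  proof (cases M)
    case Unit_Cost
    have "rmem s 4 (kindex D d) = kro (partition_function k I) (kindex D d)"
      using s(2) kindex_less Unit_Cost unfolding result_def by blast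
    moreover have "coeff_prog M off = RS 1 (Cell ld) (RLoad 4 out_index)"
      unfolding Unit_Cost by (simp add: coeff_prog_def)
    moreover have "\<delta> = 0" unfolding Unit_Cost by (simp add: width_def)
    ultimately show ?thesis using i r[OF Unit_Cost] s(3) by (auto simp: ix less_Suc_eq)
  next
    case Bit_Length
    obtain z where z: "kro (partition_function k I) (kindex D d) = of_int z" "\<bar>z\<bar> \<le> height"
        "imem s (off + 4) (kindex D d) = z mod modulus" and h: "imem s vH 0 = height" "imem s vQ 0 = modulus"
      using s(2) kindex_less[of d] Bit_Length unfolding result_def by blast
    \<comment> \<open>\<open>z + height\<close> lies between 0 and \<open>2 * height\<close>, below
      the modulus, so the shifted residue is exact.\<close>
    have "(z + height) mod modulus = z + height"
      using z(2) by (intro mod_pos_pos_trivial) (auto simp: modulus_def)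
    then have "(z mod modulus + height) mod modulus - height = z" by (simp only: mod_add_left_eq)
    then have v: "ival s (ISub (IMod (IAdd (ILoad (off + 4) out_index) (Cell vH)) (Cell vQ)) (Cell vH)) = z"
      using h z(3) by (simp add: ix)
    have \<delta>: "\<delta> = 1" unfolding Bit_Length by (simp add: width_def)
    have a: "ival s (IAdd (INum 1) (IMul (Cell ld) (IAdd sI (INum 1)))) = int (1 + d * lw)"
      using s(3) sv by (simp add: \<delta> distrib_left)
    have "out_code ! (1 + (d * lw + 0)) = z"
      using out_code_nth[of d 0] s(4) z(1) \<delta> unfolding term_code_def Bit_Length by simp
    then have o: "out_code ! (1 + d * lw) = z" by simp
    have "\<bar>z\<bar> \<le> B" using z(2) B[OF Bit_Length] height_ge by (simp add: modulus_def)
    moreover have "\<forall>i<1 + (d * lw + \<delta>). imem (iupd 1 (1 + d * lw) z s) 1 i = out_code ! i"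
      using i o by (auto simp: \<delta> less_Suc_eq)
    moreover have "coeff_prog M off = IS 1 (IAdd (INum 1) (IMul (Cell ld) (IAdd sI (INum 1))))
       (ISub (IMod (IAdd (ILoad (off + 4) out_index) (Cell vH)) (Cell vQ)) (Cell vH))"
      unfolding Bit_Length by (simp add: coeff_prog_def)
    ultimately show ?thesis by (simp only: wp.simps v a nat_int) (use Bit_Length in blast)
  qed
qed

lemma iwrites_coeff: "iwrites (coeff_prog M off) \<subseteq> {1}" "rwrites (coeff_prog M off) \<subseteq> {1}"
  by (cases M; simp add: coeff_prog_def)+

lemma result_frame: "result off s \<Longrightarrow> frame U U' s s' \<Longrightarrow> vH \<notin> U \<Longrightarrow> vQ \<notin> U \<Longrightarrow> off + 4 \<notin> U \<Longrightarrow> 4 \<notin> U' \<Longrightarrow>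
    result off s'"
  by (simp add: result_def frame_def)

text \<open>For the output program, which writes array 1: this array lies below \<open>vU\<close>,
  where \<open>tables_frame\<close> admits no writes, but no table is kept in it.\<close>

lemma tables_frame': "tables s \<Longrightarrow> frame U U' s s' \<Longrightarrow> U \<inter> ({0} \<union> {2..<vU}) = {} \<Longrightarrow> tables s'"
proof -
  assume "tables s" and fr: "frame U U' s s'" and U: "U \<inter> ({0} \<union> {2..<vU}) = {}"
  have "imem s' a = imem s a" if "a = 0 \<or> 2 \<le> a \<and> a < vU" for a
  proof -
    have "a \<notin> U" using U that by auto
    then show ?thesis using fr by (simp add: frame_def)
  qed
  then show ?thesis using \<open>tables s\<close> by (simp add: tables_def input_ok_def)
qed

lemma wp_output:
  assumes s: "tables s" "result off s" and B: "M = Bit_Length \<Longrightarrow> modulus \<le> B" and off: "36 \<le> off"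
  shows "wp (output_prog M off) (outputs M sv (partition_function k I)) s"
proof -
  let ?a = "IS 1 (IAdd (IAdd (INum (int (1 + width M))) (IMul (Cell ld) (IAdd sI (INum (int (width M)))))) (Cell lx))
           (ISub (IMod (IDiv (Cell ld) (ILoad aWP (Cell lx))) (Cell vW)) (Cell vTT))"
  let ?b = "coeff_prog M off ;; For False lx sI ?a"
  let ?R = "\<lambda>d s'. M = Unit_Cost \<longrightarrow> (\<forall>d'<d. rmem s' 1 d' = kro (partition_function k I) (kindex D d'))"
  let ?I = "\<lambda>d s'. (\<forall>i<1 + d * lw. imem s' 1 i = out_code ! i) \<and> ?R d s'"
  have sub: "iwrites ?b \<subseteq> {1, lx}" "rwrites ?b \<subseteq> {1}" using iwrites_coeff[of off] by auto
  have main: "wp (For False ld (Cell vD) ?b) (outputs M sv (partition_function k I)) s1"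
    if s1: "tables s1" "result off s1" "imem s1 1 0 = int D" for s1
  proof (rule wp_For[where n = D and I = ?I])
    show "ival s1 (Cell vD) = int D" using s1 by (simp add: tables_vD)
    show "int D \<le> B" "D \<le> (if False then Y else X)" using X_B D_le by auto
    show "ld \<notin> iwrites ?b" using sub by auto
    show "?I 0 s1" using s1(3) out_code_0 by simp
    fix d s2 assume d: "d < D" and I2: "?I d s2" and d2: "imem s2 ld 0 = int d"
      and fr: "frame (insert ld (iwrites ?b)) (rwrites ?b) s1 s2"
    have s2: "tables s2" by (rule tables_frame'[OF s1(1) fr]) (use sub in auto)
    have r2: "result off s2" by (rule result_frame[OF s1(2) fr]) (use sub off in auto)
    have c: "wp (coeff_prog M off) (\<lambda>s'. (\<forall>i<1 + (d * lw + \<delta>). imem s' 1 i = out_code ! i) \<and> ?R (Suc d) s') s2"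
      by (rule wp_coeff[OF s2 r2 d2 d B]) (use I2 in auto)
    have l: "wp (For False lx sI ?a) (?I (Suc d)) s3"
      if s3: "tables s3" "imem s3 ld 0 = int d" "\<forall>i<1 + (d * lw + \<delta>). imem s3 1 i = out_code ! i" "?R (Suc d) s3" for s3
    proof (rule wp_For[where n = sv and I = "\<lambda>x s'. \<forall>i<1 + (d * lw + (\<delta> + x)). imem s' 1 i = out_code ! i"])
      show "ival s3 sI = int sv" using s3(1) by (simp add: tables_def input_ok_def)
      show "int sv \<le> B" "sv \<le> (if False then Y else X)" using X_B sv_le by auto
      show "\<forall>i<1 + (d * lw + (\<delta> + 0)). imem s3 1 i = out_code ! i" using s3(3) by simp
      fix x s4 assume x: "x < sv" and I4: "\<forall>i<1 + (d * lw + (\<delta> + x)). imem s4 1 i = out_code ! i"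
        and x4: "imem s4 lx 0 = int x" and fr4: "frame (insert lx (iwrites ?a)) (rwrites ?a) s3 s4"
      have s4: "tables s4" by (rule tables_frame'[OF s3(1) fr4]) auto
      have d4: "imem s4 ld 0 = int d" using fr4 s3(2) by (simp add: frame_def)
      have W4: "imem s4 vW 0 = int W" "imem s4 vTT 0 = int TT" "imem s4 aWP x = int (W ^ x)" "imem s4 0 2 = int sv"
        using s4 x by (simp_all add: tables_def input_ok_def)
      have "ival s4 (ISub (IMod (IDiv (Cell ld) (ILoad aWP (Cell lx))) (Cell vW)) (Cell vTT)) =
          int (d div W ^ x mod W) - int TT"
        using d4 x4 W4 by (simp add: zdiv_int zmod_int)
      also have "\<dots> = unkron sv TT d ! x" using x by (simp add: unkron_def W_def)
      finally have v: "ival s4 (ISub (IMod (IDiv (Cell ld) (ILoad aWP (Cell lx))) (Cell vW)) (Cell vTT)) = unkron sv TT d ! x" .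
      have "d div W ^ x mod W < 2 * TT + 1" using W_ge by (simp add: W_def)
      then have "\<bar>int (d div W ^ x mod W) - int TT\<bar> \<le> int TT" by linarith
      then have b: "\<bar>unkron sv TT d ! x\<bar> \<le> B" using x code_B(1) by (simp add: unkron_def W_def)
      have a: "ival s4 (IAdd (IAdd (INum (int (1 + width M))) (IMul (Cell ld) (IAdd sI (INum (int (width M)))))) (Cell lx)) =
          int (1 + (d * lw + (\<delta> + x)))" using d4 x4 W4(4) by simp
      have "out_code ! (1 + (d * lw + (\<delta> + x))) = unkron sv TT d ! x"
        using out_code_nth[OF d, of "\<delta> + x"] x term_code_nth[of x "(kro (partition_function k I) (kindex D d), unkron sv TT d)" M]
        by simp
      then have "\<forall>i<1 + (d * lw + (\<delta> + Suc x)). imem (iupd 1 (1 + (d * lw + (\<delta> + x))) (unkron sv TT d ! x) s4) 1 i = out_code ! i"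
        using I4 by (auto simp: less_Suc_eq)
      then show "wp ?a (\<lambda>s'. \<forall>i<1 + (d * lw + (\<delta> + Suc x)). imem s' 1 i = out_code ! i) s4"
        using b by (simp only: wp.simps v a nat_int)
    next
      fix s' assume "\<forall>i<1 + (d * lw + (\<delta> + sv)). imem s' 1 i = out_code ! i"
        and fr': "frame (insert lx (iwrites ?a)) (rwrites ?a) s3 s'"
      moreover have "d * lw + (\<delta> + sv) = Suc d * lw" by simp
      ultimately show "?I (Suc d) s'" using s3(4) by (simp add: frame_def)
    qed simp_all
    show "wp ?b (?I (Suc d)) s2" unfolding wp.simps(4)
    proof (rule wp_frame_mono[OF c], elim conjE, rule l)
      fix s3 assume fr3: "frame (iwrites (coeff_prog M off)) (rwrites (coeff_prog M off)) s2 s3"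
      show "tables s3" by (rule tables_frame'[OF s2 fr3]) (use iwrites_coeff[of off] in auto)
      have "ld \<notin> iwrites (coeff_prog M off)" using iwrites_coeff[of off] by auto
      then show "imem s3 ld 0 = int d" using fr3 d2 by (simp add: frame_def)
    qed
  next
    fix s' assume "?I D s'"
    then show "outputs M sv (partition_function k I) s'" by (intro outputsI) (simp_all add: length_out_code)
  qed auto
  let ?s1 = "iupd 1 0 (int D) s"
  have "wp (For False ld (Cell vD) ?b) (outputs M sv (partition_function k I)) ?s1"
  proof (rule main)
    have fr: "frame {1} {} s ?s1" by (simp add: frame_def)
    show "tables ?s1" by (rule tables_frame'[OF s(1) fr]) auto
    show "result off ?s1" by (rule result_frame[OF s(2) fr]) (use off in auto)
  qed simp
  then show ?thesis unfolding output_prog_def using s X_B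
    by (simp add: tables_vD del: wp.simps(6))
qed

text \<open>The last conjunct lets the caller conclude that array \<open>off\<close> is still 0
  beyond the coefficients, as the relation \<open>reduced\<close> requires.\<close>

lemma wp_modulus:
  assumes s: "holds s" "imem s vTC 0 = int (length terms)" "\<forall>t<length terms. located s t"
    and M: "M = Bit_Length" and B: "modulus \<le> B" and off: "36 \<le> off"
  shows "wp (modulus_prog k off) (\<lambda>s'. imem s' vH 0 = height \<and> imem s' vQ 0 = modulus \<and>
     (\<forall>t<length terms. imem s' off t = int_coeff t mod modulus) \<and>
     (\<forall>t\<ge>length terms. imem s' off t = imem s off t)) s"
proof -
  let ?H = "\<lambda>s' :: real state. imem s' 0 = imem s 0 \<and> imem s' vTC = imem s vTC \<and> imem s' aTP = imem s aTP"
  let ?G = "\<lambda>s' :: real state. ?H s' \<and> imem s' off = imem s off"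
  have G: "holds s'" "imem s' 0 0 = int n" "imem s' vTC 0 = int (length terms)" "\<forall>t<length terms. located s' t"
    if "?H s'" for s'
    using that s holds_input_ok[OF s(1)] by (simp_all add: holds_def located_def input_ok_def)
  have hB: "height \<le> B" using B height_ge by (simp add: modulus_def)
  have c: "ival s' coeff_entry = int_coeff t"
    if s': "?H s'" and t: "t < length terms" and lt: "imem s' lt 0 = int t" for s' t
  proof -
    from G(4)[OF s'] t obtain p rest where p: "imem s' aTP t = int p" "drop p xs = term_code M (terms ! t) @ rest"
      by (auto simp: located_def occurs_def)
    have "p < length xs \<and> xs ! p = int_coeff t"
      using drop_nth[OF p(2), of 0] by (simp add: M term_code_def int_coeff_def)
    then show ?thesis using G(1)[OF s'] lt p(1) by (simp add: coeff_entry_def holds_def)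
  qed
  let ?a = "Asg vH (IMul (Cell vH) (IAdd (INum 1) (IMul coeff_entry coeff_entry)))"
  let ?A = "For False lt (Cell vTC) ?a"
  let ?b = "Asg vH (IMul (Cell vH) (INum (int k)))"
  let ?B = "For False lx nI ?b"
  let ?c = "IS off (Cell lt) (IMod coeff_entry (Cell vQ))"
  let ?C = "For False lt (Cell vTC) ?c"
  have A: "wp ?A (\<lambda>s'. ?G s' \<and> imem s' vH 0 = coeff_prod (length terms)) s1"
    if s1: "?G s1" "imem s1 vH 0 = 1" for s1
  proof (rule wp_For[where n = "length terms" and I = "\<lambda>j s'. imem s' vH 0 = coeff_prod j"])
    show "ival s1 (Cell vTC) = int (length terms)" using G(3)[of s1] s1(1) by simp
    show "int (length terms) \<le> B" "length terms \<le> (if False then Y else X)" using X_B terms_le by auto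
    show "imem s1 vH 0 = coeff_prod 0" using s1 by (simp add: coeff_prod_def)
    fix t s2 assume t: "t < length terms" and I2: "imem s2 vH 0 = coeff_prod t" and t2: "imem s2 lt 0 = int t"
      and fr: "frame (insert lt (iwrites ?a)) (rwrites ?a) s1 s2"
    have s2: "?H s2" using fr s1 by (simp add: frame_def)
    have "ival s2 (IMul (Cell vH) (IAdd (INum 1) (IMul coeff_entry coeff_entry))) = coeff_prod (Suc t)"
      using c[OF s2 t t2] I2 by (simp add: coeff_prod_def)
    moreover have "\<bar>coeff_prod (Suc t)\<bar> \<le> B"
      using coeff_prod_ge[of "Suc t"] coeff_prod_power_le[of "Suc t" 0] t hB by simp
    ultimately show "wp ?a (\<lambda>s'. imem s' vH 0 = coeff_prod (Suc t)) s2" by (simp only: wp.simps) simp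
  next
    fix s' assume "imem s' vH 0 = coeff_prod (length terms)" "frame (insert lt (iwrites ?a)) (rwrites ?a) s1 s'"
    then show "?G s' \<and> imem s' vH 0 = coeff_prod (length terms)" using s1 off by (auto simp: frame_def)
  qed simp_all
  have Bp: "wp ?B (\<lambda>s'. ?G s' \<and> imem s' vH 0 = height) s1"
    if s1: "?G s1" "imem s1 vH 0 = coeff_prod (length terms)" for s1
  proof (rule wp_For[where n = n and I = "\<lambda>j s'. imem s' vH 0 = coeff_prod (length terms) * int k ^ j"])
    show "ival s1 nI = int n" using G(2)[of s1] s1(1) by simp
    show "int n \<le> B" "n \<le> (if False then Y else X)" using X_B n_le by auto
    show "imem s1 vH 0 = coeff_prod (length terms) * int k ^ 0" using s1 by simp
    fix j and s2 :: "real state" assume j: "j < n" and I2: "imem s2 vH 0 = coeff_prod (length terms) * int k ^ j"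
    have "ival s2 (IMul (Cell vH) (INum (int k))) = coeff_prod (length terms) * int k ^ Suc j"
      using I2 by simp
    moreover have "0 \<le> coeff_prod (length terms) * int k ^ Suc j" using coeff_prod_ge[of "length terms"] by simp
    then have "\<bar>coeff_prod (length terms) * int k ^ Suc j\<bar> \<le> B"
      using coeff_prod_power_le[of "length terms" "Suc j"] j hB by linarith
    ultimately show "wp ?b (\<lambda>s'. imem s' vH 0 = coeff_prod (length terms) * int k ^ Suc j) s2"
      by (simp only: wp.simps) simp
  next
    fix s' assume "imem s' vH 0 = coeff_prod (length terms) * int k ^ n" "frame (insert lx (iwrites ?b)) (rwrites ?b) s1 s'"
    then show "?G s' \<and> imem s' vH 0 = height" using s1 off by (auto simp: frame_def height_def)
  qed simp_all
  have C: "wp ?C (\<lambda>s'. imem s' vH 0 = height \<and> imem s' vQ 0 = modulus \<and>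
     (\<forall>t<length terms. imem s' off t = int_coeff t mod modulus) \<and>
     (\<forall>t\<ge>length terms. imem s' off t = imem s off t)) s1"
    if s1: "?G s1" "imem s1 vH 0 = height" "imem s1 vQ 0 = modulus" for s1
  proof (rule wp_For[where n = "length terms" and I = "\<lambda>j s'. (\<forall>t<j. imem s' off t = int_coeff t mod modulus) \<and>
        (\<forall>t\<ge>length terms. imem s' off t = imem s off t)"])
    show "ival s1 (Cell vTC) = int (length terms)" using G(3)[of s1] s1(1) by simp
    show "int (length terms) \<le> B" "length terms \<le> (if False then Y else X)" using X_B terms_le by auto
    show "lt \<notin> iwrites ?c" using off by simp
    fix t s2 assume t: "t < length terms" and I2: "(\<forall>t'<t. imem s2 off t' = int_coeff t' mod modulus) \<and>
        (\<forall>t\<ge>length terms. imem s2 off t = imem s off t)"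
      and t2: "imem s2 lt 0 = int t" and fr: "frame (insert lt (iwrites ?c)) (rwrites ?c) s1 s2"
    have s2: "?H s2" "imem s2 vQ 0 = modulus" using fr s1 off by (auto simp: frame_def)
    have "0 < modulus" using height_ge by (simp add: modulus_def)
    then have "0 \<le> int_coeff t mod modulus" "int_coeff t mod modulus < modulus" by simp_all
    then have "\<bar>int_coeff t mod modulus\<bar> \<le> B" using B by linarith
    then show "wp ?c (\<lambda>s'. (\<forall>t'<Suc t. imem s' off t' = int_coeff t' mod modulus) \<and>
        (\<forall>t\<ge>length terms. imem s' off t = imem s off t)) s2"
      using c[OF s2(1) t t2] I2 t2 s2(2) t by (auto simp: less_Suc_eq)
  next
    fix s' assume "(\<forall>t<length terms. imem s' off t = int_coeff t mod modulus) \<and>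
        (\<forall>t\<ge>length terms. imem s' off t = imem s off t)" "frame (insert lt (iwrites ?c)) (rwrites ?c) s1 s'"
    then show "imem s' vH 0 = height \<and> imem s' vQ 0 = modulus \<and>
     (\<forall>t<length terms. imem s' off t = int_coeff t mod modulus) \<and>
        (\<forall>t\<ge>length terms. imem s' off t = imem s off t)" using s1 off by (auto simp: frame_def)
  qed (use off s1 in auto)
  let ?post = "\<lambda>s'. imem s' vH 0 = height \<and> imem s' vQ 0 = modulus \<and>
     (\<forall>t<length terms. imem s' off t = int_coeff t mod modulus) \<and>
     (\<forall>t\<ge>length terms. imem s' off t = imem s off t)"
  have 3: "wp (Asg vQ (IAdd (IMul (INum 2) (Cell vH)) (INum 1)) ;; ?C) ?post s1"
    if s1: "?G s1 \<and> imem s1 vH 0 = height" for s1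
  proof -
    have "wp ?C ?post (iupd vQ 0 modulus s1)" by (rule C) (use s1 off in auto)
    moreover have "ival s1 (IAdd (IMul (INum 2) (Cell vH)) (INum 1)) = modulus" using s1 by (simp add: modulus_def)
    moreover have "\<bar>modulus\<bar> \<le> B" using B height_ge by (simp add: modulus_def)
    ultimately show ?thesis by (simp del: wp.simps(6) ival.simps(3))
  qed
  have 2: "wp (?B ;; Asg vQ (IAdd (IMul (INum 2) (Cell vH)) (INum 1)) ;; ?C) ?post s1"
    if s1: "?G s1 \<and> imem s1 vH 0 = coeff_prod (length terms)" for s1
  proof -
    have "wp ?B (wp (Asg vQ (IAdd (IMul (INum 2) (Cell vH)) (INum 1)) ;; ?C) ?post) s1"
      by (rule wp_frame_mono[OF Bp], use s1 in blast, use s1 in blast) (rule 3)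
    then show ?thesis by (simp only: wp.simps(4))
  qed
  have "wp ?A (wp (?B ;; Asg vQ (IAdd (IMul (INum 2) (Cell vH)) (INum 1)) ;; ?C) ?post) (iupd vH 0 1 s)"
    by (rule wp_frame_mono[OF A], use off in simp, simp) (rule 2)
  then show ?thesis unfolding modulus_prog_def using B_ge by (simp only: wp.simps(2,4)) simp
qed

end

section \<open>The whole algorithm on one instance\<close>

lemma exec_imem_frame: "exec c s t m r s' \<Longrightarrow> a \<notin> cwrites c \<Longrightarrow> imem s' a = imem s a"
proof (induction rule: exec.induct)
  case (IfPos \<tau> s e c1 c2 t m r s')
  then show ?case by (cases "0 < ival s e") auto
qed auto

interpretation const: ring_embedding "Poly_Mapping.single 0 :: real \<Rightarrow> real_poly_ring"
  by standard (simp_all add: single_add single_diff mult_single flip: single_one)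

definition matmul_time :: "com \<Rightarrow> nat \<Rightarrow> nat \<Rightarrow> bool" where
  "matmul_time P N \<tau> \<longleftrightarrow> (\<forall>A B :: nat \<Rightarrow> nat \<Rightarrow> real_poly_ring. \<exists>t m r s'.
     exec P (matmul_input N A B) t m r s' \<and>
     (\<forall>i<N. \<forall>j<N. rmem s' 2 (N * i + j) = (\<Sum>l<N. A i l * B l j)) \<and> t \<le> \<tau>)"

definition multiply_setup :: "nat \<Rightarrow> prog" where
  "multiply_setup k = left_prog k ;; right_prog k ;; IS A0 (INum 0) (Cell vND)"

definition core_com :: "nat \<Rightarrow> com \<Rightarrow> com" where
  "core_com k P = Seq (compile (multiply_setup k)) (Seq (shift A0 R0 P) (compile (combine_prog k)))"

definition setup_prog :: "nat \<Rightarrow> nat \<Rightarrow> prog" where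
  "setup_prog k \<delta> = parse_prog k \<delta> ;; code_prog \<delta> ;; power_prog k"

text \<open>Lies above every integer array of the shifted program, so the integer arrays from here
  on are free to hold the simulated ring arrays.\<close>

definition array_bound :: "com \<Rightarrow> nat" where
  "array_bound P = Suc (Max (insert A0 (carrs (shift A0 R0 P))))"

text \<open>Only the core contains ring operations, so only the core is translated for the bit
  model; setup and output exist in a variant for each model.\<close>

definition solver :: "coeff_model \<Rightarrow> nat \<Rightarrow> com \<Rightarrow> com" where
  "solver M k P = (case M of
     Unit_Cost \<Rightarrow> Seq (compile (setup_prog k 0)) (Seq (core_com k P) (compile (output_prog M (array_bound P))))
   | Bit_Length \<Rightarrow> Seq (compile (setup_prog k 1 ;; modulus_prog k (array_bound P)))
       (Seq (cmod vQ (array_bound P) (core_com k P)) (compile (output_prog M (array_bound P)))))"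

lemmas prog_defs = left_prog_def right_prog_def combine_prog_def weight_prog_def select_prog_def
  factor_prog_def group_prog_def mul_prog_def test_exp_def sq_diff_def digit_exp_def edge_index_def
  term_index_def mul_index_def row_index_def sum_index_def parse_prog_def code_prog_def power_prog_def
  exp_entry_def out_index_def output_prog_def coeff_entry_def modulus_prog_def

lemma array_bound: "carrs (shift A0 R0 P) \<subseteq> {..<array_bound P}" "A0 < array_bound P"
proof -
  have "finite (insert A0 (carrs (shift A0 R0 P)))" by (simp add: finite_carrs)
  then have "x \<le> Max (insert A0 (carrs (shift A0 R0 P)))" if "x \<in> insert A0 (carrs (shift A0 R0 P))" for x
    using that by (rule Max_ge)
  then show "carrs (shift A0 R0 P) \<subseteq> {..<array_bound P}" "A0 < array_bound P"
    unfolding array_bound_def by (auto simp: less_Suc_eq_le)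
qed

text \<open>Among the static facts about the programs, \<open>bdepth\<close> at most 2 is the
  decisive one: it keeps the time outside the multiplication quadratic in \<open>Y\<close>.\<close>

lemma multiply_setup_static:
  "wf_prog (multiply_setup k)" "arrs (multiply_setup k) \<subseteq> {..<A0}"
  "iwrites (multiply_setup k) \<subseteq> {vU..A0} - {vQ, vH}" "rwrites (multiply_setup k) = {2, 3, 5, 6}"
  "bdepth (multiply_setup k) \<le> 2"
  unfolding multiply_setup_def prog_defs by auto

lemma combine_static:
  "wf_prog (combine_prog k)" "arrs (combine_prog k) \<subseteq> {..<A0}"
  "iwrites (combine_prog k) \<subseteq> {vU..<A0} - {vQ, vH}" "bdepth (combine_prog k) \<le> 2"
  unfolding prog_defs by auto

lemma setup_static:
  "wf_prog (setup_prog k \<delta>)" "arrs (setup_prog k \<delta>) \<subseteq> {..<A0}"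
  "iwrites (setup_prog k \<delta>) \<subseteq> {2..<A0}" "rwrites (setup_prog k \<delta>) = {}" "bdepth (setup_prog k \<delta>) \<le> 2"
  unfolding setup_prog_def prog_defs by auto

lemma modulus_static:
  "wf_prog (modulus_prog k off) \<longleftrightarrow> off \<noteq> lt" "arrs (modulus_prog k off) \<subseteq> {..<A0}"
  "iwrites (modulus_prog k off) = {vH, lt, lx, vQ, off}" "rwrites (modulus_prog k off) = {}"
  "bdepth (modulus_prog k off) \<le> 2"
  unfolding prog_defs by auto

lemma output_static:
  "wf_prog (output_prog M off)" "arrs (output_prog M off) \<subseteq> {..<A0} \<union> {off + 4}"
  "bdepth (output_prog M off) \<le> 2"
  unfolding prog_defs by (cases M; auto simp: coeff_prog_def out_index_def)+

lemma core_static: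
  "carrs (core_com k P) \<subseteq> {..<array_bound P}" "vQ \<notin> cwrites (core_com k P)"
  "vH \<notin> cwrites (core_com k P)" "a < vU \<Longrightarrow> a \<notin> cwrites (core_com k P)"
proof -
  have a: "{..A0} \<subseteq> {..<array_bound P}" using array_bound(2)[of P] by auto
  have s: "arrs (multiply_setup k) \<subseteq> {..A0}" "iwrites (multiply_setup k) \<subseteq> {..A0}"
    "arrs (combine_prog k) \<subseteq> {..A0}" "iwrites (combine_prog k) \<subseteq> {..A0}"
    using multiply_setup_static(2,3)[of k] combine_static(2,3)[of k] by auto
  show "carrs (core_com k P) \<subseteq> {..<array_bound P}"
    using array_bound(1)[of P] s[THEN order_trans, OF a] by (simp add: core_com_def carrs_compile)
  show "vQ \<notin> cwrites (core_com k P)" "vH \<notin> cwrites (core_com k P)" "a < vU \<Longrightarrow> a \<notin> cwrites (core_com k P)"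
    using multiply_setup_static(3)[of k] combine_static(3)[of k]
    by (auto simp: core_com_def cwrites_compile cwrites_shift)
qed

section \<open>The core around the given multiplication program\<close>

context pcsp_run
begin

lemma coeffs_frame: "coeffs s \<Longrightarrow> frame U U' s s' \<Longrightarrow> 0 \<notin> U' \<Longrightarrow> coeffs s'"
  by (simp add: coeffs_def frame_def)

lemma wp_multiply_setup:
  assumes s: "tables s" "coeffs s" and z: "\<forall>x. rmem s 5 x = 0" "\<forall>x. rmem s 6 x = 0"
  shows "wp (multiply_setup k) (\<lambda>s'. (\<forall>x. rmem s' 5 x = flat left_matrix x) \<and>
     (\<forall>x. rmem s' 6 x = flat right_matrix x) \<and> imem s' A0 = (imem s A0)(0 := int ND)) s"
proof -
  let ?post = "\<lambda>s'. (\<forall>x. rmem s' 5 x = flat left_matrix x) \<and>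
     (\<forall>x. rmem s' 6 x = flat right_matrix x) \<and> imem s' A0 = (imem s A0)(0 := int ND)"
  have NDB: "int ND \<le> B"
  proof -
    have "(n + 2) div 3 \<le> n" using thirds by linarith
    then have "ND \<le> k ^ n * X"
      using k_ge D_le unfolding ND_def N3_def by (intro mult_le_mono power_increasing) auto
    then show ?thesis using B_le by (meson of_nat_le_iff order_trans)
  qed
  have l: "iwrites (left_prog k) \<inter> {..<vU} = {}" "rwrites (left_prog k) = {2, 3, 5}"
    "iwrites (right_prog k) \<inter> {..<vU} = {}" "rwrites (right_prog k) = {2, 3, 6}"
    "A0 \<notin> iwrites (left_prog k)" "A0 \<notin> iwrites (right_prog k)"
    unfolding prog_defs by auto
  show ?thesis unfolding multiply_setup_def wp.simps(4)
  proof (rule wp_frame_mono[OF wp_left[OF s z(1)]])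
    fix s1 assume 1: "\<forall>x. rmem s1 5 x = flat left_matrix x"
      and fr: "frame (iwrites (left_prog k)) (rwrites (left_prog k)) s s1"
    have s1: "tables s1" "coeffs s1" "\<forall>x. rmem s1 (5 + 1) x = 0"
      using tables_frame[OF fr l(1) s(1)] coeffs_frame[OF s(2) fr] z(2) fr l(2) by (auto simp: frame_def)
    show "wp (right_prog k) (wp (IS A0 (INum 0) (Cell vND)) ?post) s1"
    proof (rule wp_frame_mono[OF wp_right[OF s1]])
      fix s2 assume 2: "\<forall>x. rmem s2 (5 + 1) x = flat right_matrix x"
        and fr2: "frame (iwrites (right_prog k)) (rwrites (right_prog k)) s1 s2"
      have "tables s2" by (rule tables_frame[OF fr2 l(3) s1(1)])
      then have "imem s2 vND 0 = int ND" by (simp add: tables_def ND_def)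
      moreover have "rmem s2 5 = rmem s1 5" using fr2 l(4) by (simp add: frame_def)
      moreover have "imem s2 A0 = imem s A0" using fr2 fr l(5,6) by (simp add: frame_def)
      ultimately show "wp (IS A0 (INum 0) (Cell vND)) ?post s2"
        using 1 2 NDB by simp
    qed
  qed
qed

text \<open>The multiplication program is specified only for memory that is 0 outside its input, so
  the arrays it is moved to must be untouched before the matrices are written there.\<close>

lemma core_correct:
  assumes s: "tables s" "coeffs s" "bdd s" and z: "\<And>r. 1 \<le> r \<Longrightarrow> rmem s r = (\<lambda>_. 0)"
    "\<And>a. A0 \<le> a \<Longrightarrow> imem s a = (\<lambda>_. 0)"
    and P: "matmul_time P ND \<tau>" and S: "S = {..<A0} \<union> {array_bound P + 4}"
  shows "\<exists>t m r s'. exec (core_com k P) s t m r s' \<and>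
     (\<forall>d<D. rmem s' 4 d = kro (partition_function k I) d) \<and> tables s' \<and> bdd s' \<and>
     t \<le> T (multiply_setup k) + \<tau> + T (combine_prog k)"
proof -
  have sub: "{..<A0} \<subseteq> S" using S by blast
  let ?Q = "\<lambda>s'. ((\<forall>x. rmem s' 5 x = flat left_matrix x) \<and>
     (\<forall>x. rmem s' 6 x = flat right_matrix x) \<and> imem s' A0 = (imem s A0)(0 := int ND)) \<and>
     frame (iwrites (multiply_setup k)) (rwrites (multiply_setup k)) s s'"
  have w1: "wp (multiply_setup k) ?Q s"
    by (rule wp_frame_mono[OF wp_multiply_setup[OF s(1,2)]]) (use z(1) in auto)
  obtain t1 m1 r1 s1 where 1: "exec (compile (multiply_setup k)) s t1 m1 r1 s1" "?Q s1" "bdd s1"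
      "t1 \<le> T (multiply_setup k)"
    using wp_sound[OF w1 s(3) multiply_setup_static(1) order_trans[OF multiply_setup_static(2) sub]] by blast
  have fr1: "frame {vU..A0} {2, 3, 5, 6} s s1"
    using 1(2) multiply_setup_static(3,4)[of k] by (auto simp: frame_def)
  have s1: "tables s1" "coeffs s1"
  proof -
    have "{vU..A0} \<inter> {..<vU} = {}" by auto
    then show "tables s1" by (rule tables_frame[OF fr1 _ s(1)])
    show "coeffs s1" by (rule coeffs_frame[OF s(2) fr1]) simp
  qed
  let ?h = "Poly_Mapping.single 0 :: real \<Rightarrow> real_poly_ring"
  let ?A = "\<lambda>i j. ?h (left_matrix i j)" and ?B = "\<lambda>i j. ?h (right_matrix i j)"
  obtain t2 m2 r2 v where v: "exec P (matmul_input ND ?A ?B) t2 m2 r2 v"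
      "\<forall>i<ND. \<forall>j<ND. rmem v 2 (ND * i + j) = (\<Sum>l<ND. ?A i l * ?B l j)" "t2 \<le> \<tau>"
    using P unfolding matmul_time_def by meson
  have im: "imem s1 (A0 + a) = imem (matmul_input ND ?A ?B) a" for a
  proof (cases "a = 0")
    case True
    then show ?thesis using 1(2) z(2)[of A0] by (auto simp: matmul_input_def)
  next
    case False
    then have "imem s1 (A0 + a) = imem s (A0 + a)" using fr1 by (simp add: frame_def)
    then show ?thesis using z(2)[of "A0 + a"] False by (auto simp: matmul_input_def)
  qed
  have rm: "?h (rmem s1 (R0 + a) i) = rmem (matmul_input ND ?A ?B) a i" for a i
  proof -
    consider "a = 0" | "a = 1" | "2 \<le> a" by linarith
    then show ?thesis
    proof cases
      case 3
      then have "rmem s1 (R0 + a) = rmem s (R0 + a)" using fr1 by (simp add: frame_def)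
      then show ?thesis using z(1)[of "R0 + a"] 3 by (simp add: matmul_input_def)
    qed (use 1(2) in \<open>simp_all add: matmul_input_def flat_def\<close>)
  qed
  have sh: "const.shifted A0 R0 (matmul_input ND ?A ?B) s1"
    unfolding const.shifted_def using im rm by blast
  obtain m3 r3 s3 where 3: "exec (shift A0 R0 P) s1 t2 m3 r3 s3" "const.shifted A0 R0 v s3"
      "\<forall>a<A0. imem s3 a = imem s1 a" "\<forall>a<R0. rmem s3 a = rmem s1 a"
    using const.exec_shift[OF v(1) sh] by blast
  have s3: "tables s3" "coeffs s3"
    using s1 3(3,4) tables_cong[of s3 s1] by (auto simp: coeffs_def)
  \<comment> \<open>This array belongs to \<open>S\<close>, so \<open>bdd\<close> has to be carried
    across the multiplication program for it; it lies beyond everything that program writes.\<close>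
  have "array_bound P + 4 \<notin> cwrites (shift A0 R0 P)"
  proof -
    have "cwrites c \<subseteq> carrs c" for c by (induction c) auto
    then show ?thesis using array_bound(1)[of P] by fastforce
  qed
  then have "imem s3 (array_bound P + 4) = imem s1 (array_bound P + 4)"
    using exec_imem_frame[OF 3(1)] by blast
  then have "imem s3 a = imem s1 a" if "a \<in> S" for a using that S 3(3) by auto
  then have b3: "bdd s3" using 1(3) by (simp add: bdd_def)
  have C3: "rmem s3 (R0 + 2) ((a * D + i) * ND + c) = entry a c i"
    if a: "a < N1" and i: "i < D" and c: "c < N3" for a i c
  proof -
    have "N3 * 1 \<le> N3 * D" using D_ge by (intro mult_le_mono2)
    then have cN: "c < ND" using c unfolding ND_def by linarith
    have "?h (rmem s3 (R0 + 2) x) = rmem v 2 x" for x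
      using 3(2) unfolding const.shifted_def by blast
    then have "?h (rmem s3 (R0 + 2) ((a * D + i) * ND + c)) = rmem v 2 (ND * (a * D + i) + c)"
      by (simp only: mult.commute[of ND])
    also have "\<dots> = (\<Sum>l<ND. ?A (a * D + i) l * ?B l c)"
      using v(2) row_less[OF a i] cN by blast
    also have "\<dots> = (\<Sum>l<ND. ?h (left_matrix (a * D + i) l * right_matrix l c))"
      by (simp only: const.h_mult)
    also have "\<dots> = ?h (\<Sum>l<ND. left_matrix (a * D + i) l * right_matrix l c)"
    proof -
      have "(\<Sum>l<j. ?h (g l)) = ?h (\<Sum>l<j. g l)" for g and j :: nat
        by (induction j) (simp_all add: const.h_add const.h_0)
      then show ?thesis .
    qed
    also have "\<dots> = ?h (entry a c i)" by (simp only: matrix_product[OF a i c])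
    \<comment> \<open>Constant polynomials are equal only if their values are, which brings the
      identity back to the reals.\<close>
    finally show ?thesis by (simp add: inj_eq)
  qed
  have w4: "wp (combine_prog k) (\<lambda>s'. (\<forall>d<D. rmem s' 4 d = kro (partition_function k I) d) \<and>
      frame (iwrites (combine_prog k)) (rwrites (combine_prog k)) s3 s') s3"
    by (rule wp_frame_mono[OF wp_combine[OF s3]]) (use C3 in auto)
  obtain t4 m4 r4 s4 where 4: "exec (compile (combine_prog k)) s3 t4 m4 r4 s4"
      "\<forall>d<D. rmem s4 4 d = kro (partition_function k I) d"
      "frame (iwrites (combine_prog k)) (rwrites (combine_prog k)) s3 s4" "bdd s4" "t4 \<le> T (combine_prog k)"
    using wp_sound[OF w4 b3 combine_static(1) order_trans[OF combine_static(2) sub]] by blast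
  have "tables s4" by (rule tables_frame[OF 4(3) _ s3(1)]) (use combine_static(3)[of k] in auto)
  moreover have "exec (core_com k P) s (t1 + (t2 + t4)) (max m1 (max m3 m4)) (r1 + (r3 + r4)) s4"
    unfolding core_com_def by (intro exec.Seq[OF 1(1)] exec.Seq[OF 3(1) 4(1)])
  moreover have "t1 + (t2 + t4) \<le> T (multiply_setup k) + \<tau> + T (combine_prog k)"
    using 1(4) v(3) 4(5) by linarith
  ultimately show ?thesis using 4(2,4) by blast
qed

end

section \<open>Complete runs in the two cost models\<close>

context pcsp_input
begin

lemma wp_setup:
  assumes s: "holds s"
  shows "wp (setup_prog k \<delta>) (\<lambda>s'. tables s' \<and> holds s' \<and> (\<forall>t<length terms. located s' t)) s"
proof -
  have w: "iwrites (parse_prog k \<delta>) = {2, 3, 4, 5, 6, 7, 27, 28}" "iwrites (code_prog \<delta>) = {8, 9, 10, 11, 12, 28, 29}"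
    "iwrites (power_prog k) = {13, 14, 15, 16, 17, 29}"
    unfolding prog_defs by auto
  show ?thesis unfolding setup_prog_def wp.simps(4)
  proof (rule wp_frame_mono[OF wp_parse[OF s]], elim conjE)
    fix s1 assume 1: "imem s1 vF 0 = int F" "imem s1 vTC 0 = int (length terms)"
      "\<forall>f<F. imem s1 aST f = int (start f) \<and> imem s1 aCNT f = int (length (tss ! f))"
      "\<forall>t<length terms. located s1 t" "frame (iwrites (parse_prog k \<delta>)) (rwrites (parse_prog k \<delta>)) s s1"
    have h1: "holds s1" using s 1(5) by (simp add: holds_def frame_def w)
    show "wp (code_prog \<delta>) (wp (power_prog k) (\<lambda>s'. tables s' \<and> holds s' \<and> (\<forall>t<length terms. located s' t))) s1"
    proof (rule wp_frame_mono[OF wp_code[OF h1 1(2,4)]], elim conjE)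
      fix s2 assume 2: "imem s2 vTT 0 = int TT" "imem s2 vW 0 = int W" "\<forall>x\<le>sv. imem s2 aWP x = int (W ^ x)"
        "imem s2 vD 0 = int D" "\<forall>t<length terms. imem s2 aE t = int (kcode sv W (exponent (snd (terms ! t))))"
        "frame (iwrites (code_prog \<delta>)) (rwrites (code_prog \<delta>)) s1 s2"
      have h2: "holds s2" using h1 2(6) by (simp add: holds_def frame_def w)
      have "imem s2 0 0 = int n" using holds_input_ok[OF h2] by (simp add: input_ok_def)
      from wp_power[OF this 2(4)]
      show "wp (power_prog k) (\<lambda>s'. tables s' \<and> holds s' \<and> (\<forall>t<length terms. located s' t)) s2"
      proof (rule wp_frame_mono, elim conjE)
        fix s3 assume 3: "\<forall>x\<le>n. imem s3 aKP x = int (k ^ x)" "imem s3 vN1 0 = int N1" "imem s3 vN2 0 = int N2"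
          "imem s3 vN3 0 = int N3" "imem s3 vND 0 = int (N3 * D)"
          "frame (iwrites (power_prog k)) (rwrites (power_prog k)) s2 s3"
        have f23: "imem s3 a = imem s2 a" if "a \<notin> {13, 14, 15, 16, 17, 29}" for a
          using 3(6) that by (simp add: frame_def w)
        have f12: "imem s2 a = imem s1 a" if "a \<notin> {8, 9, 10, 11, 12, 28, 29}" for a
          using 2(6) that by (simp add: frame_def w)
        have h3: "holds s3" using h2 by (simp add: holds_def f23)
        have "\<forall>t<length terms. located s3 t" using 1(4) by (simp add: located_def f23 f12)
        moreover have "tables s3"
          unfolding tables_def using holds_input_ok[OF h3] 1(1,2,3) 2(1-5) 3(1-5) by (simp add: f23 f12)
        ultimately show "tables s3 \<and> holds s3 \<and> (\<forall>t<length terms. located s3 t)" using h3 by blast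
      qed
    qed
  qed
qed

lemma solver_Unit_Cost:
  assumes M: "M = Unit_Cost" and ys: "ys = concat (map (ring_code M) tss)"
    and P: "matmul_time P ND \<tau>" and S: "S = {..<A0} \<union> {array_bound P + 4}"
    and xsB: "\<forall>x\<in>set xs. \<bar>x\<bar> \<le> B"
  shows "\<exists>t m r s'. exec (solver M k P) (input_state xs ys) t m r s' \<and>
     outputs M sv (partition_function k I) s' \<and>
     t \<le> T (setup_prog k \<delta>) + (T (multiply_setup k) + \<tau> + T (combine_prog k)) + T (output_prog M (array_bound P))"
proof -
  have sub: "{..<A0} \<subseteq> S" using S by blast
  have \<delta>: "\<delta> = 0" unfolding M by (simp add: width_def)
  let ?s = "input_state xs ys"
  have h: "holds ?s" by (simp add: holds_def input_state_def)
  have b: "bdd ?s" using xsB B_ge by (auto simp: bdd_def input_state_def)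
  have "ring_code Unit_Cost = map fst" by (rule ext) simp
  then have "ys = map fst terms" unfolding ys M by (simp add: terms_def map_concat)
  then have c: "coeffs ?s" by (simp add: coeffs_def input_state_def)
  have w1: "wp (setup_prog k \<delta>) (\<lambda>s'. tables s' \<and> frame (iwrites (setup_prog k \<delta>)) (rwrites (setup_prog k \<delta>)) ?s s') ?s"
    by (rule wp_frame_mono[OF wp_setup[OF h]]) auto
  obtain t1 m1 r1 s1 where 1: "exec (compile (setup_prog k \<delta>)) ?s t1 m1 r1 s1" "tables s1"
      "frame (iwrites (setup_prog k \<delta>)) (rwrites (setup_prog k \<delta>)) ?s s1" "bdd s1" "t1 \<le> T (setup_prog k \<delta>)"
    using wp_sound[OF w1 b setup_static(1) order_trans[OF setup_static(2) sub]] by blast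
  have fr1: "frame {2..<A0} {} ?s s1"
    using 1(3) setup_static(3,4)[of k \<delta>] by (auto simp: frame_def)
  have c1: "coeffs s1" using coeffs_frame[OF c fr1] by simp
  have z1: "rmem s1 r = (\<lambda>_. 0)" if "1 \<le> r" for r
    using fr1 that by (auto simp: frame_def input_state_def)
  have z2: "imem s1 a = (\<lambda>_. 0)" if "A0 \<le> a" for a
    using fr1 that by (auto simp: frame_def input_state_def)
  obtain t2 m2 r2 s2 where 2: "exec (core_com k P) s1 t2 m2 r2 s2"
      "\<forall>d<D. rmem s2 4 d = kro (partition_function k I) d" "tables s2" "bdd s2"
      "t2 \<le> T (multiply_setup k) + \<tau> + T (combine_prog k)"
    using core_correct[OF 1(2) c1 1(4) z1 z2 P S] by blast
  have res: "result (array_bound P) s2" unfolding result_def using 2(2) M by simp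
  have w3: "wp (output_prog M (array_bound P)) (outputs M sv (partition_function k I)) s2"
    by (rule wp_output[OF 2(3) res]) (use M array_bound(2)[of P] in auto)
  have "arrs (output_prog M (array_bound P)) \<subseteq> S" using output_static(2) S by simp
  from wp_sound[OF w3 2(4) output_static(1) this] obtain t3 m3 r3 s3 where
    3: "exec (compile (output_prog M (array_bound P))) s2 t3 m3 r3 s3"
      "outputs M sv (partition_function k I) s3" "t3 \<le> T (output_prog M (array_bound P))" by blast
  have so: "solver M k P = Seq (compile (setup_prog k \<delta>)) (Seq (core_com k P) (compile (output_prog M (array_bound P))))"
    unfolding \<delta> unfolding solver_def M by simp
  have "exec (solver M k P) ?s (t1 + (t2 + t3)) (max m1 (max m2 m3)) (r1 + (r2 + r3)) s3"
    unfolding so by (intro exec.Seq[OF 1(1)] exec.Seq[OF 2(1) 3(1)])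
  moreover have "t1 + (t2 + t3) \<le> T (setup_prog k \<delta>) + (T (multiply_setup k) + \<tau> + T (combine_prog k)) +
      T (output_prog M (array_bound P))" using 1(5) 2(5) 3(3) by linarith
  ultimately show ?thesis using 3(2) by blast
qed

lemma solver_Bit_Length:
  assumes M: "M = Bit_Length" and P: "matmul_time P ND \<tau>" and S: "S = {..<A0} \<union> {array_bound P + 4}"
    and xsB: "\<forall>x\<in>set xs. \<bar>x\<bar> \<le> B" and qB: "modulus \<le> B"
    and ints: "\<forall>t<length terms. fst (terms ! t) \<in> \<int>"
  shows "\<exists>t m r s'. exec (solver M k P) (input_state xs []) t m r s' \<and>
     outputs M sv (partition_function k I) s' \<and>
     t \<le> T (setup_prog k \<delta>) + T (modulus_prog k (array_bound P)) +
       10 * len B * (T (multiply_setup k) + \<tau> + T (combine_prog k)) + T (output_prog M (array_bound P))"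
proof -
  define off where "off = array_bound P"
  have off: "A0 < off" unfolding off_def by (rule array_bound)
  have sub: "{..<A0} \<subseteq> S" using S by blast
  have \<delta>: "\<delta> = 1" unfolding M by (simp add: width_def)
  let ?s = "input_state xs []"
  have h: "holds ?s" by (simp add: holds_def input_state_def)
  have b: "bdd ?s" using xsB B_ge by (auto simp: bdd_def input_state_def)
  have w1: "wp (setup_prog k \<delta>) (\<lambda>s'. (tables s' \<and> holds s' \<and> (\<forall>t<length terms. located s' t)) \<and>
      frame (iwrites (setup_prog k \<delta>)) (rwrites (setup_prog k \<delta>)) ?s s') ?s"
    by (rule wp_frame_mono[OF wp_setup[OF h]]) auto
  obtain t1 m1 r1 s1 where 1: "exec (compile (setup_prog k \<delta>)) ?s t1 m1 r1 s1" "tables s1" "holds s1"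
      "\<forall>t<length terms. located s1 t" "frame (iwrites (setup_prog k \<delta>)) (rwrites (setup_prog k \<delta>)) ?s s1"
      "bdd s1" "t1 \<le> T (setup_prog k \<delta>)"
    using wp_sound[OF w1 b setup_static(1) order_trans[OF setup_static(2) sub]] by blast
  have fr1: "frame {2..<A0} {} ?s s1"
    using 1(5) setup_static(3,4)[of k \<delta>] by (auto simp: frame_def)
  let ?Q = "\<lambda>s'. (imem s' vH 0 = height \<and> imem s' vQ 0 = modulus \<and>
     (\<forall>t<length terms. imem s' off t = int_coeff t mod modulus) \<and>
     (\<forall>t\<ge>length terms. imem s' off t = imem s1 off t)) \<and> frame {vH, lt, lx, vQ, off} {} s1 s'"
  have tc: "imem s1 vTC 0 = int (length terms)" using 1(2) by (simp add: tables_def)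
  have w2: "wp (modulus_prog k off) ?Q s1"
    by (rule wp_frame_mono[OF wp_modulus[OF 1(3) tc 1(4) M qB]])
      (use off modulus_static(3,4)[of k off] in auto)
  have "wf_prog (modulus_prog k off)" using off by (simp add: modulus_static(1))
  from wp_sound[OF w2 1(6) this order_trans[OF modulus_static(2) sub]] obtain t2 m2 r2 s2 where
    2: "exec (compile (modulus_prog k off)) s1 t2 m2 r2 s2" "?Q s2" "bdd s2" "t2 \<le> T (modulus_prog k off)" by blast
  have z2: "imem s2 a = (\<lambda>_. 0)" if "A0 \<le> a" "a \<noteq> off" for a
    using fr1 2(2) that by (auto simp: frame_def input_state_def)
  have zo: "imem s2 off t = 0" if "length terms \<le> t" for t
    using fr1 2(2) that off by (auto simp: frame_def input_state_def)
  \<comment> \<open>A fictitious state with the exact coefficients in its ring memory. The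
    untranslated core is analysed on it, and \<open>exec_cmod\<close> transfers that run to the true
    state, which holds residues.\<close>
  define u :: "real state" where "u = State (\<lambda>a. if a < off then imem s2 a else (\<lambda>_. 0))
    (\<lambda>r i. if r = 0 \<and> i < length terms then fst (terms ! i) else 0)"
  have red: "reduced modulus vQ off u s2"
    unfolding reduced_def
  proof (intro conjI allI impI)
    fix a assume "a < off" then show "imem s2 a = imem u a" by (simp add: u_def)
  next
    show "imem s2 vQ 0 = modulus" using 2(2) by simp
  next
    fix r i
    show "\<exists>z. rmem u r i = of_int z \<and> imem s2 (off + r) i = z mod modulus"
    proof (cases "r = 0 \<and> i < length terms")
      case True
      then have "rmem u r i = of_int (int_coeff i)"
        using ints by (simp add: u_def int_coeff_def)
      then show ?thesis using True 2(2) by auto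
    next
      case False
      then have "imem s2 (off + r) i = 0" using z2[of "off + r"] zo[of i] off by (cases "r = 0") auto
      moreover have "rmem u r i = of_int 0" using False by (auto simp: u_def)
      ultimately show ?thesis by (intro exI[of _ 0]) simp
    qed
  qed
  have tu: "tables u"
  proof -
    have "imem u a = imem s1 a" if "a < vU" for a
      using that off 2(2) by (simp add: u_def frame_def)
    then show ?thesis using 1(2) by (intro tables_cong[of u s1]) auto
  qed
  have cu: "coeffs u" by (simp add: coeffs_def u_def)
  have bu: "bdd u" using 2(3) B_ge by (auto simp: bdd_def u_def)
  have zu: "rmem u r = (\<lambda>_. 0)" if "1 \<le> r" for r using that by (auto simp: u_def)
  have zi: "imem u a = (\<lambda>_. 0)" if "A0 \<le> a" for a using that z2[of a] by (auto simp: u_def)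
  obtain t3 m3 r3 u' where 3: "exec (core_com k P) u t3 m3 r3 u'"
      "\<forall>d<D. rmem u' 4 d = kro (partition_function k I) d" "tables u'" "bdd u'"
      "t3 \<le> T (multiply_setup k) + \<tau> + T (combine_prog k)"
    using core_correct[OF tu cu bu zu zi P S] by blast
  have q2: "2 \<le> modulus" using height_ge by (simp add: modulus_def)
  have qo: "vQ < off" using off by simp
  obtain t4 m4 r4 s4 where 4: "exec (cmod vQ off (core_com k P)) s2 t4 m4 r4 s4"
      "reduced modulus vQ off u' s4" "t4 \<le> 10 * len modulus * t3"
    using exec_cmod[OF q2 qo 3(1) red] core_static(1,2)[of k P] off_def by blast
  have low: "imem s4 a = imem u' a" if "a < off" for a using 4(2) that by (simp add: reduced_def)
  have t4: "tables s4" by (rule tables_cong[OF _ 3(3)]) (use low off in auto)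
  have b4: "bdd s4"
    unfolding bdd_def
  proof (intro ballI allI)
    fix a i assume a: "a \<in> S"
    then have "a \<in> {..<A0} \<union> {array_bound P + 4}" using S by simp
    then show "\<bar>imem s4 a i\<bar> \<le> B"
    proof
      assume "a \<in> {..<A0}"
      then have "a < off" using off by simp
      moreover have "\<bar>imem u' a i\<bar> \<le> B" using 3(4) a unfolding bdd_def by blast
      ultimately show ?thesis using low[of a] by simp
    next
      assume "a \<in> {array_bound P + 4}"
      then obtain z where "imem s4 a i = z mod modulus"
        using 4(2) unfolding reduced_def off_def by blast
      moreover have "0 \<le> z mod modulus" "z mod modulus < modulus" using q2 by simp_all
      ultimately show ?thesis using qB by simp
    qed
  qed
  have "imem u' vH = imem u vH" by (rule exec_imem_frame[OF 3(1) core_static(3)])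
  then have vH: "imem s4 vH 0 = height" using low[of vH] off 2(2) by (simp add: u_def)
  have res: "result off s4"
    unfolding result_def
  proof (intro conjI impI allI)
    show "imem s4 vH 0 = height" by (rule vH)
    show "imem s4 vQ 0 = modulus" using 4(2) by (simp add: reduced_def)
    fix d assume d: "d < D"
    obtain z where z: "rmem u' 4 d = of_int z" "imem s4 (off + 4) d = z mod modulus"
      using 4(2) unfolding reduced_def by blast
    \<comment> \<open>The simulation provides an integer \<open>z\<close> equal to the coefficient;
      this bound confines it to the range in which its residue determines it.\<close>
    have "\<bar>kro (partition_function k I) d\<bar> \<le> of_int height"
      by (rule abs_kron_partition_function_le[OF ints])
    then have "\<bar>z\<bar> \<le> height" using z(1) 3(2) d by (metis of_int_abs of_int_le_iff)
    then show "\<exists>z. kro (partition_function k I) d = of_int z \<and> \<bar>z\<bar> \<le> height \<and>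
        imem s4 (off + 4) d = z mod modulus" using z 3(2) d by auto
  qed (simp add: M)
  have w5: "wp (output_prog M off) (outputs M sv (partition_function k I)) s4"
    by (rule wp_output[OF t4 res qB]) (use off in auto)
  have "arrs (output_prog M off) \<subseteq> S" using output_static(2) S off_def by simp
  from wp_sound[OF w5 b4 output_static(1) this] obtain t5 m5 r5 s5 where
    5: "exec (compile (output_prog M off)) s4 t5 m5 r5 s5"
      "outputs M sv (partition_function k I) s5" "t5 \<le> T (output_prog M off)" by blast
  have so: "solver M k P = Seq (compile (setup_prog k \<delta> ;; modulus_prog k off))
      (Seq (cmod vQ off (core_com k P)) (compile (output_prog M off)))"
    unfolding \<delta> off_def unfolding solver_def M by simp
  have "exec (solver M k P) ?s (t1 + t2 + (t4 + t5)) (max (max m1 m2) (max m4 m5)) (r1 + r2 + (r4 + r5)) s5"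
    unfolding so compile.simps by (intro exec.Seq[OF exec.Seq[OF 1(1) 2(1)]] exec.Seq[OF 4(1) 5(1)])
  moreover have "len modulus \<le> len B" using q2 qB by (intro len_mono) auto
  then have "10 * len modulus * t3 \<le> 10 * len B * (T (multiply_setup k) + \<tau> + T (combine_prog k))"
    using 3(5) by (intro mult_le_mono) auto
  then have "t1 + t2 + (t4 + t5) \<le> T (setup_prog k \<delta>) + T (modulus_prog k off) +
       10 * len B * (T (multiply_setup k) + \<tau> + T (combine_prog k)) + T (output_prog M off)"
    using 1(7) 2(4) 4(3) 5(3) by linarith
  ultimately show ?thesis using 5(2) unfolding off_def by blast
qed

end

section \<open>Sizes of the data\<close>

text \<open>A matrix with first column 1 and zeros elsewhere, times the all-one matrix, is the
  all-one matrix. All \<open>N * N\<close> output cells start as 0 and must therefore be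
  changed.\<close>

lemma matmul_time_ge:
  assumes "matmul_time P N \<tau>" "1 \<le> N"
  shows "N * N \<le> \<tau>"
proof -
  let ?A = "\<lambda>i l. if l = 0 then 1 else 0 :: real_poly_ring" and ?B = "\<lambda>l j. 1 :: real_poly_ring"
  obtain t m r s' where t: "exec P (matmul_input N ?A ?B) t m r s'"
      "\<forall>i<N. \<forall>j<N. rmem s' 2 (N * i + j) = (\<Sum>l<N. ?A i l * ?B l j)" "t \<le> \<tau>"
    using assms(1) unfolding matmul_time_def by meson
  have "(\<Sum>l<N. ?A i l * ?B l j) = 1" for i j using assms(2) by simp
  then have 1: "rmem s' 2 (N * i + j) = 1" if "i < N" "j < N" for i j using t(2) that by simp
  have "{..<N * N} \<subseteq> {x. rmem s' 2 x \<noteq> rmem (matmul_input N ?A ?B) 2 x}"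
  proof
    fix x assume "x \<in> {..<N * N}"
    then have "x div N < N" "x mod N < N" using assms(2) by (simp_all add: less_mult_imp_div_less)
    from 1[OF this] show "x \<in> {x. rmem s' 2 x \<noteq> rmem (matmul_input N ?A ?B) 2 x}"
      by (simp add: matmul_input_def)
  qed
  moreover note exec_changes[OF t(1), of 2]
  ultimately have "card {..<N * N} \<le> t" by (meson card_mono order_trans)
  then show ?thesis using t(3) by simp
qed

section \<open>Bounds on terms, group order and modulus\<close>

context pcsp_enc
begin

lemma ps_in_polys: "f < F \<Longrightarrow> ps ! f \<in> polys k I"
proof -
  assume "f < F"
  then have "ps ! f \<in> set ps" by (intro nth_mem) (simp add: length_ps)
  then show ?thesis by (fastforce simp: poly_list_def polys_def set_es[symmetric])
qed

lemma term_list: "f < F \<Longrightarrow> is_term_list sv (tss ! f) (ps ! f)"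
  using tss by (simp add: list_all2_conv_all_nth length_tss)

text \<open>Distinct exponent vectors prevent terms from merging, so hypotheses about the
  coefficients of the polynomials carry over to the listed terms.\<close>

lemma lookup_term:
  assumes f: "f < F" and j: "j < length (tss ! f)"
  shows "Poly_Mapping.lookup (ps ! f) (exponent (snd (tss ! f ! j))) = fst (tss ! f ! j)"
proof -
  have d: "distinct (map snd (tss ! f))" and l: "\<forall>t\<in>set (tss ! f). length (snd t) = sv"
    using term_list[OF f] by (auto simp: is_term_list_def)
  have "Poly_Mapping.lookup (ps ! f) (exponent (snd (tss ! f ! j))) =
      (\<Sum>i<length (tss ! f). if i = j then fst (tss ! f ! i) else 0)"
    unfolding ps_eq[OF f] lookup_sum
  proof (rule sum.cong[OF refl])
    fix i assume "i \<in> {..<length (tss ! f)}"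
    then have i: "i < length (tss ! f)" by simp
    have "exponent (snd (tss ! f ! i)) = exponent (snd (tss ! f ! j)) \<longleftrightarrow> snd (tss ! f ! i) = snd (tss ! f ! j)"
      using l i j by (intro exponent_inject) simp
    also have "\<dots> \<longleftrightarrow> i = j" using nth_eq_iff_index_eq[OF d, of i j] i j by simp
    finally show "Poly_Mapping.lookup (term_poly (tss ! f ! i)) (exponent (snd (tss ! f ! j))) =
        (if i = j then fst (tss ! f ! i) else 0)"
      by (simp add: term_poly_def lookup_single when_def)
  qed
  then show ?thesis using j by simp
qed

lemma terms_obtain:
  assumes "t < length terms"
  obtains f j where "f < F" "j < length (tss ! f)" "terms ! t = tss ! f ! j"
proof -
  have "terms ! t \<in> set terms" using assms by (rule nth_mem)
  then obtain ts where ts: "ts \<in> set tss" "terms ! t \<in> set ts" by (auto simp: terms_def)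
  then obtain f where f: "f < length tss" "ts = tss ! f" by (metis in_set_conv_nth)
  obtain j where "j < length ts" "terms ! t = ts ! j" using ts(2) by (metis in_set_conv_nth)
  then show ?thesis using that f by (simp add: length_tss)
qed

context
  fixes b c0 :: nat
  assumes exps: "\<And>t x. t < length terms \<Longrightarrow> x < sv \<Longrightarrow> \<bar>snd (terms ! t) ! x\<bar> \<le> int b" and sv: "sv \<le> c0"
begin

text \<open>The exponent vectors of one factor are distinct integer vectors with entries between
  \<open>-b\<close> and \<open>b\<close>. The number of terms is thus polynomial because the number
  of formal variables is constant.\<close>

lemma length_tss_nth_le: "f < F \<Longrightarrow> length (tss ! f) \<le> (2 * b + 1) ^ c0"
proof -
  assume f: "f < F"
  have d: "distinct (map snd (tss ! f))" and l: "\<forall>t\<in>set (tss ! f). length (snd t) = sv"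
    using term_list[OF f] by (auto simp: is_term_list_def)
  let ?L = "{xs. set xs \<subseteq> {- int b..int b} \<and> length xs = sv}"
  have "set (map snd (tss ! f)) \<subseteq> ?L"
  proof
    fix e assume "e \<in> set (map snd (tss ! f))"
    then obtain j where j: "j < length (tss ! f)" "e = snd (tss ! f ! j)"
      by (auto simp: in_set_conv_nth)
    have "start f + j < length terms" using start_le[OF f] j by simp
    then have "\<bar>e ! x\<bar> \<le> int b" if "x < sv" for x
      using exps[of "start f + j" x] that j by (simp add: terms_nth[OF f])
    moreover have "length e = sv" using l j by simp
    ultimately show "e \<in> ?L" by (fastforce simp: in_set_conv_nth abs_le_iff)
  qed
  then have "card (set (map snd (tss ! f))) \<le> card ?L"
    by (intro card_mono finite_lists_length_eq) auto
  then have "length (tss ! f) \<le> card ?L" using distinct_card[OF d] by simp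
  also have "\<dots> = card {- int b..int b} ^ sv" by (intro card_lists_length_eq) simp
  also have "card {- int b..int b} = 2 * b + 1" by simp
  also have "(2 * b + 1) ^ sv \<le> (2 * b + 1) ^ c0" using sv by (intro power_increasing) auto
  finally show ?thesis .
qed

lemma length_terms_le: "length terms \<le> F * (2 * b + 1) ^ c0"
proof -
  have "start g \<le> g * (2 * b + 1) ^ c0" if "g \<le> F" for g
    using that
  proof (induction g)
    case (Suc g)
    then show ?case using length_tss_nth_le[of g] by (simp add: start_Suc)
  qed (simp add: start_def)
  from this[of F] show ?thesis by (simp add: start_F)
qed

lemma TT_le: "TT \<le> length terms * (c0 * b ^ 2)"
proof -
  have "term_bound (terms ! t) \<le> c0 * b ^ 2" if "t < length terms" for t
  proof -
    have "nat ((snd (terms ! t) ! x) ^ 2) \<le> b ^ 2" if x: "x < sv" for x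
    proof -
      have "(snd (terms ! t) ! x) ^ 2 \<le> (int b) ^ 2"
        using exps[OF \<open>t < length terms\<close> x] by (metis abs_ge_zero power2_abs power_mono)
      then show ?thesis by (simp add: nat_le_iff)
    qed
    then have "term_bound (terms ! t) \<le> (\<Sum>x<sv. b ^ 2)" unfolding term_bound_def by (intro sum_mono) auto
    also have "\<dots> \<le> c0 * b ^ 2" using sv by simp
    finally show ?thesis .
  qed
  then have "TT \<le> (\<Sum>t<length terms. c0 * b ^ 2)" unfolding TT_def by (intro sum_mono) auto
  then show ?thesis by simp
qed

lemma D_le': "length terms \<le> l \<Longrightarrow> D \<le> (2 * (l * (c0 * b ^ 2)) + 1) ^ c0"
proof -
  assume "length terms \<le> l"
  then have "length terms * (c0 * b ^ 2) \<le> l * (c0 * b ^ 2)" by (rule mult_le_mono1)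
  then have "W \<le> 2 * (l * (c0 * b ^ 2)) + 1" using TT_le unfolding W_def by linarith
  then have "D \<le> (2 * (l * (c0 * b ^ 2)) + 1) ^ sv" unfolding D_def by (intro power_mono) auto
  also have "\<dots> \<le> (2 * (l * (c0 * b ^ 2)) + 1) ^ c0" using sv by (intro power_increasing) auto
  finally show ?thesis .
qed

end

lemma modulus_le:
  assumes "\<And>t. t < length terms \<Longrightarrow> len (int_coeff t) \<le> b" "length terms \<le> l"
  shows "modulus \<le> 2 ^ ((2 * b + 1) * l + k * nvars I + 3)"
proof -
  have c: "1 + int_coeff t * int_coeff t \<le> 2 ^ (2 * b + 1)" if "t < length terms" for t
  proof -
    have "(2 :: int) ^ len (int_coeff t) \<le> 2 ^ b" using assms(1)[OF that] by (intro power_increasing) auto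
    then have "\<bar>int_coeff t\<bar> \<le> 2 ^ b" using abs_less_power_len[of "int_coeff t"] by linarith
    then have "\<bar>int_coeff t\<bar> * \<bar>int_coeff t\<bar> \<le> 2 ^ b * 2 ^ b" by (intro mult_mono) auto
    then have "int_coeff t * int_coeff t \<le> 2 ^ (2 * b)" by (simp add: mult_2 power_add)
    moreover have "(1 :: int) \<le> 2 ^ (2 * b)" by simp
    ultimately have "1 + int_coeff t * int_coeff t \<le> 2 ^ (2 * b) + 2 ^ (2 * b)" by linarith
    then show ?thesis by simp
  qed
  have "coeff_prod (length terms) \<le> (\<Prod>t<length terms. 2 ^ (2 * b + 1))"
    unfolding coeff_prod_def using c by (intro prod_mono) auto
  also have "\<dots> = 2 ^ ((2 * b + 1) * length terms)" by (simp only: prod_constant card_lessThan power_mult)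
  also have "\<dots> \<le> 2 ^ ((2 * b + 1) * l)" using assms(2) by (intro power_increasing mult_le_mono2) auto
  finally have 1: "coeff_prod (length terms) \<le> 2 ^ ((2 * b + 1) * l)" .
  \<comment> \<open>The crude bound \<open>k \<le> 2 ^ k\<close> keeps everything a power of 2; as
    \<open>k\<close> is fixed, the exponent stays polynomial.\<close>
  have "int k ^ nvars I \<le> (2 ^ k) ^ nvars I"
    by (intro power_mono) (simp_all add: order_less_imp_le[OF of_nat_less_two_power])
  then have 2: "int k ^ nvars I \<le> 2 ^ (k * nvars I)" by (simp add: power_mult)
  have "height \<le> 2 ^ ((2 * b + 1) * l) * 2 ^ (k * nvars I)"
    unfolding height_def using 1 2 coeff_prod_ge[of "length terms"] by (intro mult_mono) auto
  then have "modulus \<le> 2 * 2 ^ ((2 * b + 1) * l + k * nvars I) + 1" by (simp add: modulus_def power_add)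
  also have "(1 :: int) \<le> 2 ^ ((2 * b + 1) * l + k * nvars I)" by simp
  finally have "modulus \<le> 2 * 2 ^ ((2 * b + 1) * l + k * nvars I) + 2 ^ ((2 * b + 1) * l + k * nvars I)" by simp
  also have "\<dots> \<le> 2 ^ ((2 * b + 1) * l + k * nvars I + 3)" by (simp add: power_add)
  finally show ?thesis .
qed

end

lemma mem_size_input_state:
  assumes "length xs \<le> X" "length ys \<le> X" "int X \<le> B" "\<forall>x\<in>set xs. \<bar>x\<bar> \<le> B"
  shows "fin_state (input_state xs ys) \<and> mem_size (input_state xs ys) \<le> 4 * X * len B"
proof -
  let ?s = "input_state xs ys"
  let ?I = "{(a, i). imem ?s a i \<noteq> 0}" and ?R = "{(a, i). rmem ?s a i \<noteq> 0}"
  have I: "?I \<subseteq> {0} \<times> {..<length xs}" and R: "?R \<subseteq> {0} \<times> {..<length ys}"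
    by (auto simp: input_state_def split: if_splits)
  have fin: "finite ?I" "finite ?R" using finite_subset[OF I] finite_subset[OF R] by auto
  have l: "len (int i) \<le> len B" if "i < X" for i using that assms(3) by (intro len_mono) simp
  have cI: "card ?I \<le> X" using card_mono[OF _ I] assms(1) by (simp add: card_cartesian_product)
  have cR: "card ?R \<le> X" using card_mono[OF _ R] assms(2) by (simp add: card_cartesian_product)
  have "(\<Sum>(a, i) \<in> ?I. len (int i) + len (imem ?s a i)) \<le> (\<Sum>p \<in> ?I. 2 * len B)"
  proof (rule sum_mono, clarify)
    fix a i assume ai: "imem ?s a i \<noteq> 0"
    then have i: "i < length xs" "imem ?s a i = xs ! i" by (auto simp: input_state_def split: if_splits)
    have "\<bar>xs ! i\<bar> \<le> B" using assms(4) nth_mem[OF i(1)] by blast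
    then have "len (xs ! i) \<le> len B" by (intro len_mono) linarith
    then show "len (int i) + len (imem ?s a i) \<le> 2 * len B" using l[of i] i assms(1) by simp
  qed
  also have "\<dots> \<le> X * (2 * len B)" using cI by simp
  finally have 1: "(\<Sum>(a, i) \<in> ?I. len (int i) + len (imem ?s a i)) \<le> X * (2 * len B)" .
  have "(\<Sum>(a, i) \<in> ?R. len (int i) + 1) \<le> (\<Sum>p \<in> ?R. 2 * len B)"
  proof (rule sum_mono, clarify)
    fix a i assume ai: "rmem ?s a i \<noteq> 0"
    then have "i < length ys" by (auto simp: input_state_def split: if_splits)
    then show "len (int i) + 1 \<le> 2 * len B" using l[of i] assms(2) len_ge_1[of B] by simp
  qed
  also have "\<dots> \<le> X * (2 * len B)" using cR by simp
  finally have "(\<Sum>(a, i) \<in> ?R. len (int i) + 1) \<le> X * (2 * len B)" .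
  with 1 fin show ?thesis by (simp add: fin_state_def mem_size_def)
qed

text \<open>From 1 on, powers increase with the degree, which makes monomial bounds closed under
  addition; the argument will be \<open>n + m + 1\<close>.\<close>

definition poly_bounded :: "(nat \<Rightarrow> nat) \<Rightarrow> bool" where
  "poly_bounded f \<longleftrightarrow> (\<exists>c d. \<forall>x\<ge>1. f x \<le> c * x ^ d)"

lemma poly_bounded_const: "poly_bounded (\<lambda>x. a)"
  unfolding poly_bounded_def by (rule exI[of _ a], rule exI[of _ 0]) simp

lemma poly_bounded_id: "poly_bounded (\<lambda>x. x)"
  unfolding poly_bounded_def by (rule exI[of _ 1], rule exI[of _ 1]) simp

lemma poly_bounded_mult:
  assumes "poly_bounded f" "poly_bounded g"
  shows "poly_bounded (\<lambda>x. f x * g x)"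
proof -
  obtain c d c' d' where "\<And>x. 1 \<le> x \<Longrightarrow> f x \<le> c * x ^ d" "\<And>x. 1 \<le> x \<Longrightarrow> g x \<le> c' * x ^ d'"
    using assms unfolding poly_bounded_def by blast
  then have "f x * g x \<le> (c * x ^ d) * (c' * x ^ d')" if "1 \<le> x" for x using that by (intro mult_le_mono) auto
  then have "f x * g x \<le> (c * c') * x ^ (d + d')" if "1 \<le> x" for x
    using that by (simp add: power_add ac_simps)
  then show ?thesis unfolding poly_bounded_def by blast
qed

lemma poly_bounded_add:
  assumes "poly_bounded f" "poly_bounded g"
  shows "poly_bounded (\<lambda>x. f x + g x)"
proof -
  obtain c d c' d' where 1: "\<And>x. 1 \<le> x \<Longrightarrow> f x \<le> c * x ^ d" "\<And>x. 1 \<le> x \<Longrightarrow> g x \<le> c' * x ^ d'"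
    using assms unfolding poly_bounded_def by blast
  have "f x + g x \<le> (c + c') * x ^ (d + d')" if x: "1 \<le> x" for x
  proof -
    have "c * x ^ d \<le> c * x ^ (d + d')" "c' * x ^ d' \<le> c' * x ^ (d + d')"
      using x by (intro mult_le_mono2 power_increasing; simp)+
    then show ?thesis using 1[OF x] unfolding distrib_right by linarith
  qed
  then show ?thesis unfolding poly_bounded_def by blast
qed

lemma poly_bounded_power: "poly_bounded f \<Longrightarrow> poly_bounded (\<lambda>x. f x ^ e)"
  by (induction e) (auto intro: poly_bounded_const poly_bounded_mult)

lemmas poly_bounded_intros = poly_bounded_const poly_bounded_id poly_bounded_mult poly_bounded_add poly_bounded_power

section \<open>The running time\<close>

definition cost_factor :: "coeff_model \<Rightarrow> nat \<Rightarrow> com \<Rightarrow> nat" where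
  "cost_factor M k P = kp (setup_prog k (width M)) + kp (modulus_prog k (array_bound P)) +
     kp (multiply_setup k) + kp (combine_prog k) + kp (output_prog M (array_bound P))"

definition cost_degree :: "coeff_model \<Rightarrow> nat \<Rightarrow> com \<Rightarrow> nat" where
  "cost_degree M k P = sdepth (setup_prog k (width M)) + sdepth (modulus_prog k (array_bound P)) +
     sdepth (multiply_setup k) + sdepth (combine_prog k) + sdepth (output_prog M (array_bound P))"

lemma (in bounds) T_le:
  assumes "sdepth c \<le> d" "bdepth c \<le> 2"
  shows "T c \<le> kp c * (X ^ d * Y ^ 2 * len B)"
  using T_mono[OF order_refl[of "kp c"] assms] by (simp add: mult.assoc)

text \<open>One bound for both models: the factor \<open>10 * len B\<close> is the price of
  simulating ring operations in the bit model.\<close>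

lemma (in pcsp_input) solver_correct:
  assumes ys: "ys = concat (map (ring_code M) tss)"
    and P: "matmul_time P ND \<tau>" and S: "S = {..<A0} \<union> {array_bound P + 4}"
    and xsB: "\<forall>x\<in>set xs. \<bar>x\<bar> \<le> B"
    and bit: "M = Bit_Length \<Longrightarrow> modulus \<le> B \<and> (\<forall>t<length terms. fst (terms ! t) \<in> \<int>)"
  shows "\<exists>t m r s'. exec (solver M k P) (input_state xs ys) t m r s' \<and>
     outputs M sv (partition_function k I) s' \<and>
     t \<le> 10 * len B * (cost_factor M k P * (X ^ cost_degree M k P * Y ^ 2 * len B) + \<tau>)"
proof -
  let ?G = "X ^ cost_degree M k P * Y ^ 2 * len B"
  have s: "T (setup_prog k \<delta>) \<le> kp (setup_prog k \<delta>) * ?G"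
    "T (modulus_prog k (array_bound P)) \<le> kp (modulus_prog k (array_bound P)) * ?G"
    "T (multiply_setup k) \<le> kp (multiply_setup k) * ?G"
    "T (combine_prog k) \<le> kp (combine_prog k) * ?G"
    "T (output_prog M (array_bound P)) \<le> kp (output_prog M (array_bound P)) * ?G"
    by (rule T_le, simp add: cost_degree_def,
        simp add: setup_static modulus_static multiply_setup_static combine_static output_static)+
  have sum: "T (setup_prog k \<delta>) + T (modulus_prog k (array_bound P)) + T (multiply_setup k) +
      T (combine_prog k) + T (output_prog M (array_bound P)) \<le> cost_factor M k P * ?G"
    using s unfolding cost_factor_def distrib_right by linarith
  have L: "y \<le> 10 * len B * y" for y :: nat using len_ge_1[of B] by simp
  show ?thesis
  proof (cases "M = Unit_Cost")
    case True
    obtain t m r s' where t: "exec (solver M k P) (input_state xs ys) t m r s'"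
      "outputs M sv (partition_function k I) s'"
      "t \<le> T (setup_prog k \<delta>) + (T (multiply_setup k) + \<tau> + T (combine_prog k)) + T (output_prog M (array_bound P))"
      using solver_Unit_Cost[OF True ys P S xsB] by blast
    have "t \<le> cost_factor M k P * ?G + \<tau>" using t(3) sum by linarith
    also have "\<dots> \<le> 10 * len B * (cost_factor M k P * ?G + \<tau>)" by (rule L)
    finally show ?thesis using t(1,2) by blast
  next
    case False
    then have M: "M = Bit_Length" by (cases M) auto
    have "ring_code M = (\<lambda>_. [])" unfolding M by (rule ext) simp
    then have "ys = []" unfolding ys by simp
    then obtain t m r s' where t: "exec (solver M k P) (input_state xs ys) t m r s'"
      "outputs M sv (partition_function k I) s'"
      "t \<le> T (setup_prog k \<delta>) + T (modulus_prog k (array_bound P)) +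
       10 * len B * (T (multiply_setup k) + \<tau> + T (combine_prog k)) + T (output_prog M (array_bound P))"
      using solver_Bit_Length[OF M P S xsB] bit[OF M] by blast
    have "t \<le> 10 * len B * (T (setup_prog k \<delta>) + T (modulus_prog k (array_bound P)) +
        (T (multiply_setup k) + \<tau> + T (combine_prog k)) + T (output_prog M (array_bound P)))"
      using t(3) L[of "T (setup_prog k \<delta>)"] L[of "T (modulus_prog k (array_bound P))"]
        L[of "T (output_prog M (array_bound P))"] unfolding distrib_left by linarith
    also have "\<dots> \<le> 10 * len B * (cost_factor M k P * ?G + \<tau>)"
      using sum by (intro mult_le_mono2) linarith
    finally show ?thesis using t(1,2) by blast
  qed
qed

section \<open>Polynomial bounds in terms of \<open>n + m + 1\<close>\<close>

context
  fixes k c d :: nat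
begin

definition exp_size :: "nat \<Rightarrow> nat" where
  "exp_size x = c * x ^ d"

definition factor_size :: "nat \<Rightarrow> nat" where
  "factor_size x = (1 + k + k * k) * x"

definition term_size :: "nat \<Rightarrow> nat" where
  "term_size x = factor_size x * (2 * exp_size x + 1) ^ c"

text \<open>The inner product bounds \<open>TT\<close>: each term contributes at most
  \<open>c\<close> squares of exponents.\<close>

definition ring_size :: "nat \<Rightarrow> nat" where
  "ring_size x = (2 * (term_size x * (c * exp_size x ^ 2)) + 1) ^ c"

definition loop_size :: "nat \<Rightarrow> nat" where
  "loop_size x = k + x + c + factor_size x + term_size x + ring_size x +
     (3 + 2 * x + factor_size x + term_size x * (c + 1)) + exp_size x"

text \<open>The exponent of \<open>B = 2 ^ bit_size\<close>. Its summands accommodate the modulus,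
  \<open>k ^ n\<close>, the factor \<open>X\<close> and the coefficients of the input.\<close>

definition bit_size :: "nat \<Rightarrow> nat" where
  "bit_size x = (2 * exp_size x + 1) * term_size x + k * x + loop_size x + 3"

lemmas size_defs = exp_size_def factor_size_def term_size_def ring_size_def loop_size_def bit_size_def

lemma poly_bounded_sizes: "poly_bounded loop_size" "poly_bounded bit_size"
  unfolding size_defs by (intro poly_bounded_intros)+

end

text \<open>The group order \<open>D\<close> is kept as a witness between 1 and \<open>X\<close>
  instead of being replaced by \<open>X\<close>: nothing makes the time \<open>\<tau>\<close> of the
  multiplication program monotone.\<close>

lemma solver_instance:
  fixes P :: com and k c d :: nat and I :: pcsp and \<tau> :: "nat \<Rightarrow> nat"
  assumes k: "1 \<le> k" and I: "is_pcsp k I" and enc: "encodes M k I xs ys"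
    and P: "\<And>N. 1 \<le> N \<Longrightarrow> matmul_time P N (\<tau> N)"
    and fv: "fvars I \<le> c"
    and exps: "\<And>p e x. p \<in> polys k I \<Longrightarrow> e \<in> Poly_Mapping.keys p \<Longrightarrow>
      \<bar>Poly_Mapping.lookup e x\<bar> \<le> real (c * (nvars I + card (edges I) + 1) ^ d)"
    and bits: "\<And>p e. M = Bit_Length \<Longrightarrow> p \<in> polys k I \<Longrightarrow> e \<in> Poly_Mapping.keys p \<Longrightarrow>
      Poly_Mapping.lookup p e \<in> \<int> \<and>
      len \<lfloor>Poly_Mapping.lookup p e\<rfloor> \<le> c * (nvars I + card (edges I) + 1) ^ d"
  defines "x \<equiv> nvars I + card (edges I) + 1"
  defines "X \<equiv> loop_size k c d x" and "Y \<equiv> k ^ ((nvars I + 2) div 3)"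
    and "L \<equiv> bit_size k c d x + 2"
  shows "\<exists>t m r s' D. exec (solver M k P) (input_state xs ys) t m r s' \<and>
     outputs M (fvars I) (partition_function k I) s' \<and> 1 \<le> D \<and> D \<le> X \<and>
     t \<le> 10 * L * (cost_factor M k P * (X ^ cost_degree M k P * Y ^ 2 * L) + \<tau> (Y * D)) \<and>
     m \<le> 4 * X * L + t"
proof -
  define B :: int where "B = 2 ^ bit_size k c d x"
  define b where "b = exp_size c d x"
  from enc obtain es tss where es: "distinct es" "set es = arcs I"
    and tss: "list_all2 (\<lambda>ts p. is_term_list (fvars I) ts p \<and> 0 \<notin> fst ` set ts) tss (poly_list k I es)"
    and xs: "xs = [int (nvars I), int (length es), int (fvars I)]
          @ concat (map (\<lambda>(x, y). [int x, int y]) es) @ concat (map (int_code M) tss)"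
    and ys: "ys = concat (map (ring_code M) tss)"
    unfolding encodes_def by blast
  have x1: "1 \<le> x" by (simp add: x_def)
  have X1: "1 \<le> X" unfolding X_def loop_size_def using k by simp
  have Y1: "1 \<le> Y" unfolding Y_def using k by simp
  have "(2 :: int) ^ 1 \<le> 2 ^ bit_size k c d x"
    by (rule power_increasing) (simp_all add: bit_size_def)
  then have B2: "2 \<le> B" by (simp add: B_def)
  have tss': "list_all2 (is_term_list (fvars I)) tss (poly_list k I es)"
    using tss by (rule list_all2_mono) simp
  interpret E: pcsp_enc k I es B X Y "{..<A0} \<union> {array_bound P + 4}" tss
    by standard (use k I es B2 X1 Y1 tss' in auto)
  have m_le: "length es \<le> card (edges I)"
  proof -
    have "finite (edges I)"
    proof (rule finite_subset)
      show "edges I \<subseteq> Pow {..<nvars I}" using I unfolding is_pcsp_def by fastforce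
    qed simp
    moreover have "inj_on (\<lambda>(x, y). {x, y}) (arcs I)"
      by (rule inj_onI) (auto simp: arcs_def doubleton_eq_iff)
    moreover have "(\<lambda>(x, y). {x, y}) ` arcs I \<subseteq> edges I" by (auto simp: arcs_def)
    ultimately have "card (arcs I) \<le> card (edges I)" by (intro card_inj_on_le)
    then show ?thesis using distinct_card[OF es(1)] es(2) by simp
  qed
  have n_x: "nvars I \<le> x" and m_x: "length es \<le> x" using m_le by (simp_all add: x_def)
  \<comment> \<open>Listed coefficients are nonzero and exponent vectors distinct, so each listed
    term really occurs in one of the polynomials, and \<open>exps\<close> and \<open>bits\<close>
    apply to it.\<close>
  have key: "fst (E.terms ! t) \<noteq> 0 \<and> (\<exists>p e. p \<in> polys k I \<and> e \<in> Poly_Mapping.keys p \<and>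
      e = exponent (snd (E.terms ! t)) \<and> Poly_Mapping.lookup p e = fst (E.terms ! t))"
    if t: "t < length E.terms" for t
  proof -
    obtain f j where fj: "f < E.F" "j < length (tss ! f)" "E.terms ! t = tss ! f ! j"
      using E.terms_obtain[OF t] .
    have "0 \<notin> fst ` set (tss ! f)"
      using tss fj(1) unfolding list_all2_conv_all_nth E.length_tss by blast
    then have nz: "fst (tss ! f ! j) \<noteq> 0" using fj(2) by (metis image_eqI nth_mem)
    have l: "Poly_Mapping.lookup (E.ps ! f) (exponent (snd (tss ! f ! j))) = fst (tss ! f ! j)"
      by (rule E.lookup_term[OF fj(1,2)])
    then have "exponent (snd (tss ! f ! j)) \<in> Poly_Mapping.keys (E.ps ! f)"
      using nz by (simp add: in_keys_iff)
    then show ?thesis using E.ps_in_polys[OF fj(1)] l nz fj(3) by metis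
  qed
  have ex: "\<bar>snd (E.terms ! t) ! y\<bar> \<le> int b" if t: "t < length E.terms" and y: "y < fvars I" for t y
  proof -
    obtain p e where p: "p \<in> polys k I" "e \<in> Poly_Mapping.keys p" "e = exponent (snd (E.terms ! t))"
      using key[OF t] by blast
    have "Poly_Mapping.lookup e y = real_of_int (snd (E.terms ! t) ! y)"
      using E.length_exps[OF t] y by (simp add: p(3) lookup_exponent)
    moreover have "\<bar>Poly_Mapping.lookup e y\<bar> \<le> real b"
      using exps[OF p(1,2), of y] unfolding b_def exp_size_def x_def .
    ultimately show ?thesis by (metis of_int_abs of_int_le_iff of_int_of_nat_eq)
  qed
  have F: "E.F \<le> factor_size k x"
  proof -
    have "nvars I * k \<le> x * k" "length es * k * k \<le> x * (k * k)"
      using n_x m_x by (simp_all add: mult.assoc)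
    moreover have "factor_size k x = x + x * k + x * (k * k)" by (simp add: factor_size_def algebra_simps)
    ultimately show ?thesis using x1 unfolding E.F_def by linarith
  qed
  have terms: "length E.terms \<le> term_size k c d x"
  proof -
    have "length E.terms \<le> E.F * (2 * b + 1) ^ c" by (rule E.length_terms_le[OF ex fv])
    also have "\<dots> \<le> factor_size k x * (2 * b + 1) ^ c" using F by (rule mult_le_mono1)
    finally show ?thesis by (simp only: term_size_def b_def)
  qed
  have D: "E.D \<le> ring_size k c d x"
    using E.D_le'[OF ex fv terms] by (simp only: ring_size_def b_def)
  have len_xs: "length xs \<le> 3 + 2 * x + factor_size k x + term_size k c d x * (c + 1)"
  proof -
    have "length (concat (map (\<lambda>(x, y). [int x, int y]) es)) = length es * 2"
      by (subst length_concat_uniform[where l = 2]) auto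
    moreover have "length (concat (map (int_code M) (take g tss))) \<le> g + E.start g * (c + 1)" if "g \<le> E.F" for g
      using that
    proof (induction g)
      case (Suc g)
      have g: "g < length tss" using Suc.prems by (simp add: E.length_tss)
      have "length (term_code M t) \<le> c + 1" if "t \<in> set (tss ! g)" for t
      proof -
        have "length (snd t) = fvars I" using E.term_list[of g] Suc.prems that by (auto simp: is_term_list_def)
        then show ?thesis using fv by (cases M) (simp_all add: length_term_code width_def)
      qed
      then have "length (concat (map (term_code M) (tss ! g))) \<le> length (tss ! g) * (c + 1)"
        unfolding length_concat map_map comp_def by (induction "tss ! g") (auto simp: sum_list_triv intro: order_trans[OF sum_list_mono[of _ _ "\<lambda>_. c + 1"]])
      then show ?case using Suc by (simp add: take_Suc_conv_app_nth[OF g] int_code_eq E.start_Suc distrib_right)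
    qed simp
    from this[of E.F] have "length (concat (map (int_code M) (take E.F tss))) \<le> E.F + length E.terms * (c + 1)"
      unfolding E.start_F by simp
    moreover have "take E.F tss = tss" by (rule take_all) (simp only: E.length_tss)
    moreover have "length E.terms * (c + 1) \<le> term_size k c d x * (c + 1)" using terms by (rule mult_le_mono1)
    ultimately show ?thesis using F m_x unfolding xs by simp
  qed
  have X_ge: "E.F \<le> X" "nvars I \<le> X" "fvars I \<le> X" "length E.terms \<le> X" "E.D \<le> X" "k \<le> X" "length xs \<le> X" "b \<le> X"
    using F n_x fv terms D len_xs unfolding X_def loop_size_def b_def by linarith+
  have pow_B: "(2 :: int) ^ y \<le> B" if "y \<le> bit_size k c d x" for y
    unfolding B_def using that by (intro power_increasing) auto
  have X_B: "int X \<le> B"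
  proof -
    have "int X \<le> 2 ^ X" by (rule order_less_imp_le[OF of_nat_less_two_power])
    also have "\<dots> \<le> B" by (rule pow_B) (simp add: bit_size_def X_def)
    finally show ?thesis .
  qed
  have kX: "int (k ^ nvars I * X) \<le> B"
  proof -
    have "k ^ nvars I \<le> (2 ^ k) ^ nvars I" by (intro power_mono) (simp_all add: order_less_imp_le)
    then have "k ^ nvars I * X \<le> (2 ^ k) ^ nvars I * 2 ^ X"
      by (intro mult_le_mono) (simp_all add: order_less_imp_le)
    also have "\<dots> = 2 ^ (k * nvars I + X)" by (simp add: power_mult power_add)
    finally have "int (k ^ nvars I * X) \<le> int (2 ^ (k * nvars I + X))" by (simp only: of_nat_le_iff)
    also have "\<dots> = 2 ^ (k * nvars I + X)" by simp
    also have "\<dots> \<le> B"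
    proof (rule pow_B)
      have "k * nvars I \<le> k * x" using n_x by simp
      then show "k * nvars I + X \<le> bit_size k c d x" unfolding bit_size_def X_def by linarith
    qed
    finally show ?thesis .
  qed
  interpret R: pcsp_run k I es B X Y "{..<A0} \<union> {array_bound P + 4}" tss
    by standard (use X_ge kX in \<open>auto simp: Y_def E.N3_def\<close>)
  interpret J: pcsp_input k I es B X Y "{..<A0} \<union> {array_bound P + 4}" tss M xs
    by standard (use xs X_ge in auto)
  have coeff: "fst (E.terms ! t) \<in> \<int> \<and> len (E.int_coeff t) \<le> b" if M: "M = Bit_Length" and t: "t < length E.terms" for t
  proof -
    obtain p e where p: "p \<in> polys k I" "e \<in> Poly_Mapping.keys p" "Poly_Mapping.lookup p e = fst (E.terms ! t)"
      using key[OF t] by blast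
    show ?thesis using bits[OF M p(1,2)] unfolding p(3) E.int_coeff_def b_def exp_size_def x_def .
  qed
  have xsB: "\<forall>z\<in>set xs. \<bar>z\<bar> \<le> B"
  proof
    fix z assume z: "z \<in> set xs"
    have small: "\<bar>int y\<bar> \<le> B" if "y \<le> X" for y using that X_B by simp
    from z consider "z = int (nvars I)" | "z = int (length es)" | "z = int (fvars I)"
      | u v where "(u, v) \<in> set es" "z = int u \<or> z = int v"
      | ts where "ts \<in> set tss" "z \<in> set (int_code M ts)"
      unfolding xs by auto
    then show "\<bar>z\<bar> \<le> B"
    proof cases
      case 1 then show ?thesis using small X_ge(2) by simp
    next
      case 2
      have "length es \<le> X" using m_x unfolding X_def loop_size_def by linarith
      then show ?thesis using 2 small by simp
    next
      case 3 then show ?thesis using small X_ge(3) by simp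
    next
      case (4 u v)
      then have "u \<le> X" "v \<le> X" using E.arcs_less[OF 4(1)] X_ge(2) by auto
      then show ?thesis using 4(2) small by auto
    next
      case (5 ts)
      then obtain f where f: "f < E.F" "ts = tss ! f" by (metis in_set_conv_nth E.length_tss)
      have lts: "length ts \<le> X" using E.start_le[OF f(1)] f(2) X_ge(4) by simp
      from 5(2) consider "z = int (length ts)" | t where "t \<in> set ts" "z \<in> set (term_code M t)"
        unfolding int_code_eq by auto
      then show ?thesis
      proof cases
        case 1 then show ?thesis using small lts by simp
      next
        case (2 t)
        then obtain j where j: "j < length (tss ! f)" "t = tss ! f ! j" unfolding f(2) by (metis in_set_conv_nth)
        let ?t = "E.start f + j"
        have t: "?t < length E.terms" "E.terms ! ?t = t"
          using E.start_le[OF f(1)] j E.terms_nth[OF f(1) j(1)] by auto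
        have "z \<in> set (snd t) \<or> M = Bit_Length \<and> z = E.int_coeff ?t"
          using 2(2) t(2) by (cases M) (auto simp: term_code_def E.int_coeff_def)
        then show ?thesis
        proof
          assume "z \<in> set (snd t)"
          then obtain y where "y < fvars I" "z = snd t ! y"
            using E.length_exps[OF t(1)] t(2) by (metis in_set_conv_nth)
          then have "\<bar>z\<bar> \<le> int b" using ex[OF t(1)] t(2) by simp
          then show ?thesis using X_ge(8) X_B by linarith
        next
          assume M: "M = Bit_Length \<and> z = E.int_coeff ?t"
          then have "len z \<le> b" using coeff[OF _ t(1)] by blast
          then have "(2 :: int) ^ len z \<le> 2 ^ b" by (intro power_increasing) auto
          also have "\<dots> \<le> B"
          proof (rule pow_B)
            show "b \<le> bit_size k c d x" unfolding b_def bit_size_def loop_size_def by linarith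
          qed
          finally show ?thesis using abs_less_power_len[of z] by linarith
        qed
      qed
    qed
  qed
  have mB: "E.modulus \<le> B" if M: "M = Bit_Length"
  proof -
    have "E.modulus \<le> 2 ^ ((2 * b + 1) * term_size k c d x + k * nvars I + 3)"
      by (rule E.modulus_le) (use coeff[OF M] terms in auto)
    also have "\<dots> \<le> B"
    proof (rule pow_B)
      have "k * nvars I \<le> k * x" using n_x by simp
      then show "(2 * b + 1) * term_size k c d x + k * nvars I + 3 \<le> bit_size k c d x"
        unfolding bit_size_def b_def by linarith
    qed
    finally show ?thesis .
  qed
  have ND: "R.ND = Y * E.D" by (simp add: R.ND_def Y_def E.N3_def)
  have "matmul_time P R.ND (\<tau> (Y * E.D))" unfolding ND[symmetric] by (rule P[OF R.ND_ge])
  from J.solver_correct[OF ys this refl xsB] mB coeff obtain t m r s' where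
    t: "exec (solver M k P) (input_state xs ys) t m r s'" "outputs M (fvars I) (partition_function k I) s'"
      "t \<le> 10 * len B * (cost_factor M k P * (X ^ cost_degree M k P * Y ^ 2 * len B) + \<tau> (Y * E.D))"
    by blast
  have "len B \<le> Suc (Suc (bit_size k c d x))" unfolding B_def by (rule len_le_if_less_power) simp
  then have LB: "len B \<le> L" by (simp add: L_def)
  have "length ys \<le> X"
  proof -
    have "length (ring_code M ts) \<le> length ts" for ts by (cases M) simp_all
    then have "length ys \<le> length (concat tss)"
      unfolding ys length_concat map_map comp_def by (intro sum_list_mono)
    then show ?thesis using X_ge(4) by (simp add: E.terms_def)
  qed
  note ms = mem_size_input_state[OF X_ge(7) this X_B xsB]
  have "m \<le> mem_size (input_state xs ys) + t" using exec_mem_size[OF t(1)] ms by blast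
  also have "\<dots> \<le> 4 * X * L + t" using ms LB by (meson add_right_mono mult_le_mono2 order_trans)
  finally have "m \<le> 4 * X * L + t" .
  moreover have "t \<le> 10 * L * (cost_factor M k P * (X ^ cost_degree M k P * Y ^ 2 * L) + \<tau> (Y * E.D))"
    using LB by (intro order_trans[OF t(3)] mult_le_mono add_mono order_refl)
  ultimately show ?thesis using t(1,2) E.D_ge X_ge(5) by blast
qed

theorem theorem11p1:
  fixes k :: nat and \<omega> :: real and M :: coeff_model
  assumes "k \<ge> 1" and "matmul_exponent \<omega>"
  shows "\<exists>Q :: com. \<forall>F :: pcsp set.
    (\<forall>I \<in> F. is_pcsp k I) \<and> polynomially_bounded M k F \<longrightarrow>
    (\<exists>c d :: nat. \<forall>I \<in> F. computes_partition_function M k I Q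
       (real (c * (nvars I + card (edges I) + 1) ^ d) * real k powr (\<omega> * real (nvars I) / 3)))"
proof -
  obtain P C dP where "\<forall>N \<ge> 1. \<forall>A B :: nat \<Rightarrow> nat \<Rightarrow> real_poly_ring. \<exists>t m r s'.
       exec P (matmul_input N A B) t m r s' \<and>
       (\<forall>i < N. \<forall>j < N. rmem s' 2 (N * i + j) = (\<Sum>l<N. A i l * B l j)) \<and>
       real r \<le> C * real N powr \<omega> \<and>
       real t \<le> C * real N powr \<omega> * (1 + log 2 (real N)) ^ dP"
    using assms(2) unfolding matmul_exponent_def by (elim exE)
  note P = this[rule_format]
  define \<tau> where "\<tau> N = nat \<lfloor>C * real N powr \<omega> * (1 + log 2 (real N)) ^ dP\<rfloor>" for N
  \<comment> \<open>Natural numbers above \<open>C\<close> and above the absolute value of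
    \<open>\<omega>\<close>, because the final polynomial bound has natural coefficients and
    exponents.\<close>
  define Cn where "Cn = nat \<lceil>C\<rceil>"
  define w where "w = nat \<lceil>\<bar>\<omega>\<bar>\<rceil>"
  have w: "\<bar>\<omega>\<bar> \<le> real w" unfolding w_def by linarith
  have mt: "matmul_time P N (\<tau> N)" if N: "1 \<le> N" for N
    unfolding matmul_time_def
  proof (intro allI)
    fix A B :: "nat \<Rightarrow> nat \<Rightarrow> real_poly_ring"
    obtain t m r s' where t: "exec P (matmul_input N A B) t m r s'"
      "\<forall>i < N. \<forall>j < N. rmem s' 2 (N * i + j) = (\<Sum>l<N. A i l * B l j)"
      "real t \<le> C * real N powr \<omega> * (1 + log 2 (real N)) ^ dP" using P[OF N] by blast
    have "t \<le> \<tau> N" unfolding \<tau>_def by (rule le_nat_floor[OF t(3)])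
    then show "\<exists>t m r s'. exec P (matmul_input N A B) t m r s' \<and>
      (\<forall>i<N. \<forall>j<N. rmem s' 2 (N * i + j) = (\<Sum>l<N. A i l * B l j)) \<and> t \<le> \<tau> N" using t(1,2) by blast
  qed
  have \<tau>_le: "real (\<tau> N) \<le> real Cn * real N powr \<omega> * real \<Lambda> ^ dP"
    if N: "1 \<le> N" and l: "1 + log 2 (real N) \<le> real \<Lambda>" for N \<Lambda>
  proof -
    let ?a = "C * real N powr \<omega> * (1 + log 2 (real N)) ^ dP"
    have "1 * 1 \<le> N * N" using N by (intro mult_le_mono)
    \<comment> \<open>As \<open>\<tau> N\<close> is at least 1, \<open>nat\<close> has not cut off a
      negative number, and the real bound can be recovered from \<open>\<tau> N\<close>.\<close>
    then have "1 \<le> \<tau> N" using matmul_time_ge[OF mt[OF N] N] by linarith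
    then have "1 \<le> \<lfloor>?a\<rfloor>" unfolding \<tau>_def by linarith
    then have "real (\<tau> N) \<le> ?a" unfolding \<tau>_def by linarith
    also have "\<dots> \<le> real Cn * real N powr \<omega> * (1 + log 2 (real N)) ^ dP"
    proof -
      have "C \<le> real Cn" unfolding Cn_def by linarith
      moreover have "0 \<le> 1 + log 2 (real N)" using N by simp
      ultimately show ?thesis by (intro mult_right_mono) auto
    qed
    also have "\<dots> \<le> real Cn * real N powr \<omega> * real \<Lambda> ^ dP"
      using N l by (intro mult_left_mono power_mono) auto
    finally show ?thesis .
  qed
  \<comment> \<open>The program depends only on \<open>M\<close>, \<open>k\<close> and
    \<open>P\<close>; the constants of the family enter nothing but its analysis.\<close>
  show ?thesis
  proof (intro exI[of _ "solver M k P"] allI impI, elim conjE)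
    fix F :: "pcsp set"
    assume pcsp: "\<forall>I\<in>F. is_pcsp k I" and "polynomially_bounded M k F"
    then obtain c d where cd: "\<forall>I \<in> F. fvars I \<le> c \<and>
     (\<forall>p \<in> polys k I. \<forall>e \<in> Poly_Mapping.keys p.
        (\<forall>x. Poly_Mapping.lookup e x \<in> \<int> \<and>
             \<bar>Poly_Mapping.lookup e x\<bar> \<le> real (c * (nvars I + card (edges I) + 1) ^ d)) \<and>
        (M = Bit_Length \<longrightarrow>
             Poly_Mapping.lookup p e \<in> \<int> \<and>
             len \<lfloor>Poly_Mapping.lookup p e\<rfloor> \<le> c * (nvars I + card (edges I) + 1) ^ d))"
      unfolding polynomially_bounded_def by blast
    define K where "K = cost_factor M k P"
    define g where "g = cost_degree M k P"
    define Xf where "Xf = loop_size k c d"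
    define Lf where "Lf x = bit_size k c d x + 2" for x
    \<comment> \<open>Bounds one plus the binary logarithm of the matrix size, using
      \<open>Y \<le> 2 ^ (k * x)\<close> and \<open>D \<le> 2 ^ Xf x\<close>.\<close>
    define \<Lambda> where "\<Lambda> x = 1 + k * x + Xf x" for x
    define Sf where "Sf x = Cn * \<Lambda> x ^ dP" for x
    \<comment> \<open>Collects all polynomial factors: \<open>k ^ w\<close> comes from rounding
      \<open>n / 3\<close>, \<open>Xf x ^ w\<close> from the factor \<open>D\<close> of the matrix
      size, \<open>Sf x\<close> from the multiplication time, and the first summand from the memory
      of the input.\<close>
    define H where "H x = k ^ w * (4 * Xf x * Lf x * Sf x +
      10 * Lf x * (K * (Xf x ^ g * Sf x * Lf x) + Xf x ^ w * Sf x))" for x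
    have "poly_bounded Xf" "poly_bounded Lf"
      unfolding Xf_def Lf_def by (intro poly_bounded_intros poly_bounded_sizes)+
    then have "poly_bounded H"
      unfolding H_def Sf_def \<Lambda>_def by (intro poly_bounded_intros)
    then obtain c' d' where H: "\<And>x. 1 \<le> x \<Longrightarrow> H x \<le> c' * x ^ d'" unfolding poly_bounded_def by blast
    show "\<exists>c d. \<forall>I\<in>F. computes_partition_function M k I (solver M k P)
       (real (c * (nvars I + card (edges I) + 1) ^ d) * real k powr (\<omega> * real (nvars I) / 3))"
    proof (intro exI ballI)
      fix I assume IF: "I \<in> F"
      define x where "x = nvars I + card (edges I) + 1"
      define h where "h = (nvars I + 2) div 3"
      define Y where "Y = k ^ h"
      let ?b = "real (c' * x ^ d') * real k powr (\<omega> * real (nvars I) / 3)"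
      have x1: "1 \<le> x" by (simp add: x_def)
      have h: "h \<le> nvars I" "3 * h \<le> nvars I + 2" "nvars I \<le> 3 * h" unfolding h_def by linarith+
      have Y1: "1 \<le> Y" unfolding Y_def using assms(1) by simp
      have Y2: "Y \<le> 2 ^ (k * x)"
      proof -
        have "Y \<le> (2 ^ k) ^ h" unfolding Y_def by (intro power_mono) (simp_all add: order_less_imp_le)
        also have "\<dots> = 2 ^ (k * h)" by (simp add: power_mult)
        also have "\<dots> \<le> 2 ^ (k * x)" using h(1) by (intro power_increasing mult_le_mono2) (auto simp: x_def)
        finally show ?thesis .
      qed
      have log_le: "1 + log 2 (real (Y * D)) \<le> real (\<Lambda> x)" if "1 \<le> D" "D \<le> Xf x" for D
      proof -
        have "D \<le> 2 ^ Xf x" using that(2) less_exp[of "Xf x"] by linarith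
        then have "Y * D \<le> 2 ^ (k * x) * 2 ^ Xf x" using Y2 by (intro mult_le_mono)
        then have "real (Y * D) \<le> real (2 ^ (k * x + Xf x))" by (simp only: power_add of_nat_le_iff)
        then have "real (Y * D) \<le> 2 ^ (k * x + Xf x)" by simp
        moreover have "0 < Y * D" using Y1 that(1) by simp
        ultimately have "log 2 (real (Y * D)) \<le> real (k * x + Xf x)"
          by (intro log_of_power_le) simp_all
        then show ?thesis by (simp add: \<Lambda>_def)
      qed
      define Yw where "Yw = real Y powr \<omega>"
      have Yw0: "0 \<le> Yw" by (simp add: Yw_def)
      have X1: "1 \<le> Xf x" unfolding Xf_def loop_size_def using assms(1) by simp
      \<comment> \<open>The work outside the multiplication is quadratic in \<open>Y\<close>.
        Writing the output of a product of size \<open>Y\<close> takes that long, so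
        \<open>Y ^ 2\<close> is absorbed by \<open>Y powr \<omega>\<close> up to a polynomial
        factor.\<close>
      have e1: "real (Y ^ 2) \<le> real (Sf x) * Yw"
      proof -
        have "Y ^ 2 \<le> \<tau> Y" using matmul_time_ge[OF mt[OF Y1] Y1] by (simp add: power2_eq_square)
        then have "real (Y ^ 2) \<le> real (\<tau> Y)" by (simp only: of_nat_le_iff)
        also have "\<dots> \<le> real Cn * Yw * real (\<Lambda> x) ^ dP"
          unfolding Yw_def by (rule \<tau>_le[OF Y1]) (use log_le[of 1] X1 in simp)
        also have "\<dots> = real (Sf x) * Yw" by (simp add: Sf_def)
        finally show ?thesis .
      qed
      \<comment> \<open>Since \<open>D\<close> is at least 1 and \<open>w\<close> at least
        \<open>\<omega>\<close>, the factor \<open>D powr \<omega>\<close> is at most the polynomial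
        \<open>Xf x ^ w\<close>.\<close>
      have e2: "real (\<tau> (Y * D)) \<le> real (Xf x ^ w * Sf x) * Yw" if D: "1 \<le> D" "D \<le> Xf x" for D
      proof -
        have YD: "1 \<le> Y * D" using mult_le_mono[OF Y1 D(1)] by simp
        have "real D powr \<omega> \<le> real D powr real w" using w D(1) by (intro powr_mono) auto
        also have "\<dots> = real D ^ w" using D(1) by (simp add: powr_realpow)
        also have "\<dots> \<le> real (Xf x) ^ w" using D(2) by (intro power_mono) auto
        finally have Dw: "real D powr \<omega> \<le> real (Xf x) ^ w" .
        have "real (\<tau> (Y * D)) \<le> real Cn * real (Y * D) powr \<omega> * real (\<Lambda> x) ^ dP"
          by (rule \<tau>_le[OF YD log_le[OF D]])
        also have "\<dots> = real Cn * (Yw * real D powr \<omega>) * real (\<Lambda> x) ^ dP"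
          by (simp add: Yw_def powr_mult)
        also have "\<dots> \<le> real Cn * (Yw * real (Xf x) ^ w) * real (\<Lambda> x) ^ dP"
          using Dw Yw0 by (intro mult_right_mono mult_left_mono) auto
        also have "\<dots> = real (Xf x ^ w * Sf x) * Yw" by (simp add: Sf_def)
        finally show ?thesis .
      qed
      \<comment> \<open>The exponent \<open>h\<close> differs from \<open>n / 3\<close> by at most
        1, which costs a factor of at most \<open>k ^ w\<close>, whatever the sign of
        \<open>\<omega>\<close>.\<close>
      have e3: "Yw \<le> real (k ^ w) * real k powr (\<omega> * real (nvars I) / 3)"
      proof -
        have "real Y = real k powr real h"
          unfolding Y_def of_nat_power by (rule powr_realpow[symmetric]) (use assms(1) in simp)
        then have "real Y powr \<omega> = real k powr (real h * \<omega>)" by (simp only: powr_powr)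
        also have "\<dots> \<le> real k powr (real w + \<omega> * real (nvars I) / 3)"
        proof (rule powr_mono)
          have "\<bar>real h - real (nvars I) / 3\<bar> \<le> 1" using h(2,3) by linarith
          then have "\<bar>\<omega>\<bar> * \<bar>real h - real (nvars I) / 3\<bar> \<le> \<bar>\<omega>\<bar> * 1" by (intro mult_left_mono) auto
          then have "\<omega> * (real h - real (nvars I) / 3) \<le> \<bar>\<omega>\<bar>" unfolding abs_mult[symmetric] by linarith
          then show "real h * \<omega> \<le> real w + \<omega> * real (nvars I) / 3" using w by (simp add: algebra_simps)
        qed (use assms(1) in simp)
        also have "\<dots> = real (k ^ w) * real k powr (\<omega> * real (nvars I) / 3)"
          using assms(1) by (simp add: powr_add powr_realpow)
        finally show ?thesis by (simp add: Yw_def)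
      qed
      have Hb: "real (4 * Xf x * Lf x * Sf x + 10 * Lf x * (K * (Xf x ^ g * Sf x * Lf x) + Xf x ^ w * Sf x)) * Yw \<le> ?b"
        (is "real ?H * Yw \<le> _")
      proof -
        have "real ?H * Yw \<le> real ?H * (real (k ^ w) * real k powr (\<omega> * real (nvars I) / 3))"
          by (rule mult_left_mono[OF e3]) (rule of_nat_0_le_iff)
        also have "\<dots> = real (H x) * real k powr (\<omega> * real (nvars I) / 3)"
          unfolding H_def by (simp only: of_nat_mult ac_simps)
        also have "\<dots> \<le> ?b" using H[OF x1] by (intro mult_right_mono) (simp_all only: of_nat_le_iff powr_ge_zero)
        finally show ?thesis .
      qed
      show "computes_partition_function M k I (solver M k P)
         (real (c' * (nvars I + card (edges I) + 1) ^ d') * real k powr (\<omega> * real (nvars I) / 3))"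
        unfolding computes_partition_function_def x_def[symmetric]
      proof (intro allI impI)
        fix xs ys assume enc: "encodes M k I xs ys"
        have "\<exists>t m r s' D. exec (solver M k P) (input_state xs ys) t m r s' \<and>
           outputs M (fvars I) (partition_function k I) s' \<and> 1 \<le> D \<and> D \<le> Xf x \<and>
           t \<le> 10 * Lf x * (K * (Xf x ^ g * Y ^ 2 * Lf x) + \<tau> (Y * D)) \<and>
           m \<le> 4 * Xf x * Lf x + t"
          unfolding Xf_def Lf_def K_def g_def x_def Y_def h_def
          by (rule solver_instance[OF assms(1) _ enc mt]) (use IF pcsp cd in auto)
        then obtain t m r s' D where t: "exec (solver M k P) (input_state xs ys) t m r s'"
           "outputs M (fvars I) (partition_function k I) s'" and D: "1 \<le> D" "D \<le> Xf x"
           and tle: "t \<le> 10 * Lf x * (K * (Xf x ^ g * Y ^ 2 * Lf x) + \<tau> (Y * D))"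
           and mle: "m \<le> 4 * Xf x * Lf x + t" by blast
        have "real t \<le> real (10 * Lf x * (K * (Xf x ^ g * Y ^ 2 * Lf x) + \<tau> (Y * D)))"
          using tle by (simp only: of_nat_le_iff)
        also have "\<dots> = real (10 * Lf x) * (real (K * Xf x ^ g * Lf x) * real (Y ^ 2) + real (\<tau> (Y * D)))"
          by (simp add: algebra_simps)
        also have "\<dots> \<le> real (10 * Lf x) * (real (K * Xf x ^ g * Lf x) * (real (Sf x) * Yw) +
            real (Xf x ^ w * Sf x) * Yw)"
          using e1 e2[OF D] by (intro mult_left_mono add_mono) auto
        also have "\<dots> = real (10 * Lf x * (K * (Xf x ^ g * Sf x * Lf x) + Xf x ^ w * Sf x)) * Yw"
          by (simp add: algebra_simps)
        finally have tr: "real t \<le> real (10 * Lf x * (K * (Xf x ^ g * Sf x * Lf x) + Xf x ^ w * Sf x)) * Yw" .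
        \<comment> \<open>By \<open>e1\<close> the product \<open>Sf x * Yw\<close> is then at least
          1; multiplying the input's memory by it gives the same form as the time bound.\<close>
        have "1 \<le> Y ^ 2" using Y1 by simp
        then have "real 1 \<le> real (Y ^ 2)" by (simp only: of_nat_le_iff)
        then have "1 \<le> real (Sf x) * Yw" using e1 by simp
        then have "real (4 * Xf x * Lf x) * 1 \<le> real (4 * Xf x * Lf x) * (real (Sf x) * Yw)"
          by (intro mult_left_mono) auto
        then have ms: "real (4 * Xf x * Lf x) \<le> real (4 * Xf x * Lf x * Sf x) * Yw" by (simp add: mult.assoc)
        have "real m \<le> real (4 * Xf x * Lf x) + real t"
          unfolding of_nat_add[symmetric] of_nat_le_iff by (rule mle)
        also have "\<dots> \<le> real ?H * Yw" unfolding of_nat_add distrib_right by (rule add_mono[OF ms tr[unfolded of_nat_add]])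
        finally have "real m \<le> ?b" using Hb by linarith
        moreover have "0 \<le> real (4 * Xf x * Lf x * Sf x) * Yw" using Yw0 by simp
        then have "real t \<le> real ?H * Yw" using tr by (simp only: of_nat_add distrib_right)
        then have "real t \<le> ?b" using Hb by linarith
        ultimately show "\<exists>t m r s'. exec (solver M k P) (input_state xs ys) t m r s' \<and>
           outputs M (fvars I) (partition_function k I) s' \<and> real t \<le> ?b \<and> real m \<le> ?b"
          using t by blast
      qed
    qed
  qed
qed

end
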